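(* Let $R:B^{r,k}\otimes B^{1,l}\to B^{1,l}\otimes B^{r,k}$ be the combinatorial $R$-matrix for type $D_n^{(1)}$, $B_n^{(1)}$ or $A_{2n-1}^{(2)}$, where $k,l\ge 1$ and $1\le r\le n-2$ for $D_n^{(1)}$, $1\le r\le n-1$ for $B_n^{(1)}$, $1\le r\le n$ for $A_{2n-1}^{(2)}$. Let $b\otimes x\in B^{r,k}\otimes B^{1,l}$ be $I_0$-highest. Then $b=\mu$ is the highest weight element of some component $B(\mu)$ of $B^{r,k}$, $\mu=\sum_i\mu_i\Lambda_i$, and the image has the form $$R(\mu\otimes x)=1^l\otimes\Phi(P)$$ for a $\pm$-diagram $P$. Let $x=(x_1,\ldots,\overline{x}_1)$ in coordinates, and set $\mu_0=k-\sum_{i>0}\mu_i$. Then the numbers $p_i^\ast$ ($\ast=\cdot,+,-,\mp$) of $P$, with $i\equiv r\pmod 2$, are given by $$p_i^\cdot=\begin{cases}\overline{x}_2-x_2-(x_1-\mu_0)_-&\text{for }i=0,\\ x_{r+1}&\text{for }i=r,\\ \overline{x}_{i+2}-x_{i+2}&\text{otherwise,}\end{cases}\qquad p_i^+=\mu_i-\overline{x}_i-x_{i+1},$$ $$p_i^-=\begin{cases}\overline{x}_1&\text{for }i=1,\\ x_i&\text{otherwise,}\end{cases}\qquad p_i^\mp=\begin{cases}\min(\mu_0,x_1)&\text{for }i=2,\\ x_{i-1}&\text{otherwise.}\end{cases}$$ Here $(y)_-=\min(y,0)$; $p_i^\cdot$ is considered for $0\le i\le r$, $p_i^+,p_i^-$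 for $1\le i\le r$ and $p_i^\mp$ for $2\le i\le r$ (always $p_1^\mp=0$). Moreover, if the energy function $H$ on $B^{r,k}\otimes B^{1,l}$ is normalized by $H((k^r)\otimes 1^l)=0$, then $$H(\mu\otimes x)=\begin{cases}\lambda_1-k-l&\text{if }r\text{ is odd},\\ (\lambda_1-k)_+-l&\text{if }r\text{ is even},\end{cases}$$ where $(y)_+=\max(y,0)$ and $\lambda_1$ is the first part of the partition corresponding to the weight of $\mu\otimes x$.
   Context: **Types.** $\mathfrak g$ is of type $D_n^{(1)},B_n^{(1)},A_{2n-1}^{(2)}$, with nodes $I=\{0,1,\ldots,n\}$ labelled as in Kac's book (nodes $0$ and $1$ are both joined to $2$ and interchanged by a diagram automorphism). $I_0=\{1,\ldots,n\}$, $J=\{2,\ldots,n\}$; the subalgebra $\mathfrak g_0$ with nodes $I_0$ has type $X_n=D_n,B_n,C_n$ respectively, with fundamental weights $\Lambda_i$. $X_{n-1}$ denotes the subalgebra with nodes $J$. A dominant weight $\sum_i m_i\Lambda_i$ without spin weights is identified with the Young diagram (French notation: longest row at the bottom, columns standing on a common base line, heights weakly decreasing left to right) having $m_i$ columns of height $i$. **Crystals.** $e_i,f_i$ are Kashiwara operators, $\varepsilon_i(b)=\max\{m: e_i^mb\ne0\}$, $\varphi_i(b)=\max\{m:f_i^mb\ne0\}$. Tensor product: $e_i(b_1\otimes b_2)=e_ib_1\otimes b_2$ if $\varphi_i(b_1)\ge\varepsilon_i(b_2)$ and $b_1\otimes e_ib_2$ otherwise; $f_i(b_1\otimes b_2)=f_ib_1\otimes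 b_2$ if $\varphi_i(b_1)>\varepsilon_i(b_2)$ and $b_1\otimes f_ib_2$ otherwise. For $K\subset I$, $b$ is $K$-highest if $e_ib=0$ for all $i\in K$. $B(\Lambda)$ is the $X_n$-crystal of highest weight $\Lambda$, realized by Kashiwara–Nakashima (KN) tableaux with letters $i,\bar i$ ($1\le i\le n$; also $0$ for $B_n$), in French notation. The symbol of a dominant weight also denotes the highest weight tableau of that weight. **$\pm$-diagrams.** A $\pm$-diagram $P$ of shape $\Lambda/\lambda$ is a sequence of partitions $\lambda\subset\nu\subset\Lambda$ with $\Lambda/\nu$ and $\nu/\lambda$ horizontal strips; cells of $\nu/\lambda$ are filled with $+$, cells of $\Lambda/\nu$ with $-$. $\Lambda$ is the outer and $\lambda$ the inner shape. For $C_n$, $\Lambda$ has columns of height at most $n$ and $\lambda$ has no column of height $n$. $p_i^\ast$ is the number of columns of the outer shape of height $i$ whose symbols are: none ($\ast=\cdot$), only $+$ ($\ast=+$), only $-$ ($\ast=-$), both, i.e. $-$ on top of $+$ ($\ast=\mp$). For a $\pm$-diagram of $B^{r,k}$, $p_0^\cdot=k-(\text{first part of the outer shape})$. **Bijection $\Phi$** from $\pm$-diagrams of shape $\Lambda/\lambda$ to $J$-highest elements of $B(\Lambda)$ of $X_{n-1}$-weight $\lambda$: for each column of height $n$ containing $+$ place the column $12\cdots n$. Otherwise place $\bar1$ in all positions of $P$ containing $-$ and fill the remainder of all columns by strings $23\cdots k'$ (read from the bottom). Then move through the columns of the resulting tableau $b$ from top to bottom, left to right; each $+$ of $P$ (from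 leftmost to rightmost, ignoring $+$ at height $n$) alters $b$ on the way: if the $+$ is at height $h$ and one encounters $\bar1$, replace it by $\overline{h+1}$; if one encounters a $2$, replace the string $23\cdots k'$ by $12\cdots h\,(h+2)\cdots k'$. **KR crystal $B^{r,k}$.** As an $X_n$-crystal $B^{r,k}\cong\bigoplus_\Lambda B(\Lambda)$ over all $\Lambda$ obtained from $k\Lambda_r$ (the $r\times k$ rectangle) by removing vertical dominoes. Define $\mathfrak S$ on $\pm$-diagrams: for inner shape $\lambda$ let $c_i$ be the number of columns of height $i$ of $\lambda$, $1\le i<r$, $c_0=k-\lambda_1$ ($\lambda_1$ the first part of the inner shape). If $i\equiv r-1\pmod2$, above each column of $\lambda$ of height $i$ there is a $+$ or a $-$; interchange the numbers of such $+$ and $-$. If $i\equiv r\pmod 2$, above each column of height $i$ there is nothing or a $\mp$ pair; if there are $q_i$ pairs, change this to $c_i-q_i$ pairs. The inner shape is kept. Let $\sigma$ be the involution on $B^{r,k}$ that commutes with $e_i,f_i$ ($i\in J$) and acts on $J$-highest elements as $\Phi\circ\mathfrak S\circ\Phi^{-1}$. Then $e_0=\sigma e_1\sigma$, $f_0=\sigma f_1\sigma$. **$B^{1,l}$.** Its elements are one-row KN tableaux of length $l$, written as coordinates $x=(x_1,\ldots,x_n,\overline{x}_n,\ldots,\overline{x}_1)$ (with an additional $x_0\in\{0,1\}$ for $B_n^{(1)}$; $x_n=0$ or $\overline{x}_n=0$ for $D_n^{(1)}$), where $x_i,\overline x_i,x_0$ are the numbers of letters $i,\bar i,0$ and the total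 is $l$. $1^l$ is the element with $x_1=l$. In the case $r=n$ for $A_{2n-1}^{(2)}$, $x_{n+1}$ is understood as $0$. **$R$ and $H$.** $R$ is the unique bijection $B^{r,k}\otimes B^{1,l}\to B^{1,l}\otimes B^{r,k}$ commuting with $e_i,f_i$ for all $i\in I$. For $R(b\otimes b')=\tilde b'\otimes\tilde b$ and $e_i(b\otimes b')\neq0$, say case (LL) occurs if $e_i$ acts on the left factor of both $b\otimes b'$ and $\tilde b'\otimes\tilde b$, and (RR) if it acts on the right factor of both. The energy function $H:B^{r,k}\otimes B^{1,l}\to\mathbb Z$ is determined up to an additive constant by: $H(e_i(b\otimes b'))=H(b\otimes b')+1$ if $i=0$ and (LL); $=H(b\otimes b')-1$ if $i=0$ and (RR); $=H(b\otimes b')$ otherwise. $(k^r)$ is the highest weight element of $B(k\Lambda_r)\subset B^{r,k}$. *)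

theory Defs
  imports Main
begin

section \<open>Crystals and tensor products\<close>

text \<open>The value \<^term>\<open>None\<close> plays the role of the element 0 of a crystal.
  The operators are only meaningful on the underlying set.\<close>

record 'a crystal =
  elts :: "'a set"
  eop :: "nat \<Rightarrow> 'a \<Rightarrow> 'a option"
  fop :: "nat \<Rightarrow> 'a \<Rightarrow> 'a option"

definition iter_op :: "('a \<Rightarrow> 'a option) \<Rightarrow> nat \<Rightarrow> 'a \<Rightarrow> 'a option" where
  "iter_op g m b = ((\<lambda>u. Option.bind u g) ^^ m) (Some b)"

definition veps :: "'a crystal \<Rightarrow> nat \<Rightarrow> 'a \<Rightarrow> nat" where
  "veps C i b = Max {m. iter_op (eop C i) m b \<noteq> None}"

definition vphi :: "'a crystal \<Rightarrow> nat \<Rightarrow> 'a \<Rightarrow> nat" where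
  "vphi C i b = Max {m. iter_op (fop C i) m b \<noteq> None}"

definition tensor :: "'a crystal \<Rightarrow> 'b crystal \<Rightarrow> ('a \<times> 'b) crystal" where
  "tensor A B =
    \<lparr> elts = elts A \<times> elts B,
      eop = (\<lambda>i (a, b). if vphi A i a \<ge> veps B i b
               then map_option (\<lambda>a'. (a', b)) (eop A i a)
               else map_option (\<lambda>b'. (a, b')) (eop B i b)),
      fop = (\<lambda>i (a, b). if vphi A i a > veps B i b
               then map_option (\<lambda>a'. (a', b)) (fop A i a)
               else map_option (\<lambda>b'. (a, b')) (fop B i b)) \<rparr>"

definition highest :: "nat set \<Rightarrow> 'a crystal \<Rightarrow> 'a \<Rightarrow> bool" where
  "highest K C b \<longleftrightarrow> (\<forall>i\<in>K. eop C i b = None)"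

inductive_set component :: "'a crystal \<Rightarrow> nat set \<Rightarrow> 'a \<Rightarrow> 'a set"
  for C :: "'a crystal" and K :: "nat set" and b :: 'a where
  base: "b \<in> component C K b"
| e_step: "x \<in> component C K b \<Longrightarrow> i \<in> K \<Longrightarrow> eop C i x = Some y \<Longrightarrow> y \<in> component C K b"
| f_step: "x \<in> component C K b \<Longrightarrow> i \<in> K \<Longrightarrow> fop C i x = Some y \<Longrightarrow> y \<in> component C K b"

definition relabel :: "('a \<Rightarrow> 'b) \<Rightarrow> ('b \<Rightarrow> 'a) \<Rightarrow> 'a crystal \<Rightarrow> 'b crystal" where
  "relabel g h C =
    \<lparr> elts = g ` elts C,
      eop = (\<lambda>i b. map_option g (eop C i (h b))),
      fop = (\<lambda>i b. map_option g (fop C i (h b))) \<rparr>"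

definition crystal_iso ::
    "nat set \<Rightarrow> 'a crystal \<Rightarrow> 'b crystal \<Rightarrow> ('a \<Rightarrow> 'b) \<Rightarrow> bool" where
  "crystal_iso K A B R \<longleftrightarrow> bij_betw R (elts A) (elts B) \<and>
     (\<forall>i\<in>K. \<forall>u\<in>elts A.
        map_option R (eop A i u) = eop B i (R u) \<and>
        map_option R (fop A i u) = fop B i (R u))"


section \<open>Vector crystals\<close>

datatype affine_type = D1 | B1 | A2odd

text \<open>The constructors stand for the affine types \<open>D\<^sub>n\<close> and \<open>B\<^sub>n\<close> (untwisted) and
  \<open>A\<^sub>2\<^sub>n\<^sub>-\<^sub>1\<close> (twisted), whose classical subalgebras have types \<open>D\<^sub>n\<close>, \<open>B\<^sub>n\<close>, \<open>C\<^sub>n\<close>.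
  The rank bounds are those for which the nodes 0 and 1 are distinct end nodes joined
  to 2; the bounds on \<open>r\<close> exclude spin weights.\<close>

fun admissible :: "affine_type \<Rightarrow> nat \<Rightarrow> nat \<Rightarrow> bool" where
  "admissible D1 n r \<longleftrightarrow> 4 \<le> n \<and> 1 \<le> r \<and> r \<le> n - 2"
| "admissible B1 n r \<longleftrightarrow> 3 \<le> n \<and> 1 \<le> r \<and> r \<le> n - 1"
| "admissible A2odd n r \<longleftrightarrow> 3 \<le> n \<and> 1 \<le> r \<and> r \<le> n"

text \<open>The letter \<open>i\<close> is encoded by \<^term>\<open>int i\<close>, the barred letter by \<^term>\<open>- int i\<close>.
  With this encoding the arrow labelled \<open>i < n\<close> is \<open>x \<mapsto> x + 1\<close> both from \<open>i\<close> and from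
  barred \<open>i + 1\<close>; in type \<open>D\<^sub>n\<close> the arrows labelled \<open>n\<close> go from \<open>n - 1\<close> to barred \<open>n\<close> and
  from \<open>n\<close> to barred \<open>n - 1\<close>.\<close>

fun letter_fn :: "affine_type \<Rightarrow> nat \<Rightarrow> int \<Rightarrow> int option" where
  "letter_fn D1 n x =
     (if x = int n - 1 then Some (- int n)
      else if x = int n then Some (- (int n - 1)) else None)"
| "letter_fn B1 n x =
     (if x = int n then Some 0 else if x = 0 then Some (- int n) else None)"
| "letter_fn A2odd n x = (if x = int n then Some (- int n) else None)"

fun letter_en :: "affine_type \<Rightarrow> nat \<Rightarrow> int \<Rightarrow> int option" where
  "letter_en D1 n x =
     (if x = - int n then Some (int n - 1)
      else if x = - (int n - 1) then Some (int n) else None)"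
| "letter_en B1 n x =
     (if x = 0 then Some (int n) else if x = - int n then Some 0 else None)"
| "letter_en A2odd n x = (if x = - int n then Some (int n) else None)"

definition vector_crystal :: "affine_type \<Rightarrow> nat \<Rightarrow> int crystal" where
  "vector_crystal t n =
    \<lparr> elts = {x. \<bar>x\<bar> \<le> int n \<and> (x = 0 \<longrightarrow> t = B1)},
      eop = (\<lambda>i x. if 1 \<le> i \<and> i < n
               then (if x = int i + 1 \<or> x = - int i then Some (x - 1) else None)
               else if i = n then letter_en t n x else None),
      fop = (\<lambda>i x. if 1 \<le> i \<and> i < n
               then (if x = int i \<or> x = - (int i + 1) then Some (x + 1) else None)
               else if i = n then letter_fn t n x else None) \<rparr>"

text \<open>Tensor powers of the vector crystal, written as words.\<close>

primrec word_crystal :: "affine_type \<Rightarrow> nat \<Rightarrow> nat \<Rightarrow> int list crystal" where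
  "word_crystal t n 0 = \<lparr> elts = {[]}, eop = (\<lambda>i w. None), fop = (\<lambda>i w. None) \<rparr>"
| "word_crystal t n (Suc m) =
     relabel (\<lambda>(x, w). x # w) (\<lambda>w. (hd w, tl w))
       (tensor (vector_crystal t n) (word_crystal t n m))"


section \<open>Kashiwara--Nakashima tableaux\<close>

text \<open>A Young diagram is the list of its column heights, from left to right (all positive,
  weakly decreasing). A tableau is the list of its columns from left to right, each column
  being read from bottom to top (French notation). Its reading word takes the columns from
  right to left, each from bottom to top; this is the reading that embeds the tableaux into
  a tensor power of the vector crystal for the tensor product rule used here.\<close>

type_synonym tableau = "int list list"

abbreviation tshape :: "tableau \<Rightarrow> nat list" where
  "tshape T \<equiv> map length T"

definition reading :: "tableau \<Rightarrow> int list" where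
  "reading T = concat (rev T)"

primrec cut :: "nat list \<Rightarrow> 'a list \<Rightarrow> 'a list list" where
  "cut [] w = []"
| "cut (h # hs) w = take h w # cut hs (drop h w)"

definition unread :: "nat list \<Rightarrow> int list \<Rightarrow> tableau" where
  "unread hs w = rev (cut (rev hs) w)"

definition hw_tableau :: "nat list \<Rightarrow> tableau" where
  "hw_tableau hs = map (\<lambda>h. [1..int h]) hs"

definition filling_crystal :: "affine_type \<Rightarrow> nat \<Rightarrow> nat list \<Rightarrow> tableau crystal" where
  "filling_crystal t n hs =
     relabel (unread hs) reading (word_crystal t n (sum_list hs))"

text \<open>The crystal of highest weight \<open>\<Lambda>\<close> for a weight without spin part. The KN tableaux of
  shape \<open>\<Lambda>\<close> are the fillings in the connected component of the highest weight tableau in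
  the tensor power of the vector crystal.\<close>

definition hw_crystal :: "affine_type \<Rightarrow> nat \<Rightarrow> nat list \<Rightarrow> tableau crystal" where
  "hw_crystal t n hs =
     (filling_crystal t n hs)
       \<lparr> elts := component (filling_crystal t n hs) {1..n} (hw_tableau hs) \<rparr>"

definition letter_count :: "tableau \<Rightarrow> int \<Rightarrow> int" where
  "letter_count T a = int (count_list (concat T) a)"

text \<open>Coefficient of the \<open>j\<close>-th standard basis vector in the weight; for a dominant weight
  without spin part this is the \<open>j\<close>-th part of the corresponding partition.\<close>

definition wt :: "tableau \<Rightarrow> nat \<Rightarrow> int" where
  "wt T j = letter_count T (int j) - letter_count T (- int j)"

definition wt_tensor :: "tableau \<times> tableau \<Rightarrow> nat \<Rightarrow> int" where
  "wt_tensor u j = wt (fst u) j + wt (snd u) j"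


section \<open>Plus-minus diagrams\<close>

text \<open>Here a partition is given by its sequence of column heights, extended by zeros.\<close>

definition partition_cols :: "(nat \<Rightarrow> nat) \<Rightarrow> bool" where
  "partition_cols c \<longleftrightarrow> antimono c \<and> finite {j. c j \<noteq> 0}"

definition first_part :: "(nat \<Rightarrow> nat) \<Rightarrow> nat" where
  "first_part c = card {j. c j \<noteq> 0}"

definition col_list :: "(nat \<Rightarrow> nat) \<Rightarrow> nat list" where
  "col_list c = map c [0..<first_part c]"

text \<open>At most one cell in each column.\<close>

definition horizontal_strip :: "(nat \<Rightarrow> nat) \<Rightarrow> (nat \<Rightarrow> nat) \<Rightarrow> bool" where
  "horizontal_strip c d \<longleftrightarrow> (\<forall>j. c j \<le> d j \<and> d j \<le> c j + 1)"

record pmdiag =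
  inner_shape :: "nat \<Rightarrow> nat"
  mid_shape :: "nat \<Rightarrow> nat"
  outer_shape :: "nat \<Rightarrow> nat"

definition pm_diagram :: "affine_type \<Rightarrow> nat \<Rightarrow> pmdiag \<Rightarrow> bool" where
  "pm_diagram t n P \<longleftrightarrow>
     partition_cols (inner_shape P) \<and> partition_cols (mid_shape P) \<and>
     partition_cols (outer_shape P) \<and>
     horizontal_strip (inner_shape P) (mid_shape P) \<and>
     horizontal_strip (mid_shape P) (outer_shape P) \<and>
     (t = A2odd \<longrightarrow> (\<forall>j. outer_shape P j \<le> n \<and> inner_shape P j < n))"

definition has_plus :: "pmdiag \<Rightarrow> nat \<Rightarrow> bool" where
  "has_plus P j \<longleftrightarrow> inner_shape P j < mid_shape P j"

definition has_minus :: "pmdiag \<Rightarrow> nat \<Rightarrow> bool" where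
  "has_minus P j \<longleftrightarrow> mid_shape P j < outer_shape P j"

definition p_none :: "nat \<Rightarrow> pmdiag \<Rightarrow> nat \<Rightarrow> int" where
  "p_none k P i =
     (if i = 0 then int k - int (first_part (outer_shape P))
      else int (card {j. outer_shape P j = i \<and> \<not> has_plus P j \<and> \<not> has_minus P j}))"

definition p_plus :: "pmdiag \<Rightarrow> nat \<Rightarrow> int" where
  "p_plus P i = int (card {j. outer_shape P j = i \<and> has_plus P j \<and> \<not> has_minus P j})"

definition p_minus :: "pmdiag \<Rightarrow> nat \<Rightarrow> int" where
  "p_minus P i = int (card {j. outer_shape P j = i \<and> \<not> has_plus P j \<and> has_minus P j})"

definition p_both :: "pmdiag \<Rightarrow> nat \<Rightarrow> int" where
  "p_both P i = int (card {j. outer_shape P j = i \<and> has_plus P j \<and> has_minus P j})"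


section \<open>The bijection from plus-minus diagrams to highest weight elements for the Levi part\<close>

text \<open>The list \<open>hs\<close> holds the heights of the \<open>+\<close> symbols (at height less than \<open>n\<close>, from
  left to right) that have not yet been used. Moving through the tableau, each barred 1 and
  each string \<open>23\<dots>k'\<close> that is encountered uses up the next one. The functions return the
  altered letters and the remaining heights; \<open>v\<close> is the length of the string,
  i.e. \<open>k' = v + 1\<close>.\<close>

fun alter_bar :: "nat list \<Rightarrow> int list \<times> nat list" where
  "alter_bar [] = ([- 1], [])"
| "alter_bar (h # hs) = ([- (int h + 1)], hs)"

fun alter_string :: "nat \<Rightarrow> nat list \<Rightarrow> int list \<times> nat list" where
  "alter_string v [] = ([2..int v + 1], [])"
| "alter_string v (h # hs) = ([1..int h] @ [int h + 2..int v + 1], hs)"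

text \<open>The third argument lists for each column the heights \<open>v\<close>, \<open>u\<close> of the middle and outer
  shape. The case \<open>v = n\<close> is that of a column of height \<open>n\<close> with a \<open>+\<close> at height \<open>n\<close>;
  columns of height \<open>n\<close> whose \<open>+\<close> sits below a \<open>-\<close> are treated like all others.\<close>

primrec Phi_cols :: "nat \<Rightarrow> nat list \<Rightarrow> (nat \<times> nat) list \<Rightarrow> tableau" where
  "Phi_cols n hs [] = []"
| "Phi_cols n hs (c # cs) =
     (let (v, u) = c in
      if v = n then [1..int n] # Phi_cols n hs cs
      else
        let (bar, hs1) = (if v < u then alter_bar hs else ([], hs));
            (str, hs2) = (if 0 < v then alter_string v hs1 else ([], hs1))
        in (str @ bar) # Phi_cols n hs2 cs)"

definition Phi :: "nat \<Rightarrow> pmdiag \<Rightarrow> tableau" where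
  "Phi n P =
     (let js = [0..<first_part (outer_shape P)] in
      Phi_cols n
        (map (mid_shape P) (filter (\<lambda>j. has_plus P j \<and> mid_shape P j \<noteq> n) js))
        (map (\<lambda>j. (mid_shape P j, outer_shape P j)) js))"


section \<open>Kirillov--Reshetikhin crystals\<close>

text \<open>Shapes obtained from the \<open>r \<times> k\<close> rectangle by removing vertical dominoes.\<close>

definition KR_shapes :: "nat \<Rightarrow> nat \<Rightarrow> nat list set" where
  "KR_shapes r k =
     {filter (\<lambda>h. 0 < h) hs | hs.
        length hs = k \<and> sorted_wrt (\<ge>) hs \<and> (\<forall>h\<in>set hs. h \<le> r \<and> even (r - h))}"

definition KR_classical ::
    "affine_type \<Rightarrow> nat \<Rightarrow> nat \<Rightarrow> nat \<Rightarrow> tableau crystal" where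
  "KR_classical t n r k =
    \<lparr> elts = (\<Union>hs\<in>KR_shapes r k. elts (hw_crystal t n hs)),
      eop = (\<lambda>i T. eop (hw_crystal t n (tshape T)) i T),
      fop = (\<lambda>i T. fop (hw_crystal t n (tshape T)) i T) \<rparr>"

definition KR_pm :: "affine_type \<Rightarrow> nat \<Rightarrow> nat \<Rightarrow> nat \<Rightarrow> pmdiag \<Rightarrow> bool" where
  "KR_pm t n r k P \<longleftrightarrow> pm_diagram t n P \<and> col_list (outer_shape P) \<in> KR_shapes r k"

text \<open>Number of columns of height \<open>i\<close> of the inner shape, among the first \<open>k\<close> columns,
  above which the given symbols stand. For \<open>i = 0\<close> this includes empty columns.\<close>

definition inner_count :: "nat \<Rightarrow> pmdiag \<Rightarrow> nat \<Rightarrow> bool \<Rightarrow> bool \<Rightarrow> nat" where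
  "inner_count k P i pl mi =
     card {j. j < k \<and> inner_shape P j = i \<and> (has_plus P j \<longleftrightarrow> pl) \<and> (has_minus P j \<longleftrightarrow> mi)}"

text \<open>The graph of the involution \<open>\<SS>\<close> on plus-minus diagrams: among the diagrams of
  \<^term>\<open>KR_pm t n r k\<close>, \<open>P'\<close> is determined by \<open>P\<close>.\<close>

definition S_graph :: "nat \<Rightarrow> nat \<Rightarrow> pmdiag \<Rightarrow> pmdiag \<Rightarrow> bool" where
  "S_graph r k P P' \<longleftrightarrow>
     inner_shape P' = inner_shape P \<and>
     (\<forall>i<r. if odd (r - i)
        then inner_count k P' i True False = inner_count k P i False True \<and>
             inner_count k P' i False True = inner_count k P i True False
        else inner_count k P' i True True =
               card {j. j < k \<and> inner_shape P j = i} - inner_count k P i True True)"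

definition KR_involution ::
    "affine_type \<Rightarrow> nat \<Rightarrow> nat \<Rightarrow> nat \<Rightarrow> (tableau \<Rightarrow> tableau) \<Rightarrow> bool" where
  "KR_involution t n r k \<sigma> \<longleftrightarrow>
     (\<forall>b\<in>elts (KR_classical t n r k).
        \<sigma> b \<in> elts (KR_classical t n r k) \<and> \<sigma> (\<sigma> b) = b) \<and>
     (\<forall>i\<in>{2..n}. \<forall>b\<in>elts (KR_classical t n r k).
        map_option \<sigma> (eop (KR_classical t n r k) i b) = eop (KR_classical t n r k) i (\<sigma> b) \<and>
        map_option \<sigma> (fop (KR_classical t n r k) i b) = fop (KR_classical t n r k) i (\<sigma> b)) \<and>
     (\<forall>P P'. KR_pm t n r k P \<and> KR_pm t n r k P' \<and> S_graph r k P P' \<longrightarrow>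
        \<sigma> (Phi n P) = Phi n P')"

text \<open>The conditions in \<^const>\<open>KR_involution\<close> determine \<open>\<sigma>\<close> on the crystal, so it may be
  passed as a parameter.\<close>

definition KR_crystal ::
    "affine_type \<Rightarrow> nat \<Rightarrow> nat \<Rightarrow> nat \<Rightarrow> (tableau \<Rightarrow> tableau) \<Rightarrow> tableau crystal" where
  "KR_crystal t n r k \<sigma> =
    \<lparr> elts = elts (KR_classical t n r k),
      eop = (\<lambda>i T. if i = 0 then map_option \<sigma> (eop (KR_classical t n r k) 1 (\<sigma> T))
                   else eop (KR_classical t n r k) i T),
      fop = (\<lambda>i T. if i = 0 then map_option \<sigma> (fop (KR_classical t n r k) 1 (\<sigma> T))
                   else fop (KR_classical t n r k) i T) \<rparr>"


section \<open>Combinatorial R-matrix and energy function\<close>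

definition R_matrix ::
    "nat \<Rightarrow> 'a crystal \<Rightarrow> 'b crystal \<Rightarrow> ('a \<times> 'b \<Rightarrow> 'b \<times> 'a) \<Rightarrow> bool" where
  "R_matrix n A B R \<longleftrightarrow> crystal_iso {0..n} (tensor A B) (tensor B A) R"

text \<open>For an element on which \<open>e\<^sub>i\<close> does not vanish: \<open>e\<^sub>i\<close> acts on the left factor.\<close>

definition acts_left :: "'a crystal \<Rightarrow> 'b crystal \<Rightarrow> nat \<Rightarrow> 'a \<times> 'b \<Rightarrow> bool" where
  "acts_left A B i u \<longleftrightarrow> vphi A i (fst u) \<ge> veps B i (snd u)"

definition energy_function ::
    "nat \<Rightarrow> 'a crystal \<Rightarrow> 'b crystal \<Rightarrow> ('a \<times> 'b \<Rightarrow> 'b \<times> 'a) \<Rightarrow>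
      ('a \<times> 'b \<Rightarrow> int) \<Rightarrow> bool" where
  "energy_function n A B R H \<longleftrightarrow>
     (\<forall>i\<in>{0..n}. \<forall>u\<in>elts (tensor A B). \<forall>u'. eop (tensor A B) i u = Some u' \<longrightarrow>
        H u' =
          (if i = 0 \<and> acts_left A B i u \<and> acts_left B A i (R u) then H u + 1
           else if i = 0 \<and> \<not> acts_left A B i u \<and> \<not> acts_left B A i (R u) then H u - 1
           else H u))"

text \<open>The coefficient of the \<open>i\<close>-th fundamental weight in the weight of the Young diagram
  \<open>\<mu>\<close>, with the convention that all coefficients, \<open>i = 0\<close> included, add up to \<open>k\<close>.\<close>

definition fund_coeff :: "nat \<Rightarrow> nat list \<Rightarrow> nat \<Rightarrow> int" where
  "fund_coeff k \<mu> i = (if i = 0 then int k - int (length \<mu>) else int (count_list \<mu> i))"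

end

theory Submission
  imports Defs
begin

text \<open>All tableaux are handled through their reading words. On words, the maximal power \<open>E\<^sub>i\<close> of
  \<open>e\<^sub>i\<close> is a transducer, and the braid relations between the \<open>E\<^sub>i\<close> make the highest weight
  word of a component unique.

  Let \<open>\<Sigma>\<close> be the pair of involutions that exchange the nodes 0 and 1 on both factors. Along the path
  \<open>1, 2, \<dots>, n, \<dots>, 2, 1\<close> the maximal raisings of \<open>\<Sigma>(\<mu> \<otimes> x)\<close> and of \<open>\<Sigma>(1\<^sup>l \<otimes> \<Phi>(P))\<close> can be
  followed explicitly: \<open>\<Phi>(P)\<close> is described by the heights of the \<open>+\<close> symbols that each of its strings
  and barred letters has consumed, and each \<open>E\<^sub>i\<close> raises all of these that are still too low. On
  both sides \<open>\<phi>\<close> before every step agrees, and so do the final weights, hence all exponents agree.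
  Doing this twice leads, by the same sequence of raising operators, to \<open>\<mu>' \<otimes> 1\<^sup>l\<close> and
  \<open>1\<^sup>l \<otimes> \<mu>'\<close>, where \<open>\<mu>'\<close> has \<open>k\<close> columns. So \<open>R(\<mu> \<otimes> x) = 1\<^sup>l \<otimes> \<Phi>(P)\<close> reduces to
  \<open>R(\<mu>' \<otimes> 1\<^sup>l) = 1\<^sup>l \<otimes> \<mu>'\<close>. This holds for the rectangle by weights, and is passed on to the
  other \<open>\<mu>'\<close> by lowering columns of minimal height by two with \<open>e\<^sub>0\<close> while the row is a power of a
  single neutral letter. The energy changes only in the two steps labelled 0 of the first
  path; there \<open>H(u) + \<epsilon>\<^sub>0(left factor of R(u)) - (\<epsilon>\<^sub>0(y) - \<phi>\<^sub>0(b))\<^sub>+\<close>, for \<open>u = b \<otimes> y\<close>, is constant along a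
  string.\<close>

section \<open>Seminormal crystals\<close>

text \<open>Since \<sigma> turns \<open>1^l\<close> into a row of barred 1s, the path is the chain
  of nodes along which barred 1 climbs to 1 in the vector crystal. Such a row shields nothing, so
  \<Phi>(P) moves as if it stood alone, and \<phi> before each step is a number of symbols of P. The
  exponents look different on the two sides and are not compared directly; this is why \<phi> is
  compared instead. Nor is R evaluated by a formula: it transports a sequence of raisings with given
  exponents, and such a sequence can be undone.

  One passage does not suffice. The m missing columns of \<mu> become columns of height 2 under
  \<sigma>, which shield min(m, x_1) barred 1s of the row; these end as barred 2s. The result is a
  highest weight element without missing columns, so the second passage ends at \<open>1^l\<close>.

  Uniqueness of highest weight words is needed because B(\<Lambda>) is given as a connected
  component: it reduces membership to the existence of one sequence of raisings, and it determines
  an I_0-highest element by its shape.\<close>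

definition seminormal ::
    "'a crystal \<Rightarrow> nat \<Rightarrow> ('a \<Rightarrow> nat) \<Rightarrow> ('a \<Rightarrow> nat) \<Rightarrow> bool" where
  "seminormal C i ep ph \<longleftrightarrow> (\<forall>b\<in>elts C.
     (case eop C i b of None \<Rightarrow> ep b = 0
      | Some c \<Rightarrow> c \<in> elts C \<and> fop C i c = Some b \<and> ep b = Suc (ep c) \<and> ph c = Suc (ph b)) \<and>
     (case fop C i b of None \<Rightarrow> ph b = 0
      | Some c \<Rightarrow> c \<in> elts C \<and> eop C i c = Some b \<and> ph b = Suc (ph c) \<and> ep c = Suc (ep b)))"

lemma seminormal_eD:
  assumes "seminormal C i ep ph" "b \<in> elts C" "eop C i b = Some c"
  shows "c \<in> elts C" "fop C i c = Some b" "ep b = Suc (ep c)" "ph c = Suc (ph b)"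
proof -
  have "case eop C i b of None \<Rightarrow> ep b = 0
      | Some c \<Rightarrow> c \<in> elts C \<and> fop C i c = Some b \<and> ep b = Suc (ep c) \<and> ph c = Suc (ph b)"
    using assms(1,2) unfolding seminormal_def by blast
  then show "c \<in> elts C" "fop C i c = Some b" "ep b = Suc (ep c)" "ph c = Suc (ph b)"
    using assms(3) by simp_all
qed

lemma seminormal_fD:
  assumes "seminormal C i ep ph" "b \<in> elts C" "fop C i b = Some c"
  shows "c \<in> elts C" "eop C i c = Some b" "ph b = Suc (ph c)" "ep c = Suc (ep b)"
proof -
  have "case fop C i b of None \<Rightarrow> ph b = 0
      | Some c \<Rightarrow> c \<in> elts C \<and> eop C i c = Some b \<and> ph b = Suc (ph c) \<and> ep c = Suc (ep b)"
    using assms(1,2) unfolding seminormal_def by blast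
  then show "c \<in> elts C" "eop C i c = Some b" "ph b = Suc (ph c)" "ep c = Suc (ep b)"
    using assms(3) by simp_all
qed

lemma seminormal_None:
  assumes "seminormal C i ep ph" "b \<in> elts C"
  shows "eop C i b = None \<longleftrightarrow> ep b = 0" "fop C i b = None \<longleftrightarrow> ph b = 0"
proof -
  have E: "case eop C i b of None \<Rightarrow> ep b = 0
      | Some c \<Rightarrow> c \<in> elts C \<and> fop C i c = Some b \<and> ep b = Suc (ep c) \<and> ph c = Suc (ph b)"
    and F: "case fop C i b of None \<Rightarrow> ph b = 0
      | Some c \<Rightarrow> c \<in> elts C \<and> eop C i c = Some b \<and> ph b = Suc (ph c) \<and> ep c = Suc (ep b)"
    using assms unfolding seminormal_def by blast+
  show "eop C i b = None \<longleftrightarrow> ep b = 0"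
  proof (cases "eop C i b")
    case (Some c)
    with E have "ep b = Suc (ep c)" by simp
    with Some show ?thesis by simp
  qed (use E in simp)
  show "fop C i b = None \<longleftrightarrow> ph b = 0"
  proof (cases "fop C i b")
    case (Some c)
    with F have "ph b = Suc (ph c)" by simp
    with Some show ?thesis by simp
  qed (use F in simp)
qed

lemma seminormalI:
  assumes "\<And>b c. b \<in> elts C \<Longrightarrow> eop C i b = Some c \<Longrightarrow>
      c \<in> elts C \<and> fop C i c = Some b \<and> ep b = Suc (ep c) \<and> ph c = Suc (ph b)"
    and "\<And>b c. b \<in> elts C \<Longrightarrow> fop C i b = Some c \<Longrightarrow>
      c \<in> elts C \<and> eop C i c = Some b \<and> ph b = Suc (ph c) \<and> ep c = Suc (ep b)"
    and "\<And>b. b \<in> elts C \<Longrightarrow> eop C i b = None \<Longrightarrow> ep b = 0"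
    and "\<And>b. b \<in> elts C \<Longrightarrow> fop C i b = None \<Longrightarrow> ph b = 0"
  shows "seminormal C i ep ph"
  unfolding seminormal_def
proof (intro ballI conjI)
  fix b assume b: "b \<in> elts C"
  show "case eop C i b of None \<Rightarrow> ep b = 0
      | Some c \<Rightarrow> c \<in> elts C \<and> fop C i c = Some b \<and> ep b = Suc (ep c) \<and> ph c = Suc (ph b)"
    using assms(1)[OF b] assms(3)[OF b] by (cases "eop C i b") simp_all
  show "case fop C i b of None \<Rightarrow> ph b = 0
      | Some c \<Rightarrow> c \<in> elts C \<and> eop C i c = Some b \<and> ph b = Suc (ph c) \<and> ep c = Suc (ep b)"
    using assms(2)[OF b] assms(4)[OF b] by (cases "fop C i b") simp_all
qed

lemma iter_op_0 [simp]: "iter_op g 0 b = Some b"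
  by (simp add: iter_op_def)

lemma iter_op_None: "((\<lambda>u. Option.bind u (g :: 'a \<Rightarrow> 'a option)) ^^ m) None = None"
  by (induction m) auto

lemma iter_op_Suc: "iter_op g (Suc m) b = Option.bind (g b) (iter_op g m)"
  unfolding iter_op_def funpow_Suc_right
  by (cases "g b") (auto simp: iter_op_None iter_op_def)

lemma iter_op_add: "iter_op g (m + k) b = Option.bind (iter_op g m b) (iter_op g k)"
proof (induction m arbitrary: b)
  case (Suc m)
  then show ?case by (cases "g b") (simp_all add: iter_op_Suc)
qed simp

lemma iter_op_1 [simp]: "iter_op g (Suc 0) b = g b"
  by (cases "g b") (simp_all add: iter_op_Suc)

lemma iter_e_Some:
  assumes "seminormal C i ep ph" "b \<in> elts C"
  shows "iter_op (eop C i) m b \<noteq> None \<longleftrightarrow> m \<le> ep b"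
  using assms(2)
proof (induction m arbitrary: b)
  case (Suc m)
  show ?case
  proof (cases "eop C i b")
    case None
    then show ?thesis using seminormal_None[OF assms(1) Suc.prems] by (simp add: iter_op_Suc)
  next
    case (Some c)
    then show ?thesis using seminormal_eD[OF assms(1) Suc.prems Some] Suc.IH[of c]
      by (simp add: iter_op_Suc)
  qed
qed simp

lemma iter_f_Some:
  assumes "seminormal C i ep ph" "b \<in> elts C"
  shows "iter_op (fop C i) m b \<noteq> None \<longleftrightarrow> m \<le> ph b"
  using assms(2)
proof (induction m arbitrary: b)
  case (Suc m)
  show ?case
  proof (cases "fop C i b")
    case None
    then show ?thesis using seminormal_None[OF assms(1) Suc.prems] by (simp add: iter_op_Suc)
  next
    case (Some c)
    then show ?thesis using seminormal_fD[OF assms(1) Suc.prems Some] Suc.IH[of c]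
      by (simp add: iter_op_Suc)
  qed
qed simp

text \<open>\<open>ep\<close> and \<open>ph\<close> are arbitrary candidates. The local conditions
  of \<open>seminormal\<close> certify a formula, and the set under the maximum in
  \<open>veps\<close> is then an initial segment ending at \<open>ep b\<close>.\<close>

lemma veps_eq:
  assumes "seminormal C i ep ph" "b \<in> elts C"
  shows "veps C i b = ep b"
proof -
  have "{m. iter_op (eop C i) m b \<noteq> None} = {..ep b}"
    using iter_e_Some[OF assms] by auto
  then show ?thesis unfolding veps_def by (metis Max_eqI atMost_iff finite_atMost order_refl)
qed

lemma vphi_eq:
  assumes "seminormal C i ep ph" "b \<in> elts C"
  shows "vphi C i b = ph b"
proof -
  have "{m. iter_op (fop C i) m b \<noteq> None} = {..ph b}"
    using iter_f_Some[OF assms] by auto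
  then show ?thesis unfolding vphi_def by (metis Max_eqI atMost_iff finite_atMost order_refl)
qed

lemma seminormal_canonical:
  assumes "seminormal C i ep ph"
  shows "seminormal C i (veps C i) (vphi C i)"
proof (rule seminormalI)
  fix b c assume b: "b \<in> elts C" and *: "eop C i b = Some c"
  note D = seminormal_eD[OF assms b *]
  show "c \<in> elts C \<and> fop C i c = Some b \<and> veps C i b = Suc (veps C i c) \<and>
      vphi C i c = Suc (vphi C i b)"
    unfolding veps_eq[OF assms b] vphi_eq[OF assms b] veps_eq[OF assms D(1)] vphi_eq[OF assms D(1)]
    using D by blast
next
  fix b c assume b: "b \<in> elts C" and *: "fop C i b = Some c"
  note D = seminormal_fD[OF assms b *]
  show "c \<in> elts C \<and> eop C i c = Some b \<and> vphi C i b = Suc (vphi C i c) \<and>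
      veps C i c = Suc (veps C i b)"
    unfolding veps_eq[OF assms b] vphi_eq[OF assms b] veps_eq[OF assms D(1)] vphi_eq[OF assms D(1)]
    using D by blast
next
  fix b assume b: "b \<in> elts C"
  show "eop C i b = None \<Longrightarrow> veps C i b = 0" "fop C i b = None \<Longrightarrow> vphi C i b = 0"
    using seminormal_None[OF assms b] veps_eq[OF assms b] vphi_eq[OF assms b] by simp_all
qed

lemma iter_e_props:
  assumes "seminormal C i ep ph" "b \<in> elts C" "iter_op (eop C i) m b = Some c"
  shows "c \<in> elts C" "iter_op (fop C i) m c = Some b" "ep b = m + ep c" "ph c = m + ph b"
proof -
  have "c \<in> elts C \<and> iter_op (fop C i) m c = Some b \<and> ep b = m + ep c \<and> ph c = m + ph b"
    using assms(2,3)
  proof (induction m arbitrary: b)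
    case (Suc m)
    then obtain d where d: "eop C i b = Some d" "iter_op (eop C i) m d = Some c"
      by (auto simp: iter_op_Suc bind_eq_Some_conv)
    note D = seminormal_eD[OF assms(1) Suc.prems(1) d(1)]
    note IH = Suc.IH[OF D(1) d(2)]
    have "iter_op (fop C i) (m + 1) c = Some b"
      using IH D(2) by (simp only: iter_op_add) simp
    then show ?case using IH D by simp
  qed simp
  then show "c \<in> elts C" "iter_op (fop C i) m c = Some b" "ep b = m + ep c" "ph c = m + ph b"
    by auto
qed

section \<open>Tensor products: the signature rule for two factors\<close>

lemma elts_tensor [simp]: "elts (tensor A B) = elts A \<times> elts B"
  by (simp add: tensor_def)

lemma eop_tensor:
  assumes "seminormal A i ea pa" "seminormal B i eb pb" "a \<in> elts A" "b \<in> elts B"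
  shows "eop (tensor A B) i (a, b) =
    (if pa a \<ge> eb b then map_option (\<lambda>a'. (a', b)) (eop A i a)
     else map_option (\<lambda>b'. (a, b')) (eop B i b))"
  by (simp add: tensor_def veps_eq[OF assms(2,4)] vphi_eq[OF assms(1,3)])

lemma fop_tensor:
  assumes "seminormal A i ea pa" "seminormal B i eb pb" "a \<in> elts A" "b \<in> elts B"
  shows "fop (tensor A B) i (a, b) =
    (if pa a > eb b then map_option (\<lambda>a'. (a', b)) (fop A i a)
     else map_option (\<lambda>b'. (a, b')) (fop B i b))"
  by (simp add: tensor_def veps_eq[OF assms(2,4)] vphi_eq[OF assms(1,3)])

text \<open>The truncated subtraction is the cancellation in the signature rule: every arrow that
  can still be followed downwards in the left factor blocks one upward arrow of the right
  factor.\<close>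

lemma seminormal_tensor:
  assumes A: "seminormal A i ea pa" and B: "seminormal B i eb pb"
  shows "seminormal (tensor A B) i
    (\<lambda>(a, b). ea a + (eb b - pa a)) (\<lambda>(a, b). pb b + (pa a - eb b))"
proof (rule seminormalI)
  fix u v assume u: "u \<in> elts (tensor A B)" and *: "eop (tensor A B) i u = Some v"
  obtain a b where ab: "u = (a, b)" "a \<in> elts A" "b \<in> elts B" using u by auto
  note E = eop_tensor[OF A B]
  note F = fop_tensor[OF A B]
  show "v \<in> elts (tensor A B) \<and> fop (tensor A B) i v = Some u \<and>
    (case u of (a, b) \<Rightarrow> ea a + (eb b - pa a)) = Suc (case v of (a, b) \<Rightarrow> ea a + (eb b - pa a)) \<and>
    (case v of (a, b) \<Rightarrow> pb b + (pa a - eb b)) = Suc (case u of (a, b) \<Rightarrow> pb b + (pa a - eb b))"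
  proof (cases "pa a \<ge> eb b")
    case True
    then obtain a' where a': "eop A i a = Some a'" "v = (a', b)"
      using * ab E[of a b] by auto
    note D = seminormal_eD[OF A ab(2) a'(1)]
    show ?thesis using True D a' ab F[of a' b] by auto
  next
    case False
    then obtain b' where b': "eop B i b = Some b'" "v = (a, b')"
      using * ab E[of a b] by auto
    note D = seminormal_eD[OF B ab(3) b'(1)]
    show ?thesis using False D b' ab F[of a b'] by auto
  qed
next
  fix u v assume u: "u \<in> elts (tensor A B)" and *: "fop (tensor A B) i u = Some v"
  obtain a b where ab: "u = (a, b)" "a \<in> elts A" "b \<in> elts B" using u by auto
  note E = eop_tensor[OF A B]
  note F = fop_tensor[OF A B]
  show "v \<in> elts (tensor A B) \<and> eop (tensor A B) i v = Some u \<and>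
    (case u of (a, b) \<Rightarrow> pb b + (pa a - eb b)) = Suc (case v of (a, b) \<Rightarrow> pb b + (pa a - eb b)) \<and>
    (case v of (a, b) \<Rightarrow> ea a + (eb b - pa a)) = Suc (case u of (a, b) \<Rightarrow> ea a + (eb b - pa a))"
  proof (cases "pa a > eb b")
    case True
    then obtain a' where a': "fop A i a = Some a'" "v = (a', b)"
      using * ab F[of a b] by auto
    note D = seminormal_fD[OF A ab(2) a'(1)]
    show ?thesis using True D a' ab E[of a' b] by auto
  next
    case False
    then obtain b' where b': "fop B i b = Some b'" "v = (a, b')"
      using * ab F[of a b] by auto
    note D = seminormal_fD[OF B ab(3) b'(1)]
    show ?thesis using False D b' ab E[of a b'] by auto
  qed
next
  fix u assume u: "u \<in> elts (tensor A B)" and *: "eop (tensor A B) i u = None"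
  obtain a b where ab: "u = (a, b)" "a \<in> elts A" "b \<in> elts B" using u by auto
  show "(case u of (a, b) \<Rightarrow> ea a + (eb b - pa a)) = 0"
    using * ab eop_tensor[OF A B ab(2,3)] seminormal_None[OF A ab(2)] seminormal_None[OF B ab(3)]
    by (auto split: if_splits)
next
  fix u assume u: "u \<in> elts (tensor A B)" and *: "fop (tensor A B) i u = None"
  obtain a b where ab: "u = (a, b)" "a \<in> elts A" "b \<in> elts B" using u by auto
  show "(case u of (a, b) \<Rightarrow> pb b + (pa a - eb b)) = 0"
    using * ab fop_tensor[OF A B ab(2,3)] seminormal_None[OF A ab(2)] seminormal_None[OF B ab(3)]
    by (auto split: if_splits)
qed

lemma iter_e_tensor_right:
  assumes A: "seminormal A i ea pa" and B: "seminormal B i eb pb"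
    and "a \<in> elts A" "b \<in> elts B"
    and "iter_op (eop B i) m b = Some b'" "m \<le> eb b - pa a"
  shows "iter_op (eop (tensor A B) i) m (a, b) = Some (a, b')"
  using assms(4-6)
proof (induction m arbitrary: b)
  case (Suc m)
  then obtain c where c: "eop B i b = Some c" "iter_op (eop B i) m c = Some b'"
    by (auto simp: iter_op_Suc bind_eq_Some_conv)
  note D = seminormal_eD[OF B Suc.prems(1) c(1)]
  have "eop (tensor A B) i (a, b) = Some (a, c)"
    using Suc.prems eop_tensor[OF A B assms(3) Suc.prems(1)] c by auto
  then show ?case using Suc.IH[OF D(1) c(2)] Suc.prems D by (simp add: iter_op_Suc)
qed simp

lemma iter_e_tensor_left:
  assumes A: "seminormal A i ea pa" and B: "seminormal B i eb pb"
    and "a \<in> elts A" "b \<in> elts B"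
    and "iter_op (eop A i) m a = Some a'" "eb b \<le> pa a"
  shows "iter_op (eop (tensor A B) i) m (a, b) = Some (a', b)"
  using assms(3-6)
proof (induction m arbitrary: a)
  case (Suc m)
  then obtain c where c: "eop A i a = Some c" "iter_op (eop A i) m c = Some a'"
    by (auto simp: iter_op_Suc bind_eq_Some_conv)
  note D = seminormal_eD[OF A Suc.prems(1) c(1)]
  have "eop (tensor A B) i (a, b) = Some (c, b)"
    using Suc.prems eop_tensor[OF A B Suc.prems(1,2)] c by auto
  then show ?case using Suc.IH[OF D(1) Suc.prems(2) c(2)] Suc.prems D by (simp add: iter_op_Suc)
qed simp

text \<open>Raising the right factor lowers its \<epsilon> until \<phi> of the left factor is
  reached. From then on the left factor moves, which only increases its \<phi>, so the right factor
  never gets another turn.\<close>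

lemma iter_e_tensor:
  assumes A: "seminormal A i ea pa" and B: "seminormal B i eb pb"
    and a: "a \<in> elts A" and b: "b \<in> elts B"
    and b': "iter_op (eop B i) (eb b - pa a) b = Some b'"
    and a': "iter_op (eop A i) m a = Some a'"
  shows "iter_op (eop (tensor A B) i) ((eb b - pa a) + m) (a, b) = Some (a', b')"
proof -
  note D = iter_e_props[OF B b b']
  have "iter_op (eop (tensor A B) i) (eb b - pa a) (a, b) = Some (a, b')"
    using iter_e_tensor_right[OF A B a b b'] by simp
  moreover have "iter_op (eop (tensor A B) i) m (a, b') = Some (a', b')"
    using iter_e_tensor_left[OF A B a D(1) a'] D(3) by linarith
  ultimately show ?thesis by (simp add: iter_op_add)
qed

lemma seminormal_cong:
  assumes "seminormal C i ep ph" "\<And>b. b \<in> elts C \<Longrightarrow> ep b = ep' b \<and> ph b = ph' b"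
  shows "seminormal C i ep' ph'"
proof (rule seminormalI)
  fix b c assume b: "b \<in> elts C" and *: "eop C i b = Some c"
  note D = seminormal_eD[OF assms(1) b *]
  show "c \<in> elts C \<and> fop C i c = Some b \<and> ep' b = Suc (ep' c) \<and> ph' c = Suc (ph' b)"
    using D assms(2)[OF b] assms(2)[OF D(1)] by simp
next
  fix b c assume b: "b \<in> elts C" and *: "fop C i b = Some c"
  note D = seminormal_fD[OF assms(1) b *]
  show "c \<in> elts C \<and> eop C i c = Some b \<and> ph' b = Suc (ph' c) \<and> ep' c = Suc (ep' b)"
    using D assms(2)[OF b] assms(2)[OF D(1)] by simp
next
  fix b assume b: "b \<in> elts C"
  show "eop C i b = None \<Longrightarrow> ep' b = 0" "fop C i b = None \<Longrightarrow> ph' b = 0"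
    using seminormal_None[OF assms(1) b] assms(2)[OF b] by simp_all
qed

lemma seminormal_relabel:
  assumes C: "seminormal C i ep ph" and hg: "\<And>x. x \<in> elts C \<Longrightarrow> h (g x) = x"
  shows "seminormal (relabel g h C) i (ep \<circ> h) (ph \<circ> h)"
proof (rule seminormalI)
  fix b c assume b: "b \<in> elts (relabel g h C)" and *: "eop (relabel g h C) i b = Some c"
  then obtain x y where x: "x \<in> elts C" "b = g x" "eop C i x = Some y" "c = g y"
    by (auto simp: relabel_def hg)
  note D = seminormal_eD[OF C x(1,3)]
  show "c \<in> elts (relabel g h C) \<and> fop (relabel g h C) i c = Some b \<and>
      (ep \<circ> h) b = Suc ((ep \<circ> h) c) \<and> (ph \<circ> h) c = Suc ((ph \<circ> h) b)"
    using D x by (auto simp: relabel_def hg)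
next
  fix b c assume b: "b \<in> elts (relabel g h C)" and *: "fop (relabel g h C) i b = Some c"
  then obtain x y where x: "x \<in> elts C" "b = g x" "fop C i x = Some y" "c = g y"
    by (auto simp: relabel_def hg)
  note D = seminormal_fD[OF C x(1,3)]
  show "c \<in> elts (relabel g h C) \<and> eop (relabel g h C) i c = Some b \<and>
      (ph \<circ> h) b = Suc ((ph \<circ> h) c) \<and> (ep \<circ> h) c = Suc ((ep \<circ> h) b)"
    using D x by (auto simp: relabel_def hg)
next
  fix b assume "b \<in> elts (relabel g h C)"
  then obtain x where x: "x \<in> elts C" "b = g x" by (auto simp: relabel_def)
  show "eop (relabel g h C) i b = None \<Longrightarrow> (ep \<circ> h) b = 0"
    and "fop (relabel g h C) i b = None \<Longrightarrow> (ph \<circ> h) b = 0"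
    using seminormal_None[OF C x(1)] x by (auto simp: relabel_def hg)
qed

lemma seminormal_restrict:
  assumes C: "seminormal C i ep ph" and D: "elts D \<subseteq> elts C"
    "\<And>b. b \<in> elts D \<Longrightarrow> eop D i b = eop C i b \<and> fop D i b = fop C i b"
    "\<And>b c. b \<in> elts D \<Longrightarrow> eop C i b = Some c \<or> fop C i b = Some c \<Longrightarrow> c \<in> elts D"
  shows "seminormal D i ep ph"
proof (rule seminormalI)
  fix b c assume b: "b \<in> elts D" and *: "eop D i b = Some c"
  then have e: "eop C i b = Some c" "b \<in> elts C" using D by auto
  note E = seminormal_eD[OF C e(2,1)]
  show "c \<in> elts D \<and> fop D i c = Some b \<and> ep b = Suc (ep c) \<and> ph c = Suc (ph b)"
    using E D(2,3) b e by metis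
next
  fix b c assume b: "b \<in> elts D" and *: "fop D i b = Some c"
  then have e: "fop C i b = Some c" "b \<in> elts C" using D by auto
  note E = seminormal_fD[OF C e(2,1)]
  show "c \<in> elts D \<and> eop D i c = Some b \<and> ph b = Suc (ph c) \<and> ep c = Suc (ep b)"
    using E D(2,3) b e by metis
next
  fix b assume b: "b \<in> elts D"
  then have b': "b \<in> elts C" using D by blast
  show "eop D i b = None \<Longrightarrow> ep b = 0" "fop D i b = None \<Longrightarrow> ph b = 0"
    using seminormal_None[OF C b'] D(2)[OF b] by simp_all
qed

section \<open>Words\<close>

locale vec =
  fixes t :: affine_type and n :: nat
  assumes rank: "3 \<le> n" and rankD: "t = D1 \<Longrightarrow> 4 \<le> n"
begin

abbreviation V where "V \<equiv> vector_crystal t n"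

definition le :: "nat \<Rightarrow> int \<Rightarrow> nat" where
  "le i a = (if 1 \<le> i \<and> i < n then (if a = int i + 1 \<or> a = - int i then 1 else 0)
     else if i = n then (case t of
         D1 \<Rightarrow> if a = - int n \<or> a = 1 - int n then 1 else 0
       | B1 \<Rightarrow> if a = - int n then 2 else if a = 0 then 1 else 0
       | A2odd \<Rightarrow> if a = - int n then 1 else 0)
     else 0)"

definition lp :: "nat \<Rightarrow> int \<Rightarrow> nat" where
  "lp i a = (if 1 \<le> i \<and> i < n then (if a = int i \<or> a = - (int i + 1) then 1 else 0)
     else if i = n then (case t of
         D1 \<Rightarrow> if a = int n \<or> a = int n - 1 then 1 else 0
       | B1 \<Rightarrow> if a = int n then 2 else if a = 0 then 1 else 0
       | A2odd \<Rightarrow> if a = int n then 1 else 0)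
     else 0)"

text \<open>A total version of the powers of e_i: the letter stays where it is once e_i vanishes on
  it.\<close>

definition up :: "nat \<Rightarrow> nat \<Rightarrow> int \<Rightarrow> int" where
  "up i c a = ((\<lambda>a. case eop V i a of None \<Rightarrow> a | Some b \<Rightarrow> b) ^^ c) a"

primrec weps :: "nat \<Rightarrow> int list \<Rightarrow> nat" where
  "weps i [] = 0"
| "weps i (a # w) = le i a + (weps i w - lp i a)"

primrec wphi :: "nat \<Rightarrow> int list \<Rightarrow> nat" where
  "wphi i [] = 0"
| "wphi i (a # w) = wphi i w + (lp i a - weps i w)"

primrec we :: "nat \<Rightarrow> int list \<Rightarrow> int list option" where
  "we i [] = None"
| "we i (a # w) = (if lp i a \<ge> weps i w then map_option (\<lambda>a'. a' # w) (eop V i a)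
     else map_option ((#) a) (we i w))"

primrec wf :: "nat \<Rightarrow> int list \<Rightarrow> int list option" where
  "wf i [] = None"
| "wf i (a # w) = (if lp i a > weps i w then map_option (\<lambda>a'. a' # w) (fop V i a)
     else map_option ((#) a) (wf i w))"

text \<open>The maximal power of \<open>e\<^sub>i\<close> as a transducer; the state \<open>s\<close> is \<open>\<phi>\<^sub>i\<close> of the part of the
  word already read, which shields as many letters from being raised.\<close>

fun raise :: "nat \<Rightarrow> nat \<Rightarrow> int list \<Rightarrow> int list" where
  "raise i s [] = []"
| "raise i s (a # w) = up i (le i a - s) a # raise i (lp i a + (s - le i a)) w"

fun st :: "nat \<Rightarrow> nat \<Rightarrow> int list \<Rightarrow> nat" where
  "st i s [] = s"
| "st i s (a # w) = st i (lp i a + (s - le i a)) w"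

lemma eop_V: "eop V i a = (if 1 \<le> i \<and> i < n
      then (if a = int i + 1 \<or> a = - int i then Some (a - 1) else None)
      else if i = n then letter_en t n a else None)"
  and fop_V: "fop V i a = (if 1 \<le> i \<and> i < n
      then (if a = int i \<or> a = - (int i + 1) then Some (a + 1) else None)
      else if i = n then letter_fn t n a else None)"
  and elts_V: "a \<in> elts V \<longleftrightarrow> \<bar>a\<bar> \<le> int n \<and> (a = 0 \<longrightarrow> t = B1)"
  by (simp_all add: vector_crystal_def)

lemma seminormal_V:
  assumes "i \<in> {1..n}"
  shows "seminormal V i (le i) (lp i)"
proof (cases "i < n")
  case True
  then have "1 \<le> i" using assms by simp
  show ?thesis
    using True \<open>1 \<le> i\<close> by (intro seminormalI) (auto simp: eop_V fop_V elts_V le_def lp_def split: if_splits)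
next
  case False
  then have i: "i = n" using assms by simp
  show ?thesis
  proof (cases t)
    case D1
    note d = eop_V fop_V elts_V le_def lp_def
    show ?thesis using rankD[OF D1]
      by (intro seminormalI) (auto simp: i d[unfolded D1] D1 split: if_splits)
  next
    case B1
    note d = eop_V fop_V elts_V le_def lp_def
    show ?thesis using rank
      by (intro seminormalI) (auto simp: i d[unfolded B1] B1 split: if_splits)
  next
    case A2odd
    note d = eop_V fop_V elts_V le_def lp_def
    show ?thesis using rank
      by (intro seminormalI) (auto simp: i d[unfolded A2odd] A2odd split: if_splits)
  qed
qed

text \<open>Brings the relabelled tensor powers to plain recursions on lists, so that words of all
  lengths can share the one crystal \<open>WC\<close>.\<close>

lemma word_crystal_facts:
  assumes i: "i \<in> {1..n}"
  shows "elts (word_crystal t n m) = {w. length w = m \<and> set w \<subseteq> elts V} \<and>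
    (\<forall>w. length w = m \<longrightarrow> set w \<subseteq> elts V \<longrightarrow>
      eop (word_crystal t n m) i w = we i w \<and> fop (word_crystal t n m) i w = wf i w) \<and>
    seminormal (word_crystal t n m) i (weps i) (wphi i)"
proof (induction m)
  case 0
  show ?case by (auto intro!: seminormalI)
next
  case (Suc m)
  let ?W = "word_crystal t n m"
  let ?g = "\<lambda>(x, w). x # w" and ?h = "\<lambda>w. (hd w, tl w)"
  have sn: "seminormal ?W i (weps i) (wphi i)"
    and el: "elts ?W = {w. length w = m \<and> set w \<subseteq> elts V}"
    and op: "\<And>w. length w = m \<Longrightarrow> set w \<subseteq> elts V \<Longrightarrow>
      eop ?W i w = we i w \<and> fop ?W i w = wf i w"
    using Suc.IH by blast+
  have T: "seminormal (tensor V ?W) i (\<lambda>(a, b). le i a + (weps i b - lp i a))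
      (\<lambda>(a, b). wphi i b + (lp i a - weps i b))"
    by (rule seminormal_tensor[OF seminormal_V[OF i] sn])
  have el': "elts (word_crystal t n (Suc m)) = {w. length w = Suc m \<and> set w \<subseteq> elts V}"
    by (auto simp: relabel_def el image_iff length_Suc_conv)
  have "seminormal (relabel ?g ?h (tensor V ?W)) i
     ((\<lambda>(a, b). le i a + (weps i b - lp i a)) \<circ> ?h) ((\<lambda>(a, b). wphi i b + (lp i a - weps i b)) \<circ> ?h)"
    by (rule seminormal_relabel[OF T]) auto
  then have "seminormal (word_crystal t n (Suc m)) i (weps i) (wphi i)"
    unfolding word_crystal.simps
    by (rule seminormal_cong) (auto simp: relabel_def)
  moreover have "eop (word_crystal t n (Suc m)) i w = we i w \<and>
      fop (word_crystal t n (Suc m)) i w = wf i w"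
    if w: "length w = Suc m" "set w \<subseteq> elts V" for w
  proof -
    obtain a v where av: "w = a # v" "a \<in> elts V" "length v = m" "set v \<subseteq> elts V"
      using w by (cases w) auto
    then have v: "v \<in> elts ?W" by (simp add: el)
    show ?thesis
      using eop_tensor[OF seminormal_V[OF i] sn av(2) v] fop_tensor[OF seminormal_V[OF i] sn av(2) v]
        op[OF av(3,4)] av(1)
      by (simp add: relabel_def option.map_comp comp_def)
  qed
  ultimately show ?case using el' by blast
qed

lemma we_length: "we i w = Some v \<Longrightarrow> length v = length w"
  by (induction w arbitrary: v) (auto split: if_splits)

definition WC :: "int list crystal" where
  "WC = \<lparr> elts = {w. set w \<subseteq> elts V}, eop = we, fop = wf \<rparr>"

lemma elts_WC: "w \<in> elts WC \<longleftrightarrow> set w \<subseteq> elts V"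
  and eop_WC [simp]: "eop WC = we"
  and fop_WC [simp]: "fop WC = wf"
  by (simp_all add: WC_def)

lemma seminormal_WC:
  assumes i: "i \<in> {1..n}"
  shows "seminormal WC i (weps i) (wphi i)"
proof (rule seminormalI)
  fix b c assume *: "b \<in> elts WC" "eop WC i b = Some c"
  let ?W = "word_crystal t n (length b)"
  note F = word_crystal_facts[OF i, of "length b"]
  have b: "b \<in> elts ?W" "eop ?W i b = Some c" using * F by (auto simp: elts_WC)
  note D = seminormal_eD[OF F[THEN conjunct2, THEN conjunct2] b]
  show "c \<in> elts WC \<and> fop WC i c = Some b \<and> weps i b = Suc (weps i c) \<and> wphi i c = Suc (wphi i b)"
    using D F by (auto simp: elts_WC)
next
  fix b c assume *: "b \<in> elts WC" "fop WC i b = Some c"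
  let ?W = "word_crystal t n (length b)"
  note F = word_crystal_facts[OF i, of "length b"]
  have b: "b \<in> elts ?W" "fop ?W i b = Some c" using * F by (auto simp: elts_WC)
  note D = seminormal_fD[OF F[THEN conjunct2, THEN conjunct2] b]
  show "c \<in> elts WC \<and> eop WC i c = Some b \<and> wphi i b = Suc (wphi i c) \<and> weps i c = Suc (weps i b)"
    using D F by (auto simp: elts_WC)
next
  fix b assume *: "b \<in> elts WC"
  let ?W = "word_crystal t n (length b)"
  note F = word_crystal_facts[OF i, of "length b"]
  have b: "b \<in> elts ?W" using * F by (auto simp: elts_WC)
  note D = seminormal_None[OF F[THEN conjunct2, THEN conjunct2] b]
  show "eop WC i b = None \<Longrightarrow> weps i b = 0" "fop WC i b = None \<Longrightarrow> wphi i b = 0"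
    using D F * by (auto simp: elts_WC)
qed

lemma weps_append: "weps i (u @ v) = weps i u + (weps i v - wphi i u)"
  and wphi_append: "wphi i (u @ v) = wphi i v + (wphi i u - weps i v)"
  by (induction u) auto

lemma st_eq: "st i s w = wphi i w + (s - weps i w)"
  by (induction w arbitrary: s) auto

lemma st_append: "st i s (u @ v) = st i (st i s u) v"
  by (induction u arbitrary: s) auto

lemma raise_append: "raise i s (u @ v) = raise i s u @ raise i (st i s u) v"
  by (induction u arbitrary: s) auto

lemma length_raise [simp]: "length (raise i s w) = length w"
  by (induction w arbitrary: s) auto

lemma up_0 [simp]: "up i 0 a = a"
  by (simp add: up_def)

lemma iter_up:
  assumes i: "i \<in> {1..n}" and a: "a \<in> elts V" and m: "m \<le> le i a"
  shows "iter_op (eop V i) m a = Some (up i m a)"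
proof -
  have "iter_op (eop V i) m a = Some c \<Longrightarrow> up i m a = c" for c
    using a
  proof (induction m arbitrary: a)
    case (Suc m)
    then obtain b where b: "eop V i a = Some b" "iter_op (eop V i) m b = Some c"
      by (auto simp: iter_op_Suc bind_eq_Some_conv)
    then have "up i m b = c"
      using Suc.IH[OF b(2)] seminormal_eD(1)[OF seminormal_V[OF i] Suc.prems(2) b(1)] by simp
    then show ?case using b(1) unfolding up_def funpow_Suc_right by simp
  qed simp
  then show ?thesis using iter_e_Some[OF seminormal_V[OF i] a, of m] m by auto
qed

lemma iter_we_right:
  assumes "m \<le> weps i w - lp i a" "iter_op (we i) m w = Some w'" "i \<in> {1..n}" "set w \<subseteq> elts V"
  shows "iter_op (we i) m (a # w) = Some (a # w')"
  using assms
proof (induction m arbitrary: w)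
  case (Suc m)
  then obtain v where v: "we i w = Some v" "iter_op (we i) m v = Some w'"
    by (auto simp: iter_op_Suc bind_eq_Some_conv)
  note D = seminormal_eD[OF seminormal_WC[OF Suc.prems(3)], of w v, unfolded elts_WC eop_WC,
      OF Suc.prems(4) v(1)]
  have "iter_op (we i) m (a # v) = Some (a # w')"
    using Suc.IH[OF _ v(2) Suc.prems(3) D(1)] Suc.prems(1) D(3) by simp
  moreover have "we i (a # w) = Some (a # v)" proof -
    have "\<not> weps i w \<le> lp i a" using Suc.prems(1) by linarith
    then show ?thesis using v(1) by simp
  qed
  ultimately show ?case by (simp add: iter_op_Suc)
qed simp

lemma iter_we_left:
  assumes "weps i w \<le> lp i a" "iter_op (eop V i) m a = Some a'" "i \<in> {1..n}" "a \<in> elts V"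
  shows "iter_op (we i) m (a # w) = Some (a' # w)"
  using assms
proof (induction m arbitrary: a)
  case (Suc m)
  then obtain v where v: "eop V i a = Some v" "iter_op (eop V i) m v = Some a'"
    by (auto simp: iter_op_Suc bind_eq_Some_conv)
  note D = seminormal_eD[OF seminormal_V[OF Suc.prems(3)] Suc.prems(4) v(1)]
  have "iter_op (we i) m (v # w) = Some (a' # w)"
    using Suc.IH[OF _ v(2) Suc.prems(3) D(1)] Suc.prems(1) D(4) by simp
  moreover have "we i (a # w) = Some (v # w)" using v(1) Suc.prems(1) by simp
  ultimately show ?case by (simp add: iter_op_Suc)
qed simp

text \<open>The state \<open>s\<close> stands for \<phi> of a word further to the left, so this is
  what the maximal raising of the longer word does to \<open>w\<close>. The tail is exhausted before
  the head moves, as the tensor product rule demands; the new state is exactly the shield that the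
  head hands on.\<close>

lemma iter_raise:
  assumes i: "i \<in> {1..n}"
  shows "set w \<subseteq> elts V \<Longrightarrow> iter_op (we i) (weps i w - s) w = Some (raise i s w)"
proof (induction w arbitrary: s)
  case (Cons a w)
  let ?s = "lp i a + (s - le i a)"
  have a: "a \<in> elts V" "set w \<subseteq> elts V" using Cons.prems by auto
  have 1: "iter_op (we i) (weps i w - ?s) (a # w) = Some (a # raise i ?s w)"
    by (rule iter_we_right[OF _ Cons.IH[OF a(2)] i a(2)]) simp
  show ?case
  proof (cases "s < le i a")
    case True
    have D: "weps i w = weps i w - ?s + weps i (raise i ?s w)"
      using iter_e_props(3)[OF seminormal_WC[OF i], of w] Cons.IH[OF a(2)] a(2)
      by (simp add: elts_WC)
    have "weps i (raise i ?s w) \<le> lp i a" using D True by simp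
    then have 2: "iter_op (we i) (le i a - s) (a # raise i ?s w) = Some (up i (le i a - s) a # raise i ?s w)"
      by (rule iter_we_left[OF _ iter_up[OF i a(1)] i a(1)]) simp
    have "weps i (a # w) - s = (weps i w - ?s) + (le i a - s)" using True by simp
    then show ?thesis using 1 2 by (simp add: iter_op_add)
  next
    case False
    then have "weps i (a # w) - s = weps i w - ?s" by simp
    then show ?thesis using 1 False by simp
  qed
qed simp

lemma raise_facts:
  assumes i: "i \<in> {1..n}" and w: "set w \<subseteq> elts V"
  shows "set (raise i s w) \<subseteq> elts V" "weps i (raise i s w) = min s (weps i w)"
    "wphi i (raise i s w) = wphi i w + (weps i w - s)"
proof -
  have w': "w \<in> elts WC" using w by (simp add: elts_WC)
  note D = iter_e_props[OF seminormal_WC[OF i] w' iter_raise[OF i w, of s, folded eop_WC]]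
  show "set (raise i s w) \<subseteq> elts V" using D(1) by (simp add: elts_WC)
  show "weps i (raise i s w) = min s (weps i w)" using D(3) by linarith
  show "wphi i (raise i s w) = wphi i w + (weps i w - s)" using D(4) by linarith
qed

end

section \<open>Uniqueness of highest weight words\<close>

context vec
begin

section \<open>Braid relations as equalities of composite transducers\<close>

fun raises :: "(nat \<times> nat) list \<Rightarrow> int list \<Rightarrow> int list" where
  "raises [] w = w"
| "raises ((i, s) # ps) w = raises ps (raise i s w)"

text \<open>One letter passes through a whole cascade of transducers. The result records the new
  states of all of them and the letter that comes out, so that a composite of raisings again reads
  its word letter by letter.\<close>

fun stepl :: "(nat \<times> nat) list \<Rightarrow> int \<Rightarrow> (nat \<times> nat) list \<times> int" where
  "stepl [] a = ([], a)"
| "stepl ((i, s) # ps) a = (let (ps', b) = stepl ps (up i (le i a - s) a)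
     in ((i, lp i a + (s - le i a)) # ps', b))"

lemma raises_Cons: "raises ps (a # w) = snd (stepl ps a) # raises (fst (stepl ps a)) w"
  by (induction ps a arbitrary: w rule: stepl.induct) (auto split: prod.splits)

lemma raises_Nil [simp]: "raises ps [] = []"
  by (induction ps "[] :: int list" rule: raises.induct) auto

text \<open>A bisimulation: two cascades agree on all words if their states are related in a way
  that every single letter preserves while both emit the same letter. This turns a braid relation on
  words into a finite check on letters.\<close>

lemma raises_bisim:
  assumes "\<And>ps qs a. Q ps qs \<Longrightarrow> a \<in> elts V \<Longrightarrow>
      snd (stepl ps a) = snd (stepl qs a) \<and> Q (fst (stepl ps a)) (fst (stepl qs a))"
  shows "Q ps qs \<Longrightarrow> set w \<subseteq> elts V \<Longrightarrow> raises ps w = raises qs w"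
  by (induction w arbitrary: ps qs) (use assms in \<open>auto simp: raises_Cons\<close>)

lemma up_1: "up i (Suc 0) a = (case eop V i a of None \<Rightarrow> a | Some b \<Rightarrow> b)"
  by (simp add: up_def)

lemma up_2: "up i (Suc (Suc 0)) a = up i (Suc 0) (up i (Suc 0) a)"
  by (simp add: up_def)

declare stepl.simps(2) [simp del]

definition Q2 where
  "Q2 i j ps qs \<longleftrightarrow> (\<exists>x y. ps = [(i, x), (j, y)] \<and> qs = [(j, y), (i, x :: nat)])"

text \<open>The correspondence of states is Lusztig's piecewise linear transition map, which sends
  \<open>(x, y, z)\<close> to \<open>(y + z - min x z, min x z, x + y - min x z)\<close>. The two
  disjuncts resolve the minimum, so that no subtraction is left.\<close>

definition Q3 where
  "Q3 i j ps qs \<longleftrightarrow> (\<exists>x y d :: nat.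
     ps = [(i, x), (j, y), (i, x + d)] \<and> qs = [(j, y + d), (i, x), (j, y)] \<or>
     ps = [(i, x + d), (j, y), (i, x)] \<and> qs = [(j, y), (i, x), (j, y + d)])"

lemma Q3_simp: "Q3 i j [(i, x), (j, y), (i, z)] [(j, a), (i, b), (j, c)] \<longleftrightarrow>
    (x \<le> z \<and> b = x \<and> c = y \<and> a + x = y + z) \<or> (z \<le> x \<and> b = z \<and> a = y \<and> c + z = y + x)"
  (is "?l \<longleftrightarrow> ?r")
proof
  assume *: ?r
  show ?l
  proof (cases "x \<le> z \<and> b = x \<and> c = y \<and> a + x = y + z")
    case True
    then show ?thesis unfolding Q3_def
      by (intro exI[of _ x] exI[of _ y] exI[of _ "z - x"] disjI1) auto
  next
    case False
    then show ?thesis using * unfolding Q3_def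
      by (intro exI[of _ z] exI[of _ y] exI[of _ "x - z"] disjI2) auto
  qed
qed (auto simp: Q3_def)

lemma Q3_sym: "Q3 i j ps qs \<Longrightarrow> Q3 j i qs ps"
  by (auto simp: Q3_def)

definition neut where "neut k a \<longleftrightarrow> le k a = 0 \<and> lp k a = 0"
definition plus where "plus k a \<longleftrightarrow> le k a = 0 \<and> lp k a = 1"
definition minus where "minus k a b \<longleftrightarrow> le k a = 1 \<and> lp k a = 0 \<and> up k 1 a = b"

lemma stepl_neut: "neut k a \<Longrightarrow>
    stepl ((k, s) # ps) a = (let (qs, b) = stepl ps a in ((k, s) # qs, b))"
  and stepl_plus: "plus k a \<Longrightarrow>
    stepl ((k, s) # ps) a = (let (qs, b) = stepl ps a in ((k, Suc s) # qs, b))"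
  and stepl_minus_0: "minus k a a' \<Longrightarrow>
    stepl ((k, 0) # ps) a = (let (qs, b) = stepl ps a' in ((k, 0) # qs, b))"
  and stepl_minus_Suc: "minus k a a' \<Longrightarrow>
    stepl ((k, Suc s) # ps) a = (let (qs, b) = stepl ps a in ((k, s) # qs, b))"
  by (simp_all add: neut_def plus_def minus_def Let_def stepl.simps(2) split: prod.splits)

lemmas stepl_letter = stepl_neut stepl_plus stepl_minus_0 stepl_minus_Suc stepl.simps(1) Let_def

definition compatible where
  "compatible Q a \<longleftrightarrow> (\<forall>ps qs. Q ps qs \<longrightarrow>
     snd (stepl ps a) = snd (stepl qs a) \<and> Q (fst (stepl ps a)) (fst (stepl qs a)))"

lemma compatible_Q3_neut:
  assumes "neut i a" "neut j a"
  shows "compatible (Q3 i j) a"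
  unfolding compatible_def
proof (intro allI impI)
  fix ps qs assume "Q3 i j ps qs"
  then obtain x y d where "ps = [(i, x), (j, y), (i, x + d)] \<and> qs = [(j, y + d), (i, x), (j, y)] \<or>
      ps = [(i, x + d), (j, y), (i, x)] \<and> qs = [(j, y), (i, x), (j, y + d)]"
    unfolding Q3_def by blast
  then show "snd (stepl ps a) = snd (stepl qs a) \<and> Q3 i j (fst (stepl ps a)) (fst (stepl qs a))"
    by (elim disjE) (simp_all add: assms stepl_letter Q3_simp)
qed

lemma compatible_Q3_sym: "compatible (Q3 i j) a \<Longrightarrow> compatible (Q3 j i) a"
  unfolding compatible_def by (metis Q3_sym)

lemma compatible_Q3I:
  assumes "\<And>x y d. snd (stepl [(i, x), (j, y), (i, x + d)] a) = snd (stepl [(j, y + d), (i, x), (j, y)] a) \<and>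
     Q3 i j (fst (stepl [(i, x), (j, y), (i, x + d)] a)) (fst (stepl [(j, y + d), (i, x), (j, y)] a))"
    and "\<And>x y d. snd (stepl [(i, x + d), (j, y), (i, x)] a) = snd (stepl [(j, y), (i, x), (j, y + d)] a) \<and>
     Q3 i j (fst (stepl [(i, x + d), (j, y), (i, x)] a)) (fst (stepl [(j, y), (i, x), (j, y + d)] a))"
  shows "compatible (Q3 i j) a"
  unfolding compatible_def
proof (intro allI impI)
  fix ps qs assume "Q3 i j ps qs"
  then obtain x y d where "ps = [(i, x), (j, y), (i, x + d)] \<and> qs = [(j, y + d), (i, x), (j, y)] \<or>
      ps = [(i, x + d), (j, y), (i, x)] \<and> qs = [(j, y), (i, x), (j, y + d)]"
    unfolding Q3_def by blast
  then show "snd (stepl ps a) = snd (stepl qs a) \<and> Q3 i j (fst (stepl ps a)) (fst (stepl qs a))"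
    by (elim disjE conjE; hypsubst; intro assms)
qed

text \<open>The letters \<open>a2\<close>, \<open>a1\<close>, \<open>a0\<close> form the vector
  representation of the type A2 subalgebra with nodes \<open>i\<close> and \<open>j\<close>, with
  \<open>a0\<close> on top. Its dual is the same situation with the two nodes exchanged.\<close>

lemma compatible_Q3:
  assumes "plus i a0" "neut j a0" "minus i a1 a0" "plus j a1" "neut i a2" "minus j a2 a1"
  shows "compatible (Q3 i j) a0" "compatible (Q3 i j) a1" "compatible (Q3 i j) a2"
proof -
  note S = assms stepl_letter
      stepl_minus_0[OF assms(3)] stepl_minus_Suc[OF assms(3)]
      stepl_minus_0[OF assms(6)] stepl_minus_Suc[OF assms(6)] Q3_simp
  show "compatible (Q3 i j) a0"
    by (rule compatible_Q3I) (simp_all add: S)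
  show "compatible (Q3 i j) a1"
  proof (rule compatible_Q3I)
    fix x y d :: nat
    show "snd (stepl [(i, x), (j, y), (i, x + d)] a1) = snd (stepl [(j, y + d), (i, x), (j, y)] a1) \<and>
     Q3 i j (fst (stepl [(i, x), (j, y), (i, x + d)] a1)) (fst (stepl [(j, y + d), (i, x), (j, y)] a1))"
     "snd (stepl [(i, x + d), (j, y), (i, x)] a1) = snd (stepl [(j, y), (i, x), (j, y + d)] a1) \<and>
     Q3 i j (fst (stepl [(i, x + d), (j, y), (i, x)] a1)) (fst (stepl [(j, y), (i, x), (j, y + d)] a1))"
      by (cases x; cases d; simp add: S)+
  qed
  show "compatible (Q3 i j) a2"
  proof (rule compatible_Q3I)
    fix x y d :: nat
    show "snd (stepl [(i, x), (j, y), (i, x + d)] a2) = snd (stepl [(j, y + d), (i, x), (j, y)] a2) \<and>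
     Q3 i j (fst (stepl [(i, x), (j, y), (i, x + d)] a2)) (fst (stepl [(j, y + d), (i, x), (j, y)] a2))"
     "snd (stepl [(i, x + d), (j, y), (i, x)] a2) = snd (stepl [(j, y), (i, x), (j, y + d)] a2) \<and>
     Q3 i j (fst (stepl [(i, x + d), (j, y), (i, x)] a2)) (fst (stepl [(j, y), (i, x), (j, y + d)] a2))"
      by (cases x; cases y; cases d; simp add: S)+
  qed
qed

lemma compatible_Q2I:
  assumes "\<And>x y. snd (stepl [(i, x), (j, y)] a) = snd (stepl [(j, y), (i, x)] a) \<and>
     Q2 i j (fst (stepl [(i, x), (j, y)] a)) (fst (stepl [(j, y), (i, x)] a))"
  shows "compatible (Q2 i j) a"
  unfolding compatible_def
proof (intro allI impI)
  fix ps qs assume "Q2 i j ps qs"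
  then obtain x y where "ps = [(i, x), (j, y)]" "qs = [(j, y), (i, x)]"
    unfolding Q2_def by blast
  then show "snd (stepl ps a) = snd (stepl qs a) \<and> Q2 i j (fst (stepl ps a)) (fst (stepl qs a))"
    by (hypsubst, intro assms)
qed

lemma compatible_Q2_neut:
  assumes "neut j a" "\<And>c. neut j (up i c a)"
  shows "compatible (Q2 i j) a"
  by (rule compatible_Q2I) (use assms in \<open>simp add: neut_def stepl.simps Let_def Q2_def\<close>)

lemma compatible_Q2_sym: "compatible (Q2 i j) a \<Longrightarrow> compatible (Q2 j i) a"
  unfolding compatible_def Q2_def by metis

text \<open>The four letters on which two commuting nodes both act, as n - 1 and n do in type D: a
  product of two strings of length one.\<close>

lemma compatible_Q2_square:
  assumes "plus i a" "plus j a" "minus i b a" "plus j b" "minus j c a" "plus i c" "minus i d c" "minus j d b"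
  shows "compatible (Q2 i j) a" "compatible (Q2 i j) b" "compatible (Q2 i j) c" "compatible (Q2 i j) d"
proof -
  note S = stepl_minus_0[OF assms(3)] stepl_minus_Suc[OF assms(3)]
    stepl_minus_0[OF assms(5)] stepl_minus_Suc[OF assms(5)]
    stepl_minus_0[OF assms(7)] stepl_minus_Suc[OF assms(7)]
    stepl_minus_0[OF assms(8)] stepl_minus_Suc[OF assms(8)] stepl_letter assms Q2_def
  have "snd (stepl [(i, x), (j, y)] e) = snd (stepl [(j, y), (i, x)] e) \<and>
     Q2 i j (fst (stepl [(i, x), (j, y)] e)) (fst (stepl [(j, y), (i, x)] e))"
    if "e \<in> {a, b, c, d}" for x y e
    using that by (elim insertE emptyE; cases x; cases y; simp add: S)
  then show "compatible (Q2 i j) a" "compatible (Q2 i j) b" "compatible (Q2 i j) c" "compatible (Q2 i j) d"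
    by (auto intro!: compatible_Q2I)
qed

lemma node_letters:
  assumes "1 \<le> k" "k < n"
  shows "plus k (int k)" "plus k (- int k - 1)" "minus k (int k + 1) (int k)"
    "minus k (- int k) (- int k - 1)"
    "a \<notin> {int k, int k + 1, - int k, - int k - 1} \<Longrightarrow> neut k a"
  using assms by (auto simp: plus_def minus_def neut_def le_def lp_def up_1 eop_V)

text \<open>The letters i, i + 1, i + 2 form the vector representation and their barred partners its
  dual, so both cases come from \<open>compatible_Q3\<close>; every other letter is neutral for both
  nodes.\<close>

lemma compatible_adjacent:
  assumes "1 \<le> i" "Suc i < n"
  shows "compatible (Q3 i (Suc i)) a"
proof -
  have i: "i < n" "1 \<le> Suc i" using assms by auto
  note L = node_letters[OF assms(1) i(1)] and L' = node_letters[OF i(2) assms(2)]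
  have "plus i (int i)" "neut (Suc i) (int i)" "minus i (int i + 1) (int i)"
    "plus (Suc i) (int i + 1)" "neut i (int i + 2)" "minus (Suc i) (int i + 2) (int i + 1)"
    using L(1,3) L(5)[of "int i + 2"] L'(1,3) L'(5)[of "int i"] by (simp_all add: algebra_simps)
  note 1 = compatible_Q3[OF this]
  have e: "- int (Suc i) = - int i - 1" "- int i - 1 - 1 = - int i - 2" by simp_all
  have "plus (Suc i) (- int i - 2)" "neut i (- int i - 2)" "minus (Suc i) (- int i - 1) (- int i - 2)"
    "plus i (- int i - 1)" "neut (Suc i) (- int i)" "minus i (- int i) (- int i - 1)"
    using L(2,4) L(5)[of "- int i - 2"] L'(2,4)[unfolded e] L'(5)[of "- int i", unfolded e] by simp_all
  note 2 = compatible_Q3[OF this, THEN compatible_Q3_sym]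
  show ?thesis
  proof (cases "a \<in> {int i, int i + 1, int i + 2, - int i, - int i - 1, - int i - 2}")
    case False
    then show ?thesis
      by (intro compatible_Q3_neut L(5) L'(5)) auto
  qed (use 1 2 in auto)
qed

lemma D_letters:
  assumes "t = D1"
  shows "plus n (int n - 1)" "plus n (int n)" "minus n (- int n) (int n - 1)"
    "minus n (1 - int n) (int n)"
    "a \<notin> {int n, int n - 1, - int n, 1 - int n} \<Longrightarrow> neut n a"
  using rankD[OF assms] unfolding plus_def minus_def neut_def le_def lp_def up_1 eop_V One_nat_def
  by (simp_all add: assms)

lemma compatible_D:
  assumes t: "t = D1"
  shows "compatible (Q3 (n - 2) n) a" "compatible (Q2 (n - 1) n) a"
proof -
  have n: "1 \<le> n - 2" "n - 2 < n" "1 \<le> n - 1" "n - 1 < n"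
    "int (n - 2) = int n - 2" "int (n - 1) = int n - 1" using rankD[OF t] by auto
  note L = node_letters[OF n(1,2)] and L' = node_letters[OF n(3,4)] and D = D_letters[OF t]
  have "plus (n - 2) (int n - 2)" "neut n (int n - 2)" "minus (n - 2) (int n - 1) (int n - 2)"
    "plus n (int n - 1)" "neut (n - 2) (- int n)" "minus n (- int n) (int n - 1)"
    using L(1,3) L(5)[of "- int n"] D(1,3) D(5)[of "int n - 2"] rankD[OF t] n(5) by simp_all
  note 1 = compatible_Q3[OF this]
  have "plus n (int n)" "neut (n - 2) (int n)" "minus n (1 - int n) (int n)"
    "plus (n - 2) (1 - int n)" "neut n (2 - int n)" "minus (n - 2) (2 - int n) (1 - int n)"
    using L(2,4) L(5)[of "int n"] D(2,4) D(5)[of "2 - int n"] rankD[OF t] n(5) by simp_all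
  note 2 = compatible_Q3[OF this, THEN compatible_Q3_sym]
  show "compatible (Q3 (n - 2) n) a"
  proof (cases "a \<in> {int n - 2, int n - 1, - int n, int n, 1 - int n, 2 - int n}")
    case False
    then show ?thesis
      by (intro compatible_Q3_neut L(5) D(5)) (use n in auto)
  qed (use 1 2 in auto)
  have "plus (n - 1) (int n - 1)" "plus n (int n - 1)" "minus (n - 1) (int n) (int n - 1)"
    "plus n (int n)" "minus n (- int n) (int n - 1)" "plus (n - 1) (- int n)"
    "minus (n - 1) (1 - int n) (- int n)" "minus n (1 - int n) (int n)"
    using L'(1-4) D(1-4) n(6) by simp_all
  note 3 = compatible_Q2_square[OF this]
  show "compatible (Q2 (n - 1) n) a"
  proof (cases "a \<in> {int n - 1, - int n, int n, 1 - int n}")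
    case False
    then have "neut n a" "neut (n - 1) a" by (intro L'(5) D(5); use n in auto)+
    then show ?thesis
      by (intro compatible_Q2I) (simp add: stepl_letter Q2_def)
  qed (use 3 in auto)
qed

lemma neut_less:
  assumes "1 \<le> k" "k < n"
  shows "neut k a \<longleftrightarrow> a \<notin> {int k, int k + 1, - int k, - int k - 1}"
  using assms by (auto simp: neut_def le_def lp_def)

lemma neut_n:
  "neut n a \<longleftrightarrow> a \<notin> (case t of D1 \<Rightarrow> {int n, - int n, int n - 1, 1 - int n}
     | B1 \<Rightarrow> {int n, 0, - int n} | A2odd \<Rightarrow> {int n, - int n})"
  unfolding neut_def le_def lp_def by (cases t) auto

text \<open>Arrows of two unconnected nodes share no letter. In type D the node n is joined to n -
  2, a pair at distance two in the labelling, which the last hypothesis excludes.\<close>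

lemma neut_closed:
  assumes ij: "i \<in> {1..n}" "j \<in> {1..n}" "i + 2 \<le> j" "t = D1 \<Longrightarrow> j = n \<Longrightarrow> i + 2 < n"
  shows "neut i a \<Longrightarrow> eop V j a = Some b \<Longrightarrow> neut i b"
    and "neut j a \<Longrightarrow> eop V i a = Some b \<Longrightarrow> neut j b"
    and "neut i a \<or> neut j a"
proof -
  have i: "1 \<le> i" "i < n" using ij by auto
  have *: "(neut i a \<longrightarrow> eop V j a = Some b \<longrightarrow> neut i b) \<and>
    (neut j a \<longrightarrow> eop V i a = Some b \<longrightarrow> neut j b) \<and> (neut i a \<or> neut j a)"
  proof (cases "j < n")
    case True
    have j: "1 \<le> j" using ij by simp
    show ?thesis unfolding neut_less[OF i] neut_less[OF j True] eop_V
      using i True ij(3) by auto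
  next
    case False
    then have j: "j = n" using ij by simp
    show ?thesis unfolding neut_less[OF i] neut_n eop_V j
      using ij(3,4) i j by (cases t) (auto split: if_splits)
  qed
  then show "neut i a \<Longrightarrow> eop V j a = Some b \<Longrightarrow> neut i b"
    and "neut j a \<Longrightarrow> eop V i a = Some b \<Longrightarrow> neut j b"
    and "neut i a \<or> neut j a" by blast+
qed

lemma neut_up: "(\<And>a b. neut i a \<Longrightarrow> eop V j a = Some b \<Longrightarrow> neut i b) \<Longrightarrow> neut i a \<Longrightarrow> neut i (up j c a)"
  by (induction c) (auto simp: up_def split: option.splits)

lemma compatible_far:
  assumes "i \<in> {1..n}" "j \<in> {1..n}" "i + 2 \<le> j" "t = D1 \<Longrightarrow> j = n \<Longrightarrow> i + 2 < n"
  shows "compatible (Q2 i j) a"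
proof (cases "neut j a")
  case True
  show ?thesis
    by (rule compatible_Q2_neut[OF True neut_up[OF neut_closed(2)[OF assms] True]])
next
  case False
  then have i: "neut i a" using neut_closed(3)[OF assms] by blast
  show ?thesis
    by (rule compatible_Q2_sym, rule compatible_Q2_neut[OF i neut_up[OF neut_closed(1)[OF assms] i]])
qed


lemma up_le_less:
  assumes "1 \<le> k" "k < n"
  shows "up k (le k a - s) a = (if (a = int k + 1 \<or> a = - int k) \<and> s = 0 then a - 1 else a)"
    "lp k a + (s - le k a) = (if a = int k \<or> a = - int k - 1 then Suc s
       else if a = int k + 1 \<or> a = - int k then s - 1 else s)"
  using assms by (cases s; auto simp: le_def lp_def up_1 eop_V)+

lemma raise_Cons_less:
  assumes "1 \<le> k" "k < n"
  shows "raise k s (a # w) = (if (a = int k + 1 \<or> a = - int k) \<and> s = 0 then a - 1 else a) #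
      raise k (if a = int k \<or> a = - int k - 1 then Suc s
       else if a = int k + 1 \<or> a = - int k then s - 1 else s) w"
    "st k s (a # w) = st k (if a = int k \<or> a = - int k - 1 then Suc s
       else if a = int k + 1 \<or> a = - int k then s - 1 else s) w"
  unfolding raise.simps st.simps up_le_less[OF assms] by (rule refl)+

declare raise.simps(2) [simp del] st.simps(2) [simp del]

section \<open>The double bond by folding\<close>

abbreviation "Araise \<equiv> vec.raise A2odd (2 * n + 10)"
abbreviation "Ast \<equiv> vec.st A2odd (2 * n + 10)"

text \<open>The rank leaves room for the codes \<open>a + int n + 6\<close>: they lie between 6 and
  2n + 6, out of reach of the nodes 1, 2, 3, which are below the rank and hence act as in type
  A.\<close>

lemma vec_A: "vec A2odd (2 * n + 10)"
  by unfold_locales auto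

text \<open>The braid relation of the double bond at node \<open>n\<close> is inherited from words in type A:
  one of its two nodes becomes node 2, the other one the product of the commuting nodes 1 and 3.
  All other letters are sent to letters on which these nodes act trivially.\<close>

definition enc :: "int \<Rightarrow> int list" where
  "enc a = (if t = B1 then
      (if a = int n - 1 then [1, 2, 1, 2] else if a = int n then [1, 3, 1, 3]
       else if a = 0 then [2, 4, 1, 3] else if a = - int n then [2, 4, 2, 4]
       else if a = 1 - int n then [3, 4, 3, 4] else [a + int n + 6])
    else
      (if a = int n - 1 then [1, 1, 2, 3] else if a = int n then [2, 1, 2, 4]
       else if a = - int n then [3, 1, 3, 4] else if a = 1 - int n then [4, 2, 3, 4]
       else [a + int n + 6]))"

lemma nat_cases3: "(s = 0 \<Longrightarrow> P) \<Longrightarrow> (s = Suc 0 \<Longrightarrow> P) \<Longrightarrow> (\<And>m. s = Suc (Suc m) \<Longrightarrow> P) \<Longrightarrow> P"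
  by (metis not0_implies_Suc)

text \<open>One arrow for \<open>k2\<close> is a pair of arrows for node 2, hence the doubled state.
  One arrow for \<open>k13\<close> is one arrow for each of the commuting nodes 1 and 3, so both of
  these carry the same state. The roles of n and n - 1 differ between types B and C because long and
  short roots are exchanged.\<close>

lemma enc_letter:
  assumes t: "t \<noteq> D1" and a: "a \<in> elts V"
    and k: "k2 = (if t = B1 then n - 1 else n)" "k13 = (if t = B1 then n else n - 1)"
  shows "Araise 2 (2 * s) (enc a) = enc (up k2 (le k2 a - s) a)"
    "Ast 2 (2 * s) (enc a) = 2 * (lp k2 a + (s - le k2 a))"
    "Araise 3 s (Araise 1 s (enc a)) = enc (up k13 (le k13 a - s) a)"
    "Ast 1 s (enc a) = lp k13 a + (s - le k13 a)"
    "Ast 3 s (Araise 1 s (enc a)) = lp k13 a + (s - le k13 a)"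
proof -
  interpret A: vec A2odd "2 * n + 10" by (rule vec_A)
  have n1: "1 \<le> n - 1" "n - 1 < n" "int (n - 1) = int n - 1" using rank by auto
  note R = A.raise_Cons_less[of 2, simplified] A.raise_Cons_less[of 1, simplified]
    A.raise_Cons_less[of 3, simplified] A.raise.simps(1) A.st.simps(1)
  have a': "- int n \<le> a" "a \<le> int n" using a by (auto simp: elts_V)
  have neg: "x < - 3 \<Longrightarrow> False" if "x = a + int n + 6" for x using a' that by simp
  have "Araise 2 (2 * s) (enc a) = enc (up k2 (le k2 a - s) a) \<and>
    Ast 2 (2 * s) (enc a) = 2 * (lp k2 a + (s - le k2 a)) \<and>
    Araise 3 s (Araise 1 s (enc a)) = enc (up k13 (le k13 a - s) a) \<and>
    Ast 1 s (enc a) = lp k13 a + (s - le k13 a) \<and>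
    Ast 3 s (Araise 1 s (enc a)) = lp k13 a + (s - le k13 a)"
  proof (cases "t = B1")
    case True
    have K: "k2 = n - 1" "k13 = n" using k True by auto
    have L: "le n b = (if b = - int n then 2 else if b = 0 then 1 else 0)"
      "lp n b = (if b = int n then 2 else if b = 0 then 1 else 0)"
      "up n (Suc 0) b = (if b = 0 then int n else if b = - int n then 0 else b)"
      "up n 2 (- int n) = int n" for b
      unfolding le_def lp_def numeral_2_eq_2 up_2 up_1 eop_V using rank by (auto simp: True)
    have E: "enc b = (if b = int n - 1 then [1, 2, 1, 2] else if b = int n then [1, 3, 1, 3]
       else if b = 0 then [2, 4, 1, 3] else if b = - int n then [2, 4, 2, 4]
       else if b = 1 - int n then [3, 4, 3, 4] else [b + int n + 6])" for b
      unfolding enc_def by (simp add: True)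
    consider "a = int n - 1" | "a = int n" | "a = 0" | "a = - int n" | "a = 1 - int n"
      | "a \<notin> {int n - 1, int n, 0, - int n, 1 - int n}" by blast
    then show ?thesis
      unfolding K up_le_less[OF n1(1,2)] n1(3) L
      apply cases
      subgoal by (insert rank; cases s; simp add: E; thin_tac "3 \<le> n"; simp add: R)
      subgoal by (insert rank; cases s; simp add: E; thin_tac "3 \<le> n"; simp add: R)
      subgoal by (insert rank; cases s; simp add: E L; thin_tac "3 \<le> n"; simp add: R)
      subgoal
        by (rule nat_cases3[of s]; insert rank; simp add: E L; thin_tac "3 \<le> n"; simp add: R)
      subgoal by (insert rank; cases s; simp add: E; thin_tac "3 \<le> n"; simp add: R)
      subgoal using rank a' by (simp add: E L R)
      done
  next
    case False
    then have tA: "t = A2odd" using t by (cases t) auto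
    have K: "k2 = n" "k13 = n - 1" using k False by auto
    have L: "le n b = (if b = - int n then 1 else 0)"
      "lp n b = (if b = int n then 1 else 0)"
      "up n (Suc 0) b = (if b = - int n then int n else b)" for b
      unfolding le_def lp_def up_1 eop_V using rank by (auto simp: tA)
    have E: "enc b = (if b = int n - 1 then [1, 1, 2, 3] else if b = int n then [2, 1, 2, 4]
       else if b = - int n then [3, 1, 3, 4] else if b = 1 - int n then [4, 2, 3, 4]
       else [b + int n + 6])" for b
      unfolding enc_def by (simp add: tA)
    consider "a = int n - 1" | "a = int n" | "a = - int n" | "a = 1 - int n"
      | "a \<notin> {int n - 1, int n, - int n, 1 - int n}" by blast
    then show ?thesis
      unfolding K up_le_less[OF n1(1,2)] n1(3) L
      apply cases
      subgoal by (insert rank; cases s; simp add: E; thin_tac "3 \<le> n"; simp add: R)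
      subgoal by (insert rank; cases s; simp add: E; thin_tac "3 \<le> n"; simp add: R)
      subgoal by (insert rank; cases s; simp add: E L; thin_tac "3 \<le> n"; simp add: R)
      subgoal by (insert rank; cases s; simp add: E; thin_tac "3 \<le> n"; simp add: R)
      subgoal using rank a' by (simp add: E L R)
      done
  qed
  then show "Araise 2 (2 * s) (enc a) = enc (up k2 (le k2 a - s) a)"
    "Ast 2 (2 * s) (enc a) = 2 * (lp k2 a + (s - le k2 a))"
    "Araise 3 s (Araise 1 s (enc a)) = enc (up k13 (le k13 a - s) a)"
    "Ast 1 s (enc a) = lp k13 a + (s - le k13 a)"
    "Ast 3 s (Araise 1 s (enc a)) = lp k13 a + (s - le k13 a)" by blast+
qed

abbreviation E :: "nat \<Rightarrow> int list \<Rightarrow> int list" where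
  "E i \<equiv> raise i 0"

lemma compatible_raises:
  assumes "\<And>a. compatible Q a" "Q ps qs" "set w \<subseteq> elts V"
  shows "raises ps w = raises qs w"
  by (rule raises_bisim[of Q, OF _ assms(2,3)]) (use assms(1) in \<open>auto simp: compatible_def\<close>)

lemma E_braid:
  assumes "1 \<le> i" "Suc i < n" "set w \<subseteq> elts V"
  shows "E i (E (Suc i) (E i w)) = E (Suc i) (E i (E (Suc i) w))"
  using compatible_raises[of "Q3 i (Suc i)" "[(i, 0), (Suc i, 0), (i, 0)]" "[(Suc i, 0), (i, 0), (Suc i, 0)]",
      OF compatible_adjacent[OF assms(1,2)] _ assms(3)]
  by (simp add: Q3_simp)

lemma E_commute:
  assumes "i \<in> {1..n}" "j \<in> {1..n}" "i + 2 \<le> j" "t = D1 \<Longrightarrow> j = n \<Longrightarrow> i + 2 < n" "set w \<subseteq> elts V"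
  shows "E i (E j w) = E j (E i w)"
  using compatible_raises[of "Q2 i j" "[(i, 0), (j, 0)]" "[(j, 0), (i, 0)]",
      OF compatible_far[OF assms(1-4)] _ assms(5)]
  by (simp add: Q2_def)

lemma E_D:
  assumes "t = D1" "set w \<subseteq> elts V"
  shows "E (n - 2) (E n (E (n - 2) w)) = E n (E (n - 2) (E n w))" "E (n - 1) (E n w) = E n (E (n - 1) w)"
  using compatible_raises[of "Q3 (n - 2) n" "[(n - 2, 0), (n, 0), (n - 2, 0)]" "[(n, 0), (n - 2, 0), (n, 0)]",
      OF compatible_D(1)[OF assms(1)] _ assms(2)]
    compatible_raises[of "Q2 (n - 1) n" "[(n - 1, 0), (n, 0)]" "[(n, 0), (n - 1, 0)]",
      OF compatible_D(2)[OF assms(1)] _ assms(2)]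
  by (simp_all add: Q2_def Q3_simp)

lemma enc_word:
  assumes t: "t \<noteq> D1"
    and k: "k2 = (if t = B1 then n - 1 else n)" "k13 = (if t = B1 then n else n - 1)"
  shows "set w \<subseteq> elts V \<Longrightarrow> Araise 2 (2 * s) (concat (map enc w)) = concat (map enc (raise k2 s w)) \<and>
    Araise 3 s (Araise 1 s (concat (map enc w))) = concat (map enc (raise k13 s w))"
proof (induction w arbitrary: s)
  case Nil
  interpret A: vec A2odd "2 * n + 10" by (rule vec_A)
  show ?case by simp
next
  case (Cons a w)
  interpret A: vec A2odd "2 * n + 10" by (rule vec_A)
  have a: "a \<in> elts V" "set w \<subseteq> elts V" using Cons.prems by auto
  note L = enc_letter[OF t a(1) k]
  show ?case
    using Cons.IH[OF a(2), of "lp k2 a + (s - le k2 a)"] Cons.IH[OF a(2), of "lp k13 a + (s - le k13 a)"]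
    by (simp only: list.map concat.simps A.raise_append L raise.simps(2) simp_thms)
qed

text \<open>A prefix code: a first letter below 5 announces a block of four letters, any other
  stands alone. Decoding is needed because the relation is first obtained for encoded words.\<close>

lemma enc_prefix:
  assumes "enc a @ x = enc b @ y" "a \<in> elts V" "b \<in> elts V"
  shows "a = b \<and> x = y"
proof -
  have L: "enc c \<noteq> [] \<and> length (enc c) = (if hd (enc c) < 5 then 4 else 1)" if "c \<in> elts V" for c
    using that by (auto simp: enc_def elts_V)
  have "hd (enc a) = hd (enc b)"
    using assms(1) L[OF assms(2)] L[OF assms(3)] by (metis hd_append2)
  then have *: "length (enc a) = length (enc b)"
    using L[OF assms(2)] L[OF assms(3)] by simp
  then have e: "enc a = enc b" "x = y" using assms(1) by simp_all
  have D: "c = d" if c: "enc c = enc d" "c \<in> elts V" "d \<in> elts V" for c d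
  proof (cases "c \<in> {int n - 1, int n, - int n, 1 - int n, 0}")
    case True
    then show ?thesis using c(1,3) rank unfolding enc_def elts_V
      by (elim insertE emptyE) (simp_all split: if_splits)
  next
    case False
    then have "enc c = [c + int n + 6]" by (simp add: enc_def)
    then show ?thesis using c unfolding enc_def elts_V by (simp split: if_splits)
  qed
  show ?thesis using D[OF e(1) assms(2,3)] e(2) by blast
qed

lemma enc_inj:
  assumes "concat (map enc u) = concat (map enc v)" "set u \<subseteq> elts V" "set v \<subseteq> elts V" "length u = length v"
  shows "u = v"
  using assms(4,1-3) by (induction u v rule: list_induct2) (auto dest: enc_prefix)

text \<open>After encoding, both sides are reduced words of the longest permutation of four letters
  in which the nodes 1 and 3 are kept together. Type A braid moves lead from one to the other, and
  the encoding is injective on words of equal length.\<close>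

lemma E_braid4:
  assumes t: "t \<noteq> D1" and w: "set w \<subseteq> elts V"
    and k: "k2 = (if t = B1 then n - 1 else n)" "k13 = (if t = B1 then n else n - 1)"
  shows "E k2 (E k13 (E k2 (E k13 w))) = E k13 (E k2 (E k13 (E k2 w)))"
proof -
  interpret A: vec A2odd "2 * n + 10" by (rule vec_A)
  let ?e = "\<lambda>w. concat (map enc w)"
  have kn: "k2 \<in> {1..n}" "k13 \<in> {1..n}" using k rank by auto
  have V: "set (E k2 u) \<subseteq> elts V" "set (E k13 u) \<subseteq> elts V" if "set u \<subseteq> elts V" for u
    using raise_facts(1) kn that by blast+
  have X: "?e (E k2 u) = A.E 2 (?e u)" "?e (E k13 u) = A.E 3 (A.E (Suc 0) (?e u))" if "set u \<subseteq> elts V" for u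
    using enc_word[OF t k that, of 0] by simp_all
  have AV: "set (A.E i u) \<subseteq> elts A.V" if "i \<in> {Suc 0, 2, 3}" "set u \<subseteq> elts A.V" for i u
    using A.raise_facts(1)[of i u 0] that by auto
  have 12: "A.E (Suc 0) (A.E 2 (A.E (Suc 0) u)) = A.E 2 (A.E (Suc 0) (A.E 2 u))"
    and 23: "A.E 2 (A.E 3 (A.E 2 u)) = A.E 3 (A.E 2 (A.E 3 u))"
    and 13: "A.E (Suc 0) (A.E 3 u) = A.E 3 (A.E (Suc 0) u)" if "set u \<subseteq> elts A.V" for u
    using A.E_braid[of 1 u] A.E_braid[of 2 u] A.E_commute[of 1 3 u] that by (simp_all add: numeral_eq_Suc)
  have "a \<in> elts V \<Longrightarrow> set (enc a) \<subseteq> elts A.V" for a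
    by (auto simp: enc_def elts_V A.elts_V)
  then have ew: "set (?e w) \<subseteq> elts A.V" using w by auto
  have "A.E 2 (A.E 3 (A.E (Suc 0) (A.E 2 (A.E 3 (A.E (Suc 0) u))))) = A.E 3 (A.E (Suc 0) (A.E 2 (A.E 3 (A.E (Suc 0) (A.E 2 u)))))"
    if u: "set u \<subseteq> elts A.V" for u
  proof -
    have "A.E 2 (A.E 3 (A.E (Suc 0) (A.E 2 (A.E 3 (A.E (Suc 0) u))))) = A.E 2 (A.E 3 (A.E (Suc 0) (A.E 2 (A.E (Suc 0) (A.E 3 u)))))"
      using u by (simp add: 13 AV)
    also have "\<dots> = A.E 2 (A.E 3 (A.E 2 (A.E (Suc 0) (A.E 2 (A.E 3 u)))))"
      using u by (simp add: 12 AV)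
    also have "\<dots> = A.E 3 (A.E 2 (A.E 3 (A.E (Suc 0) (A.E 2 (A.E 3 u)))))"
      using u by (simp add: 23 AV)
    also have "\<dots> = A.E 3 (A.E 2 (A.E (Suc 0) (A.E 3 (A.E 2 (A.E 3 u)))))"
      using u by (simp add: 13 AV)
    also have "\<dots> = A.E 3 (A.E 2 (A.E (Suc 0) (A.E 2 (A.E 3 (A.E 2 u)))))"
      using u by (simp add: 23 AV)
    also have "\<dots> = A.E 3 (A.E (Suc 0) (A.E 2 (A.E (Suc 0) (A.E 3 (A.E 2 u)))))"
      using u by (simp add: 12 AV)
    also have "\<dots> = A.E 3 (A.E (Suc 0) (A.E 2 (A.E 3 (A.E (Suc 0) (A.E 2 u)))))"
      using u by (simp add: 13 AV)
    finally show ?thesis .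
  qed
  then have "?e (E k2 (E k13 (E k2 (E k13 w)))) = ?e (E k13 (E k2 (E k13 (E k2 w))))"
    using w ew by (simp add: X V)
  then show ?thesis
    by (rule enc_inj) (use w V in auto)
qed

text \<open>The joining sequences complete i and j to the two reduced words of the longest element
  of the Weyl group generated by the two nodes; its length is 2, 3 or 4.\<close>

lemma local_join:
  assumes ij: "i \<in> {1..n}" "j \<in> {1..n}" "i < j"
  shows "\<exists>is js. set is \<subseteq> {1..n} \<and> set js \<subseteq> {1..n} \<and>
    (\<forall>w. set w \<subseteq> elts V \<longrightarrow> foldl (\<lambda>w k. E k w) (E i w) is = foldl (\<lambda>w k. E k w) (E j w) js)"
proof -
  consider "Suc i = j" "j < n" | "j = n" "i = n - 1" "t \<noteq> D1" | "t = D1" "j = n" "i = n - 1"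
    | "t = D1" "j = n" "i = n - 2" | "i + 2 \<le> j" "\<not> (t = D1 \<and> j = n \<and> i = n - 2)"
    using ij by fastforce
  then show ?thesis
  proof cases
    case 1
    show ?thesis
      by (rule exI[of _ "[j, i]"], rule exI[of _ "[i, j]"]) (use 1 ij E_braid[of i] in auto)
  next
    case 2
    show ?thesis
    proof (cases "t = B1")
      case True
      then show ?thesis
        by (intro exI[of _ "[j, i, j]"] exI[of _ "[i, j, i]"])
          (use 2 ij E_braid4[of _ "n - 1" n] in auto)
    next
      case False
      then show ?thesis
        by (intro exI[of _ "[j, i, j]"] exI[of _ "[i, j, i]"])
          (use 2 ij E_braid4[of _ n "n - 1"] in auto)
    qed
  next
    case 3
    show ?thesis
      by (rule exI[of _ "[j]"], rule exI[of _ "[i]"]) (use 3 ij E_D in auto)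
  next
    case 4
    show ?thesis
      by (rule exI[of _ "[j, i]"], rule exI[of _ "[i, j]"]) (use 4 ij E_D in auto)
  next
    case 5
    show ?thesis
      by (rule exI[of _ "[j]"], rule exI[of _ "[i]"]) (use 5 ij E_commute[of i j] in auto)
  qed
qed

section \<open>Raising as a terminating and confluent rewriting relation\<close>

definition red :: "int list \<Rightarrow> int list \<Rightarrow> bool" where
  "red w v \<longleftrightarrow> set w \<subseteq> elts V \<and> (\<exists>i\<in>{1..n}. we i w = Some v)"

definition hi :: "int list \<Rightarrow> bool" where
  "hi w \<longleftrightarrow> (\<forall>i\<in>{1..n}. we i w = None)"

definition rk :: "int \<Rightarrow> nat" where
  "rk a = nat (if a > 0 then a else if a = 0 then int n + 1 else 2 * int n + 2 + a)"

lemma rk_less: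
  assumes "eop V i a = Some b" "a \<in> elts V"
  shows "rk b < rk a"
proof (cases "1 \<le> i \<and> i < n")
  case False
  then show ?thesis
    using assms rank rankD unfolding eop_V elts_V rk_def by (cases t) (auto split: if_splits)
qed (use assms in \<open>auto simp: eop_V elts_V rk_def split: if_splits\<close>)

lemma we_rk:
  "we i w = Some v \<Longrightarrow> set w \<subseteq> elts V \<Longrightarrow> sum_list (map rk v) < sum_list (map rk w)"
  by (induction w arbitrary: v) (auto split: if_splits dest: rk_less)

lemma red_elts: "red w v \<Longrightarrow> set v \<subseteq> elts V"
  unfolding red_def using seminormal_eD(1)[OF seminormal_WC, unfolded elts_WC eop_WC] by blast

lemma reds_elts: "red\<^sup>*\<^sup>* w v \<Longrightarrow> set w \<subseteq> elts V \<Longrightarrow> set v \<subseteq> elts V"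
  by (induction rule: rtranclp_induct) (auto dest: red_elts)

lemma iter_reds:
  assumes "i \<in> {1..n}" "iter_op (we i) m w = Some v" "set w \<subseteq> elts V"
  shows "red\<^sup>*\<^sup>* w v"
  using assms(2,3)
proof (induction m arbitrary: w)
  case (Suc m)
  then obtain u where u: "we i w = Some u" "iter_op (we i) m u = Some v"
    by (auto simp: iter_op_Suc bind_eq_Some_conv)
  then have "red w u" using assms(1) Suc.prems unfolding red_def by blast
  then show ?case using Suc.IH[OF u(2) red_elts] by (meson converse_rtranclp_into_rtranclp)
qed simp

lemma E_reds:
  assumes "i \<in> {1..n}" "set w \<subseteq> elts V"
  shows "red\<^sup>*\<^sup>* w (E i w)"
  by (rule iter_reds[OF assms(1) iter_raise[OF assms] assms(2)])

lemma foldl_E_reds: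
  "set is \<subseteq> {1..n} \<Longrightarrow> set w \<subseteq> elts V \<Longrightarrow> red\<^sup>*\<^sup>* w (foldl (\<lambda>w k. E k w) w is)"
proof (induction "is" arbitrary: w)
  case (Cons i "is")
  then have "red\<^sup>*\<^sup>* w (E i w)" using E_reds by auto
  moreover have "red\<^sup>*\<^sup>* (E i w) (foldl (\<lambda>w k. E k w) (E i w) is)"
    using Cons raise_facts(1)[of i w 0] by auto
  ultimately show ?case by simp
qed simp

lemma E_we:
  assumes i: "i \<in> {1..n}" and w: "set w \<subseteq> elts V" and e: "we i w = Some v"
  shows "E i v = E i w"
proof -
  note D = seminormal_eD[OF seminormal_WC[OF i], of w v, unfolded elts_WC eop_WC, OF w e]
  have "iter_op (we i) (weps i w) w = iter_op (we i) (weps i v) v"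
    using D(3) e by (simp add: iter_op_Suc)
  then show ?thesis using iter_raise[OF i w, of 0] iter_raise[OF i D(1), of 0] by simp
qed

text \<open>Each of the two steps is first continued to the maximal power of the same operator,
  which by \<open>E_we\<close> does not depend on the step already made. Then
  \<open>local_join\<close> closes the diagram.\<close>

lemma red_join:
  assumes "red w u" "red w v"
  shows "\<exists>z. red\<^sup>*\<^sup>* u z \<and> red\<^sup>*\<^sup>* v z"
proof -
  obtain i j where ij: "i \<in> {1..n}" "j \<in> {1..n}" "we i w = Some u" "we j w = Some v"
    and w: "set w \<subseteq> elts V" using assms unfolding red_def by blast
  have *: "\<exists>z. red\<^sup>*\<^sup>* u z \<and> red\<^sup>*\<^sup>* v z"
    if ij: "i \<in> {1..n}" "j \<in> {1..n}" "we i w = Some u" "we j w = Some v" "i < j" for i j u v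
  proof -
    obtain "is" js where J: "set is \<subseteq> {1..n}" "set js \<subseteq> {1..n}"
      "foldl (\<lambda>w k. E k w) (E i w) is = foldl (\<lambda>w k. E k w) (E j w) js"
      using local_join[OF ij(1,2,5)] w by blast
    have u: "set u \<subseteq> elts V" and v: "set v \<subseteq> elts V"
      using red_elts[of w] ij w unfolding red_def by blast+
    have "red\<^sup>*\<^sup>* u (foldl (\<lambda>w k. E k w) u (i # is))" "red\<^sup>*\<^sup>* v (foldl (\<lambda>w k. E k w) v (j # js))"
      using foldl_E_reds[of "i # is" u] foldl_E_reds[of "j # js" v] J ij u v by auto
    then show ?thesis
      using J(3) E_we[OF ij(1) w ij(3)] E_we[OF ij(2) w ij(4)] by auto
  qed
  consider "i < j" | "j < i" | "i = j" by linarith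
  then show ?thesis
  proof cases
    case 3
    then show ?thesis using ij by auto
  qed (use *[of i j u v] *[of j i v u] ij in auto)
qed

lemma hi_exists: "set w \<subseteq> elts V \<Longrightarrow> \<exists>h. red\<^sup>*\<^sup>* w h \<and> hi h"
proof (induction "sum_list (map rk w)" arbitrary: w rule: less_induct)
  case less
  show ?case
  proof (cases "hi w")
    case False
    then obtain v where v: "red w v" using less.prems unfolding hi_def red_def by auto
    then have "sum_list (map rk v) < sum_list (map rk w)"
      using we_rk less.prems unfolding red_def by blast
    then obtain h where "red\<^sup>*\<^sup>* v h" "hi h" using less.hyps red_elts[OF v] by blast
    then show ?thesis using v by (meson converse_rtranclp_into_rtranclp)
  qed blast
qed

text \<open>Newman's argument: well-founded induction on the total rank of the letters, where two
  different first steps are joined by \<open>red_join\<close>.\<close>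

lemma hi_unique:
  assumes "set w \<subseteq> elts V"
  shows "\<exists>!h. red\<^sup>*\<^sup>* w h \<and> hi h"
  using assms
proof (induction "sum_list (map rk w)" arbitrary: w rule: less_induct)
  case less
  have IH: "\<exists>!h. red\<^sup>*\<^sup>* v h \<and> hi h" if "red w v" for v
  proof -
    have "sum_list (map rk v) < sum_list (map rk w)"
      using that we_rk less.prems unfolding red_def by blast
    then show ?thesis using less.hyps red_elts[OF that] by blast
  qed
  show ?case
  proof (cases "hi w")
    case True
    then have "\<not> red w v" for v unfolding hi_def red_def by auto
    then have "red\<^sup>*\<^sup>* w h \<Longrightarrow> h = w" for h by (metis converse_rtranclpE)
    then show ?thesis using True by blast
  next
    case False
    then obtain v where v: "red w v" using less.prems unfolding hi_def red_def by auto
    obtain h where h: "red\<^sup>*\<^sup>* v h" "hi h" using IH[OF v] by blast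
    show ?thesis
    proof (rule ex1I[of _ h])
      show "red\<^sup>*\<^sup>* w h \<and> hi h" using v h by (meson converse_rtranclp_into_rtranclp)
    next
      fix k assume k: "red\<^sup>*\<^sup>* w k \<and> hi k"
      then have "k \<noteq> w" using False by blast
      then obtain u where u: "red w u" "red\<^sup>*\<^sup>* u k" using k by (metis converse_rtranclpE)
      obtain z where z: "red\<^sup>*\<^sup>* u z" "red\<^sup>*\<^sup>* v z" using red_join[OF u(1) v] by blast
      have "red\<^sup>*\<^sup>* w z" using v z by (meson converse_rtranclp_into_rtranclp)
      then have zV: "set z \<subseteq> elts V" using reds_elts less.prems by blast
      obtain y where y: "red\<^sup>*\<^sup>* z y" "hi y"
        using hi_exists[OF zV] by blast
      have "k = y" using IH[OF u(1)] u(2) conjunct2[OF k] rtranclp_trans[OF z(1) y(1)] y(2) by blast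
      moreover have "h = y" using IH[OF v] h rtranclp_trans[OF z(2) y(1)] y(2) by blast
      ultimately show "k = h" by simp
    qed
  qed
qed

end

section \<open>Tableaux\<close>

lemma cut_concat: "cut (map length cs) (concat cs) = cs"
  by (induction cs) auto

lemma concat_cut: "length w = sum_list hs \<Longrightarrow> concat (cut hs w) = w \<and> map length (cut hs w) = hs"
  by (induction hs arbitrary: w) auto

lemma unread_reading [simp]: "unread (tshape T) (reading T) = T"
  using cut_concat[of "rev T"] unfolding unread_def reading_def by (simp add: rev_map)

lemma length_reading: "length (reading T) = sum_list (tshape T)"
  by (simp add: reading_def length_concat sum_list_rev flip: rev_map)

lemma reading_unread: "length w = sum_list hs \<Longrightarrow> reading (unread hs w) = w"
  and tshape_unread: "length w = sum_list hs \<Longrightarrow> tshape (unread hs w) = hs"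
  unfolding reading_def unread_def using concat_cut[of w "rev hs"]
  by (simp_all add: rev_map[symmetric])

lemma reading_inj: "reading T = reading T' \<Longrightarrow> tshape T = tshape T' \<Longrightarrow> T = T'"
  by (metis unread_reading)

lemma tshape_hw [simp]: "tshape (hw_tableau hs) = hs"
  by (induction hs) (auto simp: hw_tableau_def)

context vec
begin

definition tab :: "tableau \<Rightarrow> bool" where
  "tab T \<longleftrightarrow> set (reading T) \<subseteq> elts V"

lemma eop_filling:
  assumes i: "i \<in> {1..n}" and T: "tab T" "tshape T = hs"
  shows "eop (filling_crystal t n hs) i T = map_option (unread hs) (we i (reading T))"
    "fop (filling_crystal t n hs) i T = map_option (unread hs) (wf i (reading T))"
  using word_crystal_facts[OF i, of "sum_list hs"] T length_reading[of T]
  unfolding filling_crystal_def relabel_def tab_def by auto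

lemma wf_length: "wf i w = Some v \<Longrightarrow> length v = length w"
  by (induction w arbitrary: v) (auto split: if_splits)

lemma we_in: "i \<in> {1..n} \<Longrightarrow> set w \<subseteq> elts V \<Longrightarrow> we i w = Some v \<Longrightarrow> set v \<subseteq> elts V \<and> wf i v = Some w"
  using seminormal_eD(1,2)[OF seminormal_WC, unfolded elts_WC eop_WC fop_WC] by blast

lemma wf_in: "i \<in> {1..n} \<Longrightarrow> set w \<subseteq> elts V \<Longrightarrow> wf i w = Some v \<Longrightarrow> set v \<subseteq> elts V \<and> we i v = Some w"
  using seminormal_fD(1,2)[OF seminormal_WC, unfolded elts_WC eop_WC fop_WC] by blast

lemma we_None: "i \<in> {1..n} \<Longrightarrow> set w \<subseteq> elts V \<Longrightarrow> we i w = None \<longleftrightarrow> weps i w = 0"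
  and wf_None: "i \<in> {1..n} \<Longrightarrow> set w \<subseteq> elts V \<Longrightarrow> wf i w = None \<longleftrightarrow> wphi i w = 0"
  using seminormal_None[OF seminormal_WC, unfolded elts_WC eop_WC fop_WC] by blast+

lemma upto_snoc: "[1..int (Suc h)] = [1..int h] @ [int (Suc h)]"
  using upto_rec2[of 1 "int (Suc h)"] by simp

text \<open>For i < n the only letter of the column that e_i could raise is i + 1, and it comes
  directly after the i that shields it. The node n raises no positive letter.\<close>

lemma column_eps:
  assumes i: "i \<in> {1..n}"
  shows "weps i [1..int h] = 0"
proof (cases "i < n")
  case True
  have "weps i [1..int h] = 0 \<and> wphi i [1..int h] = (if h = i then 1 else 0)"
  proof (induction h)
    case 0
    then show ?case using i by auto
  next
    case (Suc h)
    then show ?case using i True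
      unfolding upto_snoc weps_append wphi_append by (auto simp: le_def lp_def)
  qed
  then show ?thesis by blast
next
  case False
  then have "i = n" using i by simp
  moreover have "le n a = 0" if "a > 0" for a
    using that rank unfolding le_def by (cases t) auto
  moreover have "weps n w = 0" if "\<And>a. a \<in> set w \<Longrightarrow> le n a = 0" for w
    using that by (induction w) auto
  ultimately have "weps n [1..int h] = 0" by (metis atLeastAtMost_iff set_upto zero_less_one order_less_le_trans)
  then show ?thesis using \<open>i = n\<close> by simp
qed

lemma hw_eps:
  assumes "i \<in> {1..n}"
  shows "weps i (reading (hw_tableau hs)) = 0"
proof -
  have *: "weps i (concat cs) = 0" if "\<And>c. c \<in> set cs \<Longrightarrow> weps i c = 0" for cs
    using that by (induction cs) (auto simp: weps_append)
  show ?thesis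
    unfolding reading_def hw_tableau_def by (rule *) (auto simp: column_eps[OF assms])
qed

lemma tab_hw:
  assumes "\<And>h. h \<in> set hs \<Longrightarrow> h \<le> n"
  shows "tab (hw_tableau hs)"
  using assms unfolding tab_def reading_def hw_tableau_def by (fastforce simp: elts_V)

lemma hi_hw: "(\<And>h. h \<in> set hs \<Longrightarrow> h \<le> n) \<Longrightarrow> hi (reading (hw_tableau hs))"
  unfolding hi_def using we_None hw_eps tab_hw[unfolded tab_def] by blast

definition KN :: "nat list \<Rightarrow> tableau \<Rightarrow> bool" where
  "KN hs T \<longleftrightarrow> tshape T = hs \<and> tab T \<and> red\<^sup>*\<^sup>* (reading T) (reading (hw_tableau hs))"

lemma KN_red:
  assumes "KN hs T" "red (reading T) w" "\<And>h. h \<in> set hs \<Longrightarrow> h \<le> n"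
  shows "red\<^sup>*\<^sup>* w (reading (hw_tableau hs))"
proof -
  let ?h = "reading (hw_tableau hs)"
  have "set w \<subseteq> elts V" using red_elts[OF assms(2)] .
  then obtain h where h: "red\<^sup>*\<^sup>* w h" "hi h" using hi_exists by blast
  have "red\<^sup>*\<^sup>* (reading T) h" using assms(2) h(1) by (rule converse_rtranclp_into_rtranclp)
  then have "h = ?h"
    using hi_unique[of "reading T"] assms(1) hi_hw[OF assms(3)] h(2) unfolding KN_def tab_def by blast
  then show ?thesis using h(1) by simp
qed

lemma KN_eop:
  assumes i: "i \<in> {1..n}" and T: "KN hs T" and hs: "\<And>h. h \<in> set hs \<Longrightarrow> h \<le> n"
    and e: "eop (filling_crystal t n hs) i T = Some U"
  shows "KN hs U \<and> we i (reading T) = Some (reading U)"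
proof -
  have T': "tab T" "tshape T = hs" using T by (auto simp: KN_def)
  obtain v where v: "we i (reading T) = Some v" "U = unread hs v"
    using e eop_filling[OF i T'] by auto
  have len: "length v = sum_list hs" using we_length[OF v(1)] length_reading T' by simp
  note R = reading_unread[OF len] tshape_unread[OF len]
  have "red (reading T) v" using v(1) i T' unfolding red_def tab_def by blast
  from KN_red[OF T this hs] red_elts[OF this] show ?thesis
    using R v unfolding KN_def tab_def by simp
qed

lemma KN_fop:
  assumes i: "i \<in> {1..n}" and T: "KN hs T"
    and e: "fop (filling_crystal t n hs) i T = Some U"
  shows "KN hs U \<and> wf i (reading T) = Some (reading U)"
proof -
  have T': "tab T" "tshape T = hs" using T by (auto simp: KN_def)
  obtain v where v: "wf i (reading T) = Some v" "U = unread hs v"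
    using e eop_filling[OF i T'] by auto
  have len: "length v = sum_list hs" using wf_length[OF v(1)] length_reading T' by simp
  note R = reading_unread[OF len] tshape_unread[OF len]
  have v': "set v \<subseteq> elts V" "we i v = Some (reading T)" using wf_in[OF i _ v(1)] T' by (auto simp: tab_def)
  then have "red v (reading T)" using i unfolding red_def by blast
  then show ?thesis using R v v' T unfolding KN_def tab_def
    by (auto intro: converse_rtranclp_into_rtranclp)
qed

text \<open>A component may be explored by e_i and f_i in any order, whereas \<open>KN\<close> only
  asks for one sequence of raisings to the top. That \<open>KN\<close> survives an arbitrary e_i is
  where uniqueness enters: by \<open>KN_red\<close> the same highest weight word is still ahead
  after the step. Conversely, a sequence of raisings read backwards is a sequence of f_i starting at
  the highest weight tableau.\<close>

lemma component_iff:
  assumes hs: "\<And>h. h \<in> set hs \<Longrightarrow> h \<le> n"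
  shows "T \<in> component (filling_crystal t n hs) {1..n} (hw_tableau hs) \<longleftrightarrow> KN hs T"
proof
  assume "T \<in> component (filling_crystal t n hs) {1..n} (hw_tableau hs)"
  then show "KN hs T"
  proof induction
    case base
    show ?case using tab_hw hs by (simp add: KN_def)
  next
    case (e_step T i U)
    then show ?case using KN_eop[OF e_step(2) e_step.IH hs] by blast
  next
    case (f_step T i U)
    then show ?case using KN_fop[OF f_step(2) f_step.IH] by blast
  qed
next
  assume T: "KN hs T"
  have "tshape U = hs \<Longrightarrow> U \<in> component (filling_crystal t n hs) {1..n} (hw_tableau hs)"
    if "red\<^sup>*\<^sup>* (reading U) (reading (hw_tableau hs))" for U
    using that
  proof (induction "reading U" arbitrary: U rule: converse_rtranclp_induct)
    case base
    then have "U = hw_tableau hs" by (intro reading_inj) auto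
    then show ?case by (simp add: component.base)
  next
    case (step v U)
    obtain i where i: "i \<in> {1..n}" "we i (reading U) = Some v" and U: "set (reading U) \<subseteq> elts V"
      using step.hyps(1) unfolding red_def by blast
    let ?W = "unread hs v"
    have len: "length v = sum_list hs" using we_length[OF i(2)] length_reading step.prems by simp
    note R = reading_unread[OF len] tshape_unread[OF len]
    have W: "?W \<in> component (filling_crystal t n hs) {1..n} (hw_tableau hs)"
      using step.hyps(3)[of ?W] R by simp
    have v: "set v \<subseteq> elts V" "wf i v = Some (reading U)" using we_in[OF i(1) U i(2)] by auto
    have "fop (filling_crystal t n hs) i ?W = Some U"
      using eop_filling(2)[OF i(1), of ?W hs] R v step.prems by (auto simp: tab_def)
    then show ?case by (rule component.f_step[OF W i(1)])
  qed
  then show "T \<in> component (filling_crystal t n hs) {1..n} (hw_tableau hs)"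
    using T unfolding KN_def by blast
qed

section \<open>Kirillov-Reshetikhin crystals at the nodes 1, ..., n\<close>

lemma KR_shapes_le: "hs \<in> KR_shapes r k \<Longrightarrow> h \<in> set hs \<Longrightarrow> h \<le> r"
  unfolding KR_shapes_def by auto

lemma KR_elts:
  assumes "r \<le> n"
  shows "T \<in> elts (KR_classical t n r k) \<longleftrightarrow> tshape T \<in> KR_shapes r k \<and> KN (tshape T) T"
proof -
  have *: "elts (hw_crystal t n hs) = {T. KN hs T}" if "hs \<in> KR_shapes r k" for hs
    using component_iff[of hs] KR_shapes_le[OF that] assms by (fastforce simp: hw_crystal_def)
  show ?thesis
    unfolding KR_classical_def by (auto simp: *) (auto simp: KN_def)
qed

lemma KR_ops:
  assumes "r \<le> n" "T \<in> elts (KR_classical t n r k)" "i \<in> {1..n}"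
  shows "eop (KR_classical t n r k) i T = map_option (unread (tshape T)) (we i (reading T))"
    "fop (KR_classical t n r k) i T = map_option (unread (tshape T)) (wf i (reading T))"
  using assms KR_elts eop_filling unfolding KR_classical_def hw_crystal_def KN_def by auto

lemma KR_eop_D:
  assumes "r \<le> n" "T \<in> elts (KR_classical t n r k)" "i \<in> {1..n}"
    "eop (KR_classical t n r k) i T = Some U"
  shows "U \<in> elts (KR_classical t n r k)" "we i (reading T) = Some (reading U)" "tshape U = tshape T"
proof -
  have T: "tshape T \<in> KR_shapes r k" "KN (tshape T) T" using KR_elts assms by auto
  have "eop (filling_crystal t n (tshape T)) i T = Some U"
    using assms(4) by (simp add: KR_classical_def hw_crystal_def)
  then have "KN (tshape T) U \<and> we i (reading T) = Some (reading U)"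
    by (rule KN_eop[OF assms(3) T(2), rotated]) (use KR_shapes_le[OF T(1)] assms(1) in fastforce)
  then show "U \<in> elts (KR_classical t n r k)" "we i (reading T) = Some (reading U)" "tshape U = tshape T"
    using T(1) KR_elts[OF assms(1)] by (auto simp: KN_def)
qed

lemma KR_fop_D:
  assumes "r \<le> n" "T \<in> elts (KR_classical t n r k)" "i \<in> {1..n}"
    "fop (KR_classical t n r k) i T = Some U"
  shows "U \<in> elts (KR_classical t n r k)" "wf i (reading T) = Some (reading U)" "tshape U = tshape T"
proof -
  have T: "tshape T \<in> KR_shapes r k" "KN (tshape T) T" using KR_elts assms by auto
  have "fop (filling_crystal t n (tshape T)) i T = Some U"
    using assms(4) by (simp add: KR_classical_def hw_crystal_def)
  then have "KN (tshape T) U \<and> wf i (reading T) = Some (reading U)"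
    by (rule KN_fop[OF assms(3) T(2)])
  then show "U \<in> elts (KR_classical t n r k)" "wf i (reading T) = Some (reading U)" "tshape U = tshape T"
    using T(1) KR_elts[OF assms(1)] by (auto simp: KN_def)
qed

abbreviation teps where "teps i T \<equiv> weps i (reading T)"
abbreviation tphi where "tphi i T \<equiv> wphi i (reading T)"

lemma seminormal_KR:
  assumes r: "r \<le> n" and i: "i \<in> {1..n}"
  shows "seminormal (KR_classical t n r k) i (\<lambda>T. teps i T) (\<lambda>T. tphi i T)"
proof (rule seminormalI)
  let ?K = "KR_classical t n r k"
  have tab: "set (reading T) \<subseteq> elts V" if "T \<in> elts ?K" for T
    using that KR_elts[OF r] by (auto simp: KN_def tab_def)
  fix T U assume T: "T \<in> elts ?K" and e: "eop ?K i T = Some U"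
  note D = KR_eop_D[OF r T i e]
  note W = seminormal_eD[OF seminormal_WC[OF i], unfolded elts_WC eop_WC fop_WC, OF tab[OF T] D(2)]
  show "U \<in> elts ?K \<and> fop ?K i U = Some T \<and> teps i T = Suc (teps i U) \<and> tphi i U = Suc (tphi i T)"
    using D W KR_ops(2)[OF r D(1) i] by (metis map_option_eq_Some unread_reading)
next
  let ?K = "KR_classical t n r k"
  have tab: "set (reading T) \<subseteq> elts V" if "T \<in> elts ?K" for T
    using that KR_elts[OF r] by (auto simp: KN_def tab_def)
  fix T U assume T: "T \<in> elts ?K" and e: "fop ?K i T = Some U"
  note D = KR_fop_D[OF r T i e]
  note W = seminormal_fD[OF seminormal_WC[OF i], unfolded elts_WC eop_WC fop_WC, OF tab[OF T] D(2)]
  show "U \<in> elts ?K \<and> eop ?K i U = Some T \<and> tphi i T = Suc (tphi i U) \<and> teps i U = Suc (teps i T)"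
    using D W KR_ops(1)[OF r D(1) i] by (metis map_option_eq_Some unread_reading)
next
  let ?K = "KR_classical t n r k"
  fix T assume T: "T \<in> elts ?K"
  then have tab: "set (reading T) \<subseteq> elts V"
    using KR_elts[OF r] by (auto simp: KN_def tab_def)
  show "eop ?K i T = None \<Longrightarrow> teps i T = 0" "fop ?K i T = None \<Longrightarrow> tphi i T = 0"
    using KR_ops[OF r T i] we_None[OF i tab] wf_None[OF i tab] by simp_all
qed

lemma KR_iter_e:
  assumes r: "r \<le> n" and i: "i \<in> {1..n}" and T: "T \<in> elts (KR_classical t n r k)"
    and U: "tshape U = tshape T" "iter_op (we i) m (reading T) = Some (reading U)"
  shows "iter_op (eop (KR_classical t n r k) i) m T = Some U"
  using T U
proof (induction m arbitrary: T)
  case 0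
  then have "T = U" by (intro reading_inj) auto
  then show ?case by simp
next
  case (Suc m)
  then obtain v where v: "we i (reading T) = Some v" "iter_op (we i) m v = Some (reading U)"
    by (auto simp: iter_op_Suc bind_eq_Some_conv)
  then obtain W where W: "eop (KR_classical t n r k) i T = Some W"
    using KR_ops(1)[OF r Suc.prems(1) i] by auto
  note D = KR_eop_D[OF r Suc.prems(1) i W]
  have "iter_op (eop (KR_classical t n r k) i) m W = Some U"
    by (rule Suc.IH[OF D(1)]) (use D v Suc.prems in auto)
  then show ?case using W by (simp add: iter_op_Suc)
qed

lemma KR_highest:
  assumes r: "r \<le> n" and T: "T \<in> elts (KR_classical t n r k)"
    and "\<And>i. i \<in> {1..n} \<Longrightarrow> teps i T = 0"
  shows "T = hw_tableau (tshape T)"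
proof -
  have K: "tshape T \<in> KR_shapes r k" "KN (tshape T) T" using KR_elts r T by auto
  have "hi (reading T)"
    using K assms(3) we_None unfolding hi_def KN_def tab_def by blast
  moreover have "hi (reading (hw_tableau (tshape T)))"
    by (rule hi_hw) (use KR_shapes_le[OF K(1)] r in fastforce)
  ultimately have "reading T = reading (hw_tableau (tshape T))"
    using hi_unique[of "reading T"] K(2) unfolding KN_def tab_def by blast
  then show ?thesis by (intro reading_inj) auto
qed

end

section \<open>Raising paths\<close>

fun run :: "'a crystal \<Rightarrow> (nat \<times> nat) list \<Rightarrow> 'a \<Rightarrow> 'a option" where
  "run C [] u = Some u"
| "run C ((i, m) # ps) u = Option.bind (iter_op (eop C i) m u) (run C ps)"

definition normal_on :: "nat set \<Rightarrow> 'a crystal \<Rightarrow> bool" where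
  "normal_on K C \<longleftrightarrow> (\<forall>i\<in>K. seminormal C i (veps C i) (vphi C i))"

lemma normal_onD: "normal_on K C \<Longrightarrow> i \<in> K \<Longrightarrow> seminormal C i (veps C i) (vphi C i)"
  by (simp add: normal_on_def)

lemma normal_onI: "(\<And>i. i \<in> K \<Longrightarrow> seminormal C i (ep i) (ph i)) \<Longrightarrow> normal_on K C"
  unfolding normal_on_def by (blast intro: seminormal_canonical)

lemma normal_on_tensor:
  assumes "normal_on K A" "normal_on K B"
  shows "normal_on K (tensor A B)"
  by (rule normal_onI) (rule seminormal_tensor[OF assms[THEN normal_onD]])

lemma veps_tensor:
  assumes "normal_on K A" "normal_on K B" "i \<in> K" "a \<in> elts A" "b \<in> elts B"
  shows "veps (tensor A B) i (a, b) = veps A i a + (veps B i b - vphi A i a)"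
    "vphi (tensor A B) i (a, b) = vphi B i b + (vphi A i a - veps B i b)"
  using veps_eq[OF seminormal_tensor[OF assms(1,2)[THEN normal_onD, OF assms(3)]], of "(a, b)"]
    vphi_eq[OF seminormal_tensor[OF assms(1,2)[THEN normal_onD, OF assms(3)]], of "(a, b)"] assms
  by simp_all

lemma run_append: "run C (ps @ qs) u = Option.bind (run C ps u) (run C qs)"
proof (induction ps arbitrary: u)
  case (Cons p ps)
  then show ?case by (cases p; cases "iter_op (eop C (fst p)) (snd p) u") auto
qed simp

lemma run_elts:
  assumes C: "normal_on K C"
  shows "u \<in> elts C \<Longrightarrow> fst ` set ps \<subseteq> K \<Longrightarrow> run C ps u = Some v \<Longrightarrow> v \<in> elts C"
proof (induction ps arbitrary: u)
  case (Cons p ps)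
  obtain i m where p: "p = (i, m)" by (cases p)
  obtain w where w: "iter_op (eop C i) m u = Some w" "run C ps w = Some v"
    using Cons.prems by (auto simp: p bind_eq_Some_conv)
  have "w \<in> elts C"
    using iter_e_props(1)[OF normal_onD[OF C] Cons.prems(1) w(1)] Cons.prems(2) p by auto
  then show ?case using Cons w by auto
qed auto

text \<open>f_i undoes e_i, so the end of a run together with its exponents determines the start.
  Values of R are identified in this way.\<close>

lemma run_inj:
  assumes C: "normal_on K C"
  shows "u \<in> elts C \<Longrightarrow> v \<in> elts C \<Longrightarrow> fst ` set ps \<subseteq> K \<Longrightarrow>
    run C ps u = Some w \<Longrightarrow> run C ps v = Some w \<Longrightarrow> u = v"
proof (induction ps arbitrary: u v)
  case (Cons p ps)
  obtain i m where p: "p = (i, m)" by (cases p)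
  then have i: "i \<in> K" "fst ` set ps \<subseteq> K" using Cons.prems(3) by auto
  obtain u' v' where w: "iter_op (eop C i) m u = Some u'" "run C ps u' = Some w"
    "iter_op (eop C i) m v = Some v'" "run C ps v' = Some w"
    using Cons.prems by (auto simp: p bind_eq_Some_conv)
  note U = iter_e_props(1,2)[OF normal_onD[OF C i(1)] Cons.prems(1) w(1)]
  note V = iter_e_props(1,2)[OF normal_onD[OF C i(1)] Cons.prems(2) w(3)]
  have "u' = v'" using Cons.IH[OF U(1) V(1) i(2) w(2,4)] .
  then show ?case using U(2) V(2) by simp
qed auto

lemma iso_iter:
  assumes iso: "crystal_iso K A B R" and A: "normal_on K A" and i: "i \<in> K"
  shows "u \<in> elts A \<Longrightarrow> iter_op (eop A i) m u = Some v \<Longrightarrow> iter_op (eop B i) m (R u) = Some (R v)"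
proof (induction m arbitrary: u)
  case (Suc m)
  then obtain w where w: "eop A i u = Some w" "iter_op (eop A i) m w = Some v"
    by (auto simp: iter_op_Suc bind_eq_Some_conv)
  have "eop B i (R u) = map_option R (eop A i u)"
    using iso i Suc.prems(1) unfolding crystal_iso_def by simp
  then have "eop B i (R u) = Some (R w)" using w(1) by simp
  then show ?case
    using Suc.IH[OF seminormal_eD(1)[OF normal_onD[OF A i] Suc.prems(1) w(1)] w(2)]
    by (simp add: iter_op_Suc)
qed simp

lemma iso_run:
  assumes iso: "crystal_iso K A B R" and A: "normal_on K A"
  shows "u \<in> elts A \<Longrightarrow> fst ` set ps \<subseteq> K \<Longrightarrow> run A ps u = Some v \<Longrightarrow> run B ps (R u) = Some (R v)"
proof (induction ps arbitrary: u)
  case (Cons p ps)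
  obtain i m where p: "p = (i, m)" by (cases p)
  then have i: "i \<in> K" "fst ` set ps \<subseteq> K" using Cons.prems(2) by auto
  obtain w where w: "iter_op (eop A i) m u = Some w" "run A ps w = Some v"
    using Cons.prems by (auto simp: p bind_eq_Some_conv)
  have "w \<in> elts A"
    using iter_e_props(1)[OF normal_onD[OF A i(1)] Cons.prems(1) w(1)] .
  then show ?case
    using iso_iter[OF iso A i(1) Cons.prems(1) w(1)] Cons.IH i w(2) by (simp add: p)
qed auto

lemma iso_elts:
  assumes "crystal_iso K A B R" "u \<in> elts A"
  shows "R u \<in> elts B"
  using assms unfolding crystal_iso_def bij_betw_def by blast

lemma iso_veps:
  assumes iso: "crystal_iso K A B R" and A: "normal_on K A" and B: "normal_on K B"
    and i: "i \<in> K" and u: "u \<in> elts A"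
  shows "veps B i (R u) = veps A i u" "vphi B i (R u) = vphi A i u"
proof -
  note sA = normal_onD[OF A i] and sB = normal_onD[OF B i]
  have "veps A i u = m \<Longrightarrow> u \<in> elts A \<Longrightarrow> veps B i (R u) = m" for m u
  proof (induction m arbitrary: u)
    case 0
    then have "eop A i u = None" using seminormal_None[OF sA] by simp
    then have "eop B i (R u) = None" using iso i 0 unfolding crystal_iso_def by (metis map_option_is_None)
    then show ?case using seminormal_None[OF sB iso_elts[OF iso 0(2)]] by simp
  next
    case (Suc m)
    then obtain v where v: "eop A i u = Some v"
      using seminormal_None(1)[OF sA Suc.prems(2)] by (cases "eop A i u") auto
    then have v': "eop B i (R u) = Some (R v)"
      using iso i Suc.prems unfolding crystal_iso_def by (metis option.simps(9))
    note D = seminormal_eD[OF sA Suc.prems(2) v]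
    show ?case
      using Suc.IH[of v] D Suc.prems seminormal_eD(3)[OF sB iso_elts[OF iso Suc.prems(2)] v'] by simp
  qed
  then show "veps B i (R u) = veps A i u" using u by blast
  have "vphi A i u = m \<Longrightarrow> u \<in> elts A \<Longrightarrow> vphi B i (R u) = m" for m u
  proof (induction m arbitrary: u)
    case 0
    then have "fop A i u = None" using seminormal_None[OF sA] by simp
    then have "fop B i (R u) = None" using iso i 0 unfolding crystal_iso_def by (metis map_option_is_None)
    then show ?case using seminormal_None[OF sB iso_elts[OF iso 0(2)]] by simp
  next
    case (Suc m)
    then obtain v where v: "fop A i u = Some v"
      using seminormal_None(2)[OF sA Suc.prems(2)] by (cases "fop A i u") auto
    then have v': "fop B i (R u) = Some (R v)"
      using iso i Suc.prems unfolding crystal_iso_def by (metis option.simps(9))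
    note D = seminormal_fD[OF sA Suc.prems(2) v]
    show ?case
      using Suc.IH[of v] D Suc.prems seminormal_fD(3)[OF sB iso_elts[OF iso Suc.prems(2)] v'] by simp
  qed
  then show "vphi B i (R u) = vphi A i u" using u by blast
qed


section \<open>Exchanging the nodes 0 and 1\<close>

text \<open>Applied to the nodes 1, ..., n only, where it turns a sequence of classical operators
  into one in the nodes 0, 2, ..., n.\<close>

definition sw :: "nat \<Rightarrow> nat" where
  "sw i = (if i = 1 then 0 else i)"

definition swapping :: "nat \<Rightarrow> 'a crystal \<Rightarrow> ('a \<Rightarrow> 'a) \<Rightarrow> bool" where
  "swapping n A \<alpha> \<longleftrightarrow> (\<forall>a\<in>elts A. \<alpha> a \<in> elts A \<and> \<alpha> (\<alpha> a) = a \<and>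
     (\<forall>i\<in>{1..n}. eop A (sw i) (\<alpha> a) = map_option \<alpha> (eop A i a) \<and>
        veps A (sw i) (\<alpha> a) = veps A i a \<and> vphi A (sw i) (\<alpha> a) = vphi A i a))"

lemma sw_le: "i \<in> {1..n} \<Longrightarrow> sw i \<in> {0..n}"
  by (auto simp: sw_def)

lemma swapping_run:
  assumes A: "swapping n A \<alpha>" and N: "normal_on {0..n} A"
  shows "u \<in> elts A \<Longrightarrow> fst ` set ps \<subseteq> {1..n} \<Longrightarrow> run A ps u = Some v \<Longrightarrow>
    run A (map (\<lambda>(i, m). (sw i, m)) ps) (\<alpha> u) = Some (\<alpha> v)"
proof (induction ps arbitrary: u)
  case (Cons p ps)
  obtain i m where p: "p = (i, m)" by (cases p)
  then have i: "i \<in> {1..n}" "i \<in> {0..n}" "fst ` set ps \<subseteq> {1..n}" using Cons.prems(2) by auto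
  obtain w where w: "iter_op (eop A i) m u = Some w" "run A ps w = Some v"
    using Cons.prems by (auto simp: p bind_eq_Some_conv)
  have "iter_op (eop A (sw i)) m (\<alpha> u) = Some (\<alpha> w)"
    using Cons.prems(1) w(1)
  proof (induction m arbitrary: u)
    case (Suc m)
    then obtain z where z: "eop A i u = Some z" "iter_op (eop A i) m z = Some w"
      by (auto simp: iter_op_Suc bind_eq_Some_conv)
    have "eop A (sw i) (\<alpha> u) = Some (\<alpha> z)" using A Suc.prems(1) z(1) i(1) by (simp add: swapping_def)
    then show ?case
      using Suc.IH[OF seminormal_eD(1)[OF normal_onD[OF N i(2)] Suc.prems(1) z(1)] z(2)]
      by (simp add: iter_op_Suc)
  qed simp
  moreover have "w \<in> elts A"
    using iter_e_props(1)[OF normal_onD[OF N i(2)] Cons.prems(1) w(1)] .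
  ultimately show ?case using Cons.IH i w(2) by (simp add: p)
qed auto

text \<open>The tensor product rule sees nothing of the factors but their operators and their
  \<epsilon> and \<phi>, so an exchange of nodes acts factor by factor.\<close>

lemma swapping_tensor:
  assumes A: "swapping n A \<alpha>" "normal_on {0..n} A" and B: "swapping n B \<beta>" "normal_on {0..n} B"
  shows "swapping n (tensor A B) (map_prod \<alpha> \<beta>)"
  unfolding swapping_def
proof (intro ballI conjI)
  fix u assume "u \<in> elts (tensor A B)"
  then obtain a b where u: "u = (a, b)" "a \<in> elts A" "b \<in> elts B" by auto
  have ab: "\<alpha> a \<in> elts A" "\<beta> b \<in> elts B" using A B u unfolding swapping_def by auto
  show "map_prod \<alpha> \<beta> u \<in> elts (tensor A B)" "map_prod \<alpha> \<beta> (map_prod \<alpha> \<beta> u) = u"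
    using A B u ab unfolding swapping_def by auto
  fix i assume i: "i \<in> {1..n}"
  then have i': "i \<in> {0..n}" "sw i \<in> {0..n}" using sw_le by auto
  have eA: "eop A (sw i) (\<alpha> a) = map_option \<alpha> (eop A i a)" "veps A (sw i) (\<alpha> a) = veps A i a"
    "vphi A (sw i) (\<alpha> a) = vphi A i a"
    and eB: "eop B (sw i) (\<beta> b) = map_option \<beta> (eop B i b)" "veps B (sw i) (\<beta> b) = veps B i b"
    "vphi B (sw i) (\<beta> b) = vphi B i b"
    using A B u i unfolding swapping_def by auto
  show "eop (tensor A B) (sw i) (map_prod \<alpha> \<beta> u) = map_option (map_prod \<alpha> \<beta>) (eop (tensor A B) i u)"
    using eop_tensor[OF A(2)[THEN normal_onD, OF i'(1)] B(2)[THEN normal_onD, OF i'(1)] u(2,3)]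
      eop_tensor[OF A(2)[THEN normal_onD, OF i'(2)] B(2)[THEN normal_onD, OF i'(2)] ab] eA eB u(1)
    by (simp add: option.map_comp comp_def)
  show "veps (tensor A B) (sw i) (map_prod \<alpha> \<beta> u) = veps (tensor A B) i u"
    "vphi (tensor A B) (sw i) (map_prod \<alpha> \<beta> u) = vphi (tensor A B) i u"
    using veps_tensor[OF A(2) B(2) i'(1) u(2,3)] veps_tensor[OF A(2) B(2) i'(2) ab] eA eB u(1)
    by simp_all
qed


section \<open>The energy function along strings\<close>

lemma energy_classical:
  assumes H: "energy_function n A B R H" and i: "i \<in> {1..n}"
    and N: "normal_on {0..n} (tensor A B)"
  shows "u \<in> elts (tensor A B) \<Longrightarrow> iter_op (eop (tensor A B) i) m u = Some v \<Longrightarrow> H v = H u"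
proof (induction m arbitrary: u)
  case (Suc m)
  then obtain w where w: "eop (tensor A B) i u = Some w" "iter_op (eop (tensor A B) i) m w = Some v"
    by (auto simp: iter_op_Suc bind_eq_Some_conv)
  have i': "i \<in> {0..n}" "i \<noteq> 0" using i by auto
  have "H w = H u"
    using H[unfolded energy_function_def, rule_format, OF i'(1) Suc.prems(1) w(1)] i'(2) by simp
  moreover have "w \<in> elts (tensor A B)"
    using seminormal_eD(1)[OF normal_onD[OF N i'(1)] Suc.prems(1) w(1)] .
  ultimately show ?case using Suc.IH w(2) by simp
qed simp

lemma energy_run:
  assumes H: "energy_function n A B R H" and N: "normal_on {0..n} (tensor A B)"
  shows "u \<in> elts (tensor A B) \<Longrightarrow> fst ` set ps \<subseteq> {1..n} \<Longrightarrow> run (tensor A B) ps u = Some v \<Longrightarrow> H v = H u"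
proof (induction ps arbitrary: u)
  case (Cons p ps)
  obtain i m where p: "p = (i, m)" by (cases p)
  then have i: "i \<in> {1..n}" "i \<in> {0..n}" "fst ` set ps \<subseteq> {1..n}" using Cons.prems(2) by auto
  obtain w where w: "iter_op (eop (tensor A B) i) m u = Some w" "run (tensor A B) ps w = Some v"
    using Cons.prems by (auto simp: p bind_eq_Some_conv)
  have "w \<in> elts (tensor A B)"
    using iter_e_props(1)[OF normal_onD[OF N i(2)] Cons.prems(1) w(1)] .
  then show ?case
    using energy_classical[OF H i(1) N Cons.prems(1) w(1)] Cons.IH i w(2) by simp
qed auto

definition string_energy where
  "string_energy A B R H u = H u + int (veps B 0 (fst (R u)))
     - int (veps B 0 (snd u) - vphi A 0 (fst u))"

text \<open>H grows by 1 for left-left and drops by 1 for right-right. The second term drops by 1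
  exactly if e_0 acts on the left after R, and the subtracted difference drops by 1 exactly if e_0
  acts on the right before R. In all four combinations the changes cancel.\<close>

lemma energy_string:
  assumes H: "energy_function n A B R H" and R: "crystal_iso {0..n} (tensor A B) (tensor B A) R"
    and A: "normal_on {0..n} A" and B: "normal_on {0..n} B"
  shows "u \<in> elts (tensor A B) \<Longrightarrow> iter_op (eop (tensor A B) 0) m u = Some v \<Longrightarrow>
    string_energy A B R H v = string_energy A B R H u"
proof (induction m arbitrary: u)
  case (Suc m)
  have z: "(0::nat) \<in> {0..n}" by simp
  note N = normal_on_tensor[OF A B]
  obtain w where w: "eop (tensor A B) 0 u = Some w" "iter_op (eop (tensor A B) 0) m w = Some v"
    using Suc.prems by (auto simp: iter_op_Suc bind_eq_Some_conv)
  have wE: "w \<in> elts (tensor A B)"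
    using seminormal_eD(1)[OF normal_onD[OF N z] Suc.prems(1) w(1)] .
  have Hw: "H w = (if acts_left A B 0 u \<and> acts_left B A 0 (R u) then H u + 1
      else if \<not> acts_left A B 0 u \<and> \<not> acts_left B A 0 (R u) then H u - 1 else H u)"
    using H[unfolded energy_function_def, rule_format, OF z Suc.prems(1) w(1)] by simp
  have Rw: "eop (tensor B A) 0 (R u) = Some (R w)"
    using R Suc.prems(1) w(1) z unfolding crystal_iso_def by (metis option.simps(9))
  obtain a b where u: "u = (a, b)" "a \<in> elts A" "b \<in> elts B" using Suc.prems(1) by auto
  obtain b' a' where Ru: "R u = (b', a')" "b' \<in> elts B" "a' \<in> elts A"
    using iso_elts[OF R Suc.prems(1)] by auto
  note sA = normal_onD[OF A z] and sB = normal_onD[OF B z]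
  have 1: "int (veps B 0 (snd u) - vphi A 0 (fst u)) - int (veps B 0 (snd w) - vphi A 0 (fst w)) =
      (if acts_left A B 0 u then 0 else 1)"
  proof (cases "acts_left A B 0 u")
    case True
    then obtain c where c: "eop A 0 a = Some c" "w = (c, b)"
      using w(1) eop_tensor[OF sA sB u(2,3)] u(1) by (auto simp: acts_left_def)
    then show ?thesis using True u(1) seminormal_eD(4)[OF sA u(2) c(1)] by (simp add: acts_left_def)
  next
    case False
    then obtain c where c: "eop B 0 b = Some c" "w = (a, c)"
      using w(1) eop_tensor[OF sA sB u(2,3)] u(1) by (auto simp: acts_left_def)
    then show ?thesis using False u(1) seminormal_eD(3)[OF sB u(3) c(1)] by (simp add: acts_left_def)
  qed
  have 2: "int (veps B 0 (fst (R u))) - int (veps B 0 (fst (R w))) =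
      (if acts_left B A 0 (R u) then 1 else 0)"
  proof (cases "acts_left B A 0 (R u)")
    case True
    then obtain c where c: "eop B 0 b' = Some c" "R w = (c, a')"
      using Rw eop_tensor[OF sB sA Ru(2,3)] Ru(1) by (auto simp: acts_left_def)
    then show ?thesis using True Ru(1) seminormal_eD(3)[OF sB Ru(2) c(1)] by (simp add: acts_left_def)
  next
    case False
    then obtain c where c: "eop A 0 a' = Some c" "R w = (b', c)"
      using Rw eop_tensor[OF sB sA Ru(2,3)] Ru(1) by (auto simp: acts_left_def)
    then show ?thesis using False Ru(1) by (simp add: acts_left_def)
  qed
  have "string_energy A B R H w = string_energy A B R H u"
    using Hw 1 2 unfolding string_energy_def by (auto split: if_splits)
  then show ?case using Suc.IH[OF wE w(2)] by simp
qed simp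

text \<open>At the top of the string both correction terms vanish: on the side of \<open>R v\<close>
  the left factor is exhausted, and on the side of \<open>v\<close> the right factor has no
  unshielded arrow.\<close>

lemma energy_full_string:
  assumes H: "energy_function n A B R H" and R: "crystal_iso {0..n} (tensor A B) (tensor B A) R"
    and A: "normal_on {0..n} A" and B: "normal_on {0..n} B"
    and u: "u \<in> elts (tensor A B)" and v: "iter_op (eop (tensor A B) 0) m u = Some v"
    and 0: "veps (tensor A B) 0 v = 0"
  shows "H v = string_energy A B R H u"
proof -
  have z: "(0::nat) \<in> {0..n}" by simp
  note N = normal_on_tensor[OF A B] normal_on_tensor[OF B A]
  have vE: "v \<in> elts (tensor A B)"
    using iter_e_props(1)[OF normal_onD[OF N(1) z] u v] .
  obtain a b where ab: "v = (a, b)" "a \<in> elts A" "b \<in> elts B" using vE by auto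
  obtain b' a' where Rv: "R v = (b', a')" "b' \<in> elts B" "a' \<in> elts A"
    using iso_elts[OF R vE] by auto
  have "veps (tensor B A) 0 (R v) = 0" using iso_veps(1)[OF R N z vE] 0 by simp
  then have "veps B 0 (fst (R v)) = 0"
    using veps_tensor(1)[OF B A z Rv(2,3)] Rv(1) by simp
  moreover have "veps B 0 (snd v) - vphi A 0 (fst v) = 0"
    using veps_tensor(1)[OF A B z ab(2,3)] ab(1) 0 by simp
  ultimately show ?thesis
    using energy_string[OF H R A B u v] by (simp add: string_energy_def)
qed

context vec
begin

section \<open>The node 0 of a Kirillov-Reshetikhin crystal\<close>

lemma KR_involutionD:
  assumes "KR_involution t n r k \<sigma>" "b \<in> elts (KR_classical t n r k)"
  shows "\<sigma> b \<in> elts (KR_classical t n r k)" "\<sigma> (\<sigma> b) = b"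
    "i \<in> {2..n} \<Longrightarrow> eop (KR_classical t n r k) i (\<sigma> b) = map_option \<sigma> (eop (KR_classical t n r k) i b)"
    "i \<in> {2..n} \<Longrightarrow> fop (KR_classical t n r k) i (\<sigma> b) = map_option \<sigma> (fop (KR_classical t n r k) i b)"
  using assms unfolding KR_involution_def by metis+

lemma elts_KR_crystal [simp]: "elts (KR_crystal t n r k \<sigma>) = elts (KR_classical t n r k)"
  by (simp add: KR_crystal_def)

lemma ops_KR_crystal:
  "i \<noteq> 0 \<Longrightarrow> eop (KR_crystal t n r k \<sigma>) i = eop (KR_classical t n r k) i"
  "i \<noteq> 0 \<Longrightarrow> fop (KR_crystal t n r k \<sigma>) i = fop (KR_classical t n r k) i"
  "eop (KR_crystal t n r k \<sigma>) 0 T = map_option \<sigma> (eop (KR_classical t n r k) 1 (\<sigma> T))"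
  "fop (KR_crystal t n r k \<sigma>) 0 T = map_option \<sigma> (fop (KR_classical t n r k) 1 (\<sigma> T))"
  by (auto simp: KR_crystal_def)

lemma seminormal_KR_crystal:
  assumes r: "r \<le> n" and i: "i \<in> {1..n}"
  shows "seminormal (KR_crystal t n r k \<sigma>) i (\<lambda>T. teps i T) (\<lambda>T. tphi i T)"
proof (rule seminormal_restrict[OF seminormal_KR[OF r i]])
  have "i \<noteq> 0" using i by simp
  then show "eop (KR_crystal t n r k \<sigma>) i b = eop (KR_classical t n r k) i b \<and>
      fop (KR_crystal t n r k \<sigma>) i b = fop (KR_classical t n r k) i b" for b
    by (simp add: ops_KR_crystal)
  show "c \<in> elts (KR_crystal t n r k \<sigma>)" if "b \<in> elts (KR_crystal t n r k \<sigma>)"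
    "eop (KR_classical t n r k) i b = Some c \<or> fop (KR_classical t n r k) i b = Some c" for b c
    using seminormal_eD(1)[OF seminormal_KR[OF r i], of b] seminormal_fD(1)[OF seminormal_KR[OF r i], of b]
      that unfolding elts_KR_crystal by blast
qed simp

lemma seminormal_KR_0:
  assumes r: "r \<le> n" and \<sigma>: "KR_involution t n r k \<sigma>"
  shows "seminormal (KR_crystal t n r k \<sigma>) 0 (\<lambda>T. teps 1 (\<sigma> T)) (\<lambda>T. tphi 1 (\<sigma> T))"
proof -
  let ?K = "KR_classical t n r k" and ?X = "KR_crystal t n r k \<sigma>"
  have i: "1 \<in> {1..n}" using rank by simp
  note S = seminormal_KR[OF r i, where k = k]
  note I = KR_involutionD(1,2)[OF \<sigma>]
  show ?thesis
  proof (rule seminormalI)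
    fix T U assume T: "T \<in> elts ?X" and e: "eop ?X 0 T = Some U"
    then obtain W where W: "eop ?K 1 (\<sigma> T) = Some W" "U = \<sigma> W" by (auto simp: ops_KR_crystal)
    note D = seminormal_eD[OF S _ W(1)]
    show "U \<in> elts ?X \<and> fop ?X 0 U = Some T \<and> teps 1 (\<sigma> T) = Suc (teps 1 (\<sigma> U)) \<and>
        tphi 1 (\<sigma> U) = Suc (tphi 1 (\<sigma> T))"
      using D I T W by (simp add: ops_KR_crystal)
  next
    fix T U assume T: "T \<in> elts ?X" and e: "fop ?X 0 T = Some U"
    then obtain W where W: "fop ?K 1 (\<sigma> T) = Some W" "U = \<sigma> W" by (auto simp: ops_KR_crystal)
    note D = seminormal_fD[OF S _ W(1)]
    show "U \<in> elts ?X \<and> eop ?X 0 U = Some T \<and> tphi 1 (\<sigma> T) = Suc (tphi 1 (\<sigma> U)) \<and>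
        teps 1 (\<sigma> U) = Suc (teps 1 (\<sigma> T))"
      using D I T W by (simp add: ops_KR_crystal)
  next
    fix T assume T: "T \<in> elts ?X"
    show "eop ?X 0 T = None \<Longrightarrow> teps 1 (\<sigma> T) = 0" "fop ?X 0 T = None \<Longrightarrow> tphi 1 (\<sigma> T) = 0"
      using seminormal_None[OF S, of "\<sigma> T"] I T by (simp_all add: ops_KR_crystal)
  qed
qed

lemma normal_KR:
  assumes r: "r \<le> n" and \<sigma>: "KR_involution t n r k \<sigma>"
  shows "normal_on {0..n} (KR_crystal t n r k \<sigma>)"
  unfolding normal_on_def
proof
  fix i assume "i \<in> {0..n}"
  then show "seminormal (KR_crystal t n r k \<sigma>) i (veps (KR_crystal t n r k \<sigma>) i) (vphi (KR_crystal t n r k \<sigma>) i)"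
    using seminormal_canonical[OF seminormal_KR_0[OF r \<sigma>]]
      seminormal_canonical[OF seminormal_KR_crystal[OF r], of i] by (cases "i = 0") auto
qed

lemma veps_KR:
  assumes r: "r \<le> n" and \<sigma>: "KR_involution t n r k \<sigma>" and T: "T \<in> elts (KR_classical t n r k)"
  shows "i \<in> {1..n} \<Longrightarrow> veps (KR_crystal t n r k \<sigma>) i T = teps i T"
    "i \<in> {1..n} \<Longrightarrow> vphi (KR_crystal t n r k \<sigma>) i T = tphi i T"
    "veps (KR_crystal t n r k \<sigma>) 0 T = teps 1 (\<sigma> T)"
    "vphi (KR_crystal t n r k \<sigma>) 0 T = tphi 1 (\<sigma> T)"
  using veps_eq[OF seminormal_KR_crystal[OF r]] vphi_eq[OF seminormal_KR_crystal[OF r]]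
    veps_eq[OF seminormal_KR_0[OF r \<sigma>]] vphi_eq[OF seminormal_KR_0[OF r \<sigma>]] T by auto

lemma KR_involution_J:
  assumes r: "r \<le> n" and \<sigma>: "KR_involution t n r k \<sigma>" and T: "T \<in> elts (KR_classical t n r k)"
    and i: "i \<in> {2..n}"
  shows "teps i (\<sigma> T) = teps i T" "tphi i (\<sigma> T) = tphi i T"
proof -
  let ?K = "KR_classical t n r k"
  have i': "i \<in> {1..n}" using i by simp
  note S = seminormal_KR[OF r i', where k = k]
  note I = KR_involutionD[OF \<sigma>]
  have "teps i T = m \<Longrightarrow> T \<in> elts ?K \<Longrightarrow> teps i (\<sigma> T) = m" for m T
  proof (induction m arbitrary: T)
    case 0
    then show ?case using seminormal_None(1)[OF S 0(2)] seminormal_None(1)[OF S I(1)[OF 0(2)]] I(3)[OF 0(2) i] by simp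
  next
    case (Suc m)
    then obtain U where U: "eop ?K i T = Some U"
      using seminormal_None(1)[OF S Suc.prems(2)] by (cases "eop ?K i T") auto
    note D = seminormal_eD[OF S Suc.prems(2) U]
    have "eop ?K i (\<sigma> T) = Some (\<sigma> U)" using U I(3)[OF Suc.prems(2) i] by simp
    from seminormal_eD(3)[OF S I(1)[OF Suc.prems(2)] this] Suc.IH[OF _ D(1)] D(3) Suc.prems(1) show ?case
      by simp
  qed
  then show "teps i (\<sigma> T) = teps i T" using T by blast
  have "tphi i T = m \<Longrightarrow> T \<in> elts ?K \<Longrightarrow> tphi i (\<sigma> T) = m" for m T
  proof (induction m arbitrary: T)
    case 0
    then show ?case
      using seminormal_None(2)[OF S 0(2)] seminormal_None(2)[OF S I(1)[OF 0(2)]] I(4)[OF 0(2) i] by simp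
  next
    case (Suc m)
    then obtain U where U: "fop ?K i T = Some U"
      using seminormal_None(2)[OF S Suc.prems(2)] by (cases "fop ?K i T") auto
    note D = seminormal_fD[OF S Suc.prems(2) U]
    have "fop ?K i (\<sigma> T) = Some (\<sigma> U)" using U I(4)[OF Suc.prems(2) i] by simp
    from seminormal_fD(3)[OF S I(1)[OF Suc.prems(2)] this] Suc.IH[OF _ D(1)] D(3) Suc.prems(1) show ?case
      by simp
  qed
  then show "tphi i (\<sigma> T) = tphi i T" using T by blast
qed

lemma swapping_KR:
  assumes r: "r \<le> n" and \<sigma>: "KR_involution t n r k \<sigma>"
  shows "swapping n (KR_crystal t n r k \<sigma>) \<sigma>"
  unfolding swapping_def
proof (intro ballI conjI)
  fix T assume "T \<in> elts (KR_crystal t n r k \<sigma>)"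
  then have T: "T \<in> elts (KR_classical t n r k)" by simp
  note I = KR_involutionD[OF \<sigma> T]
  show "\<sigma> T \<in> elts (KR_crystal t n r k \<sigma>)" "\<sigma> (\<sigma> T) = T" using I by auto
  fix i assume i: "i \<in> {1..n}"
  show "eop (KR_crystal t n r k \<sigma>) (sw i) (\<sigma> T) = map_option \<sigma> (eop (KR_crystal t n r k \<sigma>) i T)"
    using i I(2) I(3)[of i] by (cases "i = 1") (auto simp: sw_def ops_KR_crystal)
  show "veps (KR_crystal t n r k \<sigma>) (sw i) (\<sigma> T) = veps (KR_crystal t n r k \<sigma>) i T"
    "vphi (KR_crystal t n r k \<sigma>) (sw i) (\<sigma> T) = vphi (KR_crystal t n r k \<sigma>) i T"
    using i I(2) KR_involution_J[OF r \<sigma> T, of i] veps_KR[OF r \<sigma> T] veps_KR[OF r \<sigma> I(1)]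
    by (cases "i = 1"; auto simp: sw_def)+
qed

end

section \<open>Columns and their slots\<close>

type_synonym slotcol = "nat \<times> nat \<times> nat option"

text \<open>With \<open>g = 0\<close> this is the unaltered string \<open>2, ..., v + 1\<close> of
  \<Phi>, with positive \<open>g\<close> the string altered by a + at height \<open>g\<close>. For
  \<open>g = v\<close> the column \<open>1, ..., v\<close> is complete.\<close>

definition str :: "nat \<Rightarrow> nat \<Rightarrow> int list" where
  "str v g = [1..int g] @ [int g + 2..int v + 1]"

definition bar :: "nat option \<Rightarrow> int list" where
  "bar b = (case b of None \<Rightarrow> [] | Some h \<Rightarrow> [- (int h + 1)])"

text \<open>A column of \<^const>\<open>Phi\<close> is given by the height \<open>v\<close> of its string and by the heights \<open>g\<close>, \<open>h\<close>
  of the \<open>+\<close> symbols consumed by the string and by the barred letter, 0 standing for no symbol.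
  Raising by the nodes \<open>1, \<dots>, j\<close> replaces all these values by at least \<open>j\<close>.\<close>

definition asc_col :: "nat \<Rightarrow> slotcol \<Rightarrow> int list" where
  "asc_col j = (\<lambda>(v, g, b). str v (max g (min v j)) @ bar (map_option (max j) b))"

text \<open>After the node n all strings are complete, and a column differs from a highest weight
  column at most in its top letter, which has come down to i.\<close>

definition desc_col :: "nat \<Rightarrow> slotcol \<Rightarrow> int list" where
  "desc_col i = (\<lambda>(v, g, b). [1..int v] @ (if b = None then [] else [int (max (v + 1) i)]))"

text \<open>The order is the one in which \<Phi> uses up the + symbols: columns from left to right
  and each from top to bottom, so that a barred letter precedes the string below it.\<close>

definition slots :: "slotcol list \<Rightarrow> nat list" where
  "slots T = concat (map (\<lambda>(v, g, b). (case b of None \<Rightarrow> [] | Some h \<Rightarrow> [h]) @ (if v = 0 then [] else [g])) T)"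

definition slot_tab :: "slotcol list \<Rightarrow> bool" where
  "slot_tab T \<longleftrightarrow> sorted_wrt (\<ge>) (slots T) \<and> sorted_wrt (\<ge>) (map fst T) \<and>
     (\<forall>(v, g, b)\<in>set T. g \<le> v)"

lemma slots_Cons: "slots ((v, g, b) # T) =
    (case b of None \<Rightarrow> [] | Some h \<Rightarrow> [h]) @ (if v = 0 then [] else [g]) @ slots T"
  and slots_Nil: "slots [] = []"
  by (simp_all add: slots_def)

lemma reading_Cons: "reading (c # T) = reading T @ c"
  and reading_Nil: "reading [] = []"
  by (simp_all add: reading_def)

context vec
begin

lemma raise_neut:
  assumes "\<And>a. a \<in> set w \<Longrightarrow> neut i a"
  shows "raise i s w = w" "st i s w = s"
  using assms by (induction w arbitrary: s) (auto simp: neut_def raise.simps st.simps)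

lemma neut_upto:
  assumes "1 \<le> i" "i < n"
  shows "0 < x \<Longrightarrow> y < int i \<Longrightarrow> a \<in> set [x..y] \<Longrightarrow> neut i a"
    "int i + 1 < x \<Longrightarrow> a \<in> set [x..y] \<Longrightarrow> neut i a"
  using assms by (auto intro!: node_letters(5))

lemma raise_upto:
  assumes "1 \<le> i" "i < n"
  shows "0 < x \<Longrightarrow> y < int i \<Longrightarrow> raise i s [x..y] = [x..y]"
    "0 < x \<Longrightarrow> y < int i \<Longrightarrow> st i s [x..y] = s"
    "int i + 1 < x \<Longrightarrow> raise i s [x..y] = [x..y]"
    "int i + 1 < x \<Longrightarrow> st i s [x..y] = s"
  using raise_neut[of "[x..y]" i s] neut_upto[OF assms] by blast+

lemma upto_at:
  assumes "1 \<le> i" "i < g"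
  shows "[1..int g] = [1..int i - 1] @ [int i, int i + 1] @ [int i + 2..int g]"
proof -
  have "[int i + 1..int g] = (int i + 1) # [int i + 2..int g]"
    using upto_rec1[of "int i + 1" "int g"] assms by (simp add: add.assoc)
  then show ?thesis using upto_split3[of 1 "int i" "int g"] assms by simp
qed

lemma upto_last: "1 \<le> i \<Longrightarrow> [1..int i] = [1..int i - 1] @ [int i]"
  using upto_rec2[of 1 "int i"] by simp

lemma str_step:
  assumes i: "1 \<le> i" "i < n" and g: "g \<le> v" and s: "s > 0 \<Longrightarrow> v > 0 \<Longrightarrow> i \<le> g"
  shows "raise i s (str v (max g (min v (i - 1)))) = str v (max g (min v i))"
    "st i s (str v (max g (min v (i - 1)))) = s + (if v > 0 \<and> g = i then 1 else 0)"
proof -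
  note R = raise_Cons_less[OF i] and N = raise_upto[OF i]
  have "raise i s (str v (max g (min v (i - 1)))) = str v (max g (min v i)) \<and>
    st i s (str v (max g (min v (i - 1)))) = s + (if v > 0 \<and> g = i then 1 else 0)"
  proof -
    consider "v = 0" | "0 < v" "i + 1 \<le> g" | "0 < v" "g = i" | "0 < v" "g < i" "i \<le> v" | "0 < v" "g < i" "v < i"
      by linarith
    then show ?thesis
    proof cases
      case 1
      then show ?thesis using g i by (simp add: str_def)
    next
      case 2
      have "[1..int g] = [1..int i - 1] @ [int i, int i + 1] @ [int i + 2..int g]"
        using 2 i by (intro upto_at) auto
      then have "str v g = [1..int i - 1] @ [int i, int i + 1] @ ([int i + 2..int g] @ [int g + 2..int v + 1])"
        by (simp add: str_def)
      moreover have "raise i s ([int i + 2..int g] @ [int g + 2..int v + 1]) = [int i + 2..int g] @ [int g + 2..int v + 1]"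
        "st i s ([int i + 2..int g] @ [int g + 2..int v + 1]) = s" for s
        using 2 by (simp_all add: raise_append st_append N)
      ultimately have "raise i s (str v g) = str v g" "st i s (str v g) = s"
        using i by (simp_all add: raise_append st_append N R)
      moreover have "max g (min v (i - 1)) = g" "max g (min v i) = g" using 2 by auto
      ultimately show ?thesis using 2 by simp
    next
      case 3
      have "[1..int g] = [1..int i - 1] @ [int i]" using 3 i upto_last by simp
      then have "str v g = [1..int i - 1] @ [int i] @ [int g + 2..int v + 1]" by (simp add: str_def)
      then have "raise i s (str v g) = str v g" "st i s (str v g) = Suc s"
        using 3 i by (simp_all add: raise_append st_append N R)
      moreover have "max g (min v (i - 1)) = g" "max g (min v i) = g" using 3 by auto
      ultimately show ?thesis using 3 by simp
    next
      case 4
      then have s0: "s = 0" using s by (metis gr0I not_le)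
      have m: "max g (min v (i - 1)) = i - 1" "max g (min v i) = i" using 4 i by auto
      have e: "int i - 1 + 2 = int i + 1" "int (i - 1) = int i - 1" "int i + 1 + 1 = int i + 2"
        using i by auto
      have "str v (i - 1) = [1..int i - 1] @ [int i + 1] @ [int i + 2..int v + 1]"
        using 4 upto_rec1[of "int i + 1" "int v + 1", unfolded e] unfolding str_def e
        by (simp only: append.simps)
      moreover have "str v i = [1..int i - 1] @ [int i] @ [int i + 2..int v + 1]"
        using i upto_last by (simp add: str_def)
      ultimately show ?thesis using 4 s0 i unfolding m by (simp add: raise_append st_append N R)
    next
      case 5
      have m: "max g (min v (i - 1)) = v" "max g (min v i) = v" using 5 g by auto
      have "str v v = [1..int v]" by (simp add: str_def)
      then show ?thesis using 5 unfolding m by (simp add: N)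
    qed
  qed
  then show "raise i s (str v (max g (min v (i - 1)))) = str v (max g (min v i))"
    "st i s (str v (max g (min v (i - 1)))) = s + (if v > 0 \<and> g = i then 1 else 0)" by blast+
qed

lemma bar_step:
  assumes i: "1 \<le> i" "i < n" and s: "s > 0 \<Longrightarrow> \<forall>h. b = Some h \<longrightarrow> i \<le> h"
  shows "raise i s (bar (map_option (max (i - 1)) b)) = bar (map_option (max i) b)"
    "st i s (bar (map_option (max (i - 1)) b)) = s + (if b = Some i then 1 else 0)"
proof -
  note R = raise_Cons_less[OF i]
  have "raise i s (bar (map_option (max (i - 1)) b)) = bar (map_option (max i) b) \<and>
    st i s (bar (map_option (max (i - 1)) b)) = s + (if b = Some i then 1 else 0)"
  proof (cases b)
    case (Some h)
    show ?thesis
    proof (cases "h < i")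
      case True
      then have "s = 0" using s Some by (metis gr0I not_le)
      moreover have "max (i - 1) h = i - 1" "max i h = i" using True by auto
      ultimately show ?thesis using Some i True by (simp add: bar_def R of_nat_diff)
    next
      case False
      then have "max (i - 1) h = h" "max i h = h" by auto
      then show ?thesis using Some i False by (simp add: bar_def R)
    qed
  qed (simp add: bar_def)
  then show "raise i s (bar (map_option (max (i - 1)) b)) = bar (map_option (max i) b)"
    "st i s (bar (map_option (max (i - 1)) b)) = s + (if b = Some i then 1 else 0)" by blast+
qed

text \<open>The reading word meets the slots in reverse order, so the state counts later slots that
  equal i. As the slots decrease weakly, a slot below i meets state 0 and is raised, whereas a slot
  behind which i occurs is already at least i. Hence no raising is ever blocked, and \<phi> is the
  number of slots equal to i.\<close>

lemma asc_step:
  assumes i: "1 \<le> i" "i < n"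
  shows "slot_tab T \<Longrightarrow>
    raise i 0 (reading (map (asc_col (i - 1)) T)) = reading (map (asc_col i) T) \<and>
    st i 0 (reading (map (asc_col (i - 1)) T)) = count_list (slots T) i"
proof (induction T)
  case Nil
  show ?case by (simp add: reading_Nil slots_Nil)
next
  case (Cons c T)
  obtain v g b where c: "c = (v, g, b)" by (cases c)
  have T: "slot_tab T" using Cons.prems by (auto simp: slot_tab_def c slots_Cons sorted_wrt_append)
  let ?s = "count_list (slots T) i"
  have g: "g \<le> v" using Cons.prems by (simp add: slot_tab_def c)
  have S: "sorted_wrt (\<ge>) ((case b of None \<Rightarrow> [] | Some h \<Rightarrow> [h]) @ (if v = 0 then [] else [g]) @ slots T)"
    using Cons.prems by (simp add: slot_tab_def c slots_Cons)
  have s: "i \<in> set (slots T)" if "?s > 0" using that by (metis count_notin less_irrefl)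
  have 1: "i \<le> g" if "?s > 0" "v > 0" using S s[OF that(1)] that(2) by (auto simp: sorted_wrt_append)
  have 2: "\<forall>h. b = Some h \<longrightarrow> i \<le> h" if "?s + (if v > 0 \<and> g = i then 1 else 0) > 0"
    using S s that by (auto simp: sorted_wrt_append split: if_splits)
  show ?case
    using Cons.IH[OF T] str_step[OF i g 1] bar_step[OF i 2]
    by (simp add: c reading_Cons slots_Cons asc_col_def raise_append st_append split: option.split)
qed

text \<open>Only a column of height exactly i without extra letter ends in an unpaired i. Lower
  columns stand further to the right and are read earlier, so the letters i + 1 on top of them meet
  state 0 and come down.\<close>

lemma desc_step:
  assumes i: "1 \<le> i" "i < n"
  shows "sorted_wrt (\<ge>) (map fst T) \<Longrightarrow>
    raise i 0 (reading (map (desc_col (i + 1)) T)) = reading (map (desc_col i) T) \<and>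
    st i 0 (reading (map (desc_col (i + 1)) T)) = length (filter (\<lambda>(v, g, b). v = i \<and> b = None) T)"
proof (induction T)
  case Nil
  show ?case by (simp add: reading_Nil)
next
  case (Cons c T)
  obtain v g b where c: "c = (v, g, b)" by (cases c)
  let ?s = "length (filter (\<lambda>(v, g, b). v = i \<and> b = None) T)"
  note R = raise_Cons_less[OF i] and N = raise_upto[OF i]
  have s: "i \<le> v" if pos: "?s > 0"
  proof -
    obtain g' b' where "(i, g', b') \<in> set T" using pos by (auto simp: filter_empty_conv)
    then show ?thesis using Cons.prems by (force simp: c)
  qed
  have "raise i ?s (desc_col (i + 1) c) = desc_col i c \<and>
    st i ?s (desc_col (i + 1) c) = ?s + (if v = i \<and> b = None then 1 else 0)"
  proof -
    consider "v < i" | "v = i" | "i < v" by linarith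
    then show ?thesis
    proof cases
      case 1
      then have "?s = 0" using s by (metis gr0I not_le)
      moreover have "max (v + 1) (i + 1) = i + 1" "max (v + 1) i = i" using 1 by auto
      ultimately show ?thesis using 1 i by (simp add: c desc_col_def raise_append st_append N R)
    next
      case 2
      have "[1..int v] = [1..int i - 1] @ [int i]" using 2 i upto_last by simp
      then show ?thesis using 2 i by (simp add: c desc_col_def raise_append st_append N R)
    next
      case 3
      have e: "[1..int v] = [1..int i - 1] @ [int i, int i + 1] @ [int i + 2..int v]"
        using 3 i by (intro upto_at) auto
      have "max (v + 1) (i + 1) = v + 1" "max (v + 1) i = v + 1" using 3 by auto
      then show ?thesis using 3 i by (simp add: c desc_col_def e raise_append st_append N R)
    qed
  qed
  then show ?case
    using Cons by (simp add: c reading_Cons raise_append st_append)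
qed

lemma desc_final: "reading (map (desc_col 1) T) = reading (hw_tableau (map (\<lambda>(v, g, b). v + (if b = None then 0 else 1)) T))"
proof -
  have "desc_col 1 c = [1..int (case c of (v, g, b) \<Rightarrow> v + (if b = None then 0 else 1))]" for c
    using upto_snoc[of "fst c"] by (cases c) (auto simp: desc_col_def add.commute)
  then have "desc_col 1 = (\<lambda>c. [1..int (case c of (v, g, b) \<Rightarrow> v + (if b = None then 0 else 1))])"
    by (rule ext)
  then show ?thesis unfolding hw_tableau_def map_map comp_def by simp
qed

text \<open>The letter into which the maximal power of e_n turns barred n. In type D it is n - 1, so
  the descent starts one node lower.\<close>

definition top :: nat where
  "top = (if t = D1 then n - 1 else n)"

lemma turn_letters:
  assumes "v < n" "t = D1 \<Longrightarrow> v + 1 < n"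
  shows "raise n 0 ([1..int v] @ [- int n]) = [1..int v] @ [int top]" "st n 0 ([1..int v] @ [- int n]) = 0"
    "raise n 0 [1..int v] = [1..int v]" "st n 0 [1..int v] = 0"
proof -
  have N: "neut n a" if "a \<in> set [1..int v]" for a
    using that assms unfolding neut_n by (cases t) auto
  have NN: "raise n s [1..int v] = [1..int v]" "st n s [1..int v] = s" for s
    using raise_neut[of "[1..int v]" n s] N by blast+
  have "raise n 0 [- int n] = [int top] \<and> st n 0 [- int n] = 0"
    unfolding raise.simps st.simps le_def lp_def up_def eop_V top_def using rank
    by (cases t) (auto simp: numeral_2_eq_2)
  then show "raise n 0 ([1..int v] @ [- int n]) = [1..int v] @ [int top]" "st n 0 ([1..int v] @ [- int n]) = 0"
    "raise n 0 [1..int v] = [1..int v]" "st n 0 [1..int v] = 0"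
    by (simp_all add: raise_append st_append NN)
qed

lemma turn_full:
  assumes "t = A2odd"
  shows "raise n s [1..int n] = [1..int n]" "st n s [1..int n] = Suc s"
proof -
  have N: "neut n a" if "a \<in> set [1..int n - 1]" for a
    using that assms unfolding neut_n by auto
  have NN: "raise n s [1..int n - 1] = [1..int n - 1]" "st n s [1..int n - 1] = s" for s
    using raise_neut[of "[1..int n - 1]" n s] N by blast+
  have e: "[1..int n] = [1..int n - 1] @ [int n]" using rank by (intro upto_last) simp
  have "le n (int n) = 0" "lp n (int n) = 1" using rank assms unfolding le_def lp_def by simp_all
  then show "raise n s [1..int n] = [1..int n]" "st n s [1..int n] = Suc s"
    unfolding e by (simp_all add: raise_append st_append NN raise.simps st.simps)
qed

text \<open>Height \<open>n\<close> can only occur in type C, and only without barred letter.\<close>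

definition turn_ok :: "slotcol list \<Rightarrow> bool" where
  "turn_ok T \<longleftrightarrow> (\<forall>(v, g, b)\<in>set T. (\<forall>h. b = Some h \<longrightarrow> h < n \<and> v < n) \<and> v \<le> n \<and>
     (v = n \<longrightarrow> t = A2odd \<and> g = n) \<and> (t = D1 \<longrightarrow> v + 1 < n))"

text \<open>By now every barred letter is barred n and turns into \<open>top\<close>. A column of
  height n, possible only in type C, stays as it is and adds 1 to the state; by the order of the
  heights all columns to its left are of the same kind and need no raising.\<close>

lemma turn_step:
  shows "slot_tab T \<Longrightarrow> turn_ok T \<Longrightarrow>
    raise n 0 (reading (map (asc_col (n - 1)) T)) = reading (map (desc_col top) T) \<and>
    st n 0 (reading (map (asc_col (n - 1)) T)) = length (filter (\<lambda>c. fst c = n) T)"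
proof (induction T)
  case Nil
  show ?case by (simp add: reading_Nil)
next
  case (Cons c T)
  obtain v g b where c: "c = (v, g, b)" by (cases c)
  have T: "slot_tab T" "turn_ok T"
    using Cons.prems by (auto simp: slot_tab_def turn_ok_def c slots_Cons sorted_wrt_append)
  let ?s = "length (filter (\<lambda>c. fst c = n) T)"
  have g: "g \<le> v" "\<And>h. b = Some h \<Longrightarrow> h < n \<and> v < n" "v \<le> n" "v = n \<Longrightarrow> t = A2odd \<and> g = n"
    "t = D1 \<Longrightarrow> v + 1 < n"
  proof -
    have *: "(\<forall>h. b = Some h \<longrightarrow> h < n \<and> v < n) \<and> v \<le> n \<and>
     (v = n \<longrightarrow> t = A2odd \<and> g = n) \<and> (t = D1 \<longrightarrow> v + 1 < n)"
      using Cons.prems(2) unfolding turn_ok_def c by simp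
    show "g \<le> v" using Cons.prems(1) unfolding slot_tab_def c by simp
    show "\<And>h. b = Some h \<Longrightarrow> h < n \<and> v < n" "v \<le> n" "v = n \<Longrightarrow> t = A2odd \<and> g = n"
      "t = D1 \<Longrightarrow> v + 1 < n" using * by blast+
  qed
  have s: "v = n" if pos: "?s > 0"
  proof -
    obtain g' b' where "(n, g', b') \<in> set T" using pos by (auto simp: filter_empty_conv)
    then have "n \<le> v" using Cons.prems(1) by (force simp: c slot_tab_def)
    then show ?thesis using g(3) by simp
  qed
  have "raise n ?s (asc_col (n - 1) c) = desc_col top c \<and>
    st n ?s (asc_col (n - 1) c) = ?s + (if v = n then 1 else 0)"
  proof (cases "v = n")
    case True
    then have b: "b = None" "g = n" "t = A2odd" using g by (cases b; auto)+
    then show ?thesis using True turn_full[OF b(3)] b(1,2)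
      by (simp add: c asc_col_def desc_col_def str_def bar_def)
  next
    case False
    then have s0: "?s = 0" and v: "v < n" using s g(3) by auto
    have m: "min v (n - 1) = v" "max g v = v" using v g(1) by auto
    show ?thesis
    proof (cases b)
      case None
      then show ?thesis
        using s0 v g(5) turn_letters[OF v] False by (simp add: c asc_col_def desc_col_def str_def bar_def m)
    next
      case (Some h)
      then have h: "int (max (n - Suc 0) h) = int n - 1" using g(2)[OF Some] by auto
      have "max (v + 1) top = top" using v g(5) by (auto simp: top_def)
      then show ?thesis
        using s0 v g(5) turn_letters[OF v] False Some
        by (simp add: c asc_col_def desc_col_def str_def bar_def m h)
    qed
  qed
  then show ?case
    using Cons.IH[OF T] by (simp add: c reading_Cons raise_append st_append)
qed

end

section \<open>One-row tableaux\<close>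

lemma sorted_wrt_unique:
  assumes "sorted_wrt R xs" "sorted_wrt R ys" "\<And>a. count_list xs a = count_list ys a"
    and "\<And>a b. R a b \<Longrightarrow> R b a \<Longrightarrow> a = b"
  shows "xs = ys"
  using assms(1-3)
proof (induction xs arbitrary: ys)
  case Nil
  have "ys = []"
  proof (cases ys)
    case (Cons y ys')
    then show ?thesis using Nil(3)[of y] by simp
  qed
  then show ?case by simp
next
  case (Cons x xs)
  obtain y ys' where ys: "ys = y # ys'"
  proof (cases ys)
    case Nil
    then show ?thesis using Cons.prems(3)[of x] by simp
  qed
  have "x = y"
  proof (rule ccontr)
    assume ne: "x \<noteq> y"
    have "count_list ys' x > 0" using Cons.prems(3)[of x] ne ys by simp
    then have "x \<in> set ys'" by (metis count_notin less_irrefl)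
    then have "R y x" using Cons.prems(2) ys by simp
    moreover have "count_list xs y > 0" using Cons.prems(3)[of y] ne ys by simp
    then have "y \<in> set xs" by (metis count_notin less_irrefl)
    then have "R x y" using Cons.prems(1) by simp
    ultimately show False using assms(4) ne by blast
  qed
  moreover have "xs = ys'"
  proof (rule Cons.IH)
    show "count_list xs a = count_list ys' a" for a
      using Cons.prems(3)[of a] \<open>x = y\<close> ys by (simp split: if_splits)
  qed (use Cons.prems ys in auto)
  ultimately show ?case using ys by simp
qed

definition blk :: "(int \<Rightarrow> nat) \<Rightarrow> int list \<Rightarrow> int list" where
  "blk c as = concat (map (\<lambda>a. replicate (c a) a) as)"

lemma blk_simps: "blk c [] = []" "blk c (a # as) = replicate (c a) a @ blk c as"
  "blk c (as @ bs) = blk c as @ blk c bs"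
  by (simp_all add: blk_def)

lemma blk_cong: "(\<And>a. a \<in> set as \<Longrightarrow> c a = d a) \<Longrightarrow> blk c as = blk d as"
  by (induction as) (auto simp: blk_simps)

lemma set_blk: "a \<in> set (blk c as) \<Longrightarrow> a \<in> set as"
  by (induction as) (auto simp: blk_simps)

lemma count_replicate: "count_list (replicate m a) b = (if a = b then m else 0)"
  by (induction m) auto

lemma count_blk: "distinct as \<Longrightarrow> count_list (blk c as) x = (if x \<in> set as then c x else 0)"
  by (induction as) (auto simp: blk_simps count_replicate)

lemma sorted_blk:
  assumes "sorted_wrt (\<lambda>a b. c a > 0 \<longrightarrow> c b > 0 \<longrightarrow> R a b) as" "\<And>a. a \<in> set as \<Longrightarrow> c a > 1 \<Longrightarrow> R a a"
  shows "sorted_wrt R (blk c as)"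
  using assms
proof (induction as)
  case (Cons a as)
  have "R a x" if "x \<in> set (blk c as)" "c a > 0" for x
  proof -
    have "c x > 0" "x \<in> set as" using that(1) by (induction as) (auto simp: blk_simps)
    then show ?thesis using Cons.prems(1) that(2) by simp
  qed
  moreover have "sorted_wrt R (replicate m a)" if "m > 1 \<longrightarrow> R a a" for m
    using that by (induction m) auto
  ultimately show ?case using Cons by (auto simp: blk_simps sorted_wrt_append)
qed (simp add: blk_simps)

context vec
begin

text \<open>The order of letters in a reading word: a row increases from left to right and is read
  from right to left.\<close>

definition ord :: "int list" where
  "ord = map (\<lambda>i. - int i) [1..<n + 1] @ [0] @ rev (map int [1..<n + 1])"

definition rword :: "(int \<Rightarrow> nat) \<Rightarrow> int list" where
  "rword c = blk c ord"

lemma ord_split: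
  assumes "1 \<le> i" "i < n"
  obtains P M Q where "ord = P @ [- int i, - int i - 1] @ M @ [int i + 1, int i] @ Q"
    "set P \<union> set M \<union> set Q \<subseteq> - {int i, int i + 1, - int i, - int i - 1}"
proof -
  have e: "[1..<n + 1] = [1..<i] @ [i, Suc i] @ [Suc (Suc i)..<n + 1]"
    using assms upt_add_eq_append[of 1 i "n + 1 - i"] by (simp add: upt_conv_Cons)
  have "ord = map (\<lambda>i. - int i) [1..<i] @ [- int i, - int i - 1] @
      (map (\<lambda>i. - int i) [Suc (Suc i)..<n + 1] @ [0] @ rev (map int [Suc (Suc i)..<n + 1])) @
      [int i + 1, int i] @ rev (map int [1..<i])"
    unfolding ord_def e by simp
  then show ?thesis by (rule that) (use assms in auto)
qed

lemma ord_split_n: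
  obtains P M Q where "ord = P @ [- int n] @ [0] @ [int n] @ Q"
    "set P \<subseteq> {1 - int n..- 1}" "set Q \<subseteq> {1..int n - 1}"
    "P = map (\<lambda>i. - int i) [1..<n]" "Q = rev (map int [1..<n])"
proof -
  have "[1..<n + 1] = [1..<n] @ [n]" using rank by simp
  then have "ord = map (\<lambda>i. - int i) [1..<n] @ [- int n] @ [0] @ [int n] @ rev (map int [1..<n])"
    unfolding ord_def by simp
  then show ?thesis by (rule that) auto
qed

lemma set_ord: "set ord = {- int n..int n}"
proof -
  have "a \<in> set ord" if "\<bar>a\<bar> \<le> int n" for a
  proof -
    consider "a = 0" | "a > 0" | "a < 0" by linarith
    then show ?thesis
    proof cases
      case 2
      then have "a = int (nat a)" "nat a \<in> set [1..<n + 1]" using that by auto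
      then show ?thesis unfolding ord_def set_append set_rev set_map by blast
    next
      case 3
      then have "a = - int (nat (- a))" "nat (- a) \<in> set [1..<n + 1]" using that by auto
      then show ?thesis unfolding ord_def set_append set_rev set_map by blast
    qed (simp add: ord_def)
  qed
  moreover have "set ord \<subseteq> {- int n..int n}" unfolding ord_def by auto
  ultimately show ?thesis by auto
qed

lemma distinct_ord: "distinct ord"
  unfolding ord_def by (auto simp: distinct_map inj_on_def)

lemma count_rword: "\<bar>a\<bar> \<le> int n \<Longrightarrow> count_list (rword c) a = c a"
  using count_blk[OF distinct_ord, of c a] set_ord by (auto simp: rword_def abs_le_iff)

lemma raise_minus:
  assumes i: "1 \<le> i" "i < n" and a: "a = int i + 1 \<or> a = - int i"
  shows "raise i s (replicate b a) = replicate (min s b) a @ replicate (b - s) (a - 1)"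
    "st i s (replicate b a) = s - b"
proof -
  have "raise i s (replicate b a) = replicate (min s b) a @ replicate (b - s) (a - 1) \<and>
    st i s (replicate b a) = s - b"
  proof (induction b arbitrary: s)
    case (Suc b)
    have na: "\<not> (a = int i \<or> a = - int i - 1)" using a i by auto
    show ?case
    proof (cases s)
      case 0
      then show ?thesis using Suc[of 0] a na by (simp add: raise_Cons_less[OF i])
    next
      case (Suc s')
      then show ?thesis using Suc.IH[of s'] a na by (simp add: raise_Cons_less[OF i])
    qed
  qed simp
  then show "raise i s (replicate b a) = replicate (min s b) a @ replicate (b - s) (a - 1)"
    "st i s (replicate b a) = s - b" by blast+
qed

lemma raise_plus:
  assumes i: "1 \<le> i" "i < n" and a: "a = int i \<or> a = - int i - 1"
  shows "raise i s (replicate b a) = replicate b a" "st i s (replicate b a) = s + b"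
proof -
  have "raise i s (replicate b a) = replicate b a \<and> st i s (replicate b a) = s + b"
    using a i(1) by (induction b arbitrary: s) (auto simp: raise_Cons_less[OF i])
  then show "raise i s (replicate b a) = replicate b a" "st i s (replicate b a) = s + b" by blast+
qed

text \<open>\<open>s\<close> is the shield in front of the row, and \<open>s2\<close> the one met by
  the letters i + 1: what the letters barred i leave of \<open>s\<close>, together with the letters
  barred i + 1.\<close>

definition rowE :: "nat \<Rightarrow> nat \<Rightarrow> (int \<Rightarrow> nat) \<Rightarrow> int \<Rightarrow> nat" where
  "rowE i s c = (let s2 = (s - c (- int i)) + c (- int i - 1) in
     c (- int i := min s (c (- int i)), - int i - 1 := c (- int i - 1) + (c (- int i) - s),
        int i + 1 := min s2 (c (int i + 1)), int i := c (int i) + (c (int i + 1) - s2)))"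

lemma raise_row:
  assumes i: "1 \<le> i" "i < n"
  shows "raise i s (rword c) = rword (rowE i s c)"
    "st i s (rword c) = ((s - c (- int i)) + c (- int i - 1) - c (int i + 1)) + c (int i)"
    "weps i (rword c) = c (- int i) + (c (int i + 1) - c (- int i - 1))"
proof -
  obtain P M Q where o: "ord = P @ [- int i, - int i - 1] @ M @ [int i + 1, int i] @ Q"
    "set P \<union> set M \<union> set Q \<subseteq> - {int i, int i + 1, - int i, - int i - 1}"
    using ord_split[OF i] by blast
  have N: "raise i s (blk c as) = blk c as" "st i s (blk c as) = s" "weps i (blk c as) = 0" "wphi i (blk c as) = 0"
    if "set as \<subseteq> - {int i, int i + 1, - int i, - int i - 1}" for as s
  proof -
    have "neut i a" if "a \<in> set (blk c as)" for a
      using set_blk[OF that] \<open>set as \<subseteq> _\<close> by (intro node_letters(5)[OF i]) auto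
    then have *: "raise i s (blk c as) = blk c as \<and> st i s (blk c as) = s" for s
      using raise_neut[of "blk c as" i s] by blast
    then show "raise i s (blk c as) = blk c as" "st i s (blk c as) = s" by blast+
    have "wphi i (blk c as) = 0" using * [of 0] st_eq[of i 0 "blk c as"] by simp
    moreover have "weps i (blk c as) = 0"
      using *[of "weps i (blk c as)"] st_eq[of i "weps i (blk c as)" "blk c as"] \<open>wphi i (blk c as) = 0\<close> by simp
    ultimately show "weps i (blk c as) = 0" "wphi i (blk c as) = 0" by blast+
  qed
  have PN: "set P \<subseteq> - {int i, int i + 1, - int i, - int i - 1}"
    "set M \<subseteq> - {int i, int i + 1, - int i, - int i - 1}" "set Q \<subseteq> - {int i, int i + 1, - int i, - int i - 1}"
    using o(2) by auto
  have ne: "- int i \<noteq> int i" "- int i \<noteq> int i + 1" "int i \<noteq> - int i - 1" "int i + 1 \<noteq> - int i - 1"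
    using i by auto
  have ag: "blk (rowE i s c) as = blk c as" if "set as \<subseteq> - {int i, int i + 1, - int i, - int i - 1}" for as
    using that by (intro blk_cong) (auto simp: rowE_def Let_def)
  have mm: "- int i - 1 = (- int i) - 1" "int i = (int i + 1) - 1" by simp_all
  define s2 where "s2 = (s - c (- int i)) + c (- int i - 1)"
  have r: "rowE i s c (- int i) = min s (c (- int i))" "rowE i s c (- int i - 1) = (c (- int i) - s) + c (- int i - 1)"
    "rowE i s c (int i + 1) = min s2 (c (int i + 1))" "rowE i s c (int i) = (c (int i + 1) - s2) + c (int i)"
    using ne unfolding rowE_def s2_def Let_def by (simp_all add: fun_upd_apply)
  show "raise i s (rword c) = rword (rowE i s c)"
    unfolding rword_def o(1) blk_simps raise_append st_append N(1,2)[OF PN(1)] N(1,2)[OF PN(2)] N(1,2)[OF PN(3)]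
      ag[OF PN(1)] ag[OF PN(2)] ag[OF PN(3)] r
    by (simp add: raise_minus[OF i] raise_plus[OF i] s2_def replicate_add)
  show "st i s (rword c) = ((s - c (- int i)) + c (- int i - 1) - c (int i + 1)) + c (int i)"
    unfolding rword_def o(1) blk_simps raise_append st_append N(1,2)[OF PN(1)] N(1,2)[OF PN(2)] N(1,2)[OF PN(3)]
    by (simp add: raise_minus[OF i] raise_plus[OF i])
  have W: "weps i (replicate b a) = b \<and> wphi i (replicate b a) = 0" if "a = int i + 1 \<or> a = - int i" for a b
    using that i by (induction b) (auto simp: le_def lp_def)
  have W': "weps i (replicate b a) = 0 \<and> wphi i (replicate b a) = b" if "a = int i \<or> a = - int i - 1" for a b
    using that i by (induction b) (auto simp: le_def lp_def)
  show "weps i (rword c) = c (- int i) + (c (int i + 1) - c (- int i - 1))"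
    unfolding rword_def o(1) blk_simps weps_append wphi_append N(3,4)[OF PN(1)] N(3,4)[OF PN(2)] N(3,4)[OF PN(3)]
    by (simp add: W W')
qed

text \<open>In type D the node n would also turn barred n - 1 into n, and a letter n would act as a
  shield for what follows; the assumptions leave barred n as the only letter that moves.\<close>

lemma raise_row_n:
  assumes c0: "c 0 = 0" and D: "t = D1 \<Longrightarrow> c (int n) = 0 \<and> c (1 - int n) = 0"
  shows "raise n 0 (rword c) = rword (c (- int n := 0, int top := c (- int n) + c (int top)))"
    "st n 0 (rword c) = c (int top) * (if t = B1 then 2 else 1)"
proof -
  obtain P M Q where o: "ord = P @ [- int n] @ [0] @ [int n] @ Q" "set P \<subseteq> {1 - int n..- 1}" "set Q \<subseteq> {1..int n - 1}"
    "P = map (\<lambda>i. - int i) [1..<n]" "Q = rev (map int [1..<n])"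
    using ord_split_n by blast
  let ?c = "c (- int n := 0, int top := c (- int n) + c (int top))"
  have PP: "blk ?c P = blk c P"
    by (rule blk_cong) (use o(2) in \<open>auto simp: top_def\<close>)
  have nP: "neut n a" if "a \<in> set (blk c P)" for a
  proof (cases "t = D1")
    case True
    have "a \<noteq> 1 - int n"
    proof
      assume "a = 1 - int n"
      moreover have "c a > 0" using that by (induction P) (auto simp: blk_simps)
      ultimately show False using D True by simp
    qed
    then show ?thesis using set_blk[OF that] o(2) True rank unfolding neut_n by auto
  next
    case False
    then show ?thesis using set_blk[OF that] o(2) rank unfolding neut_n by (cases t) auto
  qed
  have NP: "raise n s (blk c P) = blk c P" "st n s (blk c P) = s" for s
    using raise_neut[of "blk c P"] nP by blast+
  have rm: "raise n 0 (replicate m (- int n)) = replicate m (int top) \<and> st n 0 (replicate m (- int n)) = 0" for m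
  proof (induction m)
    case (Suc m)
    have "up n (le n (- int n)) (- int n) = int top" "lp n (- int n) = 0" "le n (- int n) > 0"
      unfolding le_def lp_def up_def eop_V top_def using rank by (cases t; auto simp: numeral_2_eq_2)+
    then show ?case using Suc by (simp add: raise.simps st.simps)
  qed simp
  have "raise n 0 (rword c) = rword ?c \<and> st n 0 (rword c) = c (int top) * (if t = B1 then 2 else 1)"
  proof (cases "t = D1")
    case False
    have top: "top = n" using False by (simp add: top_def)
    have QQ: "blk ?c Q = blk c Q" by (rule blk_cong) (use o(3) top in auto)
    have nQ: "neut n a" if "a \<in> set (blk c Q)" for a
      using set_blk[OF that] o(3) rank False unfolding neut_n by (cases t) auto
    have NQ: "raise n s (blk c Q) = blk c Q" "st n s (blk c Q) = s" for s
      using raise_neut[of "blk c Q"] nQ by blast+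
    have rp: "raise n s (replicate m (int n)) = replicate m (int n) \<and>
        st n s (replicate m (int n)) = s + m * (if t = B1 then 2 else 1)" for m s
    proof (induction m arbitrary: s)
      case (Suc m)
      have "le n (int n) = 0" "lp n (int n) = (if t = B1 then 2 else 1)"
        using rank unfolding le_def lp_def by (cases t; auto)+
      then show ?case using Suc by (simp add: raise.simps st.simps)
    qed simp
    show ?thesis
      unfolding rword_def o(1) blk_simps raise_append st_append NP NQ PP QQ top
      using rm rp rank by (simp add: top c0 replicate_add PP[unfolded top] QQ[unfolded top])
  next
    case True
    have top: "top = n - 1" "int top = int n - 1" unfolding top_def using True rank by auto
    obtain Q' where Q: "Q = (int n - 1) # Q'" "set Q' \<subseteq> {1..int n - 2}"
    proof -
      have "[1..<n] = [1..<n - 1] @ [n - 1]"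
        using rank upt_Suc_append[of 1 "n - 1"] by simp
      then have "Q = (int n - 1) # rev (map int [1..<n - 1])" using o(5) rank by simp
      then show ?thesis by (rule that) auto
    qed
    have QQ: "blk ?c Q' = blk c Q'" by (rule blk_cong) (use Q(2) top in auto)
    have nQ: "neut n a" if "a \<in> set (blk c Q')" for a
      using set_blk[OF that] Q(2) rank True unfolding neut_n by auto
    have NQ: "raise n s (blk c Q') = blk c Q'" "st n s (blk c Q') = s" for s
      using raise_neut[of "blk c Q'"] nQ by blast+
    have rp: "raise n s (replicate m (int n - 1)) = replicate m (int n - 1) \<and>
        st n s (replicate m (int n - 1)) = s + m" for m s
    proof (induction m arbitrary: s)
      case (Suc m)
      have "le n (int n - 1) = 0" "lp n (int n - 1) = 1"
        using rank True unfolding le_def lp_def by auto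
      then show ?case using Suc by (simp add: raise.simps st.simps)
    qed simp
    have nb: "(if t = B1 then 2 else 1) = (1 :: nat)" using True by simp
    show ?thesis
      unfolding rword_def o(1) Q(1) blk_simps raise_append st_append NP NQ PP QQ top(2) nb
      using rm rp rank D[OF True] by (simp add: top(2) c0 replicate_add PP[unfolded top(2)] QQ[unfolded top(2)])
  qed
  then show "raise n 0 (rword c) = rword ?c" "st n 0 (rword c) = c (int top) * (if t = B1 then 2 else 1)"
    by blast+
qed

text \<open>The letters \<open>n\<close> and barred \<open>n\<close> are incomparable in type D, and 0 occurs at most once.\<close>

definition rr :: "int \<Rightarrow> int" where
  "rr a = (if t = D1 \<and> a = - int n then int n else if a > 0 then a
     else if a = 0 then int n + 1 else 2 * int n + 2 + a)"

definition rowrel :: "int \<Rightarrow> int \<Rightarrow> bool" where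
  "rowrel a b \<longleftrightarrow> rr a > rr b \<or> (a = b \<and> a \<noteq> 0)"

lemma rowrel_trans: "rowrel a b \<Longrightarrow> rowrel b c \<Longrightarrow> rowrel a c"
  unfolding rowrel_def by auto

lemma rowrel_antisym: "rowrel a b \<Longrightarrow> rowrel b a \<Longrightarrow> a = b"
  unfolding rowrel_def by auto

lemma rowrel_fop:
  assumes "a \<in> elts V" "b \<in> elts V" "fop V i b = Some b'" "rowrel a b"
  shows "rowrel a b' \<or> lp i a > le i b" and "rowrel b' b"
proof -
  have a: "- int n \<le> a" "a \<le> int n" "a = 0 \<Longrightarrow> t = B1" using assms(1) by (auto simp: elts_V)
  have "(rowrel a b' \<or> lp i a > le i b) \<and> rowrel b' b"
  proof (cases "1 \<le> i \<and> i < n")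
    case True
    then have b: "b = int i \<or> b = - int i - 1" "b' = b + 1" using assms(3) by (auto simp: fop_V split: if_splits)
    have L: "le i b = 0" "lp i a = (if a = int i \<or> a = - int i - 1 then 1 else 0)"
      using True b by (auto simp: le_def lp_def)
    consider "b = int i" "b' = int i + 1" | "b = - int i - 1" "b' = - int i" using b by auto
    then show ?thesis
    proof cases
      case 1
      then show ?thesis
        using assms(4) a True unfolding L rowrel_def rr_def by (cases "t = D1"; simp split: if_splits; auto?)
    next
      case 2
      then show ?thesis
        using assms(4) a True unfolding L rowrel_def rr_def by (cases "t = D1"; simp split: if_splits; auto?)
    qed
  next
    case False
    then have i: "i = n" using assms(3) by (auto simp: fop_V split: if_splits)
    then have b: "letter_fn t n b = Some b'" using assms(3) by (simp add: fop_V)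
    show ?thesis
    proof (cases t)
      case D1
      then have "b = int n - 1 \<and> b' = - int n \<or> b = int n \<and> b' = 1 - int n" using b by (auto split: if_splits)
      then show ?thesis
        using assms(4) rankD[OF D1] a D1 unfolding i le_def lp_def rowrel_def rr_def
        by (elim disjE; simp split: if_splits; auto?)
    next
      case B1
      then have "b = int n \<and> b' = 0 \<or> b = 0 \<and> b' = - int n" using b by (auto split: if_splits)
      then show ?thesis
        using assms(4) rank a B1 unfolding i le_def lp_def rowrel_def rr_def
        by (elim disjE; simp split: if_splits; auto?)
    next
      case A2odd
      then have "b = int n \<and> b' = - int n" using b by (auto split: if_splits)
      then show ?thesis
        using assms(4) rank a A2odd unfolding i le_def lp_def rowrel_def rr_def
        by (simp split: if_splits; auto?)
    qed
  qed
  then show "rowrel a b' \<or> lp i a > le i b" "rowrel b' b" by blast+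
qed

text \<open>If lowering a letter were to break the order with the letter in front of it, then by
  \<open>rowrel_fop\<close> that front letter would have an unshielded arrow, and f_i would act
  there instead.\<close>

lemma rowrel_wf:
  "sorted_wrt rowrel w \<Longrightarrow> set w \<subseteq> elts V \<Longrightarrow> wf i w = Some v \<Longrightarrow> sorted_wrt rowrel v"
proof (induction w arbitrary: v)
  case (Cons a w)
  have a: "a \<in> elts V" "set w \<subseteq> elts V" "\<forall>x\<in>set w. rowrel a x" "sorted_wrt rowrel w" using Cons.prems by auto
  show ?case
  proof (cases "lp i a > weps i w")
    case True
    then obtain a' where a': "fop V i a = Some a'" "v = a' # w" using Cons.prems(3) by auto
    have "rowrel a' x" if "x \<in> set w" for x
    proof (cases "a = 0")
      case False
      then show ?thesis using rowrel_fop(2)[OF a(1) a(1) a'(1)] rowrel_trans a(3) that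
        by (metis rowrel_def)
    next
      case True
      have "rr a' > rr a" using a'(1) True rank unfolding fop_V rr_def
        by (cases t) (auto split: if_splits)
      then show ?thesis using a(3) that unfolding rowrel_def by (metis less_trans)
    qed
    then show ?thesis using a(4) a'(2) by simp
  next
    case False
    then obtain w' where w': "wf i w = Some w'" "v = a # w'" using Cons.prems(3) by auto
    have s: "sorted_wrt rowrel w'" by (rule Cons.IH[OF a(4,2) w'(1)])
    have "\<forall>x\<in>set w'. rowrel a x"
    proof (cases w)
      case Nil
      then show ?thesis using w' by simp
    next
      case (Cons b w0)
      have b: "b \<in> elts V" "rowrel a b" using a Cons by auto
      show ?thesis
      proof (cases "lp i b > weps i w0")
        case True
        then obtain b' where b': "fop V i b = Some b'" "w' = b' # w0" using w'(1) Cons by auto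
        have "weps i w = le i b" using True Cons by simp
        then have "rowrel a b'" using rowrel_fop(1)[OF a(1) b(1) b'(1) b(2)] False by auto
        then show ?thesis using a(3) Cons b'(2) by simp
      next
        case False
        then obtain w1 where "w' = b # w1" using w'(1) Cons by auto
        then show ?thesis using s b(2) rowrel_trans by auto
      qed
    qed
    then show ?thesis using s w'(2) by simp
  qed
qed simp

definition row_ok :: "(int \<Rightarrow> nat) \<Rightarrow> bool" where
  "row_ok c \<longleftrightarrow> c 0 \<le> 1 \<and> (t \<noteq> B1 \<longrightarrow> c 0 = 0) \<and> (t = D1 \<longrightarrow> c (int n) = 0 \<or> c (- int n) = 0)"

lemma sorted_ord:
  assumes "row_ok c"
  shows "sorted_wrt rowrel (rword c)"
  unfolding rword_def
proof (rule sorted_blk)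
  define ri :: "int \<Rightarrow> int" where "ri a = (if a > 0 then a else if a = 0 then int n + 1 else 2 * int n + 2 + a)" for a
  have R: "rowrel a b" if "c a > 0" "c b > 0" "ri a > ri b" "b \<in> set ord" for a b
  proof (cases "t = D1 \<and> a = - int n")
    case True
    then have "b \<noteq> int n" "b \<noteq> 0" "- int n \<le> b" "b \<le> int n"
      using that assms unfolding row_ok_def set_ord by auto
    then show ?thesis using True that rank unfolding rowrel_def rr_def ri_def by (auto split: if_splits)
  next
    case False
    then show ?thesis using that unfolding rowrel_def rr_def ri_def by (auto split: if_splits)
  qed
  have s: "sorted_wrt (<) [1..<n + 1]" by (rule sorted_wrt_upt)
  have 1: "sorted_wrt (\<lambda>a b. ri a > ri b) (map (\<lambda>i. - int i) [1..<n + 1])"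
    unfolding sorted_wrt_map by (rule sorted_wrt_mono_rel[OF _ s]) (auto simp: ri_def)
  have 2: "sorted_wrt (\<lambda>a b. ri a > ri b) (rev (map int [1..<n + 1]))"
    unfolding sorted_wrt_rev sorted_wrt_map by (rule sorted_wrt_mono_rel[OF _ s]) (auto simp: ri_def)
  have "sorted_wrt (\<lambda>a b. ri a > ri b) ord"
    unfolding ord_def sorted_wrt_append using 1 2 by (auto simp: ri_def)
  then show "sorted_wrt (\<lambda>a b. c a > 0 \<longrightarrow> c b > 0 \<longrightarrow> rowrel a b) ord"
    by (rule sorted_wrt_mono_rel[rotated]) (use R in blast)
  show "rowrel a a" if "c a > 1" for a
    using that assms unfolding rowrel_def row_ok_def by auto
qed

lemma sorted_rword:
  assumes "sorted_wrt rowrel w" "set w \<subseteq> elts V"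
  shows "w = rword (\<lambda>a. count_list w a)" "row_ok (\<lambda>a. count_list w a)"
proof -
  have c2: "count_list w a \<le> 1 \<or> rowrel a a" for a
    using assms(1)
  proof (induction w)
    case (Cons b w)
    show ?case
    proof (cases "a = b")
      case True
      then show ?thesis using Cons.prems by (cases "a \<in> set w") auto
    qed (use Cons in auto)
  qed simp
  have cz: "count_list w a > 0 \<Longrightarrow> a \<in> elts V" for a
    using assms(2) by (metis count_notin less_irrefl subsetD)
  have nn: "rowrel a b \<or> rowrel b a" if "a \<in> set w" "b \<in> set w" "a \<noteq> b" for a b
    using assms(1) that by (induction w) auto
  show ok: "row_ok (\<lambda>a. count_list w a)"
    unfolding row_ok_def
  proof (intro conjI impI)
    show "count_list w 0 \<le> 1" using c2[of 0] by (simp add: rowrel_def)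
    show "t \<noteq> B1 \<Longrightarrow> count_list w 0 = 0" using cz[of 0] by (auto simp: elts_V)
    assume t: "t = D1"
    show "count_list w (int n) = 0 \<or> count_list w (- int n) = 0"
    proof (rule ccontr)
      assume "\<not> ?thesis"
      then have "int n \<in> set w" "- int n \<in> set w" by (metis count_notin)+
      then show False using nn[of "int n" "- int n"] rank t
        unfolding rowrel_def rr_def by auto
    qed
  qed
  show "w = rword (\<lambda>a. count_list w a)"
  proof (rule sorted_wrt_unique[OF assms(1) sorted_ord[OF ok] _ rowrel_antisym])
    fix a
    show "count_list w a = count_list (rword (\<lambda>a. count_list w a)) a"
    proof (cases "\<bar>a\<bar> \<le> int n")
      case True
      then show ?thesis by (simp add: count_rword)
    next
      case False
      then have "a \<notin> set ord" "count_list w a = 0" using cz[of a] by (auto simp: set_ord elts_V)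
      then show ?thesis using count_blk[OF distinct_ord, of "\<lambda>a. count_list w a" a] by (simp add: rword_def)
    qed
  qed
qed

lemma KR_shapes_1: "hs \<in> KR_shapes 1 l \<longleftrightarrow> hs = replicate l 1"
proof
  assume "hs \<in> KR_shapes 1 l"
  then obtain gs where gs: "hs = filter (\<lambda>h. 0 < h) gs" "length gs = l" "\<forall>h\<in>set gs. h \<le> 1 \<and> even (1 - h)"
    unfolding KR_shapes_def by blast
  have "h = 1" if "h \<in> set gs" for h
    using gs(3) that by (cases h) (auto dest: bspec[of _ _ h])
  then have "gs = replicate l 1" using gs(2) by (metis replicate_length_same)
  then show "hs = replicate l 1" using gs(1) by simp
next
  assume "hs = replicate l 1"
  then show "hs \<in> KR_shapes 1 l"
    unfolding KR_shapes_def by (intro CollectI exI[of _ hs]) (auto simp: sorted_wrt_iff_nth_less)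
qed

definition row :: "int list \<Rightarrow> tableau" where
  "row w = map (\<lambda>a. [a]) (rev w)"

lemma reading_row [simp]: "reading (row w) = w"
  by (induction w) (auto simp: reading_def row_def)

lemma tshape_row [simp]: "tshape (row w) = replicate (length w) 1"
  by (induction w) (auto simp: row_def replicate_append_same)

lemma row_reading: "tshape T = replicate l 1 \<Longrightarrow> row (reading T) = T"
  by (rule reading_inj) (auto simp: length_reading sum_list_replicate)

lemma hw_row: "hw_tableau (replicate l 1) = row (replicate l 1)"
  by (simp add: hw_tableau_def row_def)

text \<open>The row condition holds for \<open>1^l\<close> and is preserved by f_i, so reading a
  sequence of raisings backwards transports it to every element. A word satisfying it is determined
  by its letter counts.\<close>

lemma KR_row:
  assumes "T \<in> elts (KR_classical t n 1 l)"
  shows "T = row (rword (\<lambda>a. count_list (reading T) a))" "row_ok (\<lambda>a. count_list (reading T) a)"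
    "length (reading T) = l"
proof -
  have 1: "(1::nat) \<le> n" using rank by simp
  have T: "tshape T = replicate l 1" "KN (replicate l 1) T"
    using assms KR_elts[OF 1, of T l] KR_shapes_1 by auto
  have "red\<^sup>*\<^sup>* (reading T) (replicate l 1)" using T(2) unfolding KN_def hw_row reading_row by blast
  then have s: "sorted_wrt rowrel (reading T)"
  proof (induction rule: converse_rtranclp_induct)
    case base
    show ?case by (induction l) (auto simp: rowrel_def)
  next
    case (step u v)
    then obtain i where i: "i \<in> {1..n}" "we i u = Some v" "set u \<subseteq> elts V" unfolding red_def by blast
    from we_in[OF i(1,3,2)] rowrel_wf[OF step.IH] show ?case by blast
  qed
  have "set (reading T) \<subseteq> elts V" using T(2) by (simp add: KN_def tab_def)
  note S = sorted_rword[OF s this]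
  show "row_ok (\<lambda>a. count_list (reading T) a)" by (rule S(2))
  show "T = row (rword (\<lambda>a. count_list (reading T) a))" using S(1) row_reading[OF T(1)] by simp
  show "length (reading T) = l" using T(1) by (simp add: length_reading sum_list_replicate)
qed

lemma letter_count_row: "letter_count (row (rword c)) a = (if \<bar>a\<bar> \<le> int n then int (c a) else 0)"
proof -
  have "letter_count T a = int (count_list (reading T) a)" for T
  proof -
    have "count_list (concat (rev T)) a = count_list (concat T) a"
      by (induction T) auto
    then show ?thesis by (simp add: letter_count_def reading_def)
  qed
  moreover have "a \<notin> set ord" if "\<not> \<bar>a\<bar> \<le> int n" using that by (auto simp: set_ord)
  ultimately show ?thesis
    using count_rword[of a c] count_blk[OF distinct_ord, of c a] by (auto simp: rword_def)
qed

end

section \<open>Plus-minus diagrams with prescribed numbers of columns\<close>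

text \<open>The numbers of columns of outer height \<open>i\<close> with symbols none, \<open>+\<close>, \<open>-\<close>, both; \<open>Nn 0\<close> counts
  empty columns. A column is a triple of inner, middle and outer height.\<close>

record pmcount =
  Nn :: "nat \<Rightarrow> nat"
  Pp :: "nat \<Rightarrow> nat"
  Mm :: "nat \<Rightarrow> nat"
  Bb :: "nat \<Rightarrow> nat"

text \<open>Within one outer height the four kinds are listed so that the inner and middle heights
  decrease weakly as well.\<close>

definition pblk :: "pmcount \<Rightarrow> nat \<Rightarrow> (nat \<times> nat \<times> nat) list" where
  "pblk D i = replicate (Nn D i) (i, i, i) @ replicate (Pp D i) (i - 1, i, i) @
     replicate (Mm D i) (i - 1, i - 1, i) @ replicate (Bb D i) (i - 2, i - 1, i)"

definition pcols :: "pmcount \<Rightarrow> nat \<Rightarrow> (nat \<times> nat \<times> nat) list" where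
  "pcols D r = concat (map (pblk D) (rev [0..<r + 1]))"

definition pm_valid :: "nat \<Rightarrow> pmcount \<Rightarrow> bool" where
  "pm_valid r D \<longleftrightarrow> (\<forall>i. odd (r + i) \<or> r < i \<longrightarrow> Nn D i = 0 \<and> Pp D i = 0 \<and> Mm D i = 0 \<and> Bb D i = 0) \<and>
     Pp D 0 = 0 \<and> Mm D 0 = 0 \<and> Bb D 0 = 0 \<and> Bb D 1 = 0"

definition pm_of :: "(nat \<times> nat \<times> nat) list \<Rightarrow> pmdiag" where
  "pm_of cs = \<lparr> inner_shape = (\<lambda>j. if j < length cs then fst (cs ! j) else 0),
     mid_shape = (\<lambda>j. if j < length cs then fst (snd (cs ! j)) else 0),
     outer_shape = (\<lambda>j. if j < length cs then snd (snd (cs ! j)) else 0) \<rparr>"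

definition colrel :: "nat \<times> nat \<times> nat \<Rightarrow> nat \<times> nat \<times> nat \<Rightarrow> bool" where
  "colrel x y \<longleftrightarrow> fst x \<ge> fst y \<and> fst (snd x) \<ge> fst (snd y) \<and> snd (snd x) \<ge> snd (snd y)"

definition colok :: "nat \<times> nat \<times> nat \<Rightarrow> bool" where
  "colok = (\<lambda>(a, b, c). a \<le> b \<and> b \<le> a + 1 \<and> b \<le> c \<and> c \<le> b + 1)"

lemma pblk_fst: "x \<in> set (pblk D i) \<Longrightarrow> fst x = i \<Longrightarrow> 0 < i \<Longrightarrow> 0 < Nn D i"
  by (cases x) (auto simp: pblk_def split: if_splits)

lemma pcols_Suc: "pcols D (Suc r) = pblk D (Suc r) @ pcols D r"
  by (simp add: pcols_def)

lemma pcols_0: "pcols D 0 = pblk D 0"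
  by (simp add: pcols_def)

lemma pblk_outer: "x \<in> set (pblk D i) \<Longrightarrow> snd (snd x) = i \<and> fst (snd x) \<le> i \<and> fst x \<le> i \<and> i \<le> fst (snd x) + 1 \<and> i \<le> fst x + 2"
  by (auto simp: pblk_def)

lemma in_pcols: "x \<in> set (pcols D r) \<longleftrightarrow> (\<exists>i\<le>r. x \<in> set (pblk D i))"
proof -
  have "set (rev [0..<r + 1]) = {..r}" by auto
  then show ?thesis unfolding pcols_def set_concat set_map by auto
qed

lemma pcols_outer: "x \<in> set (pcols D r) \<Longrightarrow> snd (snd x) \<le> r"
  by (induction r) (auto simp: pcols_Suc pcols_0 dest: pblk_outer)

lemma pblk_empty: "pm_valid r D \<Longrightarrow> odd (r + i) \<Longrightarrow> pblk D i = []"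
  by (simp add: pm_valid_def pblk_def)

lemma pblk_even: "pm_valid r D \<Longrightarrow> x \<in> set (pblk D i) \<Longrightarrow> even (r + i)"
  using pblk_empty[of r D i] by (cases "even (r + i)") auto

lemma pblk_sorted: "sorted_wrt colrel (pblk D i)"
proof -
  have "sorted_wrt colrel (replicate m x)" for m x
    by (induction m) (auto simp: colrel_def)
  then show ?thesis by (auto simp: pblk_def sorted_wrt_append colrel_def)
qed

text \<open>Outer heights of the same parity differ by at least two, which is the most by which an
  inner height can fall below its outer height. So the inner and middle shapes are sorted across
  blocks too.\<close>

lemma pcols_sorted:
  assumes "pm_valid r D"
  shows "sorted_wrt colrel (pcols D r)"
proof -
  have "sorted_wrt colrel (pcols D m)" for m
  proof (induction m)
    case (Suc m)
    have "colrel x y" if x: "x \<in> set (pblk D (Suc m))" and y: "y \<in> set (pcols D m)" for x y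
    proof -
      obtain j where j: "j \<le> m" "y \<in> set (pblk D j)" using y unfolding in_pcols by blast
      have "even (r + Suc m)" "even (r + j)" using pblk_even[OF assms] x j(2) by blast+
      then have "even (Suc m + j)" by presburger
      then have "j \<noteq> m" by auto
      then show ?thesis using pblk_outer[OF x] pblk_outer[OF j(2)] j(1) by (simp add: colrel_def)
    qed
    then show ?case using Suc pblk_sorted by (simp add: pcols_Suc sorted_wrt_append)
  qed (simp add: pcols_0 pblk_sorted)
  then show ?thesis .
qed

lemma pcols_ok:
  assumes "pm_valid r D" "x \<in> set (pcols D r)"
  shows "colok x" "even (r - snd (snd x))"
proof -
  obtain i where i: "i \<le> r" "x \<in> set (pblk D i)" using assms(2) unfolding in_pcols by blast
  have "even (r + i)" using pblk_even[OF assms(1) i(2)] .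
  then show "even (r - snd (snd x))" using pblk_outer[OF i(2)] i(1) by auto
  show "colok x"
    using i(2) assms(1) unfolding pblk_def colok_def pm_valid_def
    by (cases i; cases "i - 1") (auto split: if_splits)
qed

lemma length_filter_pcols:
  "length (filter Q (pcols D r)) = (\<Sum>i\<le>r. (if Q (i, i, i) then Nn D i else 0) +
     (if Q (i - 1, i, i) then Pp D i else 0) + (if Q (i - 1, i - 1, i) then Mm D i else 0) +
     (if Q (i - 2, i - 1, i) then Bb D i else 0))"
proof (induction r)
  case 0
  show ?case by (simp add: pcols_0 pblk_def filter_replicate)
next
  case (Suc r)
  have "length (filter Q (pblk D i)) = (if Q (i, i, i) then Nn D i else 0) +
     (if Q (i - 1, i, i) then Pp D i else 0) + (if Q (i - 1, i - 1, i) then Mm D i else 0) +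
     (if Q (i - 2, i - 1, i) then Bb D i else 0)" for i
    by (simp add: pblk_def filter_replicate)
  then show ?case by (simp only: pcols_Suc filter_append length_append Suc sum.atMost_Suc add.commute)
qed

lemma pcols_count:
  assumes "pm_valid r D"
  shows "0 < i \<Longrightarrow> length (filter (\<lambda>(a, b, c). c = i \<and> \<not> a < b \<and> \<not> b < c) (pcols D r)) = Nn D i"
    "length (filter (\<lambda>(a, b, c). c = 0) (pcols D r)) = Nn D 0"
    "0 < i \<Longrightarrow> length (filter (\<lambda>(a, b, c). c = i \<and> a < b \<and> \<not> b < c) (pcols D r)) = Pp D i"
    "0 < i \<Longrightarrow> length (filter (\<lambda>(a, b, c). c = i \<and> \<not> a < b \<and> b < c) (pcols D r)) = Mm D i"
    "0 < i \<Longrightarrow> length (filter (\<lambda>(a, b, c). c = i \<and> a < b \<and> b < c) (pcols D r)) = Bb D i"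
    "length (filter (\<lambda>c. fst c = a) (pcols D r)) = Nn D a + Pp D (a + 1) + Mm D (a + 1) + Bb D (a + 2)"
    "0 < i \<Longrightarrow> length (filter (\<lambda>(a, b, c). b = i \<and> a < b) (pcols D r)) = Pp D i + Bb D (i + 1)"
    "0 < i \<Longrightarrow> length (filter (\<lambda>(a, b, c). b = i \<and> \<not> b < c) (pcols D r)) = Nn D i + Pp D i"
    "0 < i \<Longrightarrow> length (filter (\<lambda>(a, b, c). c = i) (pcols D r)) = Nn D i + Pp D i + Mm D i + Bb D i"
    "length (pcols D r) = (\<Sum>i\<le>r. Nn D i + Pp D i + Mm D i + Bb D i)"
proof -
  have Z: "\<And>i. r < i \<Longrightarrow> Nn D i = 0 \<and> Pp D i = 0 \<and> Mm D i = 0 \<and> Bb D i = 0"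
    "Pp D 0 = 0" "Mm D 0 = 0" "Bb D 0 = 0" "Bb D (Suc 0) = 0"
    using assms by (auto simp: pm_valid_def)
  have B: "\<not> i - 2 < i - Suc 0 \<Longrightarrow> Bb D i = 0" for i
    using Z(4,5) by (cases "i = 0 \<or> i = Suc 0") auto
  have L: "\<And>i. i \<le> Suc 0 \<Longrightarrow> i \<noteq> Suc 0 \<Longrightarrow> Pp D i = 0 \<and> Mm D i = 0"
    using Z(2,3) by (metis One_nat_def le_SucE le_zero_eq)
  have single: "(\<Sum>i\<le>r. (if i = a then f i else 0)) = f a" if "r < a \<Longrightarrow> f a = 0" for a and f :: "nat \<Rightarrow> nat"
    using that by (cases "a \<le> r") (auto simp: sum.delta')
  \<comment> \<open>All counts vanish at \<open>r + 1\<close>; this index is inserted below to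
    switch off a kind of column that does not satisfy the condition.\<close>
  have S: "(\<Sum>i\<le>r. f i) = Nn D a + Pp D b + Mm D c + Bb D d"
    if "\<And>i. f i = (if i = a then Nn D i else 0) + (if i = b then Pp D i else 0) + (if i = c then Mm D i else 0) +
      (if i = d then Bb D i else 0)" for f :: "nat \<Rightarrow> nat" and a b c d
    unfolding that sum.distrib using Z(1) by (simp add: single)
  have far: "Nn D (Suc (r + m)) = 0" "Pp D (Suc (r + m)) = 0" "Mm D (Suc (r + m)) = 0" "Bb D (Suc (r + m)) = 0" for m
    using Z(1) by auto
  have U: "(if Q then x else (0::nat)) = 0" if "Q \<Longrightarrow> x = 0" for Q x using that by simp
  show "0 < i \<Longrightarrow> length (filter (\<lambda>(a, b, c). c = i \<and> \<not> a < b \<and> \<not> b < c) (pcols D r)) = Nn D i"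
    unfolding length_filter_pcols
    by (subst S[of _ i "r + 1" "r + 1" "r + 1"]) (use Z B L far[of 0] in auto)
  show "length (filter (\<lambda>(a, b, c). c = 0) (pcols D r)) = Nn D 0"
    unfolding length_filter_pcols
    by (subst S[of _ 0 "r + 1" "r + 1" "r + 1"]) (use Z B L far[of 0] in auto)
  show "0 < i \<Longrightarrow> length (filter (\<lambda>(a, b, c). c = i \<and> a < b \<and> \<not> b < c) (pcols D r)) = Pp D i"
    unfolding length_filter_pcols
    by (subst S[of _ "r + 1" i "r + 1" "r + 1"]) (use Z B L far[of 0] in auto)
  show "0 < i \<Longrightarrow> length (filter (\<lambda>(a, b, c). c = i \<and> \<not> a < b \<and> b < c) (pcols D r)) = Mm D i"
    unfolding length_filter_pcols
    by (subst S[of _ "r + 1" "r + 1" i "r + 1"]) (use Z B L far[of 0] in auto)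
  show "0 < i \<Longrightarrow> length (filter (\<lambda>(a, b, c). c = i \<and> a < b \<and> b < c) (pcols D r)) = Bb D i"
    unfolding length_filter_pcols
    by (subst S[of _ "r + 1" "r + 1" "r + 1" i]) (use Z B L far[of 0] in \<open>auto simp: le_Suc_eq\<close>)
  show "length (filter (\<lambda>c. fst c = a) (pcols D r)) = Nn D a + Pp D (a + 1) + Mm D (a + 1) + Bb D (a + 2)"
    unfolding length_filter_pcols
    by (subst S[of _ a "a + 1" "a + 1" "a + 2"]) (use Z B L far[of 0] in auto)
  show "0 < i \<Longrightarrow> length (filter (\<lambda>(a, b, c). b = i \<and> a < b) (pcols D r)) = Pp D i + Bb D (i + 1)"
    unfolding length_filter_pcols
    by (subst S[of _ "r + 1" i "r + 1" "i + 1"]) (use Z B L far[of 0] in auto)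
  show "0 < i \<Longrightarrow> length (filter (\<lambda>(a, b, c). b = i \<and> \<not> b < c) (pcols D r)) = Nn D i + Pp D i"
    unfolding length_filter_pcols
    by (subst S[of _ i i "r + 1" "r + 1"]) (use Z B L far[of 0] in auto)
  show "0 < i \<Longrightarrow> length (filter (\<lambda>(a, b, c). c = i) (pcols D r)) = Nn D i + Pp D i + Mm D i + Bb D i"
    unfolding length_filter_pcols
    by (subst S[of _ i i i i]) (use Z B L far[of 0] in auto)
  show "length (pcols D r) = (\<Sum>i\<le>r. Nn D i + Pp D i + Mm D i + Bb D i)"
    using length_filter_pcols[of "\<lambda>_. True" D r] by simp
qed

lemma filter_positive:
  "sorted_wrt (\<ge>) xs \<Longrightarrow> filter (\<lambda>x. 0 < x) xs = take (length (filter (\<lambda>x. 0 < x) xs)) (xs :: nat list)"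
  by (induction xs) (auto simp: filter_empty_conv)

lemma first_part_list:
  "first_part (\<lambda>j. if j < length xs then xs ! j else 0) = length (filter (\<lambda>x. 0 < x) xs)"
proof -
  have "{j. (if j < length xs then xs ! j else 0) \<noteq> 0} = {j. j < length xs \<and> 0 < xs ! j}" by auto
  then show ?thesis by (simp add: first_part_def length_filter_conv_card)
qed

lemma col_list_list:
  assumes "sorted_wrt (\<ge>) xs"
  shows "col_list (\<lambda>j. if j < length xs then xs ! j else 0) = filter (\<lambda>x. 0 < x) xs"
proof -
  let ?m = "length (filter (\<lambda>x. 0 < x) xs)"
  have m: "?m \<le> length xs" by simp
  have "map (\<lambda>j. if j < length xs then xs ! j else 0) [0..<?m] = take ?m xs"
    using m by (intro nth_equalityI) (auto simp del: length_filter_le dest: less_le_trans[OF _ m])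
  then show ?thesis using filter_positive[OF assms] by (simp add: col_list_def first_part_list)
qed

lemma pm_of_shapes:
  "outer_shape (pm_of cs) = (\<lambda>j. if j < length (map (\<lambda>c. snd (snd c)) cs) then map (\<lambda>c. snd (snd c)) cs ! j else 0)"
  "mid_shape (pm_of cs) = (\<lambda>j. if j < length (map (\<lambda>c. fst (snd c)) cs) then map (\<lambda>c. fst (snd c)) cs ! j else 0)"
  "inner_shape (pm_of cs) = (\<lambda>j. if j < length (map fst cs) then map fst cs ! j else 0)"
  by (auto simp: pm_of_def)

lemma partition_list:
  assumes "sorted_wrt (\<ge>) xs"
  shows "partition_cols (\<lambda>j. if j < length xs then xs ! j else 0)"
  unfolding partition_cols_def
proof
  show "antimono (\<lambda>j. if j < length xs then xs ! j else 0)"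
  proof (rule antimonoI)
    fix i j :: nat assume "i \<le> j"
    then show "(if j < length xs then xs ! j else 0) \<le> (if i < length xs then xs ! i else 0)"
      using sorted_wrt_nth_less[OF assms, of i j] by (cases "i = j") auto
  qed
  show "finite {j. (if j < length xs then xs ! j else 0) \<noteq> 0}"
    by (rule finite_subset[of _ "{..<length xs}"]) auto
qed

lemma colrel_sorted:
  assumes "sorted_wrt colrel cs"
  shows "sorted_wrt (\<ge>) (map fst cs)" "sorted_wrt (\<ge>) (map (\<lambda>c. fst (snd c)) cs)"
    "sorted_wrt (\<ge>) (map (\<lambda>c. snd (snd c)) cs)"
  using assms unfolding sorted_wrt_map by (auto elim!: sorted_wrt_mono_rel[rotated] simp: colrel_def)

lemma KR_pm_pm_of:
  assumes D: "pm_valid r D" "length (pcols D r) = k" and C: "t = A2odd \<Longrightarrow> r \<le> n \<and> Nn D n = 0"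
    and n: "0 < n"
  shows "KR_pm t n r k (pm_of (pcols D r))"
proof -
  let ?cs = "pcols D r"
  note S = colrel_sorted[OF pcols_sorted[OF D(1)]]
  have ok: "colok (?cs ! j)" if "j < length ?cs" for j using pcols_ok(1)[OF D(1)] nth_mem[OF that] by blast
  have "horizontal_strip (inner_shape (pm_of ?cs)) (mid_shape (pm_of ?cs))"
    "horizontal_strip (mid_shape (pm_of ?cs)) (outer_shape (pm_of ?cs))"
    using ok unfolding horizontal_strip_def pm_of_def colok_def by (auto simp: case_prod_unfold)
  moreover have "outer_shape (pm_of ?cs) j \<le> n \<and> inner_shape (pm_of ?cs) j < n" if t: "t = A2odd" for j
  proof (cases "j < length ?cs")
    case True
    then have m: "?cs ! j \<in> set ?cs" by simp
    have o: "snd (snd (?cs ! j)) \<le> n" using pcols_outer[OF m] C[OF t] by simp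
    have "fst (?cs ! j) \<noteq> n"
    proof
      assume e: "fst (?cs ! j) = n"
      obtain i where i: "i \<le> r" "?cs ! j \<in> set (pblk D i)" using m unfolding in_pcols by blast
      have "i = n" using pblk_outer[OF i(2)] e o by simp
      then show False using pblk_fst[OF i(2)] e C[OF t] n by simp
    qed
    moreover have "fst (?cs ! j) \<le> snd (snd (?cs ! j))" using ok[OF True] by (simp add: colok_def case_prod_unfold)
    ultimately show ?thesis using o True by (simp add: pm_of_def)
  next
    case False
    then show ?thesis using False n by (simp add: pm_of_def)
  qed
  moreover have "col_list (outer_shape (pm_of ?cs)) \<in> KR_shapes r k"
    unfolding pm_of_shapes col_list_list[OF S(3)] KR_shapes_def
    using S(3) D(2) pcols_outer pcols_ok(2)[OF D(1)] by (intro CollectI exI[of _ "map (\<lambda>c. snd (snd c)) ?cs"]) auto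
  ultimately show ?thesis
    unfolding KR_pm_def pm_diagram_def pm_of_shapes
    using partition_list[OF S(1)] partition_list[OF S(2)] partition_list[OF S(3)] by blast
qed


section \<open>How the columns of \<Phi> use up the + symbols\<close>

fun hd0 :: "nat list \<Rightarrow> nat" where
  "hd0 [] = 0"
| "hd0 (h # hs) = h"

text \<open>Once the list has run out, the default 0 stands for an unaltered string or an unaltered
  barred 1.\<close>

primrec assign :: "nat list \<Rightarrow> (nat \<times> nat) list \<Rightarrow> slotcol list" where
  "assign hs [] = []"
| "assign hs (c # cs) =
     (let (v, u) = c;
          (b, hs1) = (if v < u then (Some (hd0 hs), tl hs) else (None, hs));
          (g, hs2) = (if 0 < v then (hd0 hs1, tl hs1) else (0, hs1))
      in (v, g, b) # assign hs2 cs)"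

lemma Phi_cols_assign:
  assumes "\<forall>(v, u)\<in>set cs. v \<noteq> n"
  shows "Phi_cols n hs cs = map (asc_col 0) (assign hs cs)"
  using assms
proof (induction cs arbitrary: hs)
  case (Cons c cs)
  obtain v u where c: "c = (v, u)" by (cases c)
  have B: "alter_bar hs = (bar (Some (hd0 hs)), tl hs)" for hs by (cases hs) (auto simp: bar_def)
  have S: "alter_string v hs = (str v (hd0 hs), tl hs)" for hs by (cases hs) (auto simp: str_def)
  have N: "v \<noteq> n" using Cons.prems c by simp
  have IH: "Phi_cols n hs cs = map (asc_col 0) (assign hs cs)" for hs using Cons by simp
  show ?case using N by (simp add: c B S IH Let_def asc_col_def) (auto simp: bar_def str_def)
qed simp

text \<open>\<Phi> sets columns with a + at height n apart. They are the leftmost ones, and their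
  content \<open>1, ..., n\<close> is what a string of height n becomes when it uses up a + at
  height n. Putting these + back in front of the list therefore makes all columns alike.\<close>

lemma Phi_cols_full:
  assumes "sorted_wrt (\<ge>) (map fst cs)" "\<forall>(v, u)\<in>set cs. v \<le> n \<and> (v = n \<longrightarrow> u = n)" "0 < n"
  shows "Phi_cols n hs cs =
    map (asc_col 0) (assign (replicate (length (filter (\<lambda>c. fst c = n) cs)) n @ hs) cs)"
  using assms
proof (induction cs)
  case (Cons c cs)
  obtain v u where c: "c = (v, u)" by (cases c)
  show ?case
  proof (cases "v = n")
    case True
    then have "u = n" using Cons.prems c by simp
    then show ?thesis using Cons True by (simp add: c asc_col_def str_def bar_def)
  next
    case False
    then have v: "v < n" using Cons.prems c by simp
    have d: "fst d \<noteq> n" if "d \<in> set (c # cs)" for d using Cons.prems(1) that v by (auto simp: c)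
    have N: "\<forall>(v, u)\<in>set (c # cs). v \<noteq> n" "filter (\<lambda>c. fst c = n) (c # cs) = []"
      using d by fastforce (intro filter_False ballI d)
    show ?thesis unfolding N(2) using Phi_cols_assign[OF N(1)] by simp
  qed
qed simp

lemma assign_shape: "map (\<lambda>(v, g, b). (v, b = None)) (assign hs cs) = map (\<lambda>(v, u). (v, \<not> v < u)) cs"
  by (induction cs arbitrary: hs) (auto simp: Let_def)

lemma slots_assign:
  assumes "M = (\<Sum>(v, u)\<leftarrow>cs. (if v < u then 1 else 0) + (if 0 < v then 1 else 0))"
  shows "slots (assign hs cs) = take M hs @ replicate (M - length hs) 0"
  using assms
proof (induction cs arbitrary: hs M)
  case (Cons c cs)
  obtain v u where c: "c = (v, u)" by (cases c)
  define M' where "M' = (\<Sum>(v, u)\<leftarrow>cs. (if v < u then 1 else 0) + (if 0 < v then 1 else 0 :: nat))"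
  have IH: "slots (assign hs cs) = take M' hs @ replicate (M' - length hs) 0" for hs
    using Cons.IH[OF M'_def] .
  have M: "M = (if v < u then 1 else 0) + (if 0 < v then 1 else 0) + M'"
    using Cons.prems by (simp add: c M'_def)
  show ?case unfolding M c
    by (cases "v < u"; cases "0 < v") (cases hs; cases "tl hs"; simp add: slots_Cons IH)+
qed (simp add: slots_Nil)

definition pheights :: "(nat \<times> nat \<times> nat) list \<Rightarrow> nat list" where
  "pheights cs = map (\<lambda>c. fst (snd c)) (filter (\<lambda>(a, b, c). a < b) cs)"

lemma hd0_drop_le: "\<forall>h\<in>set hs. h \<le> v \<Longrightarrow> hd0 (drop m hs) \<le> v"
  by (induction hs arbitrary: m) (auto simp: drop_Cons split: nat.split)

text \<open>Every column with a nonempty string consumes at least one \<open>+\<close>, so the next one to be used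
  always stems from a column not further to the left.\<close>

lemma assign_le:
  assumes "sorted_wrt (\<ge>) (map (\<lambda>c. fst (snd c)) cs)"
  shows "\<forall>(v, g, b)\<in>set (assign (drop m (pheights cs)) (map snd cs)). g \<le> v"
  using assms
proof (induction cs arbitrary: m)
  case (Cons c cs)
  obtain a v u where c: "c = (a, v, u)" by (cases c)
  define P where "P = pheights (c # cs)"
  have le: "\<forall>h\<in>set (pheights (c # cs)). h \<le> v" using Cons.prems by (auto simp: c pheights_def)
  have next_drop: "\<exists>m'. drop m (pheights (c # cs)) = drop m' (pheights cs)" if "0 < m \<or> v = 0" for m
    using that by (cases m) (auto simp: c pheights_def intro: exI[of _ 0])
  have IH: "\<forall>(v, g, b)\<in>set (assign (drop m (pheights (c # cs))) (map snd cs)). g \<le> v" if mv: "0 < m \<or> v = 0" for m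
  proof -
    obtain m' where e: "drop m (pheights (c # cs)) = drop m' (pheights cs)" using next_drop[OF mv] by blast
    have "sorted_wrt (\<ge>) (map (\<lambda>c. fst (snd c)) cs)" using Cons.prems by simp
    then show ?thesis unfolding e by (rule Cons.IH)
  qed
  have tl: "tl (drop m hs) = drop (Suc m) hs" for m and hs :: "nat list" by (simp add: drop_Suc tl_drop)
  show ?case
    unfolding P_def[symmetric]
    using IH[of "Suc (Suc m)"] IH[of "Suc m"] IH[of m] hd0_drop_le[OF le, of m] hd0_drop_le[OF le, of "Suc m"]
    unfolding P_def[symmetric]
    by (cases "v < u"; cases "0 < v") (simp_all add: c tl)
qed simp

lemma assign_full:
  assumes "sorted_wrt (\<ge>) (map fst cs)" "\<forall>(v, u)\<in>set cs. v \<le> n \<and> (v = n \<longrightarrow> u = n)" "0 < n"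
    "\<forall>h\<in>set hs. h < n"
  shows "\<forall>(v, g, b)\<in>set (assign (replicate (length (filter (\<lambda>c. fst c = n) cs)) n @ hs) cs).
    (\<forall>h. b = Some h \<longrightarrow> h < n) \<and> (v = n \<longrightarrow> g = n)"
  using assms
proof (induction cs arbitrary: hs)
  case (Cons c cs)
  obtain v u where c: "c = (v, u)" by (cases c)
  have IH: "\<forall>(v, g, b)\<in>set (assign (replicate (length (filter (\<lambda>c. fst c = n) cs)) n @ hs) cs).
    (\<forall>h. b = Some h \<longrightarrow> h < n) \<and> (v = n \<longrightarrow> g = n)" if "\<forall>h\<in>set hs. h < n" for hs
    using Cons that by simp
  show ?case
  proof (cases "v = n")
    case True
    then have "u = n" using Cons.prems c by simp
    then show ?thesis using IH[OF Cons.prems(4)] True Cons.prems(3) by (simp add: c)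
  next
    case False
    then have v: "v < n" using Cons.prems c by simp
    have "fst d \<noteq> n" if "d \<in> set (c # cs)" for d using Cons.prems(1) that v by (auto simp: c)
    then have N: "filter (\<lambda>c. fst c = n) (c # cs) = []" "filter (\<lambda>c. fst c = n) cs = []"
      by (auto simp: filter_empty_conv)
    have tl: "\<forall>h\<in>set (tl hs). h < n" "hd0 hs < n" if "\<forall>h\<in>set hs. h < n" for hs
      using that Cons.prems(3) by (cases hs; simp)+
    note I = IH[unfolded N(2), simplified]
    note h = Cons.prems(4) note h1 = tl[OF h] note h2 = tl[OF h1(1)]
    show ?thesis unfolding N
      using I[OF h] I[OF h1(1)] I[OF h2(1)] h1(2) h2(2) False
      by (cases "v < u"; cases "0 < v") (simp_all add: c)
  qed
qed simp

lemma map_filter_nth: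
  "map (\<lambda>j. F (cs ! j)) (filter (\<lambda>j. Q (cs ! j)) [0..<length cs]) = map F (filter Q cs)"
proof -
  have "filter Q cs = filter Q (map ((!) cs) [0..<length cs])" by (simp add: map_nth)
  also have "\<dots> = map ((!) cs) (filter (\<lambda>j. Q (cs ! j)) [0..<length cs])" by (simp add: filter_map comp_def)
  finally show ?thesis by simp
qed

lemma Phi_pm_of:
  assumes S: "sorted_wrt colrel cs" and ok: "\<forall>c\<in>set cs. colok c"
    and cs': "cs' = filter (\<lambda>c. 0 < snd (snd c)) cs"
  shows "Phi n (pm_of cs) = Phi_cols n (filter (\<lambda>h. h \<noteq> n) (pheights cs')) (map snd cs')"
proof -
  let ?o = "map (\<lambda>c. snd (snd c)) cs"
  have fo: "length (filter (\<lambda>x. 0 < x) ?o) = length cs'" by (simp add: cs' filter_map comp_def)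
  have fp: "first_part (outer_shape (pm_of cs)) = length cs'"
    unfolding pm_of_shapes first_part_list fo ..
  have le: "length cs' \<le> length cs" by (simp add: cs')
  have nth: "cs' ! j = cs ! j" if "j < length cs'" for j
  proof -
    have "sorted_wrt colrel cs \<Longrightarrow> filter (\<lambda>c. 0 < snd (snd c)) cs = take (length (filter (\<lambda>c. 0 < snd (snd c)) cs)) cs"
      for cs
      by (induction cs) (auto simp: filter_empty_conv colrel_def)
    then have "cs' = take (length cs') cs" using S cs' by blast
    then show ?thesis using that by (metis nth_take)
  qed
  have m: "mid_shape (pm_of cs) j = fst (snd (cs' ! j))" "outer_shape (pm_of cs) j = snd (snd (cs' ! j))"
    "has_plus (pm_of cs) j \<longleftrightarrow> fst (cs' ! j) < fst (snd (cs' ! j))" if "j < length cs'" for j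
    using that le nth[OF that] by (auto simp: pm_of_def has_plus_def)
  have "map (\<lambda>j. (mid_shape (pm_of cs) j, outer_shape (pm_of cs) j)) [0..<length cs'] = map snd cs'"
    by (intro nth_equalityI) (simp_all add: m)
  moreover have "map (mid_shape (pm_of cs)) (filter (\<lambda>j. has_plus (pm_of cs) j \<and> mid_shape (pm_of cs) j \<noteq> n) [0..<length cs'])
    = map (\<lambda>j. fst (snd (cs' ! j))) (filter (\<lambda>j. fst (cs' ! j) < fst (snd (cs' ! j)) \<and> fst (snd (cs' ! j)) \<noteq> n) [0..<length cs'])"
    by (intro map_cong filter_cong) (auto simp: m)
  moreover have "\<dots> = filter (\<lambda>h. h \<noteq> n) (pheights cs')"
    unfolding map_filter_nth[where F = "\<lambda>c. fst (snd c)" and Q = "\<lambda>c. fst c < fst (snd c) \<and> fst (snd c) \<noteq> n"]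
      pheights_def filter_map filter_filter comp_def
    by (intro arg_cong[where f = "map _"] filter_cong) auto
  ultimately show ?thesis unfolding Phi_def fp Let_def by simp
qed


lemma sorted_full_split:
  fixes hs :: "nat list"
  assumes "sorted_wrt (\<ge>) hs" "\<forall>h\<in>set hs. h \<le> N"
  shows "hs = replicate (length (filter (\<lambda>h. h = N) hs)) N @ filter (\<lambda>h. h \<noteq> N) hs"
  using assms
proof (induction hs)
  case (Cons h hs)
  show ?case
  proof (cases "h = N")
    case False
    have "h' \<noteq> N" if "h' \<in> set hs" for h' using Cons.prems that False by force
    then have "filter (\<lambda>h. h = N) hs = []" "filter (\<lambda>h. h \<noteq> N) hs = hs"
      by (auto simp: filter_empty_conv intro: filter_True)
    then show ?thesis using False by simp
  qed (use Cons in simp)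
qed simp

context vec
begin

text \<open>These statistics are what the path will see. A + at height i belongs to a column of
  height i with only + or to a \<mp> column of height i + 1; a string of height i without barred
  letter comes from a column of height i with no symbol or only +.\<close>

lemma Phi_slots:
  assumes D: "pm_valid r D" and r: "r \<le> n" "t = D1 \<Longrightarrow> r + 2 \<le> n" "t = B1 \<Longrightarrow> r < n" "t = A2odd \<Longrightarrow> Nn D n = 0"
  obtains T where "Phi n (pm_of (pcols D r)) = map (asc_col 0) T" "slot_tab T" "turn_ok T"
    "\<And>i. 0 < i \<Longrightarrow> count_list (slots T) i = Pp D i + Bb D (i + 1)"
    "\<And>i. 0 < i \<Longrightarrow> length (filter (\<lambda>(v, g, b). v = i \<and> b = None) T) = Nn D i + Pp D i"
    "length (filter (\<lambda>c. fst c = n) T) = Nn D n + Pp D n"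
    "map (\<lambda>(v, g, b). v + (if b = None then 0 else 1)) T = filter (\<lambda>h. 0 < h) (map (\<lambda>c. snd (snd c)) (pcols D r))"
    "T = assign (pheights (filter (\<lambda>c. 0 < snd (snd c)) (pcols D r))) (map snd (filter (\<lambda>c. 0 < snd (snd c)) (pcols D r)))"
proof -
  define cs where "cs = pcols D r"
  define cs' where "cs' = filter (\<lambda>c. 0 < snd (snd c)) cs"
  define hs where "hs = pheights cs'"
  define T where "T = assign hs (map snd cs')"
  have n: "0 < n" using rank by simp
  have rel: "sorted_wrt colrel cs" "sorted_wrt colrel cs'"
    using pcols_sorted[OF D] by (simp_all add: cs_def cs'_def sorted_wrt_filter)
  have sub: "c \<in> set cs" if "c \<in> set cs'" for c using that by (simp add: cs'_def)
  have ok: "\<forall>c\<in>set cs. colok c" using pcols_ok(1)[OF D] by (simp add: cs_def)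
  have vr: "snd (snd c) \<le> r" "fst (snd c) \<le> snd (snd c)" "fst c \<le> fst (snd c)" if "c \<in> set cs" for c
    using pcols_outer[of c D r] ok that by (auto simp: cs_def colok_def)
  have full: "t = A2odd \<and> snd (snd c) = n \<and> fst c < n" if c: "c \<in> set cs" and e: "fst (snd c) = n" for c
  proof -
    have rn: "r = n" using vr[OF c] e r(1) by simp
    then have A: "t = A2odd" using r by (cases t) auto
    have o: "snd (snd c) = n" using vr[OF c] e rn by simp
    have "fst c \<noteq> n"
    proof
      assume f: "fst c = n"
      obtain i where i: "i \<le> r" "c \<in> set (pblk D i)" using c unfolding cs_def in_pcols by blast
      then have "i = n" using pblk_outer[OF i(2)] o by simp
      then show False using pblk_fst[OF i(2)] f n r(4)[OF A] by simp
    qed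
    then show ?thesis using A o vr[OF c] e by simp
  qed
  have ps: "sorted_wrt (\<ge>) (map fst (map snd cs'))" using colrel_sorted(2)[OF rel(2)] by (simp add: comp_def)
  have pn: "\<forall>(v, u)\<in>set (map snd cs'). v \<le> n \<and> (v = n \<longrightarrow> u = n)"
    using vr r(1) full sub by fastforce
  have hss: "sorted_wrt (\<ge>) hs"
    using colrel_sorted(2)[OF sorted_wrt_filter[OF rel(2)]] by (simp add: hs_def pheights_def)
  have hsn: "\<forall>h\<in>set hs. h \<le> n" using pn by (auto simp: hs_def pheights_def)
  have N: "length (filter (\<lambda>h. h = n) hs) = length (filter (\<lambda>c. fst c = n) (map snd cs'))"
    unfolding hs_def pheights_def filter_map filter_filter length_map comp_def
    using full sub by (intro arg_cong[where f = length] filter_cong) fastforce+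
  have split: "hs = replicate (length (filter (\<lambda>c. fst c = n) (map snd cs'))) n @ filter (\<lambda>h. h \<noteq> n) hs"
    using sorted_full_split[OF hss hsn] unfolding N .
  have 1: "Phi n (pm_of (pcols D r)) = map (asc_col 0) T"
    using Phi_pm_of[OF rel(1) ok cs'_def] Phi_cols_full[OF ps pn n, of "filter (\<lambda>h. h \<noteq> n) hs"]
    unfolding split[symmetric] by (simp add: T_def cs_def hs_def)
  have shape: "map (\<lambda>(v, g, b). (v, b = None)) T = map (\<lambda>(a, b, c). (b, \<not> b < c)) cs'"
    using assign_shape[of hs "map snd cs'"] by (simp add: T_def comp_def case_prod_unfold)
  define M where "M = (\<Sum>(v, u)\<leftarrow>map snd cs'. (if v < u then 1 else 0) + (if 0 < v then 1 else 0 :: nat))"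
  have len: "length hs \<le> M"
  proof -
    have "length (pheights cs) \<le> (\<Sum>(v, u)\<leftarrow>map snd cs. (if v < u then 1 else 0) + (if 0 < v then 1 else 0))"
      for cs by (induction cs) (auto simp: pheights_def)
    then show ?thesis by (simp add: hs_def M_def)
  qed
  have sl: "slots T = hs @ replicate (M - length hs) 0"
    using slots_assign[OF M_def, of hs] len by (simp add: T_def)
  have fT: "map fst T = map fst (map snd cs')"
    using arg_cong[OF shape, of "map fst"] by (simp add: comp_def case_prod_unfold)
  have rep: "sorted_wrt (\<ge>) (replicate m (0::nat))" for m by (induction m) auto
  have 2: "slot_tab T"
    unfolding slot_tab_def sl fT
    using hss ps rep assign_le[of cs' 0] by (auto simp: sorted_wrt_append T_def hs_def comp_def)
  have af: "\<forall>(v, g, b)\<in>set T. (\<forall>h. b = Some h \<longrightarrow> h < n) \<and> (v = n \<longrightarrow> g = n)"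
    using assign_full[OF ps pn n, of "filter (\<lambda>h. h \<noteq> n) hs"] hsn unfolding split[symmetric] T_def[symmetric]
    by fastforce
  have 3: "turn_ok T" unfolding turn_ok_def
  proof (intro ballI, clarify)
    fix v g b assume m: "(v, g, b) \<in> set T"
    have "(v, b = None) \<in> set (map (\<lambda>(a, b, c). (b, \<not> b < c)) cs')"
      unfolding shape[symmetric] using m by force
    then obtain a u where c: "(a, v, u) \<in> set cs'" "b = None \<longleftrightarrow> \<not> v < u" by auto
    have "v \<le> r" using vr[OF sub[OF c(1)]] by simp
    moreover have "v = n \<Longrightarrow> t = A2odd \<and> u = n" using full[OF sub[OF c(1)]] by simp
    moreover have "(\<forall>h. b = Some h \<longrightarrow> h < n) \<and> (v = n \<longrightarrow> g = n)" using bspec[OF af m] by simp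
    ultimately show "(\<forall>h. b = Some h \<longrightarrow> h < n \<and> v < n) \<and> v \<le> n \<and>
       (v = n \<longrightarrow> t = A2odd \<and> g = n) \<and> (t = D1 \<longrightarrow> v + 1 < n)"
    proof (intro conjI allI impI)
      have "u \<le> n" using vr(1)[OF sub[OF c(1)]] r(1) by simp
      then show "v < n" if "b = Some h" for h using c(2) that by simp
      show "t = D1 \<Longrightarrow> v + 1 < n" using r(2) \<open>v \<le> r\<close> by simp
      show "v \<le> n" using \<open>v \<le> r\<close> r(1) by simp
    qed blast+
  qed
  have 4: "count_list (slots T) i = Pp D i + Bb D (i + 1)" if i: "0 < i" for i
  proof -
    have "count_list (slots T) i = count_list hs i" using i by (simp add: sl count_list_append count_list_0_iff)
    also have "\<dots> = length (filter (\<lambda>h. h = i) hs)" by (induction hs) auto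
    also have "\<dots> = length (filter (\<lambda>(a, b, c). b = i \<and> a < b) cs)"
      unfolding hs_def pheights_def filter_map filter_filter length_map comp_def cs'_def
      by (intro arg_cong[where f = length] filter_cong refl) (use i in \<open>auto dest!: vr(2)\<close>)
    finally show ?thesis using pcols_count(7)[OF D i] by (simp add: cs_def)
  qed
  have F: "length (filter (\<lambda>(v, g, b). Q v (b = None)) T) = length (filter (\<lambda>(a, b, c). Q b (\<not> b < c)) cs')" for Q
    using arg_cong[OF shape, of "\<lambda>xs. length (filter (\<lambda>(v, b). Q v b) xs)"]
    by (simp add: filter_map comp_def case_prod_unfold)
  have 5: "length (filter (\<lambda>(v, g, b). v = i \<and> b = None) T) = Nn D i + Pp D i" if i: "0 < i" for i
  proof -
    have "length (filter (\<lambda>(v, g, b). v = i \<and> b = None) T) = length (filter (\<lambda>(a, b, c). b = i \<and> \<not> b < c) cs')"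
      by (rule F)
    also have "\<dots> = length (filter (\<lambda>(a, b, c). b = i \<and> \<not> b < c) cs)"
      unfolding cs'_def filter_filter
      by (intro arg_cong[where f = length] filter_cong refl) (use i in \<open>auto dest!: vr(2)\<close>)
    finally show ?thesis using pcols_count(8)[OF D i] by (simp add: cs_def)
  qed
  have "length (filter (\<lambda>c. fst c = n) T) = length (filter (\<lambda>(v, g, b). v = n \<and> b = None) T)"
    using 3 unfolding turn_ok_def by (intro arg_cong[where f = length] filter_cong) fastforce+
  then have 6: "length (filter (\<lambda>c. fst c = n) T) = Nn D n + Pp D n" using 5[OF n] by simp
  have "map (\<lambda>(v, g, b). v + (if b = None then 0 else 1)) T = map (\<lambda>c. snd (snd c)) cs'"
  proof -
    have "fst (snd c) + (if \<not> fst (snd c) < snd (snd c) then 0 else 1) = snd (snd c)" if c: "c \<in> set cs'" for c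
      using bspec[OF ok sub[OF c]] by (auto simp: colok_def case_prod_unfold)
    then show ?thesis
      using arg_cong[OF shape, of "map (\<lambda>(v, b). v + (if b then 0 else 1))"]
      by (simp add: comp_def case_prod_unfold cong: map_cong)
  qed
  then have 7: "map (\<lambda>(v, g, b). v + (if b = None then 0 else 1)) T = filter (\<lambda>h. 0 < h) (map (\<lambda>c. snd (snd c)) (pcols D r))"
    by (simp add: cs'_def filter_map comp_def cs_def)
  show thesis using that[OF 1 2 3 4 5 6 7] unfolding T_def hs_def cs'_def cs_def by simp
qed

end

text \<open>A column of height i without symbols and a \<mp> column of height i + 2 have the same
  inner height i, so taking the complementary number of pairs exchanges their multiplicities,
  including the empty columns for i = 0. A column of inner height r has no room for a pair and
  stays.\<close>

definition Sdata :: "nat \<Rightarrow> pmcount \<Rightarrow> pmcount" where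
  "Sdata r D = \<lparr> Nn = (\<lambda>i. if i = r then Nn D r else if i < r then Bb D (i + 2) else 0),
     Pp = Mm D, Mm = Pp D, Bb = (\<lambda>i. if 2 \<le> i \<and> i \<le> r then Nn D (i - 2) else 0) \<rparr>"

lemma Sdata_sel:
  "Nn (Sdata r D) i = (if i = r then Nn D r else if i < r then Bb D (i + 2) else 0)"
  "Pp (Sdata r D) = Mm D" "Mm (Sdata r D) = Pp D"
  "Bb (Sdata r D) i = (if 2 \<le> i \<and> i \<le> r then Nn D (i - 2) else 0)"
  by (simp_all add: Sdata_def)

lemma pm_valid_Sdata: "pm_valid r D \<Longrightarrow> pm_valid r (Sdata r D)"
  unfolding pm_valid_def Sdata_sel by auto

lemma inner_Sdata:
  assumes "pm_valid r D"
  shows "map fst (pcols (Sdata r D) r) = map fst (pcols D r)"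
proof -
  note V = assms pm_valid_Sdata[OF assms]
  have "count_list (map fst (pcols (Sdata r D) r)) x = count_list (map fst (pcols D r)) x" for x
  proof -
    have "count_list (map fst cs) x = length (filter (\<lambda>c. fst c = x) cs)" for cs :: "(nat \<times> nat \<times> nat) list"
      by (induction cs) auto
    moreover have "Nn D x = 0" if "x < r" "\<not> x + 2 \<le> r"
    proof -
      have "r = Suc x" using that by simp
      then show ?thesis using V(1) unfolding pm_valid_def by simp
    qed
    ultimately show ?thesis
      using pcols_count(6)[OF V(1), of x] pcols_count(6)[OF V(2), of x] V(1)
      unfolding pm_valid_def Sdata_sel by auto
  qed
  then show ?thesis
    using colrel_sorted(1)[OF pcols_sorted[OF V(1)]] colrel_sorted(1)[OF pcols_sorted[OF V(2)]]
    by (intro sorted_wrt_unique[of "(\<ge>)"]) auto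
qed

lemma card_pm_of:
  assumes "length cs \<le> k" "\<not> Q 0 0 0 \<or> length cs = k"
  shows "card {j. j < k \<and> Q (inner_shape (pm_of cs) j) (mid_shape (pm_of cs) j) (outer_shape (pm_of cs) j)} =
    length (filter (\<lambda>(a, b, c). Q a b c) cs)"
proof -
  have "{j. j < k \<and> Q (inner_shape (pm_of cs) j) (mid_shape (pm_of cs) j) (outer_shape (pm_of cs) j)} =
      {j. j < length cs \<and> (case cs ! j of (a, b, c) \<Rightarrow> Q a b c)}"
    using assms by (auto simp: pm_of_def case_prod_unfold split: if_splits)
  then show ?thesis by (simp add: length_filter_conv_card)
qed

lemma outer_pm_of_less: "0 < outer_shape (pm_of cs) j \<Longrightarrow> j < length cs"
  by (simp add: pm_of_def split: if_splits)

lemma p_pcols: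
  assumes "pm_valid r D" "length (pcols D r) = k"
  shows "p_none k (pm_of (pcols D r)) i = int (Nn D i)"
    "0 < i \<Longrightarrow> p_plus (pm_of (pcols D r)) i = int (Pp D i)"
    "0 < i \<Longrightarrow> p_minus (pm_of (pcols D r)) i = int (Mm D i)"
    "0 < i \<Longrightarrow> p_both (pm_of (pcols D r)) i = int (Bb D i)"
proof -
  let ?P = "pm_of (pcols D r)"
  have C: "card {j. outer_shape ?P j = i \<and> Q (inner_shape ?P j) (mid_shape ?P j) (outer_shape ?P j)} =
      length (filter (\<lambda>(a, b, c). c = i \<and> Q a b c) (pcols D r))" if "0 < i" for Q :: "nat \<Rightarrow> nat \<Rightarrow> nat \<Rightarrow> bool" and i
  proof -
    have "{j. outer_shape ?P j = i \<and> Q (inner_shape ?P j) (mid_shape ?P j) (outer_shape ?P j)} =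
        {j. j < k \<and> outer_shape ?P j = i \<and> Q (inner_shape ?P j) (mid_shape ?P j) (outer_shape ?P j)}"
      using that assms(2) outer_pm_of_less[of "pcols D r"] by auto
    then show ?thesis
      using card_pm_of[of "pcols D r" k "\<lambda>a b c. c = i \<and> Q a b c"] assms(2) that by simp
  qed
  have S: "length (filter (\<lambda>c. 0 < snd (snd c)) (pcols D r)) + length (filter (\<lambda>(a, b, c). c = 0) (pcols D r)) = length (pcols D r)"
    using sum_length_filter_compl[of "\<lambda>c. 0 < snd (snd c)" "pcols D r"] by (simp add: case_prod_unfold)
  have "first_part (outer_shape ?P) = length (filter (\<lambda>c. 0 < snd (snd c)) (pcols D r))"
    unfolding pm_of_shapes first_part_list by (simp add: filter_map comp_def)
  then have "int k - int (first_part (outer_shape ?P)) = int (Nn D 0)"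
    using S pcols_count(2)[OF assms(1)] assms(2) by simp
  then show "p_none k ?P i = int (Nn D i)"
    using C[of i "\<lambda>a b c. \<not> a < b \<and> \<not> b < c"] pcols_count(1)[OF assms(1), of i]
    unfolding p_none_def has_plus_def has_minus_def by simp
  show "0 < i \<Longrightarrow> p_plus ?P i = int (Pp D i)" "0 < i \<Longrightarrow> p_minus ?P i = int (Mm D i)"
    "0 < i \<Longrightarrow> p_both ?P i = int (Bb D i)"
    using C[of i "\<lambda>a b c. a < b \<and> \<not> b < c"] C[of i "\<lambda>a b c. \<not> a < b \<and> b < c"] C[of i "\<lambda>a b c. a < b \<and> b < c"]
      pcols_count(3-5)[OF assms(1), of i]
    unfolding p_plus_def p_minus_def p_both_def has_plus_def has_minus_def by simp_all
qed

lemma S_graph_Sdata: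
  assumes D: "pm_valid r D" and k: "length (pcols D r) = k"
  shows "S_graph r k (pm_of (pcols D r)) (pm_of (pcols (Sdata r D) r))" "length (pcols (Sdata r D) r) = k"
proof -
  let ?D = "Sdata r D"
  note V = pm_valid_Sdata[OF D] and I = inner_Sdata[OF D]
  show k': "length (pcols ?D r) = k" using arg_cong[OF I, of length] k by simp
  have in_eq: "inner_shape (pm_of (pcols ?D r)) = inner_shape (pm_of (pcols D r))"
    unfolding pm_of_shapes I ..
  have cnt: "inner_count k (pm_of (pcols E r)) i pl mi =
      length (filter (\<lambda>(a, b, c). a = i \<and> (a < b \<longleftrightarrow> pl) \<and> (b < c \<longleftrightarrow> mi)) (pcols E r))"
    if "length (pcols E r) = k" for E i pl mi
    unfolding inner_count_def has_plus_def has_minus_def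
    using card_pm_of[of "pcols E r" k "\<lambda>a b c. a = i \<and> (a < b \<longleftrightarrow> pl) \<and> (b < c \<longleftrightarrow> mi)"] that by simp
  have F: "filter (\<lambda>(a, b, c). a = i \<and> (a < b \<longleftrightarrow> pl) \<and> (b < c \<longleftrightarrow> mi)) (pcols E r) =
        filter (\<lambda>(a, b, c). c = i + (if pl then 1 else 0) + (if mi then 1 else 0) \<and> (a < b \<longleftrightarrow> pl) \<and> (b < c \<longleftrightarrow> mi)) (pcols E r)"
    if E: "pm_valid r E" for E i pl mi
  proof (intro filter_cong refl)
    fix x assume "x \<in> set (pcols E r)"
    then have "colok x" using pcols_ok(1)[OF E] by blast
    then show "(case x of (a, b, c) \<Rightarrow> a = i \<and> (a < b \<longleftrightarrow> pl) \<and> (b < c \<longleftrightarrow> mi)) =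
      (case x of (a, b, c) \<Rightarrow> c = i + (if pl then 1 else 0) + (if mi then 1 else 0) \<and> (a < b \<longleftrightarrow> pl) \<and> (b < c \<longleftrightarrow> mi))"
      by (cases x) (auto simp: colok_def)
  qed
  have N: "inner_count k (pm_of (pcols E r)) i True False = Pp E (i + 1)"
      "inner_count k (pm_of (pcols E r)) i False True = Mm E (i + 1)"
      "inner_count k (pm_of (pcols E r)) i True True = Bb E (i + 2)"
    if "pm_valid r E" "length (pcols E r) = k" for E i
    unfolding cnt[OF that(2)] F[OF that(1)]
    using pcols_count(3,4)[OF that(1), of "i + 1"] pcols_count(5)[OF that(1), of "i + 2"] by simp_all
  have A: "card {j. j < k \<and> inner_shape (pm_of (pcols D r)) j = i} = Nn D i + Pp D (i + 1) + Mm D (i + 1) + Bb D (i + 2)" for i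
    using card_pm_of[of "pcols D r" k "\<lambda>a b c. a = i"] k pcols_count(6)[OF D, of i] by (simp add: case_prod_unfold)
  show "S_graph r k (pm_of (pcols D r)) (pm_of (pcols ?D r))"
    unfolding S_graph_def
  proof (intro conjI allI impI in_eq)
    fix i assume i: "i < r"
    have e: "Pp D (i + 1) = 0 \<and> Mm D (i + 1) = 0" if "\<not> odd (r - i)"
      using D that i unfolding pm_valid_def by auto
    have o: "Nn D i = 0 \<and> Bb D (i + 2) = 0 \<or> i + 2 \<le> r" if "\<not> odd (r - i)"
      using that i by presburger
    show "if odd (r - i)
      then inner_count k (pm_of (pcols ?D r)) i True False = inner_count k (pm_of (pcols D r)) i False True \<and>
           inner_count k (pm_of (pcols ?D r)) i False True = inner_count k (pm_of (pcols D r)) i True False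
      else inner_count k (pm_of (pcols ?D r)) i True True =
         card {j. j < k \<and> inner_shape (pm_of (pcols D r)) j = i} - inner_count k (pm_of (pcols D r)) i True True"
      unfolding N[OF D k] N[OF V k'] A Sdata_sel using e o by auto
  qed
qed


text \<open>A weakly decreasing list is determined by its multiplicities, so outer shapes can be
  found by counting the columns of each height.\<close>

lemma outer_unique:
  assumes "pm_valid r D" "sorted_wrt (\<ge>) \<mu>" "0 \<notin> set \<mu>"
    and "\<And>i. 0 < i \<Longrightarrow> count_list \<mu> i = Nn D i + Pp D i + Mm D i + Bb D i"
  shows "filter (\<lambda>h. 0 < h) (map (\<lambda>c. snd (snd c)) (pcols D r)) = \<mu>"
proof (rule sorted_wrt_unique[of "(\<ge>)"])
  show "sorted_wrt (\<ge>) (filter (\<lambda>h. 0 < h) (map (\<lambda>c. snd (snd c)) (pcols D r)))"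
    using colrel_sorted(3)[OF pcols_sorted[OF assms(1)]] by (rule sorted_wrt_filter)
  fix i
  show "count_list (filter (\<lambda>h. 0 < h) (map (\<lambda>c. snd (snd c)) (pcols D r))) i = count_list \<mu> i"
  proof (cases "i = 0")
    case False
    have "count_list (filter (\<lambda>h. 0 < h) (map (\<lambda>c. snd (snd c)) cs)) i = length (filter (\<lambda>(a, b, c). c = i) cs)"
      for cs :: "(nat \<times> nat \<times> nat) list"
      using False by (induction cs) auto
    then show ?thesis using pcols_count(9)[OF assms(1), of i] assms(4)[of i] False by simp
  next
    case True
    then show ?thesis using assms(3) by (simp add: count_list_0_iff)
  qed
qed (use assms in auto)

lemma KR_shapes_props:
  assumes "\<mu> \<in> KR_shapes r k"
  shows "sorted_wrt (\<ge>) \<mu>" "0 \<notin> set \<mu>" "\<And>h. h \<in> set \<mu> \<Longrightarrow> 0 < h \<and> h \<le> r \<and> even (r + h)" "length \<mu> \<le> k"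
    "odd r \<Longrightarrow> length \<mu> = k"
proof -
  obtain hs where hs: "\<mu> = filter (\<lambda>h. 0 < h) hs" "length hs = k" "sorted_wrt (\<ge>) hs" "\<forall>h\<in>set hs. h \<le> r \<and> even (r - h)"
    using assms unfolding KR_shapes_def by blast
  show "sorted_wrt (\<ge>) \<mu>" "0 \<notin> set \<mu>" "\<And>h. h \<in> set \<mu> \<Longrightarrow> 0 < h \<and> h \<le> r \<and> even (r + h)" "length \<mu> \<le> k"
    using hs by (auto simp: sorted_wrt_filter)
  show "length \<mu> = k" if "odd r"
  proof -
    have "0 < h" if "h \<in> set hs" for h using hs(4) that \<open>odd r\<close> by (cases h) auto
    then show ?thesis using hs(1,2) by simp
  qed
qed

lemma KR_shapesI:
  assumes "sorted_wrt (\<ge>) \<mu>" "\<And>h. h \<in> set \<mu> \<Longrightarrow> 0 < h \<and> h \<le> r \<and> even (r + h)" "length \<mu> \<le> k"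
    "odd r \<Longrightarrow> length \<mu> = k"
  shows "\<mu> \<in> KR_shapes r k"
proof -
  let ?hs = "\<mu> @ replicate (k - length \<mu>) 0"
  have "sorted_wrt (\<ge>) (replicate m (0::nat))" for m by (induction m) auto
  then have "sorted_wrt (\<ge>) ?hs" using assms(1) by (auto simp: sorted_wrt_append)
  moreover have "filter (\<lambda>h. 0 < h) ?hs = \<mu>" using assms(2) by (auto simp: filter_id_conv)
  moreover have "\<forall>h\<in>set ?hs. h \<le> r \<and> even (r - h)" using assms(2,4) by (cases "odd r") auto
  ultimately show ?thesis unfolding KR_shapes_def using assms(3)
    by (intro CollectI exI[of _ ?hs]) simp
qed

text \<open>The diagram of the highest weight tableau: every column carries a +, which is used up by
  its own string and completes it. The missing columns are counted as empty ones.\<close>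

definition hwdata :: "nat \<Rightarrow> nat list \<Rightarrow> pmcount" where
  "hwdata k \<mu> = \<lparr> Nn = (\<lambda>i. if i = 0 then k - length \<mu> else 0),
     Pp = (\<lambda>i. if i = 0 then 0 else count_list \<mu> i), Mm = (\<lambda>i. 0), Bb = (\<lambda>i. 0) \<rparr>"

lemma hwdata_sel:
  "Nn (hwdata k \<mu>) i = (if i = 0 then k - length \<mu> else 0)"
  "Pp (hwdata k \<mu>) i = (if i = 0 then 0 else count_list \<mu> i)" "Mm (hwdata k \<mu>) i = 0" "Bb (hwdata k \<mu>) i = 0"
  by (simp_all add: hwdata_def)

lemma pm_valid_hwdata:
  assumes "\<mu> \<in> KR_shapes r k"
  shows "pm_valid r (hwdata k \<mu>)"
proof -
  note P = KR_shapes_props[OF assms]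
  have "count_list \<mu> i = 0" if "odd (r + i) \<or> r < i" for i
    using P(3)[of i] that by (intro count_notin) auto
  then show ?thesis using P(5) unfolding pm_valid_def hwdata_sel by auto
qed

lemma hwdata_outer:
  assumes "\<mu> \<in> KR_shapes r k"
  shows "filter (\<lambda>h. 0 < h) (map (\<lambda>c. snd (snd c)) (pcols (hwdata k \<mu>) r)) = \<mu>"
  using KR_shapes_props[OF assms] by (intro outer_unique pm_valid_hwdata[OF assms]) (auto simp: hwdata_sel)

lemma length_pcols_outer:
  assumes "pm_valid r D" "filter (\<lambda>h. 0 < h) (map (\<lambda>c. snd (snd c)) (pcols D r)) = \<mu>"
  shows "length (pcols D r) = length \<mu> + Nn D 0"
proof -
  have "length cs = length (filter (\<lambda>h. 0 < h) (map (\<lambda>c. snd (snd c)) cs)) + length (filter (\<lambda>(a, b, c). c = 0) cs)"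
    for cs :: "(nat \<times> nat \<times> nat) list"
    by (induction cs) auto
  then show ?thesis using pcols_count(2)[OF assms(1)] assms(2) by metis
qed

lemma length_hwdata:
  assumes "\<mu> \<in> KR_shapes r k"
  shows "length (pcols (hwdata k \<mu>) r) = k"
  using length_pcols_outer[OF pm_valid_hwdata[OF assms] hwdata_outer[OF assms]] KR_shapes_props(4)[OF assms]
  by (simp add: hwdata_sel)

context vec
begin

lemma Phi_hwdata:
  assumes \<mu>: "\<mu> \<in> KR_shapes r k" and r: "r \<le> n" "t = D1 \<Longrightarrow> r + 2 \<le> n" "t = B1 \<Longrightarrow> r < n"
  shows "Phi n (pm_of (pcols (hwdata k \<mu>) r)) = hw_tableau \<mu>"
proof -
  let ?cs = "filter (\<lambda>c. 0 < snd (snd c)) (pcols (hwdata k \<mu>) r)"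
  have N: "Nn (hwdata k \<mu>) n = 0" using rank by (simp add: hwdata_sel)
  obtain T where T: "Phi n (pm_of (pcols (hwdata k \<mu>) r)) = map (asc_col 0) T"
    "T = assign (pheights ?cs) (map snd ?cs)"
    using Phi_slots[OF pm_valid_hwdata[OF \<mu>] r N] by metis
  have c: "0 < snd (snd c) \<and> fst (snd c) = snd (snd c) \<and> fst c < fst (snd c)" if c: "c \<in> set ?cs" for c
  proof -
    obtain i where "c \<in> set (pblk (hwdata k \<mu>) i)" using c unfolding filter_set[symmetric] in_pcols by (auto simp: in_pcols)
    then show ?thesis using c by (auto simp: pblk_def hwdata_sel split: if_splits)
  qed
  have "map (asc_col 0) (assign (pheights cs) (map snd cs)) = hw_tableau (map (\<lambda>c. snd (snd c)) cs)"
    if "\<forall>c\<in>set cs. 0 < snd (snd c) \<and> fst (snd c) = snd (snd c) \<and> fst c < fst (snd c)" for cs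
    using that
  proof (induction cs)
    case (Cons c cs)
    obtain a v where c: "c = (a, v, v)" "0 < v" "a < v" using Cons.prems by (cases c) auto
    have ph: "pheights (c # cs) = v # pheights cs" using c by (simp add: pheights_def)
    have A: "asc_col 0 (v, v, None) = [1..int v]" by (simp add: asc_col_def str_def bar_def)
    have "\<forall>c\<in>set cs. 0 < snd (snd c) \<and> fst (snd c) = snd (snd c) \<and> fst c < fst (snd c)"
      using Cons.prems by (meson list.set_intros(2))
    from Cons.IH[OF this] show ?case unfolding ph hw_tableau_def by (simp add: c A)
  qed (simp add: hw_tableau_def)
  then have "map (asc_col 0) T = hw_tableau (map (\<lambda>c. snd (snd c)) ?cs)" unfolding T(2) using c by blast
  also have "map (\<lambda>c. snd (snd c)) ?cs = \<mu>"
    using hwdata_outer[OF \<mu>] by (simp add: filter_map comp_def)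
  finally show ?thesis unfolding T(1) .
qed

end

section \<open>The involution on plus-minus diagrams and on rows\<close>

context vec
begin

abbreviation Es :: "nat list \<Rightarrow> int list \<Rightarrow> int list" where
  "Es ks w \<equiv> foldl (\<lambda>w k. E k w) w ks"

lemma asc_path0:
  assumes "slot_tab T" "m < n"
  shows "Es [1..<Suc m] (reading (map (asc_col 0) T)) = reading (map (asc_col m) T)"
  using assms(2)
proof (induction m)
  case (Suc m)
  have "[1..<Suc (Suc m)] = [1..<Suc m] @ [Suc m]" by simp
  then show ?case using Suc asc_step[of "Suc m" T] assms(1) by simp
qed simp

lemma desc_path:
  assumes "slot_tab T" "1 \<le> j" "j \<le> m" "m \<le> n"
  shows "Es (rev [j..<m]) (reading (map (desc_col m) T)) = reading (map (desc_col j) T)"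
  using assms(3,4)
proof (induction m rule: dec_induct)
  case (step m)
  have "rev [j..<Suc m] = m # rev [j..<m]" using step by simp
  then show ?case using step desc_step[of m T] assms(1,2) by (simp add: slot_tab_def)
qed simp

lemma top_le: "top \<le> n" "3 \<le> top"
  using rank rankD by (auto simp: top_def)

text \<open>The nodes up to n - 1 complete the strings and carry the barred letters to barred n; the
  way back brings these down to the tops of their columns. The filling is thus raised to the highest
  weight tableau, which puts the image of \<Phi> into the component.\<close>

lemma KN_slots:
  assumes T: "slot_tab T" "turn_ok T"
  shows "KN (map (\<lambda>(v, g, b). v + (if b = None then 0 else 1)) T) (map (asc_col 0) T)"
proof -
  let ?hs = "map (\<lambda>(v, g, b). v + (if b = None then 0 else 1)) T"
  have len: "length (asc_col 0 c) = (case c of (v, g, b) \<Rightarrow> v + (if b = None then 0 else 1))" if "c \<in> set T" for c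
  proof -
    obtain v g b where e: "c = (v, g, b)" by (cases c)
    have "g \<le> v" using that T(1) unfolding slot_tab_def e by auto
    then have "length (str v g) = v" by (simp add: str_def)
    then show ?thesis by (cases b) (simp_all add: e asc_col_def bar_def)
  qed
  have letters: "set (asc_col 0 c) \<subseteq> elts V" if c: "c \<in> set T" for c
  proof -
    obtain v g b where e: "c = (v, g, b)" by (cases c)
    have b: "(\<forall>h. b = Some h \<longrightarrow> h < n) \<and> v \<le> n \<and> (v = n \<longrightarrow> g = n)" "g \<le> v"
      using T c unfolding slot_tab_def turn_ok_def e by auto
    show ?thesis
    proof
      fix a assume "a \<in> set (asc_col 0 c)"
      then consider "1 \<le> a" "a \<le> int g" | "int g + 2 \<le> a" "a \<le> int v + 1" | h where "b = Some h" "a = - (int h + 1)"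
        by (auto simp: e asc_col_def str_def bar_def split: option.splits)
      then have "a \<noteq> 0 \<and> \<bar>a\<bar> \<le> int n"
        using b by cases (auto simp: abs_if)
      then show "a \<in> elts V" by (simp add: elts_V)
    qed
  qed
  have tab: "tab (map (asc_col 0) T)" unfolding tab_def reading_def using letters by fastforce
  have n: "0 < n" using rank by simp
  let ?ks = "[1..<Suc (n - 1)] @ [n] @ rev [1..<top]"
  have "Es ?ks (reading (map (asc_col 0) T)) = reading (map (desc_col 1) T)"
    using asc_path0[OF T(1), of "n - 1"] turn_step[OF T] desc_path[OF T(1), of 1 top] n top_le by simp
  moreover have "set ?ks \<subseteq> {1..n}" using n top_le by auto
  ultimately have "red\<^sup>*\<^sup>* (reading (map (asc_col 0) T)) (reading (hw_tableau ?hs))"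
    using foldl_E_reds[of ?ks "reading (map (asc_col 0) T)"] tab desc_final[of T] unfolding tab_def by metis
  moreover have "tshape (map (asc_col 0) T) = ?hs" using len by simp
  ultimately show ?thesis using tab unfolding KN_def by blast
qed

text \<open>Only the upper bounds of \<open>admissible\<close>, so that the same statements apply to
  the rectangle and, with r = 1, to the row.\<close>

definition KR_type :: "nat \<Rightarrow> bool" where
  "KR_type r \<longleftrightarrow> r \<le> n \<and> (t = D1 \<longrightarrow> r + 2 \<le> n) \<and> (t = B1 \<longrightarrow> r < n)"

lemma KR_typeD: "KR_type r \<Longrightarrow> r \<le> n" "KR_type r \<Longrightarrow> t = D1 \<Longrightarrow> r + 2 \<le> n" "KR_type r \<Longrightarrow> t = B1 \<Longrightarrow> r < n"
  unfolding KR_type_def by blast+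

lemma KR_type_1: "KR_type 1"
  unfolding KR_type_def using rank rankD by auto

text \<open>The last condition is the requirement of type C that no column of height n is left in
  the inner shape; in the other types r < n.\<close>

definition pmd :: "nat \<Rightarrow> nat \<Rightarrow> pmcount \<Rightarrow> bool" where
  "pmd r k D \<longleftrightarrow> pm_valid r D \<and> length (pcols D r) = k \<and> Nn D n = 0"

lemma pmd_Sdata: "pmd r k D \<Longrightarrow> KR_type r \<Longrightarrow> pmd r k (Sdata r D)"
  unfolding pmd_def using pm_valid_Sdata S_graph_Sdata(2)[of r D k]
  by (auto simp: Sdata_sel KR_type_def)

lemma pmd_hwdata: "\<mu> \<in> KR_shapes r k \<Longrightarrow> pmd r k (hwdata k \<mu>)"
  using pm_valid_hwdata length_hwdata rank unfolding pmd_def by (simp add: hwdata_sel)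

abbreviation Ph :: "nat \<Rightarrow> pmcount \<Rightarrow> tableau" where
  "Ph r D \<equiv> Phi n (pm_of (pcols D r))"

lemma KR_pm_pmd: "pmd r k D \<Longrightarrow> KR_type r \<Longrightarrow> KR_pm t n r k (pm_of (pcols D r))"
  using KR_pm_pm_of[of r D k t n] rank unfolding pmd_def KR_type_def by simp

lemma Ph_hwdata: "\<mu> \<in> KR_shapes r k \<Longrightarrow> KR_type r \<Longrightarrow> Ph r (hwdata k \<mu>) = hw_tableau \<mu>"
  using Phi_hwdata KR_typeD by blast

lemma sigma_Ph:
  assumes "KR_involution t n r k \<sigma>" "pmd r k D" "KR_type r"
  shows "\<sigma> (Ph r D) = Ph r (Sdata r D)"
proof -
  have "S_graph r k (pm_of (pcols D r)) (pm_of (pcols (Sdata r D) r))"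
    using assms(2) S_graph_Sdata(1) unfolding pmd_def by blast
  then show ?thesis
    using assms(1) KR_pm_pmd[OF assms(2,3)] KR_pm_pmd[OF pmd_Sdata[OF assms(2,3)] assms(3)]
    unfolding KR_involution_def by blast
qed

lemma pmd_slots:
  assumes "pmd r k D" "KR_type r"
  obtains T where "Ph r D = map (asc_col 0) T" "slot_tab T" "turn_ok T"
    "\<And>i. 0 < i \<Longrightarrow> count_list (slots T) i = Pp D i + Bb D (i + 1)"
    "\<And>i. 0 < i \<Longrightarrow> length (filter (\<lambda>(v, g, b). v = i \<and> b = None) T) = Nn D i + Pp D i"
    "length (filter (\<lambda>c. fst c = n) T) = Nn D n + Pp D n"
    "map (\<lambda>(v, g, b). v + (if b = None then 0 else 1)) T = filter (\<lambda>h. 0 < h) (map (\<lambda>c. snd (snd c)) (pcols D r))"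
proof -
  have V: "pm_valid r D" "Nn D n = 0" using assms(1) unfolding pmd_def by auto
  show thesis
  proof (rule Phi_slots[OF V(1) KR_typeD[OF assms(2)] V(2)])
    fix T assume T: "Ph r D = map (asc_col 0) T" "slot_tab T" "turn_ok T"
    "\<And>i. 0 < i \<Longrightarrow> count_list (slots T) i = Pp D i + Bb D (i + 1)"
    "\<And>i. 0 < i \<Longrightarrow> length (filter (\<lambda>(v, g, b). v = i \<and> b = None) T) = Nn D i + Pp D i"
    "length (filter (\<lambda>c. fst c = n) T) = Nn D n + Pp D n"
    "map (\<lambda>(v, g, b). v + (if b = None then 0 else 1)) T = filter (\<lambda>h. 0 < h) (map (\<lambda>c. snd (snd c)) (pcols D r))"
    show thesis by (rule that[OF T])
  qed
qed

lemma Ph_elts: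
  assumes "pmd r k D" "KR_type r"
  shows "Ph r D \<in> elts (KR_classical t n r k)"
    "tshape (Ph r D) = filter (\<lambda>h. 0 < h) (map (\<lambda>c. snd (snd c)) (pcols D r))"
proof -
  obtain T where T: "Ph r D = map (asc_col 0) T" "slot_tab T" "turn_ok T"
    "map (\<lambda>(v, g, b). v + (if b = None then 0 else 1)) T = filter (\<lambda>h. 0 < h) (map (\<lambda>c. snd (snd c)) (pcols D r))"
    by (rule pmd_slots[OF assms]) (rule that; assumption)
  have KN: "KN (filter (\<lambda>h. 0 < h) (map (\<lambda>c. snd (snd c)) (pcols D r))) (Ph r D)"
    using KN_slots[OF T(2,3)] unfolding T(1,4) .
  then show s: "tshape (Ph r D) = filter (\<lambda>h. 0 < h) (map (\<lambda>c. snd (snd c)) (pcols D r))"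
    unfolding KN_def by simp
  have V: "pm_valid r D" "length (pcols D r) = k" using assms(1) unfolding pmd_def by auto
  have "filter (\<lambda>h. 0 < h) (map (\<lambda>c. snd (snd c)) (pcols D r)) \<in> KR_shapes r k"
    unfolding KR_shapes_def
    using colrel_sorted(3)[OF pcols_sorted[OF V(1)]] V(2) pcols_outer pcols_ok(2)[OF V(1)]
    by (intro CollectI exI[of _ "map (\<lambda>c. snd (snd c)) (pcols D r)"]) auto
  then show "Ph r D \<in> elts (KR_classical t n r k)"
    using KN unfolding s[symmetric] KR_elts[OF KR_typeD(1)[OF assms(2)]] by blast
qed

section \<open>The involution on one-row tableaux\<close>

lemma raise_J:
  assumes i: "i \<in> {2..n}"
  shows "le i 1 = 0" "lp i 1 = 0" "le i (- 1) = 0" "lp i (- 1) = 0"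
  using i rank rankD unfolding le_def lp_def by (cases t; auto)+

lemma weps_J:
  assumes "i \<in> {2..n}" "set u \<subseteq> {1, - 1}"
  shows "weps i u = 0" "wphi i u = 0"
  using assms by (induction u) (auto simp: raise_J)

lemma we_J:
  assumes i: "i \<in> {2..n}" and v: "set v \<subseteq> {1, - 1}"
  shows "we i (w @ v) = map_option (\<lambda>w. w @ v) (we i w)" "wf i (w @ v) = map_option (\<lambda>w. w @ v) (wf i w)"
    "set u \<subseteq> {1, - 1} \<Longrightarrow> set w \<subseteq> elts V \<Longrightarrow> we i (u @ w) = map_option ((@) u) (we i w)"
    "set u \<subseteq> {1, - 1} \<Longrightarrow> wf i (u @ w) = map_option ((@) u) (wf i w)"
proof -
  have E: "eop V i a = None" "fop V i a = None" if "a \<in> {1, - 1}" for a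
    using that i rank rankD unfolding eop_V fop_V by (cases t; auto)+
  have "we i v = None" "wf i v = None" using v by (induction v) (auto simp: E)
  moreover have "weps i (w @ v) = weps i w" for w using weps_J[OF i v] by (simp add: weps_append)
  ultimately show "we i (w @ v) = map_option (\<lambda>w. w @ v) (we i w)" "wf i (w @ v) = map_option (\<lambda>w. w @ v) (wf i w)"
    by (induction w) (auto simp: option.map_comp comp_def)
  have i1: "i \<in> {1..n}" using i by simp
  have c: "map_option ((@) (a # u)) x = map_option ((#) a) (map_option ((@) u) x)" for a :: int and u x
    by (cases x) auto
  show "we i (u @ w) = map_option ((@) u) (we i w)" if "set u \<subseteq> {1, - 1}" "set w \<subseteq> elts V"
    using that(1)
  proof (induction u)
    case (Cons a u)
    have a: "lp i a = 0" "eop V i a = None" using Cons.prems raise_J[OF i] E by auto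
    have "weps i (u @ w) = weps i w" using weps_J[OF i, of u] Cons.prems by (simp add: weps_append)
    then show ?case
      using Cons a we_None[OF i1 that(2)] unfolding c by (cases "weps i w = 0") simp_all
  qed (cases "we i w"; simp)
  show "wf i (u @ w) = map_option ((@) u) (wf i w)" if "set u \<subseteq> {1, - 1}"
    using that
  proof (induction u)
    case (Cons a u)
    have "lp i a = 0" using Cons.prems raise_J[OF i] by auto
    then show ?case using Cons unfolding c by simp
  qed (cases "wf i w"; simp)
qed

lemma we_letters:
  assumes i: "i \<in> {2..n}"
  shows "we i w = Some v \<Longrightarrow> set w \<inter> {1, - 1} = {} \<Longrightarrow> set v \<inter> {1, - 1} = {}"
proof (induction w arbitrary: v)
  case (Cons a w)
  have "b \<notin> {1, - 1}" if "eop V i a = Some b" for b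
    using that i rank rankD unfolding eop_V by (cases t; auto split: if_splits)
  then show ?case using Cons by (auto split: if_splits)
qed simp

lemma J_highest_row:
  "sorted_wrt rowrel w \<Longrightarrow> set w \<subseteq> elts V \<Longrightarrow> \<forall>i\<in>{2..n}. weps i w = 0 \<Longrightarrow> set w \<subseteq> {- 1, 1, 2}"
proof (induction w)
  case (Cons y w)
  show ?case
  proof (cases "y = - 1")
    case True
    then have "\<forall>i\<in>{2..n}. weps i w = 0" using Cons.prems(3) raise_J by auto
    then show ?thesis using Cons True by simp
  next
    case False
    have y: "le i y = 0" if "i \<in> {2..n}" for i using Cons.prems(3) that by auto
    have yV: "\<bar>y\<bar> \<le> int n" "y = 0 \<longrightarrow> t = B1" using Cons.prems(2) by (auto simp: elts_V)
    have "y \<in> {1, 2}"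
    proof (rule ccontr)
      assume n12: "y \<notin> {1, 2}"
      consider "3 \<le> y" | "y = 0" | "y = - int n" | "- int n < y" "y \<le> - 2" using n12 False yV by fastforce
      then show False
      proof cases
        case 1
        have "nat (y - 1) \<in> {2..n}" "le (nat (y - 1)) y = 1" using 1 yV by (auto simp: le_def)
        then show False using y by fastforce
      next
        case 2
        then show False using y[of n, unfolded le_def] yV rank by simp
      next
        case 3
        then show False using y[of n, unfolded le_def] rank by (cases t) simp_all
      next
        case 4
        have "nat (- y) \<in> {2..n}" "le (nat (- y)) y = 1" using 4 by (auto simp: le_def)
        then show False using y by fastforce
      qed
    qed
    then have r: "rr y = y" "1 \<le> y" "y \<le> 2" by (auto simp: rr_def)
    have "z \<in> {1, 2}" if z: "z \<in> set w" for z
    proof -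
      have "rowrel y z" using Cons.prems(1) z by simp
      moreover have "z \<in> elts V" using Cons.prems(2) z by auto
      then have zn: "\<bar>z\<bar> \<le> int n" unfolding elts_V by blast
      moreover have "z \<in> {1, 2} \<or> 3 \<le> rr z" using zn rank unfolding rr_def by auto
      ultimately show ?thesis using r \<open>y \<in> {1, 2}\<close> unfolding rowrel_def by auto
    qed
    then show ?thesis using \<open>y \<in> {1, 2}\<close> by auto
  qed
qed simp

lemma assign_1: "assign (replicate d 1) (replicate (d + b) (1, 1) @ replicate a (0, 1)) =
   replicate d (1, 1, None) @ replicate b (1, 0, None) @ replicate a (0, 0, Some 0)"
proof (induction d)
  case 0
  have "assign [] (replicate a (0, 1)) = replicate a (0, 0, Some 0)" by (induction a) auto
  then show ?case by (induction b) auto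
qed simp

text \<open>For r = 1 a column with + gives the letter 1, one with - gives barred 1, and one without
  symbol gives 2. These are the J-highest rows.\<close>

lemma Ph_row:
  assumes "l = a + b + d"
  shows "pmd 1 l \<lparr> Nn = (\<lambda>i. if i = 1 then b else 0), Pp = (\<lambda>i. if i = 1 then d else 0),
       Mm = (\<lambda>i. if i = 1 then a else 0), Bb = (\<lambda>i. 0) \<rparr>" (is "pmd 1 l ?D")
    and "Ph 1 \<lparr> Nn = (\<lambda>i. if i = 1 then b else 0), Pp = (\<lambda>i. if i = 1 then d else 0),
       Mm = (\<lambda>i. if i = 1 then a else 0), Bb = (\<lambda>i. 0) \<rparr> = row (replicate a (- 1) @ replicate b 2 @ replicate d 1)"
proof -
  have cs: "pcols ?D 1 = replicate b (1, 1, 1) @ replicate d (0, 1, 1) @ replicate a (0, 0, 1)"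
    using pcols_Suc[of ?D 0] by (simp add: pcols_0 pblk_def)
  have v: "pm_valid 1 ?D" by (auto simp: pm_valid_def)
  have N: "Nn ?D n = 0" using rank by simp
  show "pmd 1 l ?D" unfolding pmd_def cs using v N assms by simp
  have f: "filter (\<lambda>c. 0 < snd (snd c)) (pcols ?D 1) = pcols ?D 1" unfolding cs by simp
  have "Ph 1 ?D = map (asc_col 0) (assign (pheights (pcols ?D 1)) (map snd (pcols ?D 1)))"
  proof (rule Phi_slots[OF v KR_typeD[OF KR_type_1] N])
    fix T assume "Ph 1 ?D = map (asc_col 0) T"
      "T = assign (pheights (filter (\<lambda>c. 0 < snd (snd c)) (pcols ?D 1))) (map snd (filter (\<lambda>c. 0 < snd (snd c)) (pcols ?D 1)))"
    then show ?thesis unfolding f by simp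
  qed
  also have "pheights (pcols ?D 1) = replicate d 1" unfolding cs pheights_def by simp
  also have "map snd (pcols ?D 1) = replicate (d + b) (1, 1) @ replicate a (0, 1)"
    unfolding cs by (simp add: replicate_add[symmetric] add.commute)
  finally have "Ph 1 ?D = replicate d [1] @ replicate b [2] @ replicate a [- 1]"
    unfolding assign_1 by (simp add: asc_col_def str_def bar_def)
  then show "Ph 1 ?D = row (replicate a (- 1) @ replicate b 2 @ replicate d 1)" by (simp add: row_def)
qed

lemma rword_012:
  assumes "\<And>a. a \<notin> {- 1, 1, 2} \<Longrightarrow> c a = 0"
  shows "rword c = replicate (c (- 1)) (- 1) @ replicate (c 2) 2 @ replicate (c 1) 1"
proof -
  have 1: "[1..<n + 1] = 1 # [2..<n + 1]" "[1..<n + 1] = [1, 2] @ [3..<n + 1]"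
    using rank upt_rec[of 1 "n + 1"] upt_rec[of 2 "n + 1"] by (auto simp: numeral_2_eq_2 numeral_3_eq_3)
  have z: "blk c as = []" if "set as \<inter> {- 1, 1, 2} = {}" for as
    using that assms by (induction as) (auto simp: blk_simps)
  have "blk c (map (\<lambda>i. - int i) [1..<n + 1]) = replicate (c (- 1)) (- 1)"
    unfolding 1(1) list.map blk_simps by (subst z) auto
  moreover have "blk c (rev (map int [1..<n + 1])) = replicate (c 2) 2 @ replicate (c 1) 1"
    unfolding 1(2) map_append rev_append blk_simps by (subst z) (auto simp: blk_simps)
  moreover have "blk c [0] = []" by (intro z) simp
  ultimately show ?thesis unfolding rword_def ord_def blk_simps(3) by simp
qed

text \<open>The nodes of J see only the middle part \<open>M\<close>, because 1 and barred 1 are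
  neutral for them. Raising with J ends in a row of barred 1s, 2s and 1s, where \<SS> exchanges +
  and -; lowering by the same nodes on the other side of \<sigma> restores \<open>M\<close>.\<close>

lemma sigma_row:
  assumes \<sigma>: "KR_involution t n 1 l \<sigma>" and "T \<in> elts (KR_classical t n 1 l)"
    "reading T = replicate a (- 1) @ M @ replicate d 1" "set M \<inter> {1, - 1} = {}"
  shows "reading (\<sigma> T) = replicate d (- 1) @ M @ replicate a 1"
  using assms(2-4)
proof (induction "sum_list (map rk (reading T))" arbitrary: T M rule: less_induct)
  case less
  have n1: "1 \<le> n" using rank by simp
  note T = less.prems(1) and rT = less.prems(2) and M = less.prems(3)
  have u: "set (replicate a (- 1)) \<subseteq> {1, - 1::int}" "set (replicate d 1) \<subseteq> {1, - 1::int}"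
    "set (replicate d (- 1)) \<subseteq> {1, - 1::int}" "set (replicate a 1) \<subseteq> {1, - 1::int}" by auto
  have TV: "set (reading T) \<subseteq> elts V" using KR_elts[OF n1] T unfolding KN_def tab_def by simp
  show ?case
  proof (cases "\<exists>i\<in>{2..n}. eop (KR_classical t n 1 l) i T \<noteq> None")
    case True
    then obtain i U where i: "i \<in> {2..n}" and U: "eop (KR_classical t n 1 l) i T = Some U" by blast
    have i1: "i \<in> {1..n}" using i by simp
    note UT = KR_eop_D[OF n1 T i1 U]
    have UU: "we i (replicate a (- 1) @ M @ replicate d 1) = Some (reading U)" using UT(2) rT by simp
    have TVr: "set (M @ replicate d 1) \<subseteq> elts V" using TV rT by simp
    obtain M' where M': "we i M = Some M'" "reading U = replicate a (- 1) @ M' @ replicate d 1"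
      using UU unfolding we_J(3)[OF i u(2) u(1) TVr] we_J(1)[OF i u(2)] by auto
    have "set M \<subseteq> elts V" using TV rT by simp
    then have wf: "wf i M' = Some M" using we_in[OF i1 _ M'(1)] by blast
    have "sum_list (map rk (reading U)) < sum_list (map rk (reading T))" using we_rk[OF UT(2) TV] .
    from less.hyps[OF this UT(1) M'(2) we_letters[OF i M'(1) M]]
    have \<sigma>U: "reading (\<sigma> U) = replicate d (- 1) @ M' @ replicate a 1" .
    have "fop (KR_classical t n 1 l) i U = Some T" using seminormal_eD(2)[OF seminormal_KR[OF n1 i1] T U] .
    then have "fop (KR_classical t n 1 l) i (\<sigma> U) = Some (\<sigma> T)"
      using KR_involutionD(4)[OF \<sigma> UT(1) i] by simp
    from KR_fop_D(2)[OF n1 KR_involutionD(1)[OF \<sigma> UT(1)] i1 this]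
    show ?thesis unfolding \<sigma>U we_J(4)[OF i u(4) u(3)] we_J(2)[OF i u(4)] wf by simp
  next
    case False
    have z: "weps i (reading T) = 0" if i: "i \<in> {2..n}" for i
    proof -
      have i1: "i \<in> {1..n}" using i by simp
      have "eop (KR_classical t n 1 l) i T = None" using False i by blast
      then show ?thesis using seminormal_None(1)[OF seminormal_KR[OF n1 i1] T] by simp
    qed
    define c where "c = (\<lambda>a. count_list (reading T) a)"
    have Tc: "T = row (rword c)" "row_ok c" "length (reading T) = l" using KR_row[OF T] unfolding c_def by auto
    have rc: "reading T = rword c" using arg_cong[OF Tc(1), of reading] by simp
    have "set (reading T) \<subseteq> {- 1, 1, 2}"
      using J_highest_row[OF _ TV] sorted_ord[OF Tc(2)] rc z by simp
    then have c0: "c x = 0" if "x \<notin> {- 1, 1, 2}" for x using that unfolding c_def by (intro count_notin) blast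
    have w: "reading T = replicate (c (- 1)) (- 1) @ replicate (c 2) 2 @ replicate (c 1) 1"
      using rword_012[OF c0] rc by simp
    have ca: "c (- 1) = a" "c 1 = d"
      unfolding c_def rT using M by (auto simp: count_list_append count_replicate count_notin)
    have "M = replicate (c 2) 2" using w unfolding ca rT by simp
    define b where "b = c 2"
    have l: "l = a + b + d" "l = d + b + a" using Tc(3) unfolding w ca b_def by auto
    note P = Ph_row[OF l(1)] and P' = Ph_row[OF l(2)]
    have "T = row (reading T)" using Tc(1) rc by simp
    then have T': "T = row (replicate a (- 1) @ replicate b 2 @ replicate d 1)" unfolding w ca b_def .
    have "Sdata 1 \<lparr> Nn = (\<lambda>i. if i = 1 then b else 0), Pp = (\<lambda>i. if i = 1 then d else 0),
       Mm = (\<lambda>i. if i = 1 then a else 0), Bb = (\<lambda>i. 0) \<rparr> =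
       \<lparr> Nn = (\<lambda>i. if i = 1 then b else 0), Pp = (\<lambda>i. if i = 1 then a else 0),
       Mm = (\<lambda>i. if i = 1 then d else 0), Bb = (\<lambda>i. 0) \<rparr>"
      unfolding Sdata_def by auto
    then have "\<sigma> T = row (replicate d (- 1) @ replicate b 2 @ replicate a 1)"
      using sigma_Ph[OF \<sigma> P(1) KR_type_1] P(2) P'(2) T' by simp
    then show ?thesis using \<open>M = replicate (c 2) 2\<close> b_def by simp
  qed
qed

lemma sigma_rword:
  assumes \<sigma>: "KR_involution t n 1 l \<sigma>" and T: "row (rword c) \<in> elts (KR_classical t n 1 l)"
  shows "\<sigma> (row (rword c)) = row (rword (c(1 := c (- 1), - 1 := c 1)))"
proof -
  have n1: "1 \<le> n" using rank by simp
  have s: "[1..<n + 1] = 1 # [2..<n + 1]"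
    using rank upt_rec[of 1 "n + 1"] by (auto simp: numeral_2_eq_2)
  define os where "os = map (\<lambda>i. - int i) [2..<n + 1] @ [0] @ rev (map int [2..<n + 1])"
  have o: "rword c = replicate (c (- 1)) (- 1) @ blk c os @ replicate (c 1) 1" for c
    unfolding rword_def ord_def s os_def by (simp add: blk_simps)
  have os: "set os \<inter> {1, - 1} = {}" unfolding os_def by auto
  then have "set (blk c os) \<inter> {1, - 1} = {}" for c using set_blk by fast
  then have "reading (\<sigma> (row (rword c))) = replicate (c 1) (- 1) @ blk c os @ replicate (c (- 1)) 1"
    using sigma_row[OF \<sigma> T, of "c (- 1)" "blk c os" "c 1"] o by simp
  also have "blk c os = blk (c(1 := c (- 1), - 1 := c 1)) os" using os by (intro blk_cong) auto
  finally have e: "reading (\<sigma> (row (rword c))) = rword (c(1 := c (- 1), - 1 := c 1))" unfolding o by simp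
  have "\<sigma> (row (rword c)) \<in> elts (KR_classical t n 1 l)" using KR_involutionD(1)[OF \<sigma> T] .
  then have "\<sigma> (row (rword c)) = row (reading (\<sigma> (row (rword c))))" using KR_row(1) by (metis reading_row)
  then show ?thesis unfolding e .
qed

end

section \<open>Paths of maximal raisings\<close>

context vec
begin

definition wtw :: "int list \<Rightarrow> nat \<Rightarrow> int" where
  "wtw w j = int (count_list w (int j)) - int (count_list w (- int j))"

lemma wtw_simps: "wtw [] j = 0" "wtw (a # w) j = wtw [a] j + wtw w j" "wtw (u @ w) j = wtw u j + wtw w j"
  by (simp_all add: wtw_def count_list_append)

text \<open>The coordinates of the i-th simple root; \<open>coroot\<close> is the pairing with the
  i-th simple coroot.\<close>

definition alpha :: "nat \<Rightarrow> nat \<Rightarrow> int" where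
  "alpha i j = (if i < n then (if j = i then 1 else if j = i + 1 then - 1 else 0)
     else case t of D1 \<Rightarrow> if j = n \<or> j = n - 1 then 1 else 0 | B1 \<Rightarrow> if j = n then 1 else 0
       | A2odd \<Rightarrow> if j = n then 2 else 0)"

definition coroot :: "nat \<Rightarrow> (nat \<Rightarrow> int) \<Rightarrow> int" where
  "coroot i p = (if i < n then p i - p (i + 1)
     else case t of D1 \<Rightarrow> p (n - 1) + p n | B1 \<Rightarrow> 2 * p n | A2odd \<Rightarrow> p n)"

lemma coroot_add: "coroot i (\<lambda>j. p j + q j) = coroot i p + coroot i q"
  unfolding coroot_def by (simp split: affine_type.split)

lemma letter_coroot:
  assumes "i \<in> {1..n}" "a \<in> elts V"
  shows "int (lp i a) - int (le i a) = coroot i (wtw [a])"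
proof -
  have e: "int (n - 1) = int n - 1" using rank by simp
  show ?thesis
  proof (cases "i < n")
    case True
    consider "a = int i" | "a = int i + 1" | "a = - int i" | "a = - int i - 1"
      | "a \<noteq> int i" "a \<noteq> int i + 1" "a \<noteq> - int i" "a \<noteq> - int i - 1" by blast
    then show ?thesis using True assms(1) unfolding coroot_def lp_def le_def wtw_def
      by cases auto
  next
    case False
    then have i: "i = n" using assms(1) by simp
    consider "a = int n" | "a = int n - 1" | "a = - int n" | "a = 1 - int n" | "a = 0"
      | "a \<noteq> int n" "a \<noteq> int n - 1" "a \<noteq> - int n" "a \<noteq> 1 - int n" "a \<noteq> 0" by blast
    then show ?thesis using rank unfolding i coroot_def lp_def le_def wtw_def
      by cases (cases t; simp add: e)+
  qed
qed

lemma word_coroot: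
  assumes "i \<in> {1..n}"
  shows "set w \<subseteq> elts V \<Longrightarrow> int (wphi i w) - int (weps i w) = coroot i (wtw w)"
proof (induction w)
  case Nil
  show ?case unfolding coroot_def wtw_def by (simp split: affine_type.split)
next
  case (Cons a w)
  have "wtw (a # w) = (\<lambda>j. wtw [a] j + wtw w j)" using wtw_simps(2) by blast
  then show ?case using Cons letter_coroot[OF assms, of a] by (simp add: coroot_add)
qed

lemma letter_alpha:
  assumes "i \<in> {1..n}" "a \<in> elts V" "eop V i a = Some b" "1 \<le> j"
  shows "wtw [b] j = wtw [a] j + alpha i j"
proof -
  have e: "int (n - 1) = int n - 1" using rank by simp
  show ?thesis
  proof (cases "i < n")
    case True
    then have "a = int i + 1 \<and> b = int i \<or> a = - int i \<and> b = - int i - 1"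
      using assms(1,3) unfolding eop_V by (auto split: if_splits)
    moreover have nn: "- int i \<noteq> int j" "- int i - 1 \<noteq> int j" "int i + 1 \<noteq> - int j" "int i \<noteq> - int j"
      "int i + 1 = int j \<longleftrightarrow> j = i + 1" "- int i - 1 = - int j \<longleftrightarrow> j = i + 1"
      using assms(1,4) by auto
    ultimately show ?thesis using True assms(1,4) unfolding alpha_def wtw_def
      by (elim disjE conjE) (simp_all add: nn)
  next
    case False
    then have i: "i = n" using assms(1) by simp
    have n1: "int n - 1 = int j \<longleftrightarrow> j = n - 1" "1 - int n = - int j \<longleftrightarrow> j = n - 1" using rank by auto
    have ab: "t = D1 \<and> (a = - int n \<and> b = int n - 1 \<or> a = 1 - int n \<and> b = int n) \<or>
      t = B1 \<and> (a = 0 \<and> b = int n \<or> a = - int n \<and> b = 0) \<or> t = A2odd \<and> a = - int n \<and> b = int n"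
      using assms(3) unfolding i eop_V by (cases t) (auto split: if_splits)
    consider "j = n" | "j = n - 1" | "j \<noteq> n" "j \<noteq> n - 1" by blast
    then show ?thesis using ab rank assms(4) unfolding i alpha_def wtw_def
      by cases (elim disjE conjE; simp add: e n1)+
  qed
qed

lemma we_alpha:
  assumes "i \<in> {1..n}" "1 \<le> j"
  shows "set w \<subseteq> elts V \<Longrightarrow> we i w = Some v \<Longrightarrow> wtw v j = wtw w j + alpha i j"
proof (induction w arbitrary: v)
  case (Cons a w)
  show ?case
  proof (cases "lp i a \<ge> weps i w")
    case True
    then obtain b where b: "eop V i a = Some b" "v = b # w" using Cons.prems by auto
    show ?thesis using letter_alpha[OF assms(1) _ b(1) assms(2)] Cons.prems(1) unfolding b(2)
      by (simp add: wtw_simps(2)[of _ w])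
  next
    case False
    then obtain u where u: "we i w = Some u" "v = a # u" using Cons.prems by auto
    show ?thesis using Cons.IH[OF _ u(1)] Cons.prems(1) unfolding u(2)
      by (simp add: wtw_simps(2)[of _ w] wtw_simps(2)[of _ u])
  qed
qed simp

lemma E_alpha:
  assumes i: "i \<in> {1..n}" and j: "1 \<le> j" and w: "set w \<subseteq> elts V"
  shows "wtw (E i w) j = wtw w j + int (weps i w) * alpha i j"
proof -
  have "set w \<subseteq> elts V \<Longrightarrow> iter_op (we i) m w = Some v \<Longrightarrow> wtw v j = wtw w j + int m * alpha i j" for m v w
  proof (induction m arbitrary: w)
    case (Suc m)
    then obtain u where u: "we i w = Some u" "iter_op (we i) m u = Some v"
      by (cases "we i w") (auto simp: iter_op_Suc)
    have "set u \<subseteq> elts V" using we_in[OF i Suc.prems(1) u(1)] by blast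
    then show ?case using Suc.IH[OF _ u(2)] we_alpha[OF i j Suc.prems(1) u(1)]
      by (simp add: algebra_simps)
  qed simp
  then show ?thesis using iter_raise[OF i w, of 0] w by simp
qed

primrec strs :: "nat list \<Rightarrow> int list \<Rightarrow> nat list" where
  "strs [] w = []"
| "strs (k # ks) w = weps k w # strs ks (E k w)"

primrec phis :: "nat list \<Rightarrow> int list \<Rightarrow> nat list" where
  "phis [] w = []"
| "phis (k # ks) w = wphi k w # phis ks (E k w)"

lemma phis_append: "phis (ks @ ks') w = phis ks w @ phis ks' (Es ks w)"
  by (induction ks arbitrary: w) auto

lemma strs_append: "strs (ks @ ks') w = strs ks w @ strs ks' (Es ks w)"
  by (induction ks arbitrary: w) auto

lemma length_strs [simp]: "length (strs ks w) = length ks"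
  by (induction ks arbitrary: w) auto

text \<open>Both words end in the same weight; going backwards, \<open>\<phi>\<close> before a step and the weight
  after it determine the exponent of the step and the weight before it.\<close>

lemma strs_eq:
  assumes "set ks \<subseteq> {1..n}" "set w \<subseteq> elts V" "set w' \<subseteq> elts V" "phis ks w = phis ks w'"
    "\<And>j. j \<in> {1..n} \<Longrightarrow> wtw (Es ks w) j = wtw (Es ks w') j"
  shows "strs ks w = strs ks w' \<and> (\<forall>j\<in>{1..n}. wtw w j = wtw w' j)"
  using assms
proof (induction ks arbitrary: w w')
  case (Cons k ks)
  have k: "k \<in> {1..n}" using Cons.prems(1) by simp
  note F = raise_facts[OF k Cons.prems(2), of 0] and F' = raise_facts[OF k Cons.prems(3), of 0]
  have IH: "strs ks (E k w) = strs ks (E k w') \<and> (\<forall>j\<in>{1..n}. wtw (E k w) j = wtw (E k w') j)"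
    using Cons.prems F(1) F'(1) by (intro Cons.IH) auto
  have "coroot k (wtw (E k w)) = coroot k (wtw (E k w'))"
    using IH k rank unfolding coroot_def by (auto split: affine_type.split)
  then have "wphi k w + weps k w = wphi k w' + weps k w'"
    using word_coroot[OF k F(1)] word_coroot[OF k F'(1)] F(2,3) F'(2,3) by simp
  then have e: "weps k w = weps k w'" using Cons.prems(4) by simp
  then have "wtw w j = wtw w' j" if "j \<in> {1..n}" for j
    using IH E_alpha[OF k _ Cons.prems(2), of j] E_alpha[OF k _ Cons.prems(3), of j] that by simp
  then show ?case using IH e by simp
qed simp

text \<open>The word of a tensor product is the concatenation of the two words, and the second part
  is raised with \<phi> of the first as its shield, exactly as in the tensor product. The cut
  between the two factors is recovered from the shapes.\<close>

lemma pair_run: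
  assumes r: "r \<le> n" "r' \<le> n" and "T \<in> elts (KR_classical t n r k)" "Y \<in> elts (KR_classical t n r' k')"
    and "set ks \<subseteq> {1..n}" "Es ks (reading T @ reading Y) = reading T1 @ reading Y1"
    "tshape T1 = tshape T" "tshape Y1 = tshape Y"
  shows "run (tensor (KR_crystal t n r k \<sigma>) (KR_crystal t n r' k' \<sigma>')) (zip ks (strs ks (reading T @ reading Y))) (T, Y)
    = Some (T1, Y1)"
  using assms(3-)
proof (induction ks arbitrary: T Y)
  case Nil
  then have "reading T = reading T1 \<and> reading Y = reading Y1"
    using length_reading[of T] length_reading[of T1] by (simp add: append_eq_append_conv)
  then show ?case using Nil reading_inj[of T T1] reading_inj[of Y Y1] by simp
next
  case (Cons i ks)
  have i: "i \<in> {1..n}" using Cons.prems(3) by simp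
  note T = Cons.prems(1) and Y = Cons.prems(2)
  have w: "set (reading T) \<subseteq> elts V" "set (reading Y) \<subseteq> elts V"
    using T Y KR_elts[OF r(1)] KR_elts[OF r(2)] unfolding KN_def tab_def by auto
  define T' where "T' = unread (tshape T) (E i (reading T))"
  define Y' where "Y' = unread (tshape Y) (raise i (wphi i (reading T)) (reading Y))"
  have T': "reading T' = E i (reading T)" "tshape T' = tshape T"
    unfolding T'_def by (simp_all add: reading_unread tshape_unread length_reading)
  have Y': "reading Y' = raise i (wphi i (reading T)) (reading Y)" "tshape Y' = tshape Y"
    unfolding Y'_def by (simp_all add: reading_unread tshape_unread length_reading)
  have iT: "iter_op (eop (KR_classical t n r k) i) (weps i (reading T)) T = Some T'"
    using KR_iter_e[OF r(1) i T T'(2)] iter_raise[OF i w(1), of 0] T'(1) by simp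
  have iY: "iter_op (eop (KR_classical t n r' k') i) (weps i (reading Y) - wphi i (reading T)) Y = Some Y'"
    using KR_iter_e[OF r(2) i Y Y'(2)] iter_raise[OF i w(2), of "wphi i (reading T)"] Y'(1) by simp
  note sT = seminormal_KR_crystal[OF r(1) i, of k \<sigma>] and sY = seminormal_KR_crystal[OF r(2) i, of k' \<sigma>']
  have i0: "i \<noteq> 0" using i by simp
  have step: "iter_op (eop (tensor (KR_crystal t n r k \<sigma>) (KR_crystal t n r' k' \<sigma>')) i)
      (weps i (reading T @ reading Y)) (T, Y) = Some (T', Y')"
    using iter_e_tensor[OF sT sY, of T Y Y' "weps i (reading T)" T'] T Y iT iY
    by (simp add: ops_KR_crystal(1)[OF i0] weps_append add.commute)
  have mem: "T' \<in> elts (KR_classical t n r k)" "Y' \<in> elts (KR_classical t n r' k')"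
    using iter_e_props(1)[OF seminormal_KR[OF r(1) i] T iT] iter_e_props(1)[OF seminormal_KR[OF r(2) i] Y iY] by auto
  have E: "E i (reading T @ reading Y) = reading T' @ reading Y'"
    unfolding T' Y' by (simp add: raise_append st_eq)
  have "run (tensor (KR_crystal t n r k \<sigma>) (KR_crystal t n r' k' \<sigma>')) (zip ks (strs ks (reading T' @ reading Y'))) (T', Y')
    = Some (T1, Y1)"
    using Cons.prems(3-6) by (intro Cons.IH mem) (simp_all add: E T'(2) Y'(2))
  then show ?case by (simp add: step E)
qed

end

section \<open>The two sides of the correspondence along the path\<close>

lemma int_Suc: "- int (Suc i) = - int i - 1" "int (Suc i) = int i + 1"
  by simp_all

context vec
begin

lemma asc_seg:
  assumes "\<And>i w. a \<le> i \<Longrightarrow> i < m \<Longrightarrow> I i w \<Longrightarrow> I (Suc i) (E i w) \<and> wphi i w = f i" "a \<le> m" "I a w"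
  shows "I m (Es [a..<m] w) \<and> phis [a..<m] w = map f [a..<m]"
  using assms(2,1)
proof (induction m rule: dec_induct)
  case base
  then show ?case using assms(3) by simp
next
  case (step m)
  then have "I m (Es [a..<m] w) \<and> phis [a..<m] w = map f [a..<m]" by simp
  then show ?case using step by (simp add: phis_append)
qed

lemma desc_seg:
  assumes "\<And>i w. a \<le> i \<Longrightarrow> i < m \<Longrightarrow> I (Suc i) w \<Longrightarrow> I i (E i w) \<and> wphi i w = f i" "a \<le> m" "I m w"
  shows "I a (Es (rev [a..<m]) w) \<and> phis (rev [a..<m]) w = map f (rev [a..<m])"
  using assms(2,1,3)
proof (induction m arbitrary: w rule: dec_induct)
  case base
  then show ?case by simp
next
  case (step m)
  have "I m (E m w) \<and> wphi m w = f m" using step.prems step.hyps by simp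
  moreover have "I a (Es (rev [a..<m]) (E m w)) \<and> phis (rev [a..<m]) (E m w) = map f (rev [a..<m])"
    using step.prems calculation by (intro step.IH) auto
  ultimately show ?case using step.hyps by simp
qed

text \<open>The path without its two ends, the only places where the node 1 occurs. In type D the
  node n - 1 is passed on the way up but not on the way back, since e_n takes barred n directly to
  the letter n - 1.\<close>

definition mid :: "nat list" where
  "mid = [2..<n] @ [n] @ rev [2..<top]"

definition path :: "nat list" where
  "path = [1] @ mid @ [1]"

lemma path_set: "set path \<subseteq> {1..n}" "set mid \<subseteq> {2..n}"
  using rank top_le by (auto simp: path_def mid_def)

text \<open>\<open>I\<close> and \<open>J\<close> are the invariants of the way up and of the way
  back. The two ends are left to the caller, because for \<mu> \<otimes> x the shield of the added
  columns enters at the first node and the retained barred 1s are released at the last one.\<close>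

lemma path_seg:
  assumes 1: "I 2 (E 1 w)"
    and asc: "\<And>i w. 2 \<le> i \<Longrightarrow> i < n \<Longrightarrow> I i w \<Longrightarrow> I (Suc i) (E i w) \<and> wphi i w = f i"
    and turn: "\<And>w. I n w \<Longrightarrow> J top (E n w) \<and> wphi n w = x"
    and desc: "\<And>i w. 2 \<le> i \<Longrightarrow> i < n \<Longrightarrow> J (Suc i) w \<Longrightarrow> J i (E i w) \<and> wphi i w = g i"
  shows "J 2 (Es mid (E 1 w))"
    "phis path w = [wphi 1 w] @ (map f [2..<n] @ [x] @ map g (rev [2..<top])) @ [wphi 1 (Es mid (E 1 w))]"
proof -
  have n: "2 \<le> n" "2 \<le> top" "top \<le> n" using rank top_le by auto
  have A: "I n (Es [2..<n] (E 1 w)) \<and> phis [2..<n] (E 1 w) = map f [2..<n]"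
    by (rule asc_seg[where I = I and f = f, OF asc n(1) 1])
  note B = turn[OF conjunct1[OF A]]
  have C: "J 2 (Es (rev [2..<top]) (E n (Es [2..<n] (E 1 w)))) \<and>
      phis (rev [2..<top]) (E n (Es [2..<n] (E 1 w))) = map g (rev [2..<top])"
    using n(3) by (intro desc_seg[where I = J and f = g, OF desc n(2) conjunct1[OF B]]) auto
  show "J 2 (Es mid (E 1 w))" using C by (simp add: mid_def)
  show "phis path w = [wphi 1 w] @ (map f [2..<n] @ [x] @ map g (rev [2..<top])) @ [wphi 1 (Es mid (E 1 w))]"
    using A B C by (simp add: path_def mid_def phis_append)
qed

section \<open>A row of equal letters in front of the columns\<close>

lemma raise_row_single:
  assumes "1 \<le> i" "i < n"
  shows "E i (replicate l (- int i)) = replicate l (- int i - 1)" "st i 0 (replicate l (- int i)) = 0"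
    "E i (replicate l (int i + 1)) = replicate l (int i)" "st i 0 (replicate l (int i + 1)) = 0"
  using raise_minus[OF assms, of "- int i" 0 l] raise_minus[OF assms, of "int i + 1" 0 l] by simp_all

lemma raise_row_turn:
  "E n (replicate l (- int n)) = replicate l (int top)" "st n 0 (replicate l (- int n)) = 0"
proof -
  have "E n (replicate l (- int n)) = replicate l (int top) \<and> st n 0 (replicate l (- int n)) = 0"
  proof (induction l)
    case (Suc l)
    have "raise n 0 [- int n] = [int top] \<and> st n 0 [- int n] = 0"
      using turn_letters[of 0] rank rankD by simp
    then show ?case using Suc raise_append[of n 0 "[- int n]"] st_append[of n 0 "[- int n]"] by simp
  qed simp
  then show "E n (replicate l (- int n)) = replicate l (int top)" "st n 0 (replicate l (- int n)) = 0" by auto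
qed

lemma wphi_st: "wphi i w = st i 0 w"
  by (simp add: st_eq)

text \<open>The side \<open>1\<^sup>l \<otimes> \<Phi>(P)\<close>, after exchanging the nodes 0 and 1.\<close>

lemma right_side:
  assumes D: "pmd r k D" "KR_type r" and w: "w = replicate l (- 1) @ reading (Ph r D)"
    and hs: "filter (\<lambda>h. 0 < h) (map (\<lambda>c. snd (snd c)) (pcols D r)) = \<nu>"
  shows "Es path w = replicate l 1 @ reading (hw_tableau \<nu>)"
    "\<exists>v. Es mid (E 1 w) = replicate l 2 @ v"
    "phis path w = [Pp D 1 + Bb D 2] @ (map (\<lambda>i. Pp D i + Bb D (i + 1)) [2..<n] @ [Nn D n + Pp D n] @ map (\<lambda>i. Nn D i + Pp D i) (rev [2..<top])) @ [Nn D 1 + Pp D 1]"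
proof -
  obtain T where T: "Ph r D = map (asc_col 0) T" "slot_tab T" "turn_ok T"
    "\<And>i. 0 < i \<Longrightarrow> count_list (slots T) i = Pp D i + Bb D (i + 1)"
    "\<And>i. 0 < i \<Longrightarrow> length (filter (\<lambda>(v, g, b). v = i \<and> b = None) T) = Nn D i + Pp D i"
    "length (filter (\<lambda>c. fst c = n) T) = Nn D n + Pp D n"
    "map (\<lambda>(v, g, b). v + (if b = None then 0 else 1)) T = filter (\<lambda>h. 0 < h) (map (\<lambda>c. snd (snd c)) (pcols D r))"
    by (rule pmd_slots[OF D]) (rule that; (assumption | blast))
  have n: "1 < n" using rank by simp
  have T1: "sorted_wrt (\<ge>) (map fst T)" using T(2) by (simp add: slot_tab_def)
  define I where "I = (\<lambda>i w. w = replicate l (- int i) @ reading (map (asc_col (i - 1)) T))"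
  define J where "J = (\<lambda>i w. w = replicate l (int i) @ reading (map (desc_col i) T))"
  define f where "f = (\<lambda>i. Pp D i + Bb D (i + 1))"
  define g where "g = (\<lambda>i. Nn D i + Pp D i)"
  \<comment> \<open>Letters barred i are all raised and leave state 0, so the columns behind them
    move as if they stood alone.\<close>
  have asc: "I (Suc i) (E i w) \<and> wphi i w = f i" if "1 \<le> i" "i < n" "I i w" for i w
    using that raise_row_single[OF that(1,2), of l] asc_step[OF that(1,2) T(2)] T(4)[of i]
    unfolding I_def f_def wphi_st by (simp add: raise_append st_append)
  have turn: "J top (E n w) \<and> wphi n w = Nn D n + Pp D n" if "I n w" for w
    using that raise_row_turn[of l] turn_step[OF T(2,3)] T(6)
    unfolding I_def J_def wphi_st by (simp add: raise_append st_append)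
  have desc: "J i (E i w) \<and> wphi i w = g i" if "1 \<le> i" "i < n" "J (Suc i) w" for i w
    using that raise_row_single[OF that(1,2), of l] desc_step[OF that(1,2) T1] T(5)[of i]
    unfolding J_def g_def wphi_st by (simp add: raise_append st_append add.commute)
  have w1: "I 1 w" unfolding I_def w T(1) by simp
  note S = asc[OF order_refl n w1]
  have S2: "I 2 (E 1 w)" using S by (simp add: numeral_2_eq_2)
  have P: "J 2 (Es mid (E 1 w))"
    "phis path w = [wphi 1 w] @ (map f [2..<n] @ [Nn D n + Pp D n] @ map g (rev [2..<top])) @ [wphi 1 (Es mid (E 1 w))]"
    by (rule path_seg[where I = I and J = J, OF S2 asc turn desc]; simp)+
  have P1: "J (Suc 1) (Es mid (E 1 w))" using P(1) by (simp add: numeral_2_eq_2)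
  note Q = desc[OF order_refl n P1]
  have "Es path w = E 1 (Es mid (E 1 w))" by (simp add: path_def)
  also have "\<dots> = replicate l 1 @ reading (map (desc_col 1) T)" using Q by (simp add: J_def)
  finally show "Es path w = replicate l 1 @ reading (hw_tableau \<nu>)" using desc_final[of T] T(7) hs by simp
  show "\<exists>v. Es mid (E 1 w) = replicate l 2 @ v" using P(1) by (auto simp: J_def)
  have "f 1 = Pp D 1 + Bb D 2" using n by (simp add: f_def numeral_2_eq_2)
  then show "phis path w = [Pp D 1 + Bb D 2] @ (map (\<lambda>i. Pp D i + Bb D (i + 1)) [2..<n] @ [Nn D n + Pp D n] @ map (\<lambda>i. Nn D i + Pp D i) (rev [2..<top])) @ [Nn D 1 + Pp D 1]"
    using P(2) S Q unfolding f_def[symmetric] g_def[symmetric] by (simp add: g_def)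
qed

text \<open>The conditions on \<open>x\<close> for \<open>\<mu> \<otimes> x\<close> to be of highest weight.\<close>

definition dom :: "nat \<Rightarrow> nat list \<Rightarrow> (int \<Rightarrow> nat) \<Rightarrow> bool" where
  "dom r \<mu> c \<longleftrightarrow> c 0 = 0 \<and> (\<forall>a. int n < \<bar>a\<bar> \<longrightarrow> c a = 0) \<and> (\<forall>i\<ge>1. odd (r + i) \<longrightarrow> c (- int i) = 0) \<and>
     (\<forall>i\<ge>2. even (r + i) \<longrightarrow> c (int i) \<le> c (- int i)) \<and>
     (\<forall>i\<ge>1. even (r + i) \<longrightarrow> c (- int i) + c (int i + 1) \<le> count_list \<mu> i)"

lemma domD:
  assumes "dom r \<mu> c"
  shows "c 0 = 0" "int n < \<bar>a\<bar> \<Longrightarrow> c a = 0" "1 \<le> i \<Longrightarrow> odd (r + i) \<Longrightarrow> c (- int i) = 0"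
    "2 \<le> i \<Longrightarrow> even (r + i) \<Longrightarrow> c (int i) \<le> c (- int i)"
    "1 \<le> i \<Longrightarrow> even (r + i) \<Longrightarrow> c (- int i) + c (int i + 1) \<le> count_list \<mu> i"
  using assms unfolding dom_def by blast+

lemma dom_high:
  assumes "dom r \<mu> c" "\<And>h. h \<in> set \<mu> \<Longrightarrow> h \<le> r"
  shows "r < i \<Longrightarrow> c (- int i) = 0" "1 \<le> r \<Longrightarrow> r + 1 < i \<Longrightarrow> c (int i) = 0"
proof -
  have z: "count_list \<mu> j = 0" if "r < j" for j using assms(2)[of j] that by (intro count_notin) auto
  show *: "c (- int i) = 0" if "r < i" for i
    using domD(3)[OF assms(1), of i] domD(5)[OF assms(1), of i] z[of i] that by (cases "odd (r + i)") auto
  show "c (int i) = 0" if "1 \<le> r" "r + 1 < i"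
  proof (cases "odd (r + i)")
    case False
    then show ?thesis using domD(4)[OF assms(1), of i] * that by simp
  next
    case True
    define j where "j = i - 1"
    then have i: "i = Suc j" "r < j" using that by auto
    then show ?thesis using True domD(5)[OF assms(1), of j] z[of j] by (simp add: add.commute)
  qed
qed

text \<open>The row after the nodes 1, ..., i. The number \<open>C\<close> counts the barred 1s that
  were shielded at the first node and stay until the last one. The multiplicity of barred i + 1,
  where the raised barred letters gather, is left open: the length of the row, carried along
  separately, takes its place.\<close>

definition asc_row :: "nat \<Rightarrow> nat \<Rightarrow> (int \<Rightarrow> nat) \<Rightarrow> nat \<Rightarrow> (int \<Rightarrow> nat) \<Rightarrow> bool" where
  "asc_row r C c i d \<longleftrightarrow> d (- 1) = C \<and> d 0 = 0 \<and> d 1 = (if odd r then c (- 1) + c 2 else 0) \<and>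
     (\<forall>j. 2 \<le> j \<and> j \<le> i \<longrightarrow> d (- int j) = 0) \<and> (\<forall>j>i + 1. d (- int j) = c (- int j)) \<and>
     (\<forall>j. 2 \<le> j \<and> j \<le> i \<longrightarrow> d (int j) = (if even (r + j) then c (int j) + c (int j + 1) else 0)) \<and>
     d (int i + 1) = (if even (r + i + 1) then c (int i + 1) else 0) \<and> (\<forall>j>i + 1. d (int j) = c (int j))"

definition desc_row :: "nat \<Rightarrow> nat \<Rightarrow> (int \<Rightarrow> nat) \<Rightarrow> nat \<Rightarrow> (int \<Rightarrow> nat) \<Rightarrow> bool" where
  "desc_row r C c i d \<longleftrightarrow> d (- 1) = C \<and> d 0 = 0 \<and> d 1 = (if odd r then c (- 1) + c 2 else 0) \<and>
     (\<forall>j\<ge>2. d (- int j) = 0) \<and>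
     (\<forall>j. 2 \<le> j \<and> j < i \<longrightarrow> d (int j) = (if even (r + j) then c (int j) + c (int j + 1) else 0)) \<and>
     (\<forall>j>i. d (int j) = 0)"

definition asc_phi :: "nat \<Rightarrow> (int \<Rightarrow> nat) \<Rightarrow> nat \<Rightarrow> nat" where
  "asc_phi r c i = (if even (r + i) then c (int i) else c (- int i - 1) - c (int i + 1))"

text \<open>\<open>dom\<close> decides every cancellation. For i \<equiv> r no letter barred i + 1
  was present in the original row, and all letters i + 1 become i; otherwise the letters barred i +
  1 suffice to shield all letters i + 1.\<close>

lemma asc_row_step:
  assumes c: "dom r \<mu> c" and i: "2 \<le> i" "i < n" and d: "asc_row r C c (i - 1) d"
  shows "asc_row r C c i (rowE i 0 d)" "st i 0 (rword d) = asc_phi r c i"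
proof -
  obtain m where m: "i = Suc m" "1 \<le> m" using i by (cases i) auto
  have d': "d (- 1) = C" "d 0 = 0" "d 1 = (if odd r then c (- 1) + c 2 else 0)"
     "\<And>j. 2 \<le> j \<Longrightarrow> j < i \<Longrightarrow> d (- int j) = 0" "\<And>j. j > i \<Longrightarrow> d (- int j) = c (- int j)"
     "\<And>j. 2 \<le> j \<Longrightarrow> j < i \<Longrightarrow> d (int j) = (if even (r + j) then c (int j) + c (int j + 1) else 0)"
     "d (int i) = (if even (r + i) then c (int i) else 0)" "\<And>j. j > i \<Longrightarrow> d (int j) = c (int j)"
    using d unfolding asc_row_def m by (auto simp: add.commute)
  have s: "d (- int i - 1) = c (- int i - 1)" "d (int i + 1) = c (int i + 1)"
    using d'(5)[of "Suc i"] d'(8)[of "Suc i"] unfolding int_Suc by simp_all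
  have le: "odd (r + i) \<Longrightarrow> c (int i + 1) \<le> c (- int i - 1)" "even (r + i) \<Longrightarrow> c (- int i - 1) = 0"
    using domD(4)[OF c, of "Suc i"] domD(3)[OF c, of "Suc i"] i unfolding int_Suc by simp_all
  show "st i 0 (rword d) = asc_phi r c i"
    using raise_row(2)[of i 0 d] i s le d'(7) unfolding asc_phi_def by auto
  define e where "e = rowE i 0 d"
  have e1: "e (- int i) = 0" "e (int i + 1) = min (c (- int i - 1)) (c (int i + 1))"
      "e (int i) = d (int i) + (c (int i + 1) - c (- int i - 1))"
    unfolding e_def rowE_def Let_def using s i by auto
  have e2: "e a = d a" if "a \<notin> {- int i, - int i - 1, int i + 1, int i}" for a
    unfolding e_def rowE_def Let_def using that by auto
  have "asc_row r C c i e" unfolding asc_row_def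
  proof (intro conjI allI impI)
    show "e (- 1) = C" "e 0 = 0" "e 1 = (if odd r then c (- 1) + c 2 else 0)"
      using d'(1-3) i e2[of "- 1"] e2[of 0] e2[of 1] by auto
    show "e (- int j) = 0" if "2 \<le> j \<and> j \<le> i" for j
      using that e1(1) e2[of "- int j"] d'(4)[of j] by (cases "j = i") auto
    show "e (- int j) = c (- int j)" if "i + 1 < j" for j
      using that e2[of "- int j"] d'(5)[of j] by auto
    show "e (int j) = (if even (r + j) then c (int j) + c (int j + 1) else 0)" if "2 \<le> j \<and> j \<le> i" for j
      using that e1(3) e2[of "int j"] d'(6)[of j] d'(7) le by (cases "j = i") auto
    show "e (int i + 1) = (if even (r + i + 1) then c (int i + 1) else 0)"
      using e1(2) le by auto
    show "e (int j) = c (int j)" if "i + 1 < j" for j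
      using that e2[of "int j"] d'(8)[of j] by auto
  qed
  then show "asc_row r C c i (rowE i 0 d)" unfolding e_def .
qed

lemma desc_row_step:
  assumes i: "2 \<le> i" "i < n" and d: "desc_row r C c (Suc i) d"
  shows "desc_row r C c i (rowE i 0 d)"
    "st i 0 (rword d) = (if even (r + i) then c (int i) + c (int i + 1) else 0)"
proof -
  have d': "d (- 1) = C" "d 0 = 0" "d 1 = (if odd r then c (- 1) + c 2 else 0)"
     "\<And>j. 2 \<le> j \<Longrightarrow> d (- int j) = 0"
     "\<And>j. 2 \<le> j \<Longrightarrow> j < Suc i \<Longrightarrow> d (int j) = (if even (r + j) then c (int j) + c (int j + 1) else 0)"
     "\<And>j. j > Suc i \<Longrightarrow> d (int j) = 0"
    using d unfolding desc_row_def by auto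
  have s: "d (- int i - 1) = 0" "d (- int i) = 0"
    using d'(4)[of "Suc i"] d'(4)[of i] i unfolding int_Suc by simp_all
  show "st i 0 (rword d) = (if even (r + i) then c (int i) + c (int i + 1) else 0)"
    using raise_row(2)[of i 0 d] i s d'(5)[of i] by simp
  define e where "e = rowE i 0 d"
  have e1: "e (- int i) = 0" "e (- int i - 1) = 0" "e (int i + 1) = 0"
    unfolding e_def rowE_def Let_def using s i by auto
  have e2: "e a = d a" if "a \<notin> {- int i, - int i - 1, int i + 1, int i}" for a
    unfolding e_def rowE_def Let_def using that by auto
  have "desc_row r C c i e" unfolding desc_row_def
  proof (intro conjI allI impI)
    show "e (- 1) = C" "e 0 = 0" "e 1 = (if odd r then c (- 1) + c 2 else 0)"
      using d'(1-3) i e2[of "- 1"] e2[of 0] e2[of 1] by auto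
    show "e (- int j) = 0" if "2 \<le> j" for j
      using that e1(1,2) e2[of "- int j"] d'(4)[of j] unfolding int_Suc by (cases "j = i"; cases "j = Suc i") (simp_all add: int_Suc del: of_nat_Suc)
    show "e (int j) = (if even (r + j) then c (int j) + c (int j + 1) else 0)" if "2 \<le> j \<and> j < i" for j
      using that e2[of "int j"] d'(5)[of j] by auto
    show "e (int j) = 0" if "i < j" for j
      using that e1(3) e2[of "int j"] d'(6)[of j] by (cases "j = Suc i") (auto simp: int_Suc simp del: of_nat_Suc)
  qed
  then show "desc_row r C c i (rowE i 0 d)" unfolding e_def .
qed

lemma rword_12:
  assumes "\<And>a. a \<notin> {- 2, 1} \<Longrightarrow> c a = 0"
  shows "rword c = replicate (c (- 2)) (- 2) @ replicate (c 1) 1"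
proof -
  have 1: "[1..<n + 1] = 1 # [2..<n + 1]" "[1..<n + 1] = [1, 2] @ [3..<n + 1]"
    using rank upt_rec[of 1 "n + 1"] upt_rec[of 2 "n + 1"] by (auto simp: numeral_2_eq_2 numeral_3_eq_3)
  have z: "blk c as = []" if "set as \<inter> {- 2, 1} = {}" for as
    using that assms by (induction as) (auto simp: blk_simps)
  have "blk c (map (\<lambda>i. - int i) [1..<n + 1]) = replicate (c (- 2)) (- 2)"
    unfolding 1(2) list.map map_append blk_simps by (subst z) (auto simp: blk_simps assms)
  moreover have "blk c (rev (map int [1..<n + 1])) = replicate (c 1) 1"
    unfolding 1(1) list.map rev.simps blk_simps by (subst z) (auto simp: blk_simps)
  moreover have "blk c [0] = []" by (intro z) simp
  ultimately show ?thesis unfolding rword_def ord_def blk_simps(3) by simp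
qed

text \<open>The \<open>C\<close> barred 1s held back at the first node now become barred 2s, and all
  letters 2 become 1, since no barred 2 was left to shield them.\<close>

lemma desc_row_last:
  assumes d: "desc_row r C c 2 d"
  shows "E 1 (rword d) = replicate C (- 2) @ replicate (length (rword d) - C) 1"
    "st 1 0 (rword d) = (if odd r then c (- 1) + c 2 else 0)"
    "weps 1 (rword d) + (if odd r then c (- 1) + c 2 else 0) = length (rword d)"
proof -
  have n: "1 \<le> (1::nat)" "1 < n" using rank by auto
  have d': "d (- 1) = C" "d 0 = 0" "d 1 = (if odd r then c (- 1) + c 2 else 0)" "\<And>j. 2 \<le> j \<Longrightarrow> d (- int j) = 0"
     "\<And>j. j > 2 \<Longrightarrow> d (int j) = 0"
    using d unfolding desc_row_def by auto
  have s: "d (- 2) = 0" using d'(4)[of 2] by simp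
  define e where "e = rowE 1 0 d"
  have e: "e a = (if a = - 2 then C else if a = 1 then d 1 + d 2 else 0)" for a
  proof -
    consider "a = - 1" | "a = - 2" | "a = 1" | "a = 2" | "a = 0" | "a < - 2" | "2 < a" by linarith
    then show ?thesis
    proof cases
      case 6
      then show ?thesis unfolding e_def rowE_def Let_def using d'(4)[of "nat (- a)"] by simp
    next
      case 7
      then show ?thesis unfolding e_def rowE_def Let_def using d'(5)[of "nat a"] by simp
    qed (unfold e_def rowE_def Let_def, use s d'(1,2) in auto)
  qed
  have re: "rword e = replicate C (- 2) @ replicate (d 1 + d 2) 1"
    using rword_12[of e] e by simp
  have E: "E 1 (rword d) = rword e" unfolding e_def using raise_row(1)[OF n, of 0 d] by simp
  have len: "length (rword d) = C + (d 1 + d 2)" using arg_cong[OF E, of length] re by simp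
  show "E 1 (rword d) = replicate C (- 2) @ replicate (length (rword d) - C) 1" using E re len by simp
  show "st 1 0 (rword d) = (if odd r then c (- 1) + c 2 else 0)"
    using raise_row(2)[OF n, of 0 d] s d'(1,3) by simp
  show "weps 1 (rword d) + (if odd r then c (- 1) + c 2 else 0) = length (rword d)"
    using raise_row(3)[OF n, of d] s d'(1) len unfolding d'(3)[symmetric] by simp
qed

text \<open>\<open>m\<close> is the shield cast by the columns of height 2 that \<sigma> adds to
  \<mu>. It is used up first by the barred 1s, which are the letters 1 of the original row.\<close>

lemma asc_row_first:
  assumes c: "dom r \<mu> c" and m: "odd r \<Longrightarrow> m = 0"
  defines "d \<equiv> c(1 := c (- 1), - 1 := c 1)"
  shows "asc_row r (min m (c 1)) c 1 (rowE 1 m d)"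
    "st 1 m (rword d) = (if odd r then c (- 1) else (c (- 2) - c 2) + (m - c 1))"
    "weps 1 (rword d) = c 1 + (c 2 - c (- 2))"
proof -
  have n: "1 \<le> (1::nat)" "1 < n" using rank by auto
  have o: "c (- 2) = 0" if "odd r" using domD(3)[OF c, of 2] that by simp
  have v: "c (- 1) = 0" "c 2 \<le> c (- 2)" if "even r"
    using domD(3)[OF c, of 1] domD(4)[OF c, of 2] that by simp_all
  have dd: "d (- 1) = c 1" "d 1 = c (- 1)" "d a = c a" if "a \<notin> {1, - 1}" for a using that by (auto simp: d_def)
  show "st 1 m (rword d) = (if odd r then c (- 1) else (c (- 2) - c 2) + (m - c 1))"
    using raise_row(2)[OF n, of m d] o v m by (auto simp: d_def)
  show "weps 1 (rword d) = c 1 + (c 2 - c (- 2))"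
    using raise_row(3)[OF n, of d] by (simp add: d_def)
  define e where "e = rowE 1 m d"
  have e2: "e a = d a" if "a \<notin> {- 1, - 2, 1, 2}" for a
    unfolding e_def rowE_def Let_def using that by auto
  have e1: "e (- 1) = min m (c 1)" "e 1 = (if odd r then c (- 1) + c 2 else 0)" "e 2 = (if even r then c 2 else 0)"
    unfolding e_def rowE_def Let_def using o v m by (auto simp: d_def)
  have c0: "c 0 = 0" using domD(1)[OF c] .
  have "asc_row r (min m (c 1)) c 1 e" unfolding asc_row_def
  proof (intro conjI allI impI)
    show "e (- 1) = min m (c 1)" "e 1 = (if odd r then c (- 1) + c 2 else 0)" using e1 by auto
    show "e 0 = 0" using e2[of 0] c0 by (simp add: d_def)
    show "e (int 1 + 1) = (if even (r + 1 + 1) then c (int 1 + 1) else 0)" using e1(3) by simp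
    show "e (- int j) = c (- int j)" "e (int j) = c (int j)" if "1 + 1 < j" for j
      using that e2[of "- int j"] e2[of "int j"] by (auto simp: d_def)
  qed auto
  then show "asc_row r (min m (c 1)) c 1 (rowE 1 m d)" unfolding e_def .
qed

text \<open>In type D the bound \<open>r + 2 \<le> n\<close> guarantees that n, n - 1 and barred n -
  1 are absent when the node n is reached, so that only barred n moves and the descent may start at
  \<open>top\<close>.\<close>

lemma asc_row_turn:
  assumes c: "dom r \<mu> c" and r: "KR_type r" "1 \<le> r" "\<And>h. h \<in> set \<mu> \<Longrightarrow> h \<le> r"
    and d: "asc_row r C c (n - 1) d"
  shows "\<exists>e. E n (rword d) = rword e \<and> desc_row r C c top e" "st n 0 (rword d) = (if r = n then c (int n) else 0)"
proof -
  have n: "int (n - 1) = int n - 1" "3 \<le> n" using rank by auto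
  have d': "d (- 1) = C" "d 0 = 0" "d 1 = (if odd r then c (- 1) + c 2 else 0)"
     "\<And>j. 2 \<le> j \<Longrightarrow> j < n \<Longrightarrow> d (- int j) = 0" "\<And>j. j > n \<Longrightarrow> d (- int j) = c (- int j)"
     "\<And>j. 2 \<le> j \<Longrightarrow> j < n \<Longrightarrow> d (int j) = (if even (r + j) then c (int j) + c (int j + 1) else 0)"
     "d (int n) = (if even (r + n) then c (int n) else 0)" "\<And>j. j > n \<Longrightarrow> d (int j) = c (int j)"
    using d n unfolding asc_row_def by auto
  have big: "c (int j) = 0" if "r < j" "even (r + j)" for j
  proof -
    have "r + 1 < j" using that by (metis Suc_eq_plus1 Suc_lessI add_Suc_right even_Suc even_add)
    then show ?thesis using dom_high(2)[OF c r(3) r(2)] by blast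
  qed
  have dn: "d (int n) = (if r = n then c (int n) else 0)" using d'(7) big[of n] KR_typeD(1)[OF r(1)] by auto
  have D: "d (int n) = 0 \<and> d (1 - int n) = 0" "d (int (n - 1)) = 0" if "t = D1"
  proof -
    have rn: "r + 2 \<le> n" using KR_typeD(2)[OF r(1)] that by blast
    have "d (- int (n - 1)) = 0" using d'(4)[of "n - 1"] n by simp
    then show "d (int n) = 0 \<and> d (1 - int n) = 0" using dn rn n by simp
    have "c (int (n - 1) + 1) = 0" if "even (r + (n - 1))"
      using dom_high(2)[OF c r(3) r(2), of n] rn that by (cases "n = r + 2") (auto simp: n)
    then show "d (int (n - 1)) = 0" using d'(6)[of "n - 1"] n rn big[of "n - 1"] by auto
  qed
  note T = raise_row_n[OF d'(2) D(1)]
  show "st n 0 (rword d) = (if r = n then c (int n) else 0)"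
    using T(2) D(2) dn KR_typeD[OF r(1)] unfolding top_def by (cases t) auto
  define e where "e = d(- int n := 0, int top := d (- int n) + d (int top))"
  have tp: "2 < top" "top \<le> n" "n \<le> Suc top" "top = n \<or> t = D1 \<and> Suc top = n" using top_le n by (auto simp: top_def)
  have "desc_row r C c top e" unfolding desc_row_def
  proof (intro conjI allI impI)
    show "e (- 1) = C" "e 0 = 0" "e 1 = (if odd r then c (- 1) + c 2 else 0)"
      using d'(1-3) n tp by (auto simp: e_def)
    show "e (- int j) = 0" if "2 \<le> j" for j
    proof -
      consider "j < n" | "j = n" | "n < j" by linarith
      then show ?thesis using that d'(4)[of j] d'(5)[of j] domD(2)[OF c, of "- int j"] tp by cases (auto simp: e_def)
    qed
    show "e (int j) = (if even (r + j) then c (int j) + c (int j + 1) else 0)" if "2 \<le> j \<and> j < top" for j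
      using that d'(6)[of j] tp by (auto simp: e_def)
    show "e (int j) = 0" if tj: "top < j" for j
    proof -
      consider "j = n" "t = D1" | "n < j" using tj tp(2-4) by (cases "n < j") auto
      then show ?thesis using tj d'(8)[of j] domD(2)[OF c, of "int j"] D by cases (auto simp: e_def)
    qed
  qed
  then show "\<exists>e. E n (rword d) = rword e \<and> desc_row r C c top e" using T(1) unfolding e_def by blast
qed

text \<open>\<SS> turns the empty columns into \<mp> columns of height 2, whose + at height 1 are
  the only nonzero slots, and gives every other column a - instead of its +. The first node is
  therefore the only one with a shield in front of the row.\<close>

lemma hw_slots:
  assumes \<mu>: "\<mu> \<in> KR_shapes r k" and r: "KR_type r" "1 \<le> r"
  obtains T where "Ph r (Sdata r (hwdata k \<mu>)) = map (asc_col 0) T" "slot_tab T" "turn_ok T"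
    "\<forall>i>0. count_list (slots T) i = (if i = 1 then k - length \<mu> else 0)"
    "\<forall>i>0. length (filter (\<lambda>(v, g, b). v = i \<and> b = None) T) = 0"
    "length (filter (\<lambda>c. fst c = n) T) = 0"
    "map (\<lambda>(v, g, b). v + (if b = None then 0 else 1)) T = \<mu> @ replicate (k - length \<mu>) 2"
proof -
  let ?D = "Sdata r (hwdata k \<mu>)"
  note P = KR_shapes_props[OF \<mu>]
  note pm = pmd_Sdata[OF pmd_hwdata[OF \<mu>] r(1)]
  obtain T where T: "Ph r ?D = map (asc_col 0) T" "slot_tab T" "turn_ok T"
    "\<And>i. 0 < i \<Longrightarrow> count_list (slots T) i = Pp ?D i + Bb ?D (i + 1)"
    "\<And>i. 0 < i \<Longrightarrow> length (filter (\<lambda>(v, g, b). v = i \<and> b = None) T) = Nn ?D i + Pp ?D i"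
    "length (filter (\<lambda>c. fst c = n) T) = Nn ?D n + Pp ?D n"
    "map (\<lambda>(v, g, b). v + (if b = None then 0 else 1)) T = filter (\<lambda>h. 0 < h) (map (\<lambda>c. snd (snd c)) (pcols ?D r))"
    by (rule pmd_slots[OF pm r(1)]) (rule that; (assumption | blast))
  have r1: "k - length \<mu> = 0" if "r = 1" using P(5) that by simp
  have o: "odd r \<Longrightarrow> k - length \<mu> = 0" using P(5) by simp
  have h2: "2 \<le> h" if "h \<in> set \<mu>" "even r" for h
  proof -
    have "0 < h" "even h" using P(3)[OF that(1)] that(2) by auto
    then show ?thesis by (cases "h = 1") auto
  qed
  have n0: "n \<noteq> 0" using rank by simp
  have srt: "sorted_wrt (\<ge>) (\<mu> @ replicate (k - length \<mu>) 2)"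
  proof -
    have "sorted_wrt (\<ge>) (replicate m (2::nat))" for m by (induction m) auto
    then show ?thesis using P(1) h2 o by (cases "odd r") (auto simp: sorted_wrt_append)
  qed
  have cr: "count_list (replicate m a) i = (if i = a then m else 0)" for m and a i :: nat
    by (induction m) auto
  have "filter (\<lambda>h. 0 < h) (map (\<lambda>c. snd (snd c)) (pcols ?D r)) = \<mu> @ replicate (k - length \<mu>) 2"
  proof (rule outer_unique[OF _ srt])
    show "pm_valid r ?D" using pm by (simp add: pmd_def)
    show "0 \<notin> set (\<mu> @ replicate (k - length \<mu>) 2)" using P(2) by auto
    fix i :: nat assume i: "0 < i"
    have "2 \<le> r \<or> k - length \<mu> = 0" using r1 r(2) by fastforce
    then show "count_list (\<mu> @ replicate (k - length \<mu>) 2) i = Nn ?D i + Pp ?D i + Mm ?D i + Bb ?D i"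
      using i by (auto simp: Sdata_sel hwdata_sel cr count_list_append)
  qed
  then have 7: "map (\<lambda>(v, g, b). v + (if b = None then 0 else 1)) T = \<mu> @ replicate (k - length \<mu>) 2" using T(7) by simp
  have 4: "\<forall>i>0. count_list (slots T) i = (if i = 1 then k - length \<mu> else 0)"
  proof (intro allI impI)
    fix i :: nat assume i: "0 < i"
    have "2 \<le> r \<or> k - length \<mu> = 0" using r1 r(2) by fastforce
    then show "count_list (slots T) i = (if i = 1 then k - length \<mu> else 0)"
      using T(4)[OF i] i by (auto simp: Sdata_sel hwdata_sel)
  qed
  have 5: "\<forall>i>0. length (filter (\<lambda>(v, g, b). v = i \<and> b = None) T) = 0"
  proof (intro allI impI)
    fix i :: nat assume i: "0 < i"
    show "length (filter (\<lambda>(v, g, b). v = i \<and> b = None) T) = 0"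
      unfolding T(5)[OF i] using r(2) by (simp add: Sdata_sel hwdata_sel)
  qed
  have 6: "length (filter (\<lambda>c. fst c = n) T) = 0"
    using T(6) n0 r(2) by (simp add: Sdata_sel hwdata_sel)
  show thesis by (rule that[OF T(1-3) 4 5 6 7])
qed

text \<open>The side \<open>\<mu> \<otimes> x\<close>, after exchanging the nodes 0 and 1.\<close>

lemma left_side:
  assumes \<mu>: "\<mu> \<in> KR_shapes r k" and r: "KR_type r" "1 \<le> r" and c: "dom r \<mu> c"
  defines "m \<equiv> k - length \<mu>" and "d \<equiv> c(1 := c (- 1), - 1 := c 1)"
    and "S \<equiv> reading (Ph r (Sdata r (hwdata k \<mu>)))"
  shows "Es path (S @ rword d) = reading (hw_tableau (\<mu> @ replicate m 2)) @
      replicate (min m (c 1)) (- 2) @ replicate (length (rword d) - min m (c 1)) 1"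
    "phis path (S @ rword d) = [if odd r then c (- 1) else (c (- 2) - c 2) + (m - c 1)] @
      (map (asc_phi r c) [2..<n] @ [if r = n then c (int n) else 0] @
       map (\<lambda>i. if even (r + i) then c (int i) + c (int i + 1) else 0) (rev [2..<top])) @
      [if odd r then c (- 1) + c 2 else 0]"
    "wphi 1 S = m" "weps 1 (rword d) = c 1 + (c 2 - c (- 2))"
    "\<exists>u v. Es mid (E 1 (S @ rword d)) = u @ v \<and> length u = length S \<and> wphi 1 u = 0 \<and>
      weps 1 v + (if odd r then c (- 1) + c 2 else 0) = length (rword d)"
proof -
  obtain T where T: "Ph r (Sdata r (hwdata k \<mu>)) = map (asc_col 0) T" "slot_tab T" "turn_ok T"
    "\<forall>i>0. count_list (slots T) i = (if i = 1 then m else 0)"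
    "\<forall>i>0. length (filter (\<lambda>(v, g, b). v = i \<and> b = None) T) = 0"
    "length (filter (\<lambda>c. fst c = n) T) = 0"
    "map (\<lambda>(v, g, b). v + (if b = None then 0 else 1)) T = \<mu> @ replicate m 2"
    unfolding m_def by (rule hw_slots[OF \<mu> r])
  have n: "1 \<le> (1::nat)" "1 < n" using rank by auto
  have T1: "sorted_wrt (\<ge>) (map fst T)" using T(2) by (simp add: slot_tab_def)
  have le: "h \<le> r" if "h \<in> set \<mu>" for h using KR_shapes_props(3)[OF \<mu> that] by simp
  have odd: "m = 0" if "odd r" using KR_shapes_props(5)[OF \<mu> that] by (simp add: m_def)
  define C where "C = min m (c 1)"
  define L where "L = length (rword d)"
  define I where "I = (\<lambda>i w. \<exists>d. w = reading (map (asc_col (i - 1)) T) @ rword d \<and> asc_row r C c (i - 1) d \<and> length (rword d) = L)"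
  define J where "J = (\<lambda>i w. \<exists>d. w = reading (map (desc_col i) T) @ rword d \<and> desc_row r C c i d \<and> length (rword d) = L)"
  define f where "f = asc_phi r c"
  define g where "g = (\<lambda>i. if even (r + i) then c (int i) + c (int i + 1) else 0)"
  have S: "S = reading (map (asc_col 0) T)" by (simp add: S_def T(1))
  have s: "st 1 0 S = m" "E 1 S = reading (map (asc_col 1) T)"
    using asc_step[OF n T(2)] T(4) by (auto simp: S)
  show "wphi 1 S = m" using s by (simp add: wphi_st)
  note F = asc_row_first[OF c odd, folded d_def C_def]
  show "weps 1 (rword d) = c 1 + (c 2 - c (- 2))" by (rule F(3))
  have E1: "E 1 (S @ rword d) = reading (map (asc_col 1) T) @ rword (rowE 1 m d)"
    using s raise_row(1)[OF n, of m d] by (simp add: raise_append)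
  have len1: "length (rword (rowE 1 m d)) = L"
    using raise_row(1)[OF n, of m d] length_raise[of 1 m "rword d"] by (simp add: L_def)
  have I2: "I 2 (E 1 (S @ rword d))" unfolding I_def E1 using F(1) len1 by auto
  have phi1: "wphi 1 (S @ rword d) = (if odd r then c (- 1) else (c (- 2) - c 2) + (m - c 1))"
    using F(2) s by (simp add: wphi_st st_append)
  have asc: "I (Suc i) (E i w) \<and> wphi i w = f i" if i: "2 \<le> i" "i < n" and I: "I i w" for i w
  proof -
    obtain d where d: "w = reading (map (asc_col (i - 1)) T) @ rword d" "asc_row r C c (i - 1) d" "length (rword d) = L"
      using I unfolding I_def by blast
    have i1: "1 \<le> i" using i by simp
    note A = asc_step[OF i1 i(2) T(2)] and B = asc_row_step[OF c i d(2)]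
    have t0: "st i 0 (reading (map (asc_col (i - 1)) T)) = 0" using A T(4) i by simp
    have "E i w = reading (map (asc_col i) T) @ rword (rowE i 0 d)"
      using A t0 raise_row(1)[OF i1 i(2), of 0 d] by (simp add: d(1) raise_append)
    moreover have "length (rword (rowE i 0 d)) = L"
      using raise_row(1)[OF i1 i(2), of 0 d] length_raise[of i 0 "rword d"] d(3) by simp
    moreover have "wphi i w = f i" using t0 B(2) by (simp add: d(1) wphi_st st_append f_def)
    ultimately show ?thesis using B(1) unfolding I_def by auto
  qed
  have turn: "J top (E n w) \<and> wphi n w = (if r = n then c (int n) else 0)" if I: "I n w" for w
  proof -
    obtain d where d: "w = reading (map (asc_col (n - 1)) T) @ rword d" "asc_row r C c (n - 1) d" "length (rword d) = L"
      using I unfolding I_def by blast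
    note A = turn_step[OF T(2,3)] and B = asc_row_turn[OF c r le d(2)]
    obtain e where e: "E n (rword d) = rword e" "desc_row r C c top e" using B(1) by blast
    have t0: "st n 0 (reading (map (asc_col (n - 1)) T)) = 0" using A T(6) by simp
    have "E n w = reading (map (desc_col top) T) @ rword e" using A t0 e by (simp add: d(1) raise_append)
    moreover have "length (rword e) = L" using e(1) length_raise[of n 0 "rword d"] d(3) by simp
    moreover have "wphi n w = (if r = n then c (int n) else 0)" using t0 B(2) by (simp add: d(1) wphi_st st_append)
    ultimately show ?thesis using e(2) unfolding J_def by auto
  qed
  have desc: "J i (E i w) \<and> wphi i w = g i" if i: "2 \<le> i" "i < n" and J: "J (Suc i) w" for i w
  proof -
    obtain d where d: "w = reading (map (desc_col (Suc i)) T) @ rword d" "desc_row r C c (Suc i) d" "length (rword d) = L"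
      using J unfolding J_def by blast
    have i1: "1 \<le> i" using i by simp
    note A = desc_step[OF i1 i(2) T1] and B = desc_row_step[OF i d(2)]
    have t0: "st i 0 (reading (map (desc_col (Suc i)) T)) = 0" using A T(5) i by simp
    have "E i w = reading (map (desc_col i) T) @ rword (rowE i 0 d)"
      using A t0 raise_row(1)[OF i1 i(2), of 0 d] by (simp add: d(1) raise_append)
    moreover have "length (rword (rowE i 0 d)) = L"
      using raise_row(1)[OF i1 i(2), of 0 d] length_raise[of i 0 "rword d"] d(3) by simp
    moreover have "wphi i w = g i" using t0 B(2) by (simp add: d(1) wphi_st st_append g_def)
    ultimately show ?thesis using B(1) unfolding J_def by auto
  qed
  have P: "J 2 (Es mid (E 1 (S @ rword d)))"
    "phis path (S @ rword d) = [wphi 1 (S @ rword d)] @ (map f [2..<n] @ [if r = n then c (int n) else 0] @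
      map g (rev [2..<top])) @ [wphi 1 (Es mid (E 1 (S @ rword d)))]"
    by (rule path_seg[where I = I and J = J, OF I2 asc turn desc]; simp)+
  obtain e where e: "Es mid (E 1 (S @ rword d)) = reading (map (desc_col 2) T) @ rword e" "desc_row r C c 2 e"
    "length (rword e) = L" using P(1) unfolding J_def by blast
  note A = desc_step[OF n T1] and B = desc_row_last[OF e(2)]
  have t0: "st 1 0 (reading (map (desc_col 2) T)) = 0"
    using A T(5) by (simp add: numeral_2_eq_2)
  have A1: "E 1 (reading (map (desc_col 2) T)) = reading (map (desc_col 1) T)"
    using A by (simp add: numeral_2_eq_2)
  have last: "wphi 1 (Es mid (E 1 (S @ rword d))) = (if odd r then c (- 1) + c 2 else 0)"
    unfolding e(1) wphi_st using t0 B(2) by (simp add: st_append)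
  show "phis path (S @ rword d) = [if odd r then c (- 1) else (c (- 2) - c 2) + (m - c 1)] @
      (map (asc_phi r c) [2..<n] @ [if r = n then c (int n) else 0] @
       map (\<lambda>i. if even (r + i) then c (int i) + c (int i + 1) else 0) (rev [2..<top])) @
      [if odd r then c (- 1) + c 2 else 0]"
    using P(2) unfolding phi1 last f_def g_def .
  have "Es path (S @ rword d) = E 1 (Es mid (E 1 (S @ rword d)))" by (simp add: path_def)
  also have "\<dots> = reading (map (desc_col 1) T) @ E 1 (rword e)" unfolding e(1) using t0 A1 by (simp add: raise_append)
  also have "\<dots> = reading (hw_tableau (\<mu> @ replicate m 2)) @ replicate C (- 2) @ replicate (L - C) 1"
    using desc_final[of T] T(7) B(1) e(3) by simp
  finally show "Es path (S @ rword d) = reading (hw_tableau (\<mu> @ replicate m 2)) @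
      replicate (min m (c 1)) (- 2) @ replicate (length (rword d) - min m (c 1)) 1" unfolding C_def L_def .
  have "length (reading (map (desc_col 2) T)) = length S"
  proof -
    have "length (Es ks w) = length w" for ks w by (induction ks arbitrary: w) auto
    from this[of "E 1 (S @ rword d)" mid] show ?thesis unfolding e(1) using e(3) by (simp add: L_def)
  qed
  then show "\<exists>u v. Es mid (E 1 (S @ rword d)) = u @ v \<and> length u = length S \<and> wphi 1 u = 0 \<and>
      weps 1 v + (if odd r then c (- 1) + c 2 else 0) = length (rword d)"
    using e(1,3) t0 B(3) unfolding wphi_st L_def
    by (intro exI[of _ "reading (map (desc_col 2) T)"] exI[of _ "rword e"]) simp
qed

text \<open>The claimed numbers as naturals. For a highest weight element no subtraction is
  truncated except \<open>k - length \<mu> - c 1\<close> in \<open>Nn\<close>, where the truncation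
  produces the term -(x_1 - \<mu>_0)_- of the statement.\<close>

definition image_data :: "nat \<Rightarrow> nat \<Rightarrow> nat list \<Rightarrow> (int \<Rightarrow> nat) \<Rightarrow> pmcount" where
  "image_data r k \<mu> c = \<lparr>
     Nn = (\<lambda>i. if odd (r + i) \<or> r < i then 0 else if i = 0 then (c (- 2) - c 2) + (k - length \<mu> - c 1)
        else if i = r then c (int r + 1) else c (- int i - 2) - c (int i + 2)),
     Pp = (\<lambda>i. if odd (r + i) \<or> r < i \<or> i = 0 then 0 else count_list \<mu> i - c (- int i) - c (int i + 1)),
     Mm = (\<lambda>i. if odd (r + i) \<or> r < i \<or> i = 0 then 0 else if i = 1 then c (- 1) else c (int i)),
     Bb = (\<lambda>i. if odd (r + i) \<or> r < i \<or> i < 2 then 0 else if i = 2 then min (k - length \<mu>) (c 1) else c (int i - 1)) \<rparr>"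

lemma image_data_sel:
  "Nn (image_data r k \<mu> c) i = (if odd (r + i) \<or> r < i then 0 else if i = 0 then (c (- 2) - c 2) + (k - length \<mu> - c 1)
        else if i = r then c (int r + 1) else c (- int i - 2) - c (int i + 2))"
  "Pp (image_data r k \<mu> c) i = (if odd (r + i) \<or> r < i \<or> i = 0 then 0 else count_list \<mu> i - c (- int i) - c (int i + 1))"
  "Mm (image_data r k \<mu> c) i = (if odd (r + i) \<or> r < i \<or> i = 0 then 0 else if i = 1 then c (- 1) else c (int i))"
  "Bb (image_data r k \<mu> c) i = (if odd (r + i) \<or> r < i \<or> i < 2 then 0 else if i = 2 then min (k - length \<mu>) (c 1) else c (int i - 1))"
  by (simp_all add: image_data_def)

text \<open>The outer shape is counted after \<SS>, because this is the shape at which the path ends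
  on the side of \<Phi>(P). The number of columns, with the empty ones, is the same before and after
  since \<SS> keeps the inner shape.\<close>

lemma image_outer:
  assumes \<mu>: "\<mu> \<in> KR_shapes r k" and r: "KR_type r" "1 \<le> r" and c: "dom r \<mu> c"
  shows "pmd r k (image_data r k \<mu> c)"
    "filter (\<lambda>h. 0 < h) (map (\<lambda>x. snd (snd x)) (pcols (Sdata r (image_data r k \<mu> c)) r)) =
      \<mu> @ replicate (k - length \<mu> - c 1) 2"
proof -
  let ?D = "image_data r k \<mu> c" and ?m = "k - length \<mu>"
  note P = KR_shapes_props[OF \<mu>]
  have o: "odd r \<Longrightarrow> ?m = 0" using P(5) by simp
  have h2: "2 \<le> h" if "h \<in> set \<mu>" "even r" for h
  proof -
    have "0 < h" "even h" using P(3)[OF that(1)] that(2) by auto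
    then show ?thesis by (cases "h = 1") auto
  qed
  have srt: "sorted_wrt (\<ge>) (\<mu> @ replicate (?m - c 1) 2)"
  proof -
    have "sorted_wrt (\<ge>) (replicate m (2::nat))" for m by (induction m) auto
    then show ?thesis using P(1) h2 o by (cases "odd r") (auto simp: sorted_wrt_append)
  qed
  have v: "pm_valid r ?D" unfolding pm_valid_def image_data_sel by auto
  note vS = pm_valid_Sdata[OF v]
  have cr: "count_list (replicate m a) i = (if i = a then m else 0)" for m and a i :: nat
    by (induction m) auto
  have mz: "count_list \<mu> i = 0" if "odd (r + i) \<or> r < i" for i
    using P(3)[of i] that by (intro count_notin) auto
  show out: "filter (\<lambda>h. 0 < h) (map (\<lambda>x. snd (snd x)) (pcols (Sdata r ?D) r)) = \<mu> @ replicate (?m - c 1) 2"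
  proof (rule outer_unique[OF vS srt])
    show "0 \<notin> set (\<mu> @ replicate (?m - c 1) 2)" using P(2) by auto
    fix i :: nat assume i: "0 < i"
    show "count_list (\<mu> @ replicate (?m - c 1) 2) i =
      Nn (Sdata r ?D) i + Pp (Sdata r ?D) i + Mm (Sdata r ?D) i + Bb (Sdata r ?D) i"
    proof (cases "odd (r + i) \<or> r < i")
      case True
      have "?m = 0 \<or> i \<noteq> 2" using True o r(2) by (cases "r = 1") auto
      moreover have "Bb ?D (i + 2) = 0" "Nn ?D i = 0" "Pp ?D i = 0" "Mm ?D i = 0"
        using True unfolding image_data_sel by auto
      moreover have "Bb (Sdata r ?D) i = 0"
        using True unfolding Sdata_sel image_data_sel by auto
      ultimately show ?thesis using mz[OF True] True by (auto simp: Sdata_sel count_list_append cr)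
    next
      case False
      then have ev: "even (r + i)" "i \<le> r" by auto
      note a = domD(5)[OF c _ ev(1)]
      have N: "Nn (Sdata r ?D) i = c (int i + 1)"
        using ev i unfolding Sdata_sel image_data_sel
        by (cases "i = r"; cases "i + 2 \<le> r") (auto simp: algebra_simps, presburger+)
      have PM: "Pp (Sdata r ?D) i = (if i = 1 then c (- 1) else c (int i))"
        "Mm (Sdata r ?D) i = count_list \<mu> i - c (- int i) - c (int i + 1)"
        using ev i unfolding Sdata_sel image_data_sel by auto
      consider "i = 1" | "i = 2" | "3 \<le> i" using i by linarith
      then show ?thesis
      proof cases
        case 1
        have "Bb (Sdata r ?D) i = 0" using 1 by (simp add: Sdata_sel)
        then show ?thesis using a 1 unfolding N PM by (simp add: count_list_append cr)
      next
        case 2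
        have "Bb (Sdata r ?D) i = (c (- 2) - c 2) + (?m - c 1)" using 2 ev by (simp add: Sdata_sel image_data_sel)
        moreover have "c 2 \<le> c (- 2)" using domD(4)[OF c, of 2] ev 2 by simp
        ultimately show ?thesis using a 2 unfolding N PM by (simp add: count_list_append cr)
      next
        case 3
        define j where "j = i - 2"
        have j: "i = j + 2" "0 < j" "j < r" using 3 ev by (auto simp: j_def)
        have "Bb (Sdata r ?D) i = Nn ?D j" using ev j by (simp add: Sdata_sel)
        also have "\<dots> = c (- int j - 2) - c (int j + 2)" using ev j by (simp add: image_data_sel)
        also have "\<dots> = c (- int i) - c (int i)" by (simp add: j(1) algebra_simps)
        finally have B: "Bb (Sdata r ?D) i = c (- int i) - c (int i)" .
        have "c (int i) \<le> c (- int i)" using domD(4)[OF c _ ev(1)] 3 by simp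
        then show ?thesis using a 3 unfolding N PM B by (simp add: count_list_append cr)
      qed
    qed
  qed
  have "length (pcols ?D r) = length (pcols (Sdata r ?D) r)"
    using arg_cong[OF inner_Sdata[OF v], of length] by simp
  also have "\<dots> = length (\<mu> @ replicate (?m - c 1) 2) + Nn (Sdata r ?D) 0"
    by (rule length_pcols_outer[OF vS out])
  also have "\<dots> = k"
  proof (cases "odd r")
    case True
    then show ?thesis using P(5) r(2) by (simp add: Sdata_sel image_data_sel)
  next
    case False
    then have "2 \<le> r" using r(2) by (cases "r = 1") auto
    then have "Nn (Sdata r ?D) 0 = min ?m (c 1)" using False by (simp add: Sdata_sel image_data_sel)
    then show ?thesis using P(4) by simp
  qed
  finally have len: "length (pcols ?D r) = k" .
  have "Nn ?D n = 0"
    using domD(2)[OF c, of "int n + 1"] KR_typeD(1)[OF r(1)] rank by (auto simp: image_data_sel)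
  then show "pmd r k ?D" using v len by (simp add: pmd_def)
qed

lemma wtw_hw:
  assumes "1 \<le> j"
  shows "wtw (reading (hw_tableau hs)) j = int (length (filter (\<lambda>h. j \<le> h) hs))"
proof (induction hs)
  case Nil
  then show ?case by (simp add: hw_tableau_def reading_def wtw_def)
next
  case (Cons h hs)
  have "count_list [1..int h] (int j) = (if j \<le> h then 1 else 0)" "count_list [1..int h] (- int j) = 0"
    using assms by (induction h) (auto simp: upto_snoc[simplified] count_list_append)
  then have "wtw [1..int h] j = (if j \<le> h then 1 else 0)" by (simp add: wtw_def)
  then show ?case using Cons by (simp add: hw_tableau_def reading_def wtw_simps(3))
qed

lemma wtw_replicate: "wtw (replicate m a) j = (if a = int j then int m else 0) - (if a = - int j then int m else 0)"
  by (auto simp: wtw_def count_replicate)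

lemma hw_elts:
  assumes "\<mu> \<in> KR_shapes r k" "KR_type r"
  shows "hw_tableau \<mu> \<in> elts (KR_classical t n r k)"
  using Ph_elts(1)[OF pmd_hwdata[OF assms(1)] assms(2)] Ph_hwdata[OF assms] by simp

lemma ones_elts: "row (replicate l 1) \<in> elts (KR_classical t n 1 l)"
proof -
  have "replicate l 1 \<in> KR_shapes 1 l" using KR_shapes_1 by blast
  then have "hw_tableau (replicate l 1) \<in> elts (KR_classical t n 1 l)" by (rule hw_elts[OF _ KR_type_1])
  then show ?thesis unfolding hw_row .
qed

lemma sigma_ones:
  assumes "KR_involution t n 1 l \<sigma>"
  shows "\<sigma> (row (replicate l 1)) = row (replicate l (- 1))"
proof -
  have 1: "reading (\<sigma> (row (replicate l 1))) = replicate l (- 1)"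
    using sigma_row[OF assms ones_elts, of 0 "[]" l] by simp
  have "\<sigma> (row (replicate l 1)) = row (reading (\<sigma> (row (replicate l 1))))"
    using KR_row(1)[OF KR_involutionD(1)[OF assms ones_elts]] by (metis reading_row)
  then show ?thesis unfolding 1 .
qed

lemma sigma_hw:
  assumes "KR_involution t n r k \<sigma>" "\<mu> \<in> KR_shapes r k" "KR_type r"
  shows "\<sigma> (hw_tableau \<mu>) = Ph r (Sdata r (hwdata k \<mu>))"
  using sigma_Ph[OF assms(1) pmd_hwdata[OF assms(2)] assms(3)] Ph_hwdata[OF assms(2,3)] by simp

text \<open>Here the formulas for P are tested: \<phi> at each node for \<mu> \<otimes> x against
  \<phi> at the same node for \<open>1^l \<otimes> \<Phi>(P)\<close>. Above r both sides vanish,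
  because the row has no letter beyond r + 1 and no barred letter beyond r.\<close>

lemma sides_phis:
  assumes \<mu>: "\<mu> \<in> KR_shapes r k" and r: "KR_type r" "1 \<le> r" and c: "dom r \<mu> c"
  defines "D \<equiv> Sdata r (image_data r k \<mu> c)" and "m \<equiv> k - length \<mu>"
  shows "(if odd r then c (- 1) else (c (- 2) - c 2) + (m - c 1)) = Pp D 1 + Bb D 2"
    "\<And>i. 2 \<le> i \<Longrightarrow> i < n \<Longrightarrow> asc_phi r c i = Pp D i + Bb D (i + 1)"
    "(if r = n then c (int n) else 0) = Nn D n + Pp D n"
    "\<And>i. 2 \<le> i \<Longrightarrow> (if even (r + i) then c (int i) + c (int i + 1) else 0) = Nn D i + Pp D i"
    "(if odd r then c (- 1) + c 2 else 0) = Nn D 1 + Pp D 1"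
proof -
  have le: "h \<le> r" if "h \<in> set \<mu>" for h using KR_shapes_props(3)[OF \<mu> that] by simp
  have o: "odd r \<Longrightarrow> m = 0" using KR_shapes_props(5)[OF \<mu>] by (simp add: m_def)
  have big: "c (int j) = 0" if "r < j" "even (r + j)" for j
  proof -
    have "r + 1 < j" using that by (metis Suc_eq_plus1 Suc_lessI add_Suc_right even_Suc even_add)
    then show ?thesis using dom_high(2)[OF c le r(2)] by blast
  qed
  have big': "c (int j + 1) = 0" if "r < j" for j
    using dom_high(2)[OF c le r(2), of "Suc j"] that by (simp add: add.commute)
  note bar = dom_high(1)[OF c le]
  have n: "r \<le> n" "3 \<le> n" using KR_typeD(1)[OF r(1)] rank by auto
  have r2: "even r \<Longrightarrow> 2 \<le> r" using r(2) by (cases "r = 1") auto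
  show "(if odd r then c (- 1) else (c (- 2) - c 2) + (m - c 1)) = Pp D 1 + Bb D 2"
    using r(2) r2 unfolding D_def Sdata_sel image_data_sel m_def by auto
  show "asc_phi r c i = Pp D i + Bb D (i + 1)" if i: "2 \<le> i" "i < n" for i
  proof (cases "even (r + i)")
    case True
    have "Bb D (i + 1) = 0" using True i unfolding D_def Sdata_sel image_data_sel by auto
    then show ?thesis using True i big[of i] unfolding D_def asc_phi_def Sdata_sel image_data_sel by auto
  next
    case False
    obtain j where j: "i = Suc j" "1 \<le> j" using i by (cases i) auto
    have P: "Pp D i = 0" using False unfolding D_def Sdata_sel image_data_sel by auto
    show ?thesis
    proof (cases "i + 1 \<le> r")
      case True
      have "Bb D (i + 1) = c (- int j - 2) - c (int j + 2)"
        using True False j unfolding D_def Sdata_sel image_data_sel by simp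
      also have "- int j - 2 = - int i - 1" using j by simp
      also have "int j + 2 = int i + 1" using j by simp
      finally show ?thesis using False P unfolding asc_phi_def by simp
    next
      case no: False
      have "c (- int (i + 1)) = 0" using bar[of "i + 1"] no False i by auto
      also have "- int (i + 1) = - int i - 1" by simp
      finally have "asc_phi r c i = 0" using False unfolding asc_phi_def by (simp add: algebra_simps)
      moreover have "Bb D (i + 1) = 0" using no unfolding D_def Sdata_sel by simp
      ultimately show ?thesis using P by simp
    qed
  qed
  show "(if r = n then c (int n) else 0) = Nn D n + Pp D n"
    using n big'[of n] domD(2)[OF c, of "int n + 1"] unfolding D_def Sdata_sel image_data_sel by auto
  have N: "Nn D i = (if even (r + i) \<and> i \<le> r then c (int i + 1) else 0)" if "1 \<le> i" for i
  proof (cases "i = r")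
    case True
    then show ?thesis using that unfolding D_def Sdata_sel image_data_sel by simp
  next
    case False
    show ?thesis
    proof (cases "even (r + i) \<and> i \<le> r")
      case True
      then have "i + 2 \<le> r" using False by presburger
      then show ?thesis using True False that unfolding D_def Sdata_sel image_data_sel by (simp add: algebra_simps)
    next
      case no: False
      then show ?thesis using False unfolding D_def Sdata_sel image_data_sel by auto
    qed
  qed
  have P: "Pp D i = (if even (r + i) \<and> i \<le> r then if i = 1 then c (- 1) else c (int i) else 0)" if "1 \<le> i" for i
    using that unfolding D_def Sdata_sel image_data_sel by auto
  show "(if even (r + i) then c (int i) + c (int i + 1) else 0) = Nn D i + Pp D i" if "2 \<le> i" for i
    using that N[of i] P[of i] big[of i] big'[of i] by auto
  show "(if odd r then c (- 1) + c 2 else 0) = Nn D 1 + Pp D 1"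
    using N[of 1] P[of 1] r(2) by auto
qed

end

section \<open>The image of a highest weight element\<close>

context vec
begin

lemma append_twos:
  assumes "\<mu> \<in> KR_shapes r k" "1 \<le> r" "j \<le> k - length \<mu>"
  shows "\<mu> @ replicate j 2 \<in> KR_shapes r k"
proof (rule KR_shapesI)
  note P = KR_shapes_props[OF assms(1)]
  have o: "j = 0" if "odd r" using P(5) assms(3) that by simp
  have r2: "2 \<le> r" if "even r" using that assms(2) by (cases "r = 1") auto
  have h2: "2 \<le> h" if "h \<in> set \<mu>" "even r" for h
  proof -
    have "0 < h" "even h" using P(3)[OF that(1)] that(2) by auto
    then show ?thesis by (cases "h = 1") auto
  qed
  have "sorted_wrt (\<ge>) (replicate m (2::nat))" for m by (induction m) auto
  then show "sorted_wrt (\<ge>) (\<mu> @ replicate j 2)" using P(1) h2 o by (cases "odd r") (auto simp: sorted_wrt_append)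
  show "0 < h \<and> h \<le> r \<and> even (r + h)" if "h \<in> set (\<mu> @ replicate j 2)" for h
    using that P(3)[of h] o r2 by (cases "odd r") auto
  show "length (\<mu> @ replicate j 2) \<le> k" using P(4) assms(3) by simp
  show "length (\<mu> @ replicate j 2) = k" if "odd r" using P(5) o that by simp
qed

definition next_row :: "nat \<Rightarrow> nat \<Rightarrow> int \<Rightarrow> nat" where
  "next_row C l = (\<lambda>a. if a = - 2 then C else if a = 1 then l - C else 0)"

lemma rword_next_row: "rword (next_row C l) = replicate C (- 2) @ replicate (l - C) 1"
  using rword_12[of "next_row C l"] by (simp add: next_row_def)

lemma dom_next:
  assumes \<mu>: "\<mu> \<in> KR_shapes r k" and C: "C \<le> k - length \<mu>"
  shows "dom r (\<mu> @ replicate (k - length \<mu>) 2) (next_row C l)"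
proof -
  have "C = 0" if "odd r" using KR_shapes_props(5)[OF \<mu> that] C by simp
  moreover have "count_list (replicate m a) i = (if i = a then m else 0)" for m and a i :: nat
    by (induction m) auto
  ultimately show ?thesis using rank C unfolding dom_def next_row_def by (auto simp: count_list_append)
qed

text \<open>On the side of \<Phi>(P) the first passage ends in a highest weight tableau, all of
  whose columns carry a +. This is just what the same formulas predict for the other end, so the
  second passage again starts from a matching pair.\<close>

lemma image_next:
  assumes \<mu>: "\<mu> \<in> KR_shapes r k" and r: "1 \<le> r" and C: "C \<le> k - length \<mu>"
  shows "image_data r k (\<mu> @ replicate (k - length \<mu>) 2) (next_row C l) =
    hwdata k (\<mu> @ replicate (k - length \<mu> - C) 2)"
proof -
  let ?m = "k - length \<mu>"
  note P = KR_shapes_props[OF \<mu>]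
  have o: "?m = 0" if "odd r" using P(5) that by simp
  have z: "count_list \<mu> i = 0" if "odd (r + i) \<or> r < i" for i
    using P(3)[of i] that by (intro count_notin) auto
  have cr: "count_list (replicate m a) i = (if i = a then m else 0)" for m and a i :: nat
    by (induction m) auto
  have r2: "2 \<le> r" if "even r" using that r by (cases "r = 1") auto
  have lk: "length \<mu> + ?m = k" using P(4) by simp
  have N: "Nn (image_data r k (\<mu> @ replicate ?m 2) (next_row C l)) i = Nn (hwdata k (\<mu> @ replicate (?m - C) 2)) i" for i
    unfolding image_data_sel hwdata_sel next_row_def using o C lk r by (cases "odd r") auto
  have Q: "Pp (image_data r k (\<mu> @ replicate ?m 2) (next_row C l)) i = Pp (hwdata k (\<mu> @ replicate (?m - C) 2)) i" for i
  proof (cases "odd (r + i) \<or> r < i")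
    case True
    have "?m = 0 \<or> i \<noteq> 2" using True o r2 by (cases "odd r") auto
    then show ?thesis using True z[OF True] unfolding image_data_sel hwdata_sel by (auto simp: count_list_append cr)
  next
    case False
    then show ?thesis using C unfolding image_data_sel hwdata_sel next_row_def by (auto simp: count_list_append cr)
  qed
  have M: "Mm (image_data r k (\<mu> @ replicate ?m 2) (next_row C l)) i = Mm (hwdata k (\<mu> @ replicate (?m - C) 2)) i" for i
    unfolding image_data_sel hwdata_sel next_row_def by auto
  have B: "Bb (image_data r k (\<mu> @ replicate ?m 2) (next_row C l)) i = Bb (hwdata k (\<mu> @ replicate (?m - C) 2)) i" for i
    unfolding image_data_sel hwdata_sel next_row_def using lk by auto
  show ?thesis using N Q M B by (intro pmcount.equality) auto
qed

text \<open>One passage on both sides. By \<open>strs_eq\<close> the exponents agree once \<phi> and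
  the final weights do. The final weights agree because the left end has \<open>min m (c 1)\<close>
  more columns of height 2, and equally many letters 1 of the row are replaced by barred 2s.\<close>

lemma stage:
  assumes \<sigma>: "KR_involution t n r k \<sigma>" "KR_involution t n 1 l \<sigma>'"
    and \<mu>: "\<mu> \<in> KR_shapes r k" and r: "KR_type r" "1 \<le> r" and c: "dom r \<mu> c"
    and X: "row (rword c) \<in> elts (KR_classical t n 1 l)"
  defines "m \<equiv> k - length \<mu>" and "d \<equiv> c(1 := c (- 1), - 1 := c 1)"
    and "D \<equiv> image_data r k \<mu> c"
  defines "wL \<equiv> reading (\<sigma> (hw_tableau \<mu>)) @ reading (\<sigma>' (row (rword c)))"
    and "wR \<equiv> reading (\<sigma>' (row (replicate l 1))) @ reading (\<sigma> (Ph r D))"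
  shows "\<sigma>' (row (rword c)) = row (rword d)" "length (rword d) = l"
    "Es path wL = reading (hw_tableau (\<mu> @ replicate m 2)) @ rword (next_row (min m (c 1)) l)"
    "Es path wR = replicate l 1 @ reading (hw_tableau (\<mu> @ replicate (m - c 1) 2))"
    "strs path wL = strs path wR"
    "tshape (\<sigma> (hw_tableau \<mu>)) = \<mu> @ replicate m 2" "tshape (\<sigma> (Ph r D)) = \<mu> @ replicate (m - c 1) 2"
    "\<exists>v. Es mid (E 1 wR) = replicate l 2 @ v"
proof -
  note I = image_outer[OF \<mu> r c, folded m_def D_def]
  note sh = sigma_hw[OF \<sigma>(1) \<mu> r(1)] and sP = sigma_Ph[OF \<sigma>(1) I(1) r(1)]
  note pS = pmd_Sdata[OF I(1) r(1)]
  show sX: "\<sigma>' (row (rword c)) = row (rword d)" unfolding d_def by (rule sigma_rword[OF \<sigma>(2) X])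
  have Xe: "row (rword d) \<in> elts (KR_classical t n 1 l)" using KR_involutionD(1)[OF \<sigma>(2) X] unfolding sX .
  show len: "length (rword d) = l" using KR_row(3)[OF Xe] by simp
  note L = left_side[OF \<mu> r c, folded m_def d_def, folded sh]
  have wL: "wL = reading (\<sigma> (hw_tableau \<mu>)) @ rword d" unfolding wL_def sX by simp
  have wR: "wR = replicate l (- 1) @ reading (Ph r (Sdata r D))"
    unfolding wR_def sP sigma_ones[OF \<sigma>(2)] by simp
  note Rs = right_side[OF pS r(1) wR I(2)]
  show EL: "Es path wL = reading (hw_tableau (\<mu> @ replicate m 2)) @ rword (next_row (min m (c 1)) l)"
    unfolding wL rword_next_row L(1) len ..
  show ER: "Es path wR = replicate l 1 @ reading (hw_tableau (\<mu> @ replicate (m - c 1) 2))" by (rule Rs(1))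
  show "\<exists>v. Es mid (E 1 wR) = replicate l 2 @ v" by (rule Rs(2))
  note S = sides_phis[OF \<mu> r c, folded m_def D_def]
  have ph: "phis path wL = phis path wR"
    unfolding wL L(2) Rs(3) S(1) S(3) S(5)
    using S(2,4) by (intro arg_cong2[where f = append] refl map_cong) auto
  have c1: "c 1 \<le> l"
  proof -
    have "count_list (rword d) (- 1) = c 1" using rank by (subst count_rword) (auto simp: d_def)
    then show ?thesis using count_le_length[of "rword d" "- 1"] len by simp
  qed
  have mm: "int m - int (min m (c 1)) = int (m - c 1)" by (simp add: min_def)
  have wt: "wtw (Es path wL) j = wtw (Es path wR) j" if "j \<in> {1..n}" for j
    unfolding EL ER rword_next_row wtw_simps(3) wtw_replicate
    using that c1 mm by (simp add: wtw_hw)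
  have VL: "set wL \<subseteq> elts V"
    using KR_involutionD(1)[OF \<sigma>(1) hw_elts[OF \<mu> r(1)]] Xe KR_elts[OF KR_typeD(1)[OF r(1)]] KR_elts[OF KR_typeD(1)[OF KR_type_1]]
    unfolding wL KN_def tab_def by fastforce
  have PhE: "Ph r (Sdata r D) \<in> elts (KR_classical t n r k)" by (rule Ph_elts(1)[OF pS r(1)])
  have "set (reading (Ph r (Sdata r D))) \<subseteq> elts V"
    using PhE KR_elts[OF KR_typeD(1)[OF r(1)]] unfolding KN_def tab_def by blast
  moreover have "- 1 \<in> elts V" using rank by (simp add: elts_V)
  ultimately have VR: "set wR \<subseteq> elts V" unfolding wR by auto
  show "strs path wL = strs path wR" using strs_eq[OF path_set(1) VL VR ph wt] by blast
  show "tshape (\<sigma> (Ph r D)) = \<mu> @ replicate (m - c 1) 2"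
    unfolding sP Ph_elts(2)[OF pS r(1)] I(2) ..
  obtain T where T: "Ph r (Sdata r (hwdata k \<mu>)) = map (asc_col 0) T" "slot_tab T" "turn_ok T"
    "map (\<lambda>(v, g, b). v + (if b = None then 0 else 1)) T = \<mu> @ replicate m 2"
    by (rule hw_slots[OF \<mu> r, folded m_def]) (rule that; assumption)
  show "tshape (\<sigma> (hw_tableau \<mu>)) = \<mu> @ replicate m 2"
    using KN_slots[OF T(2,3)] unfolding sh T(1,4) KN_def by blast
qed

lemma sw_mid: "map (\<lambda>(i, m). (sw i, m)) (zip mid es) = zip mid es"
proof -
  have "map (\<lambda>(i, m). (sw i, m)) (zip ks es) = zip ks es" if "set ks \<subseteq> {2..n}" for ks es
    using that
  proof (induction ks arbitrary: es)
    case (Cons a ks)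
    then show ?case by (cases es) (auto simp: sw_def)
  qed simp
  then show ?thesis using path_set(2) .
qed

lemma zip_nodes: "fst ` set (zip ks es) \<subseteq> set ks"
  by (auto dest: set_zip_leftD)

lemma prefix_eq:
  assumes "strs path w = strs path w'"
  shows "weps 1 w = weps 1 w'" "strs mid (E 1 w) = strs mid (E 1 w')"
    "weps 1 (Es mid (E 1 w)) = weps 1 (Es mid (E 1 w'))"
  using assms by (auto simp: path_def strs_append)

lemma weps_single: "weps 1 (replicate l (- 1)) = l" "weps 1 (replicate l 2) = l"
proof -
  have "le 1 (- 1) = 1 \<and> lp 1 (- 1) = 0 \<and> le 1 2 = 1 \<and> lp 1 2 = 0" using rank by (simp add: le_def lp_def)
  then show "weps 1 (replicate l (- 1)) = l" "weps 1 (replicate l 2) = l" by (induction l) auto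
qed

lemma image_thm:
  assumes \<sigma>: "KR_involution t n r k \<sigma>" "KR_involution t n 1 l \<sigma>'"
    and \<mu>: "\<mu> \<in> KR_shapes r k" and r: "KR_type r" "1 \<le> r" and c: "dom r \<mu> c"
    and X: "row (rword c) \<in> elts (KR_classical t n 1 l)"
    and R: "crystal_iso {0..n} (tensor (KR_crystal t n r k \<sigma>) (KR_crystal t n 1 l \<sigma>'))
      (tensor (KR_crystal t n 1 l \<sigma>') (KR_crystal t n r k \<sigma>)) R"
    and H: "energy_function n (KR_crystal t n r k \<sigma>) (KR_crystal t n 1 l \<sigma>') R H"
    and base: "\<And>\<nu>. \<nu> \<in> KR_shapes r k \<Longrightarrow> length \<nu> = k \<Longrightarrow>
      R (hw_tableau \<nu>, row (replicate l 1)) = (row (replicate l 1), hw_tableau \<nu>) \<and>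
      H (hw_tableau \<nu>, row (replicate l 1)) = 0"
  shows "R (hw_tableau \<mu>, row (rword c)) = (row (replicate l 1), Ph r (image_data r k \<mu> c))"
    "H (hw_tableau \<mu>, row (rword c)) =
      (if odd r then int (c 1) - int (c (- 1)) - int l else int (c 1 - (k - length \<mu>)) - int l)"
proof -
  define A where "A = KR_crystal t n r k \<sigma>"
  define B where "B = KR_crystal t n 1 l \<sigma>'"
  define m where "m = k - length \<mu>"
  define D where "D = image_data r k \<mu> c"
  define d where "d = c(1 := c (- 1), - 1 := c 1)"
  define C where "C = min m (c 1)"
  define \<mu>' where "\<mu>' = \<mu> @ replicate m 2"
  define \<mu>'' where "\<mu>'' = \<mu> @ replicate (m - c 1) 2"
  define o1 where "o1 = row (replicate l 1)"
  define u0 where "u0 = (hw_tableau \<mu>, row (rword c))"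
  define v0 where "v0 = (o1, Ph r D)"
  define wL where "wL = reading (\<sigma> (hw_tableau \<mu>)) @ reading (\<sigma>' (row (rword c)))"
  define wR where "wR = reading (\<sigma>' o1) @ reading (\<sigma> (Ph r D))"
  note rn = KR_typeD(1)[OF r(1)] and n1 = KR_typeD(1)[OF KR_type_1]
  note iso = R[folded A_def B_def]
  have NA: "normal_on {0..n} A" unfolding A_def by (rule normal_KR[OF rn \<sigma>(1)])
  have NB: "normal_on {0..n} B" unfolding B_def by (rule normal_KR[OF n1 \<sigma>(2)])
  have SA: "swapping n A \<sigma>" unfolding A_def by (rule swapping_KR[OF rn \<sigma>(1)])
  have SB: "swapping n B \<sigma>'" unfolding B_def by (rule swapping_KR[OF n1 \<sigma>(2)])
  note NAB = normal_on_tensor[OF NA NB] and NBA = normal_on_tensor[OF NB NA]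
  note SAB = swapping_tensor[OF SA NA SB NB] and SBA = swapping_tensor[OF SB NB SA NA]
  have eA: "elts A = elts (KR_classical t n r k)" and eB: "elts B = elts (KR_classical t n 1 l)"
    by (simp_all add: A_def B_def)
  note I = image_outer[OF \<mu> r c, folded D_def m_def]
  have PhE: "Ph r D \<in> elts A" unfolding eA by (rule Ph_elts(1)[OF I(1) r(1)])
  have hwE: "hw_tableau \<mu> \<in> elts A" unfolding eA by (rule hw_elts[OF \<mu> r(1)])
  have o1E: "o1 \<in> elts B" unfolding eB o1_def by (rule ones_elts)
  have XE: "row (rword c) \<in> elts B" using X eB by simp
  have u0: "u0 \<in> elts (tensor A B)" "v0 \<in> elts (tensor B A)"
    using hwE XE o1E PhE by (simp_all add: u0_def v0_def)
  have \<sigma>\<sigma>: "\<sigma> (\<sigma> a) = a" "\<sigma> a \<in> elts A" if "a \<in> elts A" for a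
    using KR_involutionD(1,2)[OF \<sigma>(1)] that unfolding eA by auto
  have \<sigma>'\<sigma>': "\<sigma>' (\<sigma>' a) = a" "\<sigma>' a \<in> elts B" if "a \<in> elts B" for a
    using KR_involutionD(1,2)[OF \<sigma>(2)] that unfolding eB by auto
  note St = stage[OF \<sigma> \<mu> r c X, folded m_def D_def d_def C_def o1_def, folded \<mu>'_def \<mu>''_def wL_def wR_def]
  define es where "es = strs path wL"
  have pn: "set path \<subseteq> {1..n}" by (rule path_set(1))
  have Cm: "C \<le> k - length \<mu>" by (simp add: C_def m_def)
  have mC: "m - C = m - c 1" by (simp add: C_def min_def)
  have \<mu>'K: "\<mu>' \<in> KR_shapes r k" unfolding \<mu>'_def m_def by (rule append_twos[OF \<mu> r(2)]) simp
  have \<mu>''K: "\<mu>'' \<in> KR_shapes r k" unfolding \<mu>''_def m_def by (rule append_twos[OF \<mu> r(2)]) simp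
  have l': "length \<mu>' = k" using KR_shapes_props(4)[OF \<mu>] by (simp add: \<mu>'_def m_def)
  define X' where "X' = row (rword (next_row C l))"
  have C_le: "C \<le> l"
  proof -
    have "length (Es ks w) = length w" for ks w by (induction ks arbitrary: w) auto
    from this[of wL path] have e: "length wL = length (reading (hw_tableau \<mu>')) + length (rword (next_row C l))"
      unfolding St(3) by simp
    have "length wL = length (reading (hw_tableau \<mu>')) + l"
      unfolding wL_def using St(1,2,6) by (simp add: length_reading)
    then show ?thesis using e by (simp add: rword_next_row)
  qed
  have tX': "tshape X' = replicate l 1" unfolding X'_def using C_le by (simp add: rword_next_row)
  have tsX: "tshape (\<sigma>' (row (rword c))) = replicate l 1" using St(1,2) by simp
  have tso: "tshape (\<sigma>' o1) = replicate l 1" unfolding o1_def sigma_ones[OF \<sigma>(2)] by simp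
  have run1: "run (tensor A B) (zip path es) (\<sigma> (hw_tableau \<mu>), \<sigma>' (row (rword c))) = Some (hw_tableau \<mu>', X')"
    unfolding A_def B_def es_def wL_def
    by (rule pair_run[OF rn n1 _ _ pn])
      (use \<sigma>\<sigma>(2)[OF hwE] \<sigma>'\<sigma>'(2)[OF XE] St(3,6) tX' tsX in \<open>simp_all add: eA eB wL_def X'_def\<close>)
  have run1': "run (tensor B A) (zip path es) (\<sigma>' o1, \<sigma> (Ph r D)) = Some (o1, hw_tableau \<mu>'')"
    unfolding A_def B_def es_def St(5) wR_def
    by (rule pair_run[OF n1 rn _ _ pn])
      (use \<sigma>\<sigma>(2)[OF PhE] \<sigma>'\<sigma>'(2)[OF o1E] St(4,7) tso in \<open>simp_all add: eA eB wR_def o1_def\<close>)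
  define sws where "sws = (\<lambda>ps :: (nat \<times> nat) list. map (\<lambda>(i, m). (sw i, m)) ps)"
  have pf: "fst ` set (zip path es) \<subseteq> {1..n}" using zip_nodes[of path es] pn by blast
  have \<Sigma>E: "(\<sigma> (hw_tableau \<mu>), \<sigma>' (row (rword c))) \<in> elts (tensor A B)" "(\<sigma>' o1, \<sigma> (Ph r D)) \<in> elts (tensor B A)"
    using \<sigma>\<sigma>(2) \<sigma>'\<sigma>'(2) hwE XE o1E PhE by simp_all
  have r1: "run (tensor A B) (sws (zip path es)) u0 = Some (\<sigma> (hw_tableau \<mu>'), \<sigma>' X')"
    using swapping_run[OF SAB NAB \<Sigma>E(1) pf run1] \<sigma>\<sigma>(1)[OF hwE] \<sigma>'\<sigma>'(1)[OF XE] by (simp add: u0_def sws_def)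
  have r1': "run (tensor B A) (sws (zip path es)) v0 = Some (\<sigma>' o1, \<sigma> (hw_tableau \<mu>''))"
    using swapping_run[OF SBA NBA \<Sigma>E(2) pf run1'] \<sigma>\<sigma>(1)[OF PhE] \<sigma>'\<sigma>'(1)[OF o1E] by (simp add: v0_def sws_def)
  have c': "dom r \<mu>' (next_row C l)" unfolding \<mu>'_def m_def by (rule dom_next[OF \<mu> Cm])
  have X'E: "row (rword (next_row C l)) \<in> elts (KR_classical t n 1 l)"
  proof -
    have "(hw_tableau \<mu>', X') \<in> elts (tensor A B)"
      by (rule run_elts[OF NAB \<Sigma>E(1) _ run1]) (use pf in auto)
    then show ?thesis by (simp add: eB X'_def)
  qed
  note St2 = stage[OF \<sigma> \<mu>'K r c' X'E, unfolded l' diff_self_eq_0 min_0L diff_0_eq_0 replicate_0 append_Nil2,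
      folded o1_def X'_def]
  have im': "Ph r (image_data r k \<mu>' (next_row C l)) = hw_tableau \<mu>''"
    unfolding \<mu>'_def m_def image_next[OF \<mu> r(2) Cm]
    using Ph_hwdata[OF \<mu>''K r(1)] mC by (simp add: \<mu>''_def m_def)
  define wL2 where "wL2 = reading (\<sigma> (hw_tableau \<mu>')) @ reading (\<sigma>' X')"
  define es2 where "es2 = strs path wL2"
  have z: "rword (next_row 0 l) = replicate l 1" by (simp add: rword_next_row)
  have hw'E: "hw_tableau \<mu>' \<in> elts A" "hw_tableau \<mu>'' \<in> elts A" "X' \<in> elts B"
    using hw_elts[OF \<mu>'K r(1)] hw_elts[OF \<mu>''K r(1)] X'E by (simp_all add: eA eB X'_def)
  have tsX2: "tshape (\<sigma>' X') = replicate l 1" using St2(1,2) by simp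
  have run2: "run (tensor A B) (zip path es2) (\<sigma> (hw_tableau \<mu>'), \<sigma>' X') = Some (hw_tableau \<mu>', o1)"
    unfolding A_def B_def es2_def wL2_def
    by (rule pair_run[OF rn n1 _ _ pn])
      (use \<sigma>\<sigma>(2)[OF hw'E(1)] \<sigma>'\<sigma>'(2)[OF hw'E(3)] St2(3,6) tsX2 z in \<open>simp_all add: eA eB o1_def\<close>)
  have run2': "run (tensor B A) (zip path es2) (\<sigma>' o1, \<sigma> (hw_tableau \<mu>'')) = Some (o1, hw_tableau \<mu>')"
    unfolding A_def B_def es2_def wL2_def St2(5)[unfolded im']
    by (rule pair_run[OF n1 rn _ _ pn])
      (use \<sigma>\<sigma>(2)[OF hw'E(2)] \<sigma>'\<sigma>'(2)[OF o1E] St2(4,7) tso im' in \<open>simp_all add: eA eB o1_def\<close>)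
  \<comment> \<open>Starting from \<open>u0\<close> itself, the first passage runs in the nodes 0,
    2, ..., 2, 0 and arrives at the \<Sigma>-image of \<mu>' \<otimes> X'. This is where the second
    passage starts, which therefore runs in the classical nodes and ends at \<mu>' \<otimes>
    \<open>1^l\<close> without any \<Sigma>.\<close>
  define ps where "ps = sws (zip path es) @ zip path es2"
  have "fst ` set (sws (zip path es)) \<subseteq> {0..n}" using pf by (auto simp: sws_def sw_def)
  moreover have "fst ` set (zip path es2) \<subseteq> {0..n}" by (rule order_trans[OF order_trans[OF zip_nodes pn]]) auto
  ultimately have psn: "fst ` set ps \<subseteq> {0..n}" "fst ` set (sws (zip path es)) \<subseteq> {0..n}" by (auto simp: ps_def)
  have ru: "run (tensor A B) ps u0 = Some (hw_tableau \<mu>', o1)" unfolding ps_def run_append r1 by (simp add: run2)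
  have rv: "run (tensor B A) ps v0 = Some (o1, hw_tableau \<mu>')" unfolding ps_def run_append r1' by (simp add: run2')
  note bs = base[OF \<mu>'K l', folded o1_def]
  \<comment> \<open>\<open>R u0\<close> and \<open>v0\<close> are carried by the same raisings to
    the same element, hence they coincide.\<close>
  have "run (tensor B A) ps (R u0) = Some (o1, hw_tableau \<mu>')"
    using iso_run[OF iso NAB u0(1) psn(1) ru] bs by simp
  then have Ru: "R u0 = v0"
    using run_inj[OF NBA iso_elts[OF iso u0(1)] u0(2) psn(1) _ rv] by simp
  then show "R (hw_tableau \<mu>, row (rword c)) = (row (replicate l 1), Ph r (image_data r k \<mu> c))"
    by (simp add: u0_def v0_def o1_def D_def)
  show "H (hw_tableau \<mu>, row (rword c)) =
      (if odd r then int (c 1) - int (c (- 1)) - int l else int (c 1 - (k - length \<mu>)) - int l)"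
  proof -
    define em where "em = strs mid (E 1 wL)"
    define e0 where "e0 = weps 1 wL"
    define e2 where "e2 = weps 1 (Es mid (E 1 wL))"
    have es: "es = [e0] @ em @ [e2]" by (simp add: es_def path_def strs_append e0_def em_def e2_def)
    have lem: "length em = length mid" by (simp add: em_def)
    have zp: "zip path es = zip ([1] @ mid) ([e0] @ em) @ [(1, e2)]" using lem by (simp add: path_def es)
    have s1: "strs ([1] @ mid) wL = [e0] @ em" by (simp add: e0_def em_def)
    have s1': "strs ([1] @ mid) wR = [e0] @ em" using prefix_eq[OF St(5)] by (simp add: e0_def em_def)
    have pm: "set ([1] @ mid) \<subseteq> {1..n}" "fst ` set (zip ([1] @ mid) ([e0] @ em)) \<subseteq> {1..n}"
      using path_set zip_nodes[of "[1] @ mid" "[e0] @ em"] by (auto simp: path_def)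
    have sz: "sws (zip ([1] @ mid) ([e0] @ em)) = (0, e0) # zip mid em"
      using sw_mid[of em] by (simp add: sws_def sw_def)
    have dl: "wL = reading (\<sigma> (hw_tableau \<mu>)) @ rword d" by (simp add: wL_def St(1))
    note LS = left_side[OF \<mu> r c, folded m_def d_def, folded sigma_hw[OF \<sigma>(1) \<mu> r(1)], folded dl]
    define q where "q = (if odd r then c (- 1) + c 2 else 0)"
    \<comment> \<open>Of the element before the last node only \<phi> of the first and \<epsilon> of
      the second factor matter for the energy.\<close>
    obtain u v where uv: "Es mid (E 1 wL) = u @ v" "length u = length (reading (\<sigma> (hw_tableau \<mu>)))" "wphi 1 u = 0"
      "weps 1 v + q = l"
      using LS(5) unfolding St(2) q_def by blast
    have le: "length (Es ks w) = length w" for ks w by (induction ks arbitrary: w) auto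
    have lv: "length v = l"
      using le[of "E 1 wL" mid] uv(1,2) St(2) by (simp add: dl)
    define Tb where "Tb = unread (tshape (\<sigma> (hw_tableau \<mu>))) u"
    define Yb where "Yb = row v"
    have Tb: "reading Tb = u" "tshape Tb = tshape (\<sigma> (hw_tableau \<mu>))"
      using uv(2) by (simp_all add: Tb_def reading_unread tshape_unread length_reading)
    have runb: "run (tensor A B) (zip ([1] @ mid) ([e0] @ em)) (\<sigma> (hw_tableau \<mu>), \<sigma>' (row (rword c))) = Some (Tb, Yb)"
      unfolding A_def B_def s1[symmetric] wL_def
      by (rule pair_run[OF rn n1 _ _ pm(1)])
        (use \<sigma>\<sigma>(2)[OF hwE] \<sigma>'\<sigma>'(2)[OF XE] uv(1)[unfolded wL_def] Tb tsX lv in \<open>simp_all add: eA eB Yb_def\<close>)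
    have bE: "Tb \<in> elts A" "Yb \<in> elts B"
      using run_elts[OF NAB \<Sigma>E(1) _ runb] pm(2) by force+
    define ub where "ub = (\<sigma> Tb, \<sigma>' Yb)"
    have rb: "run (tensor A B) ((0, e0) # zip mid em) u0 = Some ub"
      using swapping_run[OF SAB NAB \<Sigma>E(1) pm(2) runb] \<sigma>\<sigma>(1)[OF hwE] \<sigma>'\<sigma>'(1)[OF XE]
      unfolding sws_def[symmetric] sz by (simp add: u0_def ub_def)
    obtain v' where v': "Es mid (E 1 wR) = replicate l 2 @ v'" using St(8) by blast
    define Tc where "Tc = unread (tshape (\<sigma> (Ph r D))) v'"
    have lv': "length v' = length (reading (\<sigma> (Ph r D)))"
      using le[of "E 1 wR" mid] v' by (simp add: wR_def o1_def sigma_ones[OF \<sigma>(2)])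
    have Tc: "reading Tc = v'" "tshape Tc = tshape (\<sigma> (Ph r D))"
      using lv' by (simp_all add: Tc_def reading_unread tshape_unread length_reading)
    have runc: "run (tensor B A) (zip ([1] @ mid) ([e0] @ em)) (\<sigma>' o1, \<sigma> (Ph r D)) = Some (row (replicate l 2), Tc)"
      unfolding A_def B_def s1'[symmetric] wR_def
      by (rule pair_run[OF n1 rn _ _ pm(1)])
        (use \<sigma>\<sigma>(2)[OF PhE] \<sigma>'\<sigma>'(2)[OF o1E] v'[unfolded wR_def] Tc tso in \<open>simp_all add: eA eB\<close>)
    have cE: "row (replicate l 2) \<in> elts B" "Tc \<in> elts A"
      using run_elts[OF NBA \<Sigma>E(2) _ runc] pm(2) by force+
    have rc: "run (tensor B A) ((0, e0) # zip mid em) v0 = Some (\<sigma>' (row (replicate l 2)), \<sigma> Tc)"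
      using swapping_run[OF SBA NBA \<Sigma>E(2) pm(2) runc] \<sigma>\<sigma>(1)[OF PhE] \<sigma>'\<sigma>'(1)[OF o1E]
      unfolding sws_def[symmetric] sz by (simp add: v0_def)
    have mn: "fst ` set (zip mid em) \<subseteq> {1..n}"
      by (rule order_trans[OF zip_nodes]) (use path_set(2) in auto)
    then have mn0: "fst ` set ((0, e0) # zip mid em) \<subseteq> {0..n}" by auto
    have Rub: "R ub = (\<sigma>' (row (replicate l 2)), \<sigma> Tc)"
      using iso_run[OF iso NAB u0(1) mn0 rb] rc unfolding Ru by simp
    obtain ua where ua: "iter_op (eop (tensor A B) 0) e0 u0 = Some ua" "run (tensor A B) (zip mid em) ua = Some ub"
      using rb by (cases "iter_op (eop (tensor A B) 0) e0 u0") auto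
    define u1 where "u1 = (\<sigma> (hw_tableau \<mu>'), \<sigma>' X')"
    have ub1: "iter_op (eop (tensor A B) 0) e2 ub = Some u1"
    proof -
      have sn: "sws (ps @ [(1, e2)]) = sws ps @ [(0, e2)]" for ps by (simp add: sws_def sw_def)
      have "run (tensor A B) (((0, e0) # zip mid em) @ [(0, e2)]) u0 = Some u1"
        using r1 unfolding zp sn sz u1_def .
      then show ?thesis unfolding run_append rb
        by (cases "iter_op (eop (tensor A B) 0) e2 ub") auto
    qed
    have z0: "0 \<in> {0..n}" by simp
    note s0 = normal_onD[OF NAB z0]
    have ubE: "ub \<in> elts (tensor A B)" using \<sigma>\<sigma>(2)[OF bE(1)] \<sigma>'\<sigma>'(2)[OF bE(2)] by (simp add: ub_def)
    have kr: "veps A 0 b = teps 1 (\<sigma> b)" "vphi A 0 b = tphi 1 (\<sigma> b)" if "b \<in> elts A" for b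
      using veps_KR(3,4)[OF rn \<sigma>(1)] that unfolding eA by (simp_all add: A_def)
    have kr': "veps B 0 b = teps 1 (\<sigma>' b)" "vphi B 0 b = tphi 1 (\<sigma>' b)" if "b \<in> elts B" for b
      using veps_KR(3,4)[OF n1 \<sigma>(2)] that unfolding eB by (simp_all add: B_def)
    have v0e: "veps (tensor A B) 0 u0 = e0"
      using veps_tensor(1)[OF NA NB z0 hwE XE] unfolding u0_def kr[OF hwE] kr'[OF XE]
      by (simp add: e0_def wL_def weps_append)
    have vbe: "veps (tensor A B) 0 ub = e2"
      using veps_tensor(1)[OF NA NB z0 \<sigma>\<sigma>(2)[OF bE(1)] \<sigma>'\<sigma>'(2)[OF bE(2)]]
      unfolding ub_def kr[OF \<sigma>\<sigma>(2)[OF bE(1)]] kr'[OF \<sigma>'\<sigma>'(2)[OF bE(2)]] \<sigma>\<sigma>(1)[OF bE(1)] \<sigma>'\<sigma>'(1)[OF bE(2)]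
      unfolding e2_def uv(1) weps_append Tb(1) Yb_def reading_row .
    have za: "veps (tensor A B) 0 ua = 0" using iter_e_props(3)[OF s0 u0(1) ua(1)] v0e by simp
    have zb: "veps (tensor A B) 0 u1 = 0" using iter_e_props(3)[OF s0 ubE ub1] vbe by simp
    have uaE: "ua \<in> elts (tensor A B)" using iter_e_props(1)[OF s0 u0(1) ua(1)] .
    note H' = H[folded A_def B_def]
    have o2: "veps B 0 o1 = l" using kr'(1)[OF o1E] by (simp add: o1_def sigma_ones[OF \<sigma>(2)] weps_single[unfolded One_nat_def])
    \<comment> \<open>The left factor of \<open>R u0\<close> is \<open>1^l\<close> with \<epsilon>_0
      = l. On the other side \<phi>_0(\<mu>) = m, and \<epsilon>_0(x) is x_1 plus the excess of x_2
      over its barred partner.\<close>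
    have Ha: "H ua = H u0 + int l - int (c 1 + (c 2 - c (- 2)) - m)"
      using energy_full_string[OF H' iso NA NB u0(1) ua(1) za] LS(3,4) o2
      unfolding string_energy_def Ru by (simp add: u0_def v0_def kr[OF hwE] kr'[OF XE] St(1))
    have Hb: "H ub = H ua" by (rule energy_run[OF H' NAB uaE mn ua(2)])
    have yv: "reading Yb = v" by (simp add: Yb_def)
    \<comment> \<open>Before the second step with label 0 the left factor of the image is the
      \<sigma>'-image of a row of 2s, again with \<epsilon>_0 = l, and \<phi>_0 of the first factor
      of \<open>ub\<close> is 0.\<close>
    have H1: "H u1 = H ub + int l - int (weps 1 v)"
      using energy_full_string[OF H' iso NA NB ubE ub1 zb] uv(3)
      unfolding string_energy_def Rub
      by (simp add: ub_def kr[OF \<sigma>\<sigma>(2)[OF bE(1)]] kr'[OF \<sigma>'\<sigma>'(2)[OF bE(2)]] kr'[OF \<sigma>'\<sigma>'(2)[OF cE(1)]]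
          \<sigma>\<sigma>(1)[OF bE(1)] \<sigma>'\<sigma>'(1)[OF bE(2)] \<sigma>'\<sigma>'(1)[OF cE(1)] Tb(1) yv weps_single[unfolded One_nat_def])
    have u1E: "u1 \<in> elts (tensor A B)" using iter_e_props(1)[OF s0 ubE ub1] .
    have "fst ` set (zip path es2) \<subseteq> {1..n}" by (rule order_trans[OF zip_nodes pn])
    then have "H (hw_tableau \<mu>', o1) = H u1" using energy_run[OF H' NAB u1E _ run2[folded u1_def]] by blast
    then have H0: "H u1 = 0" using bs by simp
    have od: "m = 0" "c (- 2) = 0" if "odd r"
      using KR_shapes_props(5)[OF \<mu> that] domD(3)[OF c, of 2] that by (simp_all add: m_def)
    have ev: "c 2 \<le> c (- 2)" if "even r" using domD(4)[OF c, of 2] that by simp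
    have vq: "int (weps 1 v) = int l - int q" using uv(4) by linarith
    have "H u0 = (if odd r then int (c 1) - int (c (- 1)) - int l else int (c 1 - m) - int l)"
      using Ha Hb H1 H0 vq od ev by (cases "odd r") (simp_all add: q_def)
    then show ?thesis by (simp add: u0_def m_def)
  qed
qed

end

section \<open>The case of a one-row tableau of ones\<close>

lemma sum_list_bound:
  fixes f :: "'a \<Rightarrow> int"
  assumes "\<And>h. h \<in> set hs \<Longrightarrow> f h \<le> M"
  shows "sum_list (map f hs) \<le> int (length hs) * M \<and>
    (sum_list (map f hs) = int (length hs) * M \<longrightarrow> (\<forall>h\<in>set hs. f h = M))"
  using assms
proof (induction hs)
  case (Cons h hs)
  have IH: "sum_list (map f hs) \<le> int (length hs) * M"
    "sum_list (map f hs) = int (length hs) * M \<Longrightarrow> \<forall>h\<in>set hs. f h = M" and h: "f h \<le> M"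
    using Cons by auto
  have e: "int (length (h # hs)) * M = M + int (length hs) * M" "sum_list (map f (h # hs)) = f h + sum_list (map f hs)"
    by (simp_all add: distrib_right)
  have "f h = M \<and> sum_list (map f hs) = int (length hs) * M"
    if "f h + sum_list (map f hs) = M + int (length hs) * M"
    using that h IH(1) by linarith
  then show ?case unfolding e using IH h by fastforce
qed simp

context vec
begin

section \<open>Dominant weights and rows of equal letters\<close>

lemma wphi_hw:
  assumes "i \<in> {1..n}" "\<And>h. h \<in> set \<mu> \<Longrightarrow> h \<le> n"
  shows "i < n \<Longrightarrow> wphi i (reading (hw_tableau \<mu>)) = count_list \<mu> i"
    "i = n \<Longrightarrow> (t = D1 \<longrightarrow> (\<forall>h\<in>set \<mu>. h + 2 \<le> n)) \<Longrightarrow> (t = B1 \<longrightarrow> (\<forall>h\<in>set \<mu>. h < n)) \<Longrightarrow>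
      wphi i (reading (hw_tableau \<mu>)) = count_list \<mu> n"
proof -
  have V: "set (reading (hw_tableau \<mu>)) \<subseteq> elts V" using tab_hw[OF assms(2)] by (simp add: tab_def)
  have c: "int (wphi i (reading (hw_tableau \<mu>))) = coroot i (wtw (reading (hw_tableau \<mu>)))"
    using word_coroot[OF assms(1) V] hw_eps[OF assms(1), of \<mu>] by simp
  have d: "length (filter (\<lambda>h. j \<le> h) \<mu>) = count_list \<mu> j + length (filter (\<lambda>h. j + 1 \<le> h) \<mu>)" for j and \<mu> :: "nat list"
    by (induction \<mu>) auto
  show "wphi i (reading (hw_tableau \<mu>)) = count_list \<mu> i" if "i < n"
    using c that assms(1) d[of i \<mu>] unfolding coroot_def by (simp add: wtw_hw)
  show "wphi i (reading (hw_tableau \<mu>)) = count_list \<mu> n"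
    if "i = n" and D: "t = D1 \<longrightarrow> (\<forall>h\<in>set \<mu>. h + 2 \<le> n)" and B: "t = B1 \<longrightarrow> (\<forall>h\<in>set \<mu>. h < n)"
  proof -
    have n3: "3 \<le> n" by (rule rank)
    have f: "length (filter (\<lambda>h. j \<le> h) \<mu>) = 0" if "\<forall>h\<in>set \<mu>. h < j" for j
      using that by (auto simp: filter_empty_conv)
    have g: "count_list \<mu> n = 0" if "\<forall>h\<in>set \<mu>. h < n" using that by (intro count_notin) auto
    have e: "length (filter (\<lambda>h. n \<le> h) \<mu>) = count_list \<mu> n"
      using d[of n \<mu>] f[of "n + 1"] assms(2) by fastforce
    show ?thesis
    proof (cases t)
      case D1
      have "\<forall>h\<in>set \<mu>. h < n - 1" "\<forall>h\<in>set \<mu>. h < n" using D D1 n3 by fastforce+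
      then show ?thesis using c D1 f[of "n - 1"] f[of n] g n3 \<open>i = n\<close> unfolding coroot_def by (simp add: wtw_hw)
    next
      case B1
      then have "\<forall>h\<in>set \<mu>. h < n" using B by simp
      then show ?thesis using c B1 f[of n] g n3 \<open>i = n\<close> unfolding coroot_def by (simp add: wtw_hw)
    next
      case A2odd
      then show ?thesis using c e n3 \<open>i = n\<close> unfolding coroot_def by (simp add: wtw_hw)
    qed
  qed
qed

lemma row_letter:
  assumes "1 \<le> j" "j \<le> n"
  shows "row (replicate l (int j)) \<in> elts (KR_classical t n 1 l)"
proof -
  have "Es (rev [1..<j]) (replicate l (int j)) = replicate l 1"
    using assms
  proof (induction j rule: dec_induct)
    case (step j)
    then show ?case using raise_row_single(3)[of j l] by (simp add: add.commute)
  qed simp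
  moreover have V: "set (replicate l (int j)) \<subseteq> elts V" using assms by (auto simp: elts_V)
  moreover have "set (rev [1..<j]) \<subseteq> {1..n}" using assms by auto
  ultimately have "red\<^sup>*\<^sup>* (replicate l (int j)) (replicate l 1)"
    using foldl_E_reds[of "rev [1..<j]", OF _ V] by metis
  then have "KN (replicate l 1) (row (replicate l (int j)))"
    using V unfolding KN_def tab_def hw_row by simp
  then show ?thesis using KR_elts[OF KR_typeD(1)[OF KR_type_1]] KR_shapes_1 by simp
qed

lemma row_neutral:
  assumes "1 \<le> i" "i < n" "j \<noteq> i" "j \<noteq> i + 1"
  shows "weps i (replicate l (int j)) = 0" "wphi i (replicate l (int j)) = 0"
  using assms by (induction l) (auto simp: le_def lp_def)

lemma row_lower:
  assumes "1 \<le> i" "i < n"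
  shows "wphi i (replicate l (int i + 1)) = 0" "weps i (replicate l (int i + 1)) = l"
proof -
  show "wphi i (replicate l (int i + 1)) = 0" using raise_row_single(4)[OF assms, of l] by (simp add: wphi_st)
  show "weps i (replicate l (int i + 1)) = l" using assms by (induction l) (auto simp: le_def lp_def)
qed

text \<open>A strictly dominant functional: it is positive on every simple root, hence increases
  with every raising.\<close>

definition weight_fn :: "int list \<Rightarrow> int" where
  "weight_fn w = (\<Sum>j=1..n. (int n + 1 - int j) * wtw w j)"

lemma weight_fn_red:
  assumes "red w v"
  shows "weight_fn w < weight_fn v"
proof -
  obtain i where i: "i \<in> {1..n}" "we i w = Some v" and w: "set w \<subseteq> elts V" using assms unfolding red_def by blast
  have "weight_fn v - weight_fn w = (\<Sum>j=1..n. (int n + 1 - int j) * (wtw v j - wtw w j))"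
    unfolding weight_fn_def sum_subtractf[symmetric] by (intro sum.cong) (auto simp: right_diff_distrib)
  also have "\<dots> = (\<Sum>j=1..n. (int n + 1 - int j) * alpha i j)"
    using we_alpha[OF i(1) _ w i(2)] by (intro sum.cong) auto
  also have "\<dots> > 0"
  proof (cases "i < n")
    case True
    have "(\<Sum>j=1..n. (int n + 1 - int j) * alpha i j) =
        (\<Sum>j=1..n. (if j = i then int n + 1 - int j else 0)) - (\<Sum>j=1..n. (if j = i + 1 then int n + 1 - int j else 0))"
      unfolding sum_subtractf[symmetric] alpha_def using True by (intro sum.cong) auto
    also have "\<dots> = (int n + 1 - int i) - (int n + 1 - int (i + 1))"
      using True i(1) by (subst (1 2) sum.delta) auto
    finally show ?thesis by simp
  next
    case False
    then have "0 \<le> alpha i j" for j unfolding alpha_def by (auto split: affine_type.split)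
    moreover have "0 < alpha i n" using False unfolding alpha_def by (auto split: affine_type.split)
    ultimately show ?thesis using rank by (intro sum_pos2[of _ n]) auto
  qed
  finally show ?thesis by simp
qed

lemma weight_fn_reds: "red\<^sup>*\<^sup>* w v \<Longrightarrow> w = v \<or> weight_fn w < weight_fn v"
proof (induction rule: rtranclp_induct)
  case (step y z)
  then show ?case using weight_fn_red[of y z] by auto
qed simp

definition col_fn :: "nat \<Rightarrow> int" where
  "col_fn h = (\<Sum>j=1..n. if j \<le> h then int n + 1 - int j else 0)"

lemma weight_fn_hw: "weight_fn (reading (hw_tableau \<mu>)) = sum_list (map col_fn \<mu>)"
proof -
  have "weight_fn (reading (hw_tableau \<mu>)) = (\<Sum>j=1..n. (int n + 1 - int j) * int (length (filter (\<lambda>h. j \<le> h) \<mu>)))"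
    unfolding weight_fn_def using wtw_hw by (intro sum.cong) auto
  also have "\<dots> = sum_list (map col_fn \<mu>)"
  proof (induction \<mu>)
    case (Cons h \<mu>)
    have "(\<Sum>j=1..n. (int n + 1 - int j) * int (length (filter (\<lambda>x. j \<le> x) (h # \<mu>)))) =
      (\<Sum>j=1..n. (if j \<le> h then int n + 1 - int j else 0) + (int n + 1 - int j) * int (length (filter (\<lambda>x. j \<le> x) \<mu>)))"
      by (intro sum.cong) (auto simp: algebra_simps)
    then show ?case using Cons by (simp add: col_fn_def sum.distrib)
  qed simp
  finally show ?thesis .
qed

lemma col_fn_less: "h < r \<Longrightarrow> r \<le> n \<Longrightarrow> col_fn h < col_fn r"
  unfolding col_fn_def by (intro sum_strict_mono_ex1) (auto intro!: bexI[of _ r])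

lemma col_fn_pos: "0 < h \<Longrightarrow> h \<le> n \<Longrightarrow> 0 < col_fn h"
  using col_fn_less[of 0 h] by (simp add: col_fn_def)

text \<open>The Cartan matrix is nonsingular: the nodes below n give the differences of neighbouring
  coordinates, and the node n fixes the last coordinate.\<close>

lemma coroot_inj:
  assumes "\<And>i. i \<in> {1..n} \<Longrightarrow> coroot i p = coroot i q" "j \<in> {1..n}"
  shows "p j = q j"
proof -
  have n: "3 \<le> n" by (rule rank)
  have s: "p i - p (i + 1) = q i - q (i + 1)" if "1 \<le> i" "i < n" for i
    using assms(1)[of i] that by (simp add: coroot_def)
  have "p n = q n"
  proof -
    have "n - 1 + 1 = n" using n by simp
    then have "p (n - 1) - p n = q (n - 1) - q n" using s[of "n - 1"] n by simp
    then show ?thesis using assms(1)[of n] n unfolding coroot_def by (cases t) auto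
  qed
  moreover have "p (n - d) = q (n - d)" if "p n = q n" "d < n" for d
    using that(2)
  proof (induction d)
    case (Suc d)
    have "n - Suc d + 1 = n - d" using Suc.prems by simp
    then show ?case using s[of "n - Suc d"] Suc by simp
  qed (use that in simp)
  ultimately show ?thesis using assms(2) by (metis atLeastAtMost_iff diff_diff_cancel diff_less less_le_trans n zero_less_numeral zero_less_one)
qed

end

section \<open>Pairs whose factors R merely exchanges\<close>

locale kr_pair = vec +
  fixes r k l :: nat and \<sigma> \<sigma>' :: "tableau \<Rightarrow> tableau"
    and R :: "tableau \<times> tableau \<Rightarrow> tableau \<times> tableau" and H :: "tableau \<times> tableau \<Rightarrow> int"
  assumes \<sigma>: "KR_involution t n r k \<sigma>" and \<sigma>': "KR_involution t n 1 l \<sigma>'" and r: "KR_type r" "1 \<le> r"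
    and R: "crystal_iso {0..n} (tensor (KR_crystal t n r k \<sigma>) (KR_crystal t n 1 l \<sigma>'))
      (tensor (KR_crystal t n 1 l \<sigma>') (KR_crystal t n r k \<sigma>)) R"
    and H: "energy_function n (KR_crystal t n r k \<sigma>) (KR_crystal t n 1 l \<sigma>') R H"
begin

abbreviation "A \<equiv> KR_crystal t n r k \<sigma>"
abbreviation "B \<equiv> KR_crystal t n 1 l \<sigma>'"

lemma NA: "normal_on {0..n} A" by (rule normal_KR[OF KR_typeD(1)[OF r(1)] \<sigma>])
lemma NB: "normal_on {0..n} B" by (rule normal_KR[OF KR_typeD(1)[OF KR_type_1] \<sigma>'])
lemma NAB: "normal_on {0..n} (tensor A B)" by (rule normal_on_tensor[OF NA NB])
lemma NBA: "normal_on {0..n} (tensor B A)" by (rule normal_on_tensor[OF NB NA])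

lemma A_eps: "b \<in> elts A \<Longrightarrow> i \<in> {1..n} \<Longrightarrow> veps A i b = teps i b"
  "b \<in> elts A \<Longrightarrow> i \<in> {1..n} \<Longrightarrow> vphi A i b = tphi i b"
  using veps_KR[OF KR_typeD(1)[OF r(1)] \<sigma>] by simp_all

lemma B_eps: "y \<in> elts B \<Longrightarrow> i \<in> {1..n} \<Longrightarrow> veps B i y = teps i y"
  "y \<in> elts B \<Longrightarrow> i \<in> {1..n} \<Longrightarrow> vphi B i y = tphi i y"
  "y \<in> elts B \<Longrightarrow> veps B 0 y = teps 1 (\<sigma>' y)" "y \<in> elts B \<Longrightarrow> vphi B 0 y = tphi 1 (\<sigma>' y)"
  using veps_KR[OF KR_typeD(1)[OF KR_type_1] \<sigma>'] by simp_all

definition swaps :: "tableau \<Rightarrow> tableau \<Rightarrow> bool" where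
  "swaps b y \<longleftrightarrow> b \<in> elts A \<and> y \<in> elts B \<and> R (b, y) = (y, b) \<and> H (b, y) = 0"

text \<open>A factor with \<epsilon>_i = \<phi>_i = 0 neither moves nor shields. For i = 0 the
  operator acts on opposite sides before and after R, so neither case of the energy rule applies and
  H stays the same.\<close>

lemma swaps_left:
  assumes g: "swaps b y" and i: "i \<in> {0..n}" and y: "veps B i y = 0" "vphi B i y = 0"
    and b': "iter_op (eop A i) m b = Some b'"
  shows "swaps b' y"
proof -
  have b: "b \<in> elts A" and yE: "y \<in> elts B" and Rb: "R (b, y) = (y, b)" and Hb: "H (b, y) = 0"
    using g unfolding swaps_def by auto
  note sA = normal_onD[OF NA i] and sB = normal_onD[OF NB i]
  have m: "m \<le> veps A i b" using iter_e_Some[OF sA b, of m] b' by simp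
  have 1: "iter_op (eop (tensor A B) i) m (b, y) = Some (b', y)"
    by (rule iter_e_tensor_left[OF sA sB b yE b']) (use y in simp)
  have 2: "iter_op (eop (tensor B A) i) m (y, b) = Some (y, b')"
    by (rule iter_e_tensor_right[OF sB sA yE b b']) (use y m in simp)
  have bE: "(b, y) \<in> elts (tensor A B)" using b yE by simp
  have b'E: "b' \<in> elts A" using iter_e_props(1)[OF sA b b'] .
  have R': "R (b', y) = (y, b')" using iso_iter[OF R NAB i bE 1] unfolding Rb 2 by simp
  moreover have "H (b', y) = 0"
  proof (cases "i = 0")
    case True
    have y0: "veps B 0 y = 0" using y(1) True by simp
    have "string_energy A B R H (b', y) = string_energy A B R H (b, y)"
      by (rule energy_string[OF H R NA NB bE 1[unfolded True]])
    then show ?thesis using Hb y0 unfolding string_energy_def R' Rb by simp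
  next
    case False
    then have "i \<in> {1..n}" using i by simp
    then show ?thesis using energy_classical[OF H _ NAB bE 1] Hb by simp
  qed
  ultimately show ?thesis using b'E yE unfolding swaps_def by simp
qed

text \<open>As both \<phi> vanish, neither factor shields the other, and in either order both are
  raised to the top. Raising can be undone, so the property passes in both directions; H is constant
  because the node is classical.\<close>

lemma swaps_both:
  assumes bE: "b \<in> elts A" and yE: "y \<in> elts B" and i: "i \<in> {1..n}" and z: "vphi B i y = 0" "vphi A i b = 0"
    and b': "iter_op (eop A i) (veps A i b) b = Some b'" and y': "iter_op (eop B i) (veps B i y) y = Some y'"
  shows "swaps b y \<longleftrightarrow> swaps b' y'"
proof -
  have i0: "i \<in> {0..n}" using i by simp
  note sA = normal_onD[OF NA i0] and sB = normal_onD[OF NB i0]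
  have 1: "iter_op (eop (tensor A B) i) (veps B i y + veps A i b) (b, y) = Some (b', y')"
    using iter_e_tensor[OF sA sB bE yE _ b', of y'] y' z(2) by simp
  have 2: "iter_op (eop (tensor B A) i) (veps B i y + veps A i b) (y, b) = Some (y', b')"
    using iter_e_tensor[OF sB sA yE bE _ y', of b'] b' z(1) by (simp add: add.commute)
  have E: "(b, y) \<in> elts (tensor A B)" "(y, b) \<in> elts (tensor B A)" using bE yE by simp_all
  have E': "b' \<in> elts A" "y' \<in> elts B" using iter_e_props(1)[OF sA bE b'] iter_e_props(1)[OF sB yE y'] .
  have 3: "iter_op (eop (tensor B A) i) (veps B i y + veps A i b) (R (b, y)) = Some (R (b', y'))"
    by (rule iso_iter[OF R NAB i0 E(1) 1])
  note s = normal_onD[OF NBA i0]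
  have RE: "R (b, y) \<in> elts (tensor B A)" by (rule iso_elts[OF R E(1)])
  have "R (b, y) = (y, b) \<longleftrightarrow> R (b', y') = (y', b')"
  proof
    assume "R (b, y) = (y, b)"
    then show "R (b', y') = (y', b')" using 2 3 by simp
  next
    assume "R (b', y') = (y', b')"
    then show "R (b, y) = (y, b)"
      using iter_e_props(2)[OF s RE 3] iter_e_props(2)[OF s E(2) 2] by simp
  qed
  moreover have "H (b', y') = H (b, y)" by (rule energy_classical[OF H i NAB E(1) 1])
  ultimately show ?thesis using bE yE E' unfolding swaps_def by simp
qed

lemma hwA: "\<nu> \<in> KR_shapes r k \<Longrightarrow> hw_tableau \<nu> \<in> elts A"
  using hw_elts[OF _ r(1)] by simp

lemma rowB: "1 \<le> j \<Longrightarrow> j \<le> n \<Longrightarrow> row (replicate l (int j)) \<in> elts B"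
  using row_letter by simp

lemma iter_word:
  assumes "b \<in> elts A" "i \<in> {1..n}" "tshape b' = tshape b" "reading b' = raise i s (reading b)"
  shows "iter_op (eop A i) (teps i b - s) b = Some b'"
proof -
  have V: "set (reading b) \<subseteq> elts V" using assms(1) KR_elts[OF KR_typeD(1)[OF r(1)]] unfolding KN_def tab_def by simp
  have i0: "i \<noteq> 0" using assms(2) by simp
  show ?thesis unfolding ops_KR_crystal(1)[OF i0]
    by (rule KR_iter_e[OF KR_typeD(1)[OF r(1)] assms(2) _ assms(3)])
      (use assms(1) iter_raise[OF assms(2) V, of s] assms(4) in simp_all)
qed

lemma row_iter:
  assumes "1 \<le> i" "i < n"
  shows "iter_op (eop B i) (veps B i (row (replicate l (int i + 1)))) (row (replicate l (int i + 1))) = Some (row (replicate l (int i)))"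
proof -
  have i: "i \<in> {1..n}" "i \<noteq> 0" using assms by auto
  have E: "row (replicate l (int i + 1)) \<in> elts (KR_classical t n 1 l)"
    using row_letter[of "Suc i" l] assms by (simp add: add.commute)
  have V: "set (replicate l (int i + 1)) \<subseteq> elts V" using assms by (auto simp: elts_V)
  have "iter_op (eop (KR_classical t n 1 l) i) (weps i (replicate l (int i + 1)) - 0) (row (replicate l (int i + 1))) = Some (row (replicate l (int i)))"
    by (rule KR_iter_e[OF KR_typeD(1)[OF KR_type_1] i(1) E])
      (use iter_raise[OF i(1) V, of 0] raise_row_single(3)[OF assms, of l] in simp_all)
  then show ?thesis unfolding ops_KR_crystal(1)[OF i(2)] using B_eps(1)[of "row (replicate l (int i + 1))" i] E i(1) by simp
qed

text \<open>Parks the row at a letter h, where only the nodes h - 1 and h still act on it among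
  those that will be used, and brings it back afterwards. The columns must be neutral for the nodes
  below h.\<close>

lemma swaps_row:
  assumes b: "b \<in> elts A" and z: "\<And>i. 1 \<le> i \<Longrightarrow> i < h \<Longrightarrow> teps i b = 0 \<and> tphi i b = 0" and h: "1 \<le> h" "h \<le> n"
  shows "swaps b (row (replicate l (int h))) \<longleftrightarrow> swaps b (row (replicate l 1))"
  using h(1) z h(2)
proof (induction h rule: dec_induct)
  case (step i)
  have i: "i \<in> {1..n}" "1 \<le> i" "i < n" using step by auto
  have E: "row (replicate l (int i + 1)) \<in> elts B" using rowB[of "Suc i"] i by (simp add: add.commute)
  have zi: "teps i b = 0" "tphi i b = 0" using step.prems(1)[of i] i by auto
  have "swaps b (row (replicate l (int i + 1))) \<longleftrightarrow> swaps b (row (replicate l (int i)))"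
  proof (rule swaps_both[OF b E i(1)])
    show "vphi B i (row (replicate l (int i + 1))) = 0" using B_eps(2)[OF E i(1)] row_lower(1)[OF i(2,3)] by simp
    show "vphi A i b = 0" using A_eps(2)[OF b i(1)] zi by simp
    show "iter_op (eop A i) (veps A i b) b = Some b" using A_eps(1)[OF b i(1)] zi by simp
    show "iter_op (eop B i) (veps B i (row (replicate l (int i + 1)))) (row (replicate l (int i + 1))) = Some (row (replicate l (int i)))"
      by (rule row_iter[OF i(2,3)])
  qed
  moreover have "swaps b (row (replicate l (int i))) \<longleftrightarrow> swaps b (row (replicate l 1))"
    using step.prems i by (intro step.IH) auto
  ultimately show ?case by (simp add: add.commute)
qed simp

lemma sigma_iter:
  assumes "z \<in> elts A" "i \<in> {1..n}" "iter_op (eop A i) m z = Some z'"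
  shows "iter_op (eop A (sw i)) m (\<sigma> z) = Some (\<sigma> z')"
proof -
  have "run A [(i, m)] z = Some z'" using assms(3) by simp
  then have "run A (map (\<lambda>(i, m). (sw i, m)) [(i, m)]) (\<sigma> z) = Some (\<sigma> z')"
    using assms(2) by (intro swapping_run[OF swapping_KR[OF KR_typeD(1)[OF r(1)] \<sigma>] NA assms(1)]) auto
  then show ?thesis by (cases "iter_op (eop A (sw i)) m (\<sigma> z)") auto
qed

text \<open>R preserves \<epsilon> and \<phi>. The left factor of the image is highest, hence
  \<open>1^l\<close>, so the right factor has the weight of the rectangle. Among all shapes of the
  crystal only the rectangle reaches this value of \<open>weight_fn\<close>, and only at its highest
  weight tableau.\<close>

lemma swaps_base:
  assumes H0: "H (hw_tableau (replicate k r), row (replicate l 1)) = 0"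
  shows "swaps (hw_tableau (replicate k r)) (row (replicate l 1))"
proof -
  define b0 where "b0 = hw_tableau (replicate k r)"
  define y0 where "y0 = row (replicate l 1)"
  have rn: "r \<le> n" "1 \<le> n" using KR_typeD(1)[OF r(1)] rank by auto
  have K: "replicate k r \<in> KR_shapes r k"
  proof (rule KR_shapesI)
    show "sorted_wrt (\<ge>) (replicate k r)" by (induction k) auto
  qed (use r(2) in auto)
  have bE: "b0 \<in> elts A" unfolding b0_def by (rule hwA[OF K])
  have yE: "y0 \<in> elts B" unfolding y0_def using ones_elts by simp
  have E: "(b0, y0) \<in> elts (tensor A B)" using bE yE by simp
  obtain y b where yb: "R (b0, y0) = (y, b)" by (cases "R (b0, y0)")
  have yb': "y \<in> elts B" "b \<in> elts A" using iso_elts[OF R E] unfolding yb by auto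
  have ye: "y0 = hw_tableau (replicate l 1)" unfolding y0_def hw_row ..
  have bcl: "b0 \<in> elts (KR_classical t n r k)" "b \<in> elts (KR_classical t n r k)" "y \<in> elts (KR_classical t n 1 l)"
    using bE yb' by simp_all
  have z: "teps i b0 = 0" "teps i y0 = 0" if "i \<in> {1..n}" for i
    using hw_eps[OF that] unfolding b0_def ye by auto
  have eq: "teps i y = 0 \<and> tphi i b + (tphi i y - teps i b) = tphi i y0 + tphi i b0 \<and> teps i b - tphi i y = 0"
    if i: "i \<in> {1..n}" for i
  proof -
    have i0: "i \<in> {0..n}" using i by simp
    note v = veps_tensor[OF NA NB i0 bE yE] and v' = veps_tensor[OF NB NA i0 yb']
    note e = A_eps[OF bE i] A_eps[OF yb'(2) i] B_eps(1,2)[OF yE i] B_eps(1,2)[OF yb'(1) i]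
    show ?thesis using v v' iso_veps[OF R NAB NBA i0 E] z[OF i] unfolding yb e by auto
  qed
  have "y = hw_tableau (tshape y)" by (rule KR_highest[OF rn(2) bcl(3)]) (use eq in auto)
  moreover have "tshape y = replicate l 1" using KR_elts[OF rn(2)] KR_shapes_1 bcl(3) by blast
  ultimately have yy: "y = y0" unfolding ye by simp
  have Vb: "set (reading b) \<subseteq> elts V" "set (reading b0) \<subseteq> elts V" "tshape b \<in> KR_shapes r k" "KN (tshape b) b"
    using bcl KR_elts[OF rn(1)] unfolding KN_def tab_def by auto
  have "coroot i (wtw (reading b)) = coroot i (wtw (reading b0))" if i: "i \<in> {1..n}" for i
    using eq[OF i] z[OF i] word_coroot[OF i Vb(1)] word_coroot[OF i Vb(2)] unfolding yy by auto
  then have "wtw (reading b) j = wtw (reading b0) j" if "j \<in> {1..n}" for j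
    using coroot_inj that by blast
  then have w: "weight_fn (reading b) = weight_fn (reading b0)" unfolding weight_fn_def by (intro sum.cong) auto
  have "red\<^sup>*\<^sup>* (reading b) (reading (hw_tableau (tshape b)))" using Vb(4) unfolding KN_def by simp
  note wr = weight_fn_reds[OF this]
  note P = KR_shapes_props[OF Vb(3)]
  have cf: "col_fn h \<le> col_fn r" if "h \<in> set (tshape b)" for h
    using P(3)[OF that] col_fn_less[of h r] rn(1) by (cases "h = r") auto
  have cr: "0 < col_fn r" using col_fn_pos r(2) rn(1) by simp
  note sm = sum_list_bound[of "tshape b" col_fn "col_fn r", OF cf]
  have lk: "int (length (tshape b)) * col_fn r \<le> int k * col_fn r" using P(4) cr by (intro mult_right_mono) auto
  have w0: "weight_fn (reading b0) = int k * col_fn r"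
    unfolding b0_def weight_fn_hw by (simp add: sum_list_replicate)
  have "weight_fn (reading (hw_tableau (tshape b))) \<le> int k * col_fn r"
    unfolding weight_fn_hw using sm lk by linarith
  then have e: "reading b = reading (hw_tableau (tshape b))" using wr w w0 by auto
  then have s: "sum_list (map col_fn (tshape b)) = int k * col_fn r" using w w0 weight_fn_hw by metis
  then have sl: "sum_list (map col_fn (tshape b)) = int (length (tshape b)) * col_fn r" using sm lk by linarith
  have hr: "col_fn h = col_fn r" if "h \<in> set (tshape b)" for h
    using bspec[OF mp[OF conjunct2[OF sm] sl] that] .
  have "h = r" if "h \<in> set (tshape b)" for h
    using hr[OF that] P(3)[OF that] col_fn_less[of h r] rn(1) by (cases "h = r") auto
  moreover have "length (tshape b) = k"
  proof -
    have "int k * col_fn r = int (length (tshape b)) * col_fn r" using s sl by linarith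
    then show ?thesis using cr by simp
  qed
  ultimately have t: "tshape b = replicate k r" using replicate_eqI by metis
  have "b = hw_tableau (tshape b)" using reading_inj[OF e] by simp
  then have "b = b0" unfolding t b0_def .
  then show ?thesis using yb yy H0 bE yE unfolding swaps_def b0_def y0_def by simp
qed

end

section \<open>Explicit tableaux for the lowering of columns\<close>

lemma pcols_form:
  assumes "\<And>i x. 0 < i \<Longrightarrow> x \<in> set (pblk D i) \<Longrightarrow> x = F i"
  shows "filter (\<lambda>c. 0 < snd (snd c)) (pcols D r) = map F (filter (\<lambda>h. 0 < h) (map (\<lambda>c. snd (snd c)) (pcols D r)))"
proof -
  have "c = F (snd (snd c))" if "c \<in> set (filter (\<lambda>c. 0 < snd (snd c)) (pcols D r))" for c
  proof -
    have c: "c \<in> set (pcols D r)" "0 < snd (snd c)" using that by auto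
    obtain i where i: "c \<in> set (pblk D i)" using c(1) unfolding in_pcols by blast
    then have "snd (snd c) = i" using pblk_outer by blast
    then show ?thesis using assms[OF _ i] c(2) by simp
  qed
  then have "filter (\<lambda>c. 0 < snd (snd c)) (pcols D r) =
      map (\<lambda>c. F (snd (snd c))) (filter (\<lambda>c. 0 < snd (snd c)) (pcols D r))"
    by (intro map_idI[symmetric]) auto
  then show ?thesis by (simp add: filter_map comp_def)
qed

lemma assign_plus:
  assumes "0 < e" "0 \<notin> set \<rho>"
  shows "assign \<rho> (map (\<lambda>i. (i, i)) \<rho> @ replicate m (e, e)) = map (\<lambda>i. (i, i, None)) \<rho> @ replicate m (e, 0, None)"
  using assms(2)
proof (induction \<rho>)
  case Nil
  show ?case using assms(1) by (induction m) auto
qed auto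

context vec
begin

text \<open>All columns have a barred letter; the first \<open>m\<close> slots hold the mark
  \<open>i\<close> and the others 0. With \<open>i = 0\<close> this is \<Phi> of the diagram with a
  - in every column.\<close>

definition zcols :: "nat \<Rightarrow> nat \<Rightarrow> nat list \<Rightarrow> tableau" where
  "zcols m i hs = map (asc_col 0) (assign (replicate m i) (map (\<lambda>h. (h - 1, h)) hs))"

lemma zcols_Cons:
  assumes "2 \<le> h"
  shows "zcols m i (h # hs) = (str (h - 1) (if 2 \<le> m then i else 0) @ [- (int (if 1 \<le> m then i else 0) + 1)]) # zcols (m - 2) i hs"
proof -
  consider "m = 0" | "m = 1" | m' where "m = Suc (Suc m')" by (metis One_nat_def not0_implies_Suc)
  then show ?thesis using assms by cases (auto simp: zcols_def asc_col_def bar_def)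
qed

lemma str_fixed:
  assumes "2 \<le> i" "i \<le> v" "i < n"
  shows "raise i 0 (str v 0) = str v 0" "st i 0 (str v 0) = 0"
proof -
  have i: "1 \<le> i" "i < n" using assms by auto
  have e: "[1..int (v + 1)] = [1..int i - 1] @ [int i, int i + 1] @ [int i + 2..int (v + 1)]"
    using assms by (intro upto_at) auto
  have v1: "int (v + 1) = int v + 1" by simp
  have u: "[1..x] = 1 # [2..x]" if "1 \<le> x" for x :: int using upto_rec1[of 1 x] that by simp
  have "[1..int v + 1] = 1 # [2..int v + 1]" "[1..int i - 1] = 1 # [2..int i - 1]"
    using assms by (intro u; simp)+
  then have s: "str v 0 = [2..int i - 1] @ [int i, int i + 1] @ [int i + 2..int v + 1]"
    using e unfolding v1 by (simp add: str_def)
  note R = raise_Cons_less[OF i] and N = raise_upto[OF i]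
  show "raise i 0 (str v 0) = str v 0" "st i 0 (str v 0) = 0"
    unfolding s using assms by (simp_all add: raise_append st_append R N)
qed

text \<open>From node 2 on an unmarked slot is inert: its string contains i directly followed by i +
  1, and its barred 1 is neutral. So the marks move on by themselves.\<close>

lemma zcols_raise:
  assumes i: "2 \<le> i" "i < n"
  shows "\<forall>h\<in>set hs. i < h \<Longrightarrow> raise i 0 (reading (zcols m (i - 1) hs)) = reading (zcols m i hs) \<and>
    st i 0 (reading (zcols m (i - 1) hs)) = 0"
proof (induction hs arbitrary: m)
  case Nil
  show ?case by (simp add: zcols_def reading_Nil)
next
  case (Cons h hs)
  have i1: "1 \<le> i" using i by simp
  have h: "2 \<le> h" "i \<le> h - 1" using Cons.prems i by auto
  have IH: "raise i 0 (reading (zcols m (i - 1) hs)) = reading (zcols m i hs) \<and> st i 0 (reading (zcols m (i - 1) hs)) = 0" for m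
    using Cons by simp
  have s1: "raise i 0 (str (h - 1) (if 2 \<le> m then i - 1 else 0)) = str (h - 1) (if 2 \<le> m then i else 0) \<and>
      st i 0 (str (h - 1) (if 2 \<le> m then i - 1 else 0)) = 0"
  proof -
    have m: "max (i - 1) (min (h - 1) (i - 1)) = i - 1" "max (i - 1) (min (h - 1) i) = i" "i - 1 \<noteq> i" "i - 1 \<le> h - 1"
      using h(2) i1 by auto
    have "raise i 0 (str (h - 1) (i - 1)) = str (h - 1) i \<and> st i 0 (str (h - 1) (i - 1)) = 0"
      using str_step[OF i1 i(2) m(4), of 0] m(3) unfolding m(1,2) by simp
    then show ?thesis using str_fixed[OF i(1) h(2) i(2)] by (cases "2 \<le> m") simp_all
  qed
  have s2: "raise i 0 [- (int (if 1 \<le> m then i - 1 else 0) + 1)] = [- (int (if 1 \<le> m then i else 0) + 1)] \<and>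
      st i 0 [- (int (if 1 \<le> m then i - 1 else 0) + 1)] = 0"
    using i by (auto simp: raise_Cons_less[OF i1 i(2)])
  show ?case unfolding zcols_Cons[OF h(1)] reading_Cons using IH[of "m - 2"] s1 s2
    by (simp only: raise_append st_append)
qed

text \<open>Every slot offers one arrow for the node 1: the 2 at the foot of a string or the barred
  1. A state \<open>s\<close> shields those that are read first, which are the last slots, so the
  marks are set from the first slot on.\<close>

lemma zcols_raise_1:
  shows "\<forall>h\<in>set hs. 2 < h \<Longrightarrow> raise 1 s (reading (zcols 0 0 hs)) = reading (zcols (2 * length hs - s) 1 hs) \<and>
    st 1 s (reading (zcols 0 0 hs)) = s - 2 * length hs"
proof (induction hs)
  case Nil
  show ?case by (simp add: zcols_def reading_Nil)
next
  case (Cons h hs)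
  have n: "1 \<le> (1::nat)" "1 < n" using rank by auto
  have h: "2 \<le> h" "2 < h" using Cons.prems by auto
  note R = raise_Cons_less[OF n, unfolded One_nat_def] and N = raise_upto[OF n, unfolded One_nat_def]
  define s' where "s' = s - 2 * length hs"
  have e: "[2..int (h - 1) + 1] = 2 # [3..int h]" using upto_rec1[of 2 "int h"] h by (simp add: of_nat_diff)
  have e1: "str (h - 1) 0 = 2 # [3..int h]" "str (h - 1) 1 = 1 # [3..int h]"
    using e h by (simp_all add: str_def of_nat_diff)
  have c: "raise 1 s' (str (h - 1) 0 @ [- 1]) = str (h - 1) (if 2 \<le> 2 - s' then 1 else 0) @
      [- (int (if 1 \<le> 2 - s' then 1 else 0) + 1)]"
    "st 1 s' (str (h - 1) 0 @ [- 1]) = s' - 2"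
    using e1 by (auto simp: raise_append st_append R N)
  have eq: "2 * length (h # hs) - s - 2 = 2 * length hs - s"
    "(2 \<le> 2 * length (h # hs) - s) = (2 \<le> 2 - s')" "(1 \<le> 2 * length (h # hs) - s) = (1 \<le> 2 - s')"
    unfolding s'_def by auto
  have zc: "zcols 0 0 (h # hs) = (str (h - 1) 0 @ [- 1]) # zcols 0 0 hs"
    using zcols_Cons[OF h(1), of 0 0] by simp
  have IH: "raise 1 s (reading (zcols 0 0 hs)) = reading (zcols (2 * length hs - s) 1 hs)"
    "st 1 s (reading (zcols 0 0 hs)) = s'"
    using Cons unfolding s'_def by auto
  have "raise 1 s (reading (zcols 0 0 (h # hs))) = raise 1 s (reading (zcols 0 0 hs)) @
      raise 1 (st 1 s (reading (zcols 0 0 hs))) (str (h - 1) 0 @ [- 1])"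
    unfolding zc reading_Cons by (rule raise_append)
  also have "\<dots> = reading (zcols (2 * length (h # hs) - s) 1 (h # hs))"
    unfolding zcols_Cons[OF h(1)] eq reading_Cons IH c ..
  finally have 1: "raise 1 s (reading (zcols 0 0 (h # hs))) = reading (zcols (2 * length (h # hs) - s) 1 (h # hs))" .
  have "st 1 s (reading (zcols 0 0 (h # hs))) = st 1 (st 1 s (reading (zcols 0 0 hs))) (str (h - 1) 0 @ [- 1])"
    unfolding zc reading_Cons by (rule st_append)
  also have "\<dots> = s - 2 * length (h # hs)" unfolding IH c by (simp add: s'_def)
  finally show ?case using 1 by blast
qed

lemma tshape_zcols: "\<forall>h\<in>set hs. 2 \<le> h \<and> i < h \<Longrightarrow> tshape (zcols m i hs) = hs"
proof (induction hs arbitrary: m)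
  case (Cons h hs)
  then have h: "2 \<le> h" "i < h" by auto
  show ?case unfolding zcols_Cons[OF h(1)] using Cons h by (simp add: str_def) linarith
qed (simp add: zcols_def)

text \<open>Recognizes a marked tableau as \<Phi> of a diagram with only - and \<mp> columns as soon
  as the mark fits the height, so that \<SS> can be evaluated on it.\<close>

lemma Ph_zcols:
  assumes D: "pmd r k D" "KR_type r" and z: "\<And>i. 0 < i \<Longrightarrow> Nn D i = 0" "\<And>i. Pp D i = 0" "\<And>i. i \<noteq> h \<Longrightarrow> Bb D i = 0"
    and h: "2 \<le> h" and \<nu>: "filter (\<lambda>h. 0 < h) (map (\<lambda>c. snd (snd c)) (pcols D r)) = \<nu>"
  shows "Ph r D = zcols (Bb D h) (h - 1) \<nu>"
proof -
  let ?cs = "filter (\<lambda>c. 0 < snd (snd c)) (pcols D r)"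
  have V: "pm_valid r D" "Nn D n = 0" using D(1) unfolding pmd_def by auto
  have form: "map snd ?cs = map (\<lambda>h. (h - 1, h)) \<nu>"
  proof -
    have c: "snd c = (snd (snd c) - 1, snd (snd c))" if "c \<in> set ?cs" for c
    proof -
      have c: "c \<in> set (pcols D r)" "0 < snd (snd c)" using that by auto
      obtain i where i: "c \<in> set (pblk D i)" using c(1) unfolding in_pcols by blast
      then have "snd (snd c) = i" using pblk_outer by blast
      then show ?thesis using i c(2) z(1)[of i] z(2)[of i] unfolding pblk_def by - (cases c, auto)
    qed
    have "map snd ?cs = map (\<lambda>h. (h - 1, h)) (map (\<lambda>c. snd (snd c)) ?cs)"
      unfolding map_map comp_def by (rule map_cong[OF refl c])
    also have "map (\<lambda>c. snd (snd c)) ?cs = \<nu>" unfolding \<nu>[symmetric] by (simp add: filter_map comp_def)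
    finally show ?thesis .
  qed
  have "pheights ?cs = replicate (Bb D h) (h - 1)"
  proof -
    have p: "fst (snd c) = h - 1" if c: "c \<in> set (pcols D r)" "fst c < fst (snd c)" for c
    proof -
      obtain i where i: "c \<in> set (pblk D i)" using c(1) unfolding in_pcols by blast
      have "0 < Bb D i \<and> c = (i - 2, i - 1, i)" using i c(2) z(2)[of i] unfolding pblk_def by - (cases c, auto)
      then show ?thesis using z(3)[of i] by (cases "i = h") auto
    qed
    have all: "\<forall>x\<in>set (pheights ?cs). x = h - 1" using p by (auto simp: pheights_def)
    have "filter (\<lambda>(a, b, c). a < b) ?cs = filter (\<lambda>(a, b, c). b = h - 1 \<and> a < b) (pcols D r)"
      unfolding filter_filter
    proof (intro filter_cong refl)
      fix c assume c: "c \<in> set (pcols D r)"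
      have "fst (snd c) \<le> snd (snd c)" using pcols_ok(1)[OF V(1) c] by (auto simp: colok_def)
      then show "(0 < snd (snd c) \<and> (case c of (a, b, c) \<Rightarrow> a < b)) = (case c of (a, b, c) \<Rightarrow> b = h - 1 \<and> a < b)"
        using p[OF c] by (cases c) auto
    qed
    then have "length (pheights ?cs) = length (filter (\<lambda>(a, b, c). b = h - 1 \<and> a < b) (pcols D r))"
      by (simp add: pheights_def)
    also have "\<dots> = Bb D h" using pcols_count(7)[OF V(1), of "h - 1"] h z(2) by simp
    finally show ?thesis using replicate_eqI[OF _ all[rule_format]] by metis
  qed
  note ph = this
  show ?thesis
  proof (rule Phi_slots[OF V(1) KR_typeD[OF D(2)] V(2)])
    fix T assume "Ph r D = map (asc_col 0) T" "T = assign (pheights ?cs) (map snd ?cs)"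
    then show ?thesis unfolding ph form zcols_def by simp
  qed
qed

lemma Ph_plus:
  assumes D: "pmd r k D" "KR_type r" and z: "\<And>i. Mm D i = 0" "\<And>i. Bb D i = 0" "\<And>i. 0 < i \<Longrightarrow> i \<noteq> e \<Longrightarrow> Nn D i = 0"
    "Pp D e = 0" and e: "0 < e" "e \<notin> set \<rho>" "0 \<notin> set \<rho>"
    and \<nu>: "filter (\<lambda>h. 0 < h) (map (\<lambda>c. snd (snd c)) (pcols D r)) = \<rho> @ replicate m e"
  shows "Ph r D = map (asc_col 0) (map (\<lambda>i. (i, i, None)) \<rho> @ replicate m (e, 0, None))"
proof -
  have V: "pm_valid r D" "Nn D n = 0" using D(1) unfolding pmd_def by auto
  define F where "F = (\<lambda>i. if i = e then (e, e, e) else (i - 1, i, i :: nat))"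
  have F: "x = F i" if "0 < i" "x \<in> set (pblk D i)" for x i
    using that z unfolding pblk_def F_def by (cases "i = e") auto
  have cs: "filter (\<lambda>c. 0 < snd (snd c)) (pcols D r) = map F (\<rho> @ replicate m e)"
    unfolding \<nu>[symmetric] by (rule pcols_form) (rule F)
  have F1: "map F \<rho> = map (\<lambda>i. (i - 1, i, i)) \<rho>" using e by (auto simp: F_def)
  have Fe: "F e = (e, e, e)" by (simp add: F_def)
  have "pheights (map F (\<rho> @ replicate m e)) = \<rho>"
  proof -
    have "pheights (map (\<lambda>i. (i - 1, i, i)) \<rho>) = \<rho>" using e(3) by (induction \<rho>) (auto simp: pheights_def)
    moreover have "pheights (u @ v) = pheights u @ pheights v" for u v by (simp add: pheights_def)
    moreover have "pheights (replicate m (e, e, e)) = []" by (simp add: pheights_def)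
    ultimately show ?thesis by (simp only: map_append map_replicate F1 Fe append_Nil2)
  qed
  note ph = this
  have sn: "map snd (map F (\<rho> @ replicate m e)) = map (\<lambda>i. (i, i)) \<rho> @ replicate m (e, e)"
    by (simp only: map_append map_replicate F1 Fe) simp
  show ?thesis
  proof (rule Phi_slots[OF V(1) KR_typeD[OF D(2)] V(2)])
    fix T assume "Ph r D = map (asc_col 0) T"
      "T = assign (pheights (filter (\<lambda>c. 0 < snd (snd c)) (pcols D r))) (map snd (filter (\<lambda>c. 0 < snd (snd c)) (pcols D r)))"
    then show ?thesis unfolding cs ph sn assign_plus[OF e(1,3)] by simp
  qed
qed

end

section \<open>Induction over the shapes without missing columns\<close>

context kr_pair
begin

text \<open>Lowering \<open>m\<close> columns of the minimal height \<open>h\<close> to \<open>h - 2\<close>: the operator \<open>e\<^sub>0\<close> marks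
  the first \<open>m\<close> slots of the barred tableau, raising moves the marks up to height \<open>h - 1\<close>, where
  they become \<open>\<mp>\<close> pairs, which \<open>\<SS>\<close> removes. The row is kept neutral.\<close>

lemma link:
  assumes \<nu>': "\<rho> @ replicate m h \<in> KR_shapes r k" "length (\<rho> @ replicate m h) = k" and h: "3 \<le> h"
    and \<rho>: "\<And>x. x \<in> set \<rho> \<Longrightarrow> h \<le> x" and m: "0 < m"
    and g: "swaps (hw_tableau (\<rho> @ replicate m h)) (row (replicate l 1))"
  shows "swaps (hw_tableau (\<rho> @ replicate m (h - 2))) (row (replicate l 1))"
proof -
  define \<nu>' where "\<nu>' = \<rho> @ replicate m h"
  define \<nu> where "\<nu> = \<rho> @ replicate m (h - 2)"
  define e where "e = h - 2"
  have K: "\<nu>' \<in> KR_shapes r k" "length \<nu>' = k" using \<nu>' by (simp_all add: \<nu>'_def)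
  note P = KR_shapes_props[OF K(1)]
  have rn: "r \<le> n" using KR_typeD(1)[OF r(1)] .
  have hr: "h \<le> r" "even (r + h)" "h \<le> n" using P(3)[of h] m rn by (simp_all add: \<nu>'_def)
  have e: "0 < e" "h = e + 2" "e < r" using h hr by (auto simp: e_def)
  have ge: "h \<le> x" if "x \<in> set \<nu>'" for x using that \<rho> by (auto simp: \<nu>'_def)
  have cr: "count_list (replicate m a) i = (if i = a then m else 0)" for m and a i :: nat
    by (induction m) auto
  have c0: "count_list \<rho> i = 0" if "i < h \<or> odd (r + i) \<or> r < i" for i
  proof (rule count_notin)
    show "i \<notin> set \<rho>" using that \<rho>[of i] P(3)[of i] by (auto simp: \<nu>'_def)
  qed
  have b0: "hw_tableau \<nu>' \<in> elts A" by (rule hwA[OF K(1)])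
  define z where "z = (\<lambda>i. zcols m i \<nu>')"
  have zz: "z i = zcols m i \<nu>'" for i by (simp add: z_def)
  define y where "y = row (replicate l (int h))"
  define y1 where "y1 = row (replicate l (int h - 1))"
  define y2 where "y2 = row (replicate l (int h - 2))"
  have i1: "int (h - 1) = int h - 1" "int (h - 2) = int h - 2" using h by auto
  have yB: "y \<in> elts B" "y1 \<in> elts B" "y2 \<in> elts B"
    using rowB[of h] rowB[of "h - 1"] rowB[of "h - 2"] h hr(3) unfolding y_def y1_def y2_def i1 by auto
  have teps0: "teps i (hw_tableau \<nu>') = 0" if "i \<in> {1..n}" for i using hw_eps[OF that] .
  have hn: "x \<le> n" if "x \<in> set \<nu>'" for x using P(3)[OF that] rn by simp
  have tphi0: "tphi i (hw_tableau \<nu>') = 0" if "1 \<le> i" "i < h" for i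
    using wphi_hw(1)[of i \<nu>'] that hr(3) hn count_notin[of i \<nu>'] ge[of i] by fastforce
  \<comment> \<open>The row waits at the letter h, where it is neutral for node 0 and for the nodes
    1, ..., h - 2.\<close>
  have s1: "swaps (hw_tableau \<nu>') y"
    unfolding y_def by (subst swaps_row[OF b0]) (use teps0 tphi0 h hr(3) g in \<open>auto simp: \<nu>'_def\<close>)
  have ops: "\<And>i. i \<noteq> 0 \<Longrightarrow> eop A i = eop (KR_classical t n r k) i" by (rule ops_KR_crystal(1))
  have rr: "KR_type r" by (rule r(1))
  have tz: "tshape (z i) = \<nu>'" if "i < h" for i unfolding z_def using ge h that by (intro tshape_zcols) fastforce
  have z0: "\<sigma> (hw_tableau \<nu>') = zcols 0 0 \<nu>'"
  proof -
    let ?D = "Sdata r (hwdata k \<nu>')"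
    have pm: "pmd r k ?D" by (rule pmd_Sdata[OF pmd_hwdata[OF K(1)] rr])
    have V: "pm_valid r ?D" using pm unfolding pmd_def by simp
    have "filter (\<lambda>h. 0 < h) (map (\<lambda>c. snd (snd c)) (pcols ?D r)) = \<nu>'"
      by (rule outer_unique[OF V P(1,2)]) (use K(2) r(2) in \<open>auto simp: Sdata_sel hwdata_sel\<close>)
    from Ph_zcols[OF pm rr _ _ _ _ this, of 2]
    have "Ph r ?D = zcols (Bb ?D 2) (2 - 1) \<nu>'" using K(2) r(2) by (simp add: Sdata_sel hwdata_sel)
    moreover have "Bb ?D 2 = 0" using K(2) by (simp add: Sdata_sel hwdata_sel)
    moreover have "zcols 0 (2 - 1) \<nu>' = zcols 0 0 \<nu>'" by (simp add: zcols_def)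
    ultimately show ?thesis unfolding sigma_hw[OF \<sigma> K(1) rr] by simp
  qed
  have zE0: "zcols 0 0 \<nu>' \<in> elts A" using KR_involutionD(1)[OF \<sigma>, of "hw_tableau \<nu>'"] b0 unfolding z0 by simp
  have n1: "1 \<in> {1..n}" "1 < n" using rank by auto
  \<comment> \<open>Of the \<open>2 * length \<nu>'\<close> slots, a state of this size leaves
    exactly \<open>m\<close> unshielded; the operator is not applied to its maximal power
    here.\<close>
  have mk: "2 * length \<nu>' - (2 * length \<nu>' - m) = m" by (simp add: \<nu>'_def)
  have Z1: "raise 1 (2 * length \<nu>' - m) (reading (zcols 0 0 \<nu>')) = reading (z 1)"
    using zcols_raise_1[of \<nu>' "2 * length \<nu>' - m"] ge h unfolding mk z_def by fastforce
  have t0: "tshape (z 1) = tshape (zcols 0 0 \<nu>')"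
    using tz[of 1] tshape_zcols[of \<nu>' 0 0] ge h by fastforce
  note it1 = iter_word[OF zE0 n1(1) t0 Z1[symmetric]]
  have zE1: "z 1 \<in> elts A"
    by (rule iter_e_props(1)[OF normal_onD[OF NA] zE0 it1]) (use rank in simp)
  have \<sigma>0: "\<sigma> (zcols 0 0 \<nu>') = hw_tableau \<nu>'"
    using KR_involutionD(2)[OF \<sigma>, of "hw_tableau \<nu>'"] b0 z0 by simp
  note it0 = sigma_iter[OF zE0 n1(1) it1, unfolded \<sigma>0]
  have sy: "\<sigma>' y = y"
  proof -
    have h1: "1 \<le> h" using h by simp
    have yE: "y \<in> elts (KR_classical t n 1 l)" using row_letter[OF h1 hr(3), of l] by (simp add: y_def)
    have "reading (\<sigma>' y) = reading y"
      using sigma_row[OF \<sigma>' yE, of 0 "replicate l (int h)" 0] h by (auto simp: y_def)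
    moreover have "\<sigma>' y = row (reading (\<sigma>' y))"
      using KR_row(1)[OF KR_involutionD(1)[OF \<sigma>' yE]] by (metis reading_row)
    ultimately show ?thesis by (simp add: y_def)
  qed
  have y00: "veps B 0 y = 0" "vphi B 0 y = 0"
    using B_eps(3,4)[OF yB(1)] row_neutral[of 1 h l] h n1 unfolding sy by (simp_all add: y_def)
  have sw1: "sw 1 = 0" by (simp add: sw_def)
  have s2: "swaps (\<sigma> (z 1)) y"
    by (rule swaps_left[OF s1 _ y00 it0[unfolded sw1]]) simp
  have zi: "iter_op (eop A i) (teps i (z (i - 1)) - 0) (z (i - 1)) = Some (z i)" "tphi i (z (i - 1)) = 0" "z i \<in> elts A"
      "iter_op (eop A i) (teps i (z (i - 1)) - 0) (\<sigma> (z (i - 1))) = Some (\<sigma> (z i))"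
    if i: "2 \<le> i" "i < h" and zE: "z (i - 1) \<in> elts A" for i
  proof -
    have ii: "i \<in> {1..n}" "i < n" using i hr(3) by auto
    have "\<forall>x\<in>set \<nu>'. i < x" using ge i by fastforce
    note Z = zcols_raise[OF i(1) ii(2) this, of m, folded zz]
    show 1: "iter_op (eop A i) (teps i (z (i - 1)) - 0) (z (i - 1)) = Some (z i)"
      by (rule iter_word[OF zE ii(1)]) (use Z tz[of i] tz[of "i - 1"] i in simp_all)
    show "tphi i (z (i - 1)) = 0" using Z by (simp add: wphi_st)
    show "z i \<in> elts A" by (rule iter_e_props(1)[OF normal_onD[OF NA] zE 1]) (use ii in simp)
    show "iter_op (eop A i) (teps i (z (i - 1)) - 0) (\<sigma> (z (i - 1))) = Some (\<sigma> (z i))"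
      using sigma_iter[OF zE ii(1) 1] i by (simp add: sw_def)
  qed
  have s3: "z i \<in> elts A \<and> swaps (\<sigma> (z i)) y" if "1 \<le> i" "i + 1 < h" for i
    using that
  proof (induction i rule: dec_induct)
    case base
    show ?case using zE1 s2 by simp
  next
    case (step i)
    have IH: "z i \<in> elts A" "swaps (\<sigma> (z i)) y" using step by auto
    have a: "2 \<le> Suc i" "Suc i < h" "z (Suc i - 1) \<in> elts A" using step IH by auto
    note Z = zi[OF a, simplified]
    have ii: "Suc i \<in> {1..n}" "1 \<le> Suc i" "Suc i < n" "h \<noteq> Suc i" "h \<noteq> Suc i + 1" using step hr(3) by auto
    have "veps B (Suc i) y = 0" "vphi B (Suc i) y = 0"
      using B_eps(1,2)[OF yB(1) ii(1)] row_neutral[OF ii(2-5), of l] by (simp_all add: y_def)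
    then have "swaps (\<sigma> (z (Suc i))) y" using ii(1) by (intro swaps_left[OF IH(2) _ _ _ Z(4)]) simp_all
    then show ?case using Z(3) by simp
  qed
  have zh: "z (h - 2) \<in> elts A" "swaps (\<sigma> (z (h - 2))) y" using s3[of "h - 2"] h by auto
  have hh: "h - 1 - 1 = h - 2" by simp
  have a: "2 \<le> h - 1" "h - 1 < h" "z (h - 1 - 1) \<in> elts A" unfolding hh using h zh(1) by auto
  note Zh = zi[OF a, unfolded hh]
  have Jz: "teps i (\<sigma> b) = teps i b" "tphi i (\<sigma> b) = tphi i b" if "b \<in> elts A" "i \<in> {2..n}" for b i
    using KR_involution_J[OF rn \<sigma> _ that(2)] that(1) by simp_all
  have h1n: "h - 1 \<in> {1..n}" "h - 1 \<in> {2..n}" "1 \<le> h - 1" "h - 1 < n" using h hr(3) by auto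
  have szE: "\<sigma> (z (h - 2)) \<in> elts A" using zh(2) unfolding swaps_def by simp
  \<comment> \<open>The node h - 1 is the first that also acts on the row: it moves the marks to h -
    1 and the row from h to h - 1 at the same time.\<close>
  have s4: "swaps (\<sigma> (z (h - 1))) y1"
  proof -
    have yi: "row (replicate l (int (h - 1) + 1)) = y" "row (replicate l (int (h - 1))) = y1"
      unfolding y_def y1_def i1 by simp_all
    have "swaps (\<sigma> (z (h - 2))) y \<longleftrightarrow> swaps (\<sigma> (z (h - 1))) y1"
    proof (rule swaps_both[OF szE yB(1) h1n(1)])
      show "vphi B (h - 1) y = 0"
        using B_eps(2)[OF yB(1) h1n(1)] row_lower(1)[OF h1n(3,4), of l] unfolding yi[symmetric] by simp
      show "vphi A (h - 1) (\<sigma> (z (h - 2))) = 0"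
        using A_eps(2)[OF szE h1n(1)] Jz(2)[OF zh(1) h1n(2)] Zh(2) by simp
      show "iter_op (eop A (h - 1)) (veps A (h - 1) (\<sigma> (z (h - 2)))) (\<sigma> (z (h - 2))) = Some (\<sigma> (z (h - 1)))"
        using A_eps(1)[OF szE h1n(1)] Jz(1)[OF zh(1) h1n(2)] Zh(4) by simp
      show "iter_op (eop B (h - 1)) (veps B (h - 1) y) y = Some y1"
        using row_iter[OF h1n(3,4)] unfolding yi .
    qed
    then show ?thesis using zh(2) by simp
  qed
  \<comment> \<open>Read as \<Phi> of a diagram, the \<open>m\<close> marks h - 1 are the + symbols
    of \<open>m\<close> \<mp> columns of height h, while the columns of \<rho> carry only a
    -.\<close>
  define D where "D = \<lparr> Nn = (\<lambda>i. 0), Pp = (\<lambda>i. 0), Mm = (\<lambda>i. if i = 0 then 0 else count_list \<rho> i),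
    Bb = (\<lambda>i. if i = h then m else 0) \<rparr>"
  have D: "Nn D i = 0" "Pp D i = 0" "Mm D i = (if i = 0 then 0 else count_list \<rho> i)" "Bb D i = (if i = h then m else 0)" for i
    by (simp_all add: D_def)
  have vD: "pm_valid r D" unfolding pm_valid_def D using c0 hr h by auto
  have oD: "filter (\<lambda>h. 0 < h) (map (\<lambda>c. snd (snd c)) (pcols D r)) = \<nu>'"
    by (rule outer_unique[OF vD P(1,2)]) (auto simp: D \<nu>'_def count_list_append cr)
  have pD: "pmd r k D" using length_pcols_outer[OF vD oD] K(2) vD by (simp add: pmd_def D)
  have "2 \<le> h" using h by simp
  then have zP: "z (h - 1) = Ph r D" using Ph_zcols[OF pD rr _ _ _ _ oD, of h] by (simp add: D z_def)
  \<comment> \<open>\<SS> removes the \<open>m\<close> pairs, which lowers their columns to height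
    \<open>e\<close>, and turns each - over \<rho> into a +. The columns of \<rho> are then
    complete, and the strings of the lowered ones are still unaltered; the nodes 1, ..., e complete
    them.\<close>
  define T where "T = map (\<lambda>i. (i, i, None)) \<rho> @ replicate m (e, 0, None :: nat option)"
  have sP: "\<sigma> (z (h - 1)) = map (asc_col 0) T"
  proof -
    let ?D = "Sdata r D"
    have pm: "pmd r k ?D" by (rule pmd_Sdata[OF pD rr])
    have V: "pm_valid r ?D" using pm unfolding pmd_def by simp
    have e\<rho>: "e \<notin> set \<rho>" "0 \<notin> set \<rho>" using \<rho> h e by fastforce+
    have sel: "Nn ?D i = (if i = e then m else 0)" "Pp ?D i = Mm D i" "Mm ?D i = 0" "Bb ?D i = 0" for i
      unfolding Sdata_sel D using e by auto
    have "sorted_wrt (\<ge>) (replicate m e)" by (induction m) auto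
    then have "sorted_wrt (\<ge>) (\<rho> @ replicate m e)" using P(1) \<rho> e by (fastforce simp: sorted_wrt_append \<nu>'_def)
    then have "filter (\<lambda>h. 0 < h) (map (\<lambda>c. snd (snd c)) (pcols ?D r)) = \<rho> @ replicate m e"
      using e\<rho> e(1) by (intro outer_unique[OF V]) (auto simp: sel D count_list_append cr)
    moreover have "Pp ?D e = 0" using c0[of e] e by (simp add: sel D)
    ultimately have "Ph r ?D = map (asc_col 0) T"
      unfolding T_def using e(1) e\<rho> by (intro Ph_plus[OF pm rr]) (auto simp: sel)
    then show ?thesis unfolding zP sigma_Ph[OF \<sigma> pD rr] .
  qed
  have slT: "slots T = \<rho> @ replicate m 0"
  proof -
    have "slots (map (\<lambda>i. (i, i, None)) \<rho>) = \<rho>" using \<rho> h by (induction \<rho>) (fastforce simp: slots_def)+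
    moreover have "slots (replicate m (e, 0, None)) = replicate m 0" using e(1) by (induction m) (auto simp: slots_def)
    moreover have "slots (u @ v) = slots u @ slots v" for u v by (simp add: slots_def)
    ultimately show ?thesis unfolding T_def by simp
  qed
  have sT: "slot_tab T"
  proof -
    have rep: "sorted_wrt (\<ge>) (replicate m (x::nat))" for x by (induction m) auto
    have s\<rho>: "sorted_wrt (\<ge>) \<rho>" using P(1) by (simp add: \<nu>'_def sorted_wrt_append)
    have "sorted_wrt (\<ge>) (\<rho> @ replicate m 0)" "sorted_wrt (\<ge>) (\<rho> @ replicate m e)"
      using s\<rho> rep \<rho> e by (fastforce simp: sorted_wrt_append)+
    moreover have "map fst T = \<rho> @ replicate m e" by (simp add: T_def comp_def)
    ultimately show ?thesis unfolding slot_tab_def slT by (auto simp: T_def)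
  qed
  have slc: "count_list (slots T) i = 0" if "1 \<le> i" "i < h" for i
    unfolding slT using c0[of i] that by (simp add: count_list_append cr)
  define w where "w = (\<lambda>j. map (asc_col j) T)"
  have ww: "w j = map (asc_col j) T" for j by (simp add: w_def)
  have tw: "tshape (w j) = \<rho> @ replicate m e" if "j \<le> e" for j
  proof -
    have "length (str v g) = v" if "g \<le> v" for v g using that by (simp add: str_def)
    moreover have "e \<le> x" if "x \<in> set \<rho>" for x using \<rho>[OF that] e by simp
    ultimately show ?thesis using that e unfolding w_def T_def
      by (auto simp: asc_col_def bar_def comp_def intro!: map_idI)
  qed
  have wi: "iter_op (eop A i) (teps i (w (i - 1)) - 0) (w (i - 1)) = Some (w i)" "tphi i (w (i - 1)) = 0"
    if i: "1 \<le> i" "i \<le> e" and wE: "w (i - 1) \<in> elts A" for i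
  proof -
    have ii: "i \<in> {1..n}" "i < n" "i < h" using i e hr(3) by auto
    note S = asc_step[OF i(1) ii(2) sT, folded ww]
    show "iter_op (eop A i) (teps i (w (i - 1)) - 0) (w (i - 1)) = Some (w i)"
      by (rule iter_word[OF wE ii(1)]) (use S tw[of i] tw[of "i - 1"] i in simp_all)
    show "tphi i (w (i - 1)) = 0" using S slc[OF i(1) ii(3)] by (simp add: wphi_st)
  qed
  have s5: "swaps (w i) y1" if "i < e" for i
    using that
  proof (induction i)
    case 0
    show ?case using s4 unfolding sP w_def .
  next
    case (Suc i)
    have IH: "swaps (w i) y1" using Suc by simp
    have wE: "w (Suc i - 1) \<in> elts A" using IH by (simp add: swaps_def)
    have ii: "Suc i \<in> {1..n}" "1 \<le> Suc i" "Suc i < n" "h - 1 \<noteq> Suc i" "h - 1 \<noteq> Suc i + 1" "Suc i \<le> e"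
      using Suc.prems e hr(3) by auto
    have "veps B (Suc i) y1 = 0" "vphi B (Suc i) y1 = 0"
      using B_eps(1,2)[OF yB(2) ii(1)] row_neutral[OF ii(2-5), of l] unfolding i1 by (simp_all add: y1_def)
    then show ?case using ii(1) wi(1)[OF ii(2,6) wE, simplified] by (intro swaps_left[OF IH]) simp_all
  qed
  \<comment> \<open>The node \<open>e\<close> completes the lowered columns and at the same time
    takes the row from e + 1 = h - 1 to e.\<close>
  have s6: "swaps (w e) y2"
  proof -
    have we: "swaps (w (e - 1)) y1" using s5 e(1) by simp
    then have wE: "w (e - 1) \<in> elts A" by (simp add: swaps_def)
    have ee: "e \<in> {1..n}" "1 \<le> e" "e < n" "e \<le> e" using e hr(3) by auto
    have yi: "row (replicate l (int e + 1)) = y1" "row (replicate l (int e)) = y2"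
    proof -
      have h12: "int h - 1 = int e + 1" "int h - 2 = int e" using e(2) by simp_all
      show "row (replicate l (int e + 1)) = y1" unfolding y1_def h12 ..
      show "row (replicate l (int e)) = y2" unfolding y2_def h12 ..
    qed
    have "swaps (w (e - 1)) y1 \<longleftrightarrow> swaps (w e) y2"
    proof (rule swaps_both[OF wE yB(2) ee(1)])
      show "vphi B e y1 = 0"
        using B_eps(2)[OF yB(2) ee(1)] row_lower(1)[OF ee(2,3), of l] unfolding yi[symmetric] by simp
      show "vphi A e (w (e - 1)) = 0" using A_eps(2)[OF wE ee(1)] wi(2)[OF ee(2,4) wE] by simp
      show "iter_op (eop A e) (veps A e (w (e - 1))) (w (e - 1)) = Some (w e)"
        using A_eps(1)[OF wE ee(1)] wi(1)[OF ee(2,4) wE] by simp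
      show "iter_op (eop B e) (veps B e y1) y1 = Some y2" using row_iter[OF ee(2,3)] unfolding yi .
    qed
    then show ?thesis using we by simp
  qed
  have we: "w e = hw_tableau \<nu>"
  proof -
    have "asc_col e (i, i, None) = [1..int i]" "asc_col e (e, 0, None) = [1..int e]" for i
      by (simp_all add: asc_col_def bar_def str_def)
    then show ?thesis unfolding w_def T_def hw_tableau_def \<nu>_def e_def[symmetric] by simp
  qed
  have wE: "hw_tableau \<nu> \<in> elts A" using s6 unfolding we swaps_def by simp
  have nn: "x \<le> n" if "x \<in> set \<nu>" for x using that hn[of x] e hr(3) by (auto simp: \<nu>_def \<nu>'_def)
  have "swaps (hw_tableau \<nu>) (row (replicate l (int e)))" using s6 e(2) unfolding we y2_def by simp
  moreover have "teps i (hw_tableau \<nu>) = 0 \<and> tphi i (hw_tableau \<nu>) = 0" if i: "1 \<le> i" "i < e" for i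
  proof -
    have ii: "i \<in> {1..n}" "i < n" using i e hr(3) by auto
    have "i \<notin> set \<nu>" using \<rho>[of i] i e by (auto simp: \<nu>_def)
    then show ?thesis using hw_eps[OF ii(1)] wphi_hw(1)[OF ii(1) nn ii(2)] by (simp add: count_notin)
  qed
  ultimately have "swaps (hw_tableau \<nu>) (row (replicate l 1))"
    using swaps_row[OF wE, of e] e hr(3) by simp
  then show ?thesis by (simp add: \<nu>_def)
qed

lemma swaps_all:
  assumes H0: "H (hw_tableau (replicate k r), row (replicate l 1)) = 0"
    and "\<nu> \<in> KR_shapes r k" "length \<nu> = k"
  shows "swaps (hw_tableau \<nu>) (row (replicate l 1))"
proof -
  have "swaps (hw_tableau \<nu>) (row (replicate l 1))"
    if "\<nu> \<in> KR_shapes r k" "length \<nu> = k" "\<forall>x\<in>set \<nu>. r \<le> x + 2 * d" for d \<nu>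
    using that
  proof (induction d arbitrary: \<nu>)
    case 0
    have "\<forall>x\<in>set \<nu>. x = r" using 0 KR_shapes_props(3)[OF 0(1)] by fastforce
    then have "\<nu> = replicate k r" using 0(2) replicate_eqI by metis
    then show ?case using swaps_base[OF H0] by simp
  next
    case (Suc d)
    note P = KR_shapes_props[OF Suc.prems(1)]
    define h where "h = r - 2 * d"
    show ?case
    proof (cases "\<forall>x\<in>set \<nu>. r \<le> x + 2 * d")
      case True
      then show ?thesis using Suc by blast
    next
      case False
      then obtain x0 where x0: "x0 \<in> set \<nu>" "x0 + 2 * d < r" by auto
      have rx: "even (r + x)" "0 < x" "x \<le> r" "r \<le> x + 2 * d + 2" if "x \<in> set \<nu>" for x
        using P(3)[OF that] Suc.prems(3) that by auto
      have h3: "3 \<le> h" "r = h + 2 * d" using rx[OF x0(1)] x0(2) unfolding h_def by presburger+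
      have low: "x = h - 2" if "x \<in> set \<nu>" "\<not> h \<le> x" for x
        using rx[OF that(1)] that(2) h3 by presburger
      have split: "sorted_wrt (\<ge>) xs \<Longrightarrow> xs = filter (\<lambda>x. h \<le> x) xs @ filter (\<lambda>x. \<not> h \<le> x) xs" for xs :: "nat list"
      proof (induction xs)
        case (Cons x xs)
        show ?case
        proof (cases "h \<le> x")
          case False
          then have "filter (\<lambda>x. h \<le> x) xs = []" using Cons.prems by (fastforce simp: filter_empty_conv)
          then show ?thesis using Cons False by simp
        qed (use Cons in simp)
      qed simp
      define \<rho> where "\<rho> = filter (\<lambda>x. h \<le> x) \<nu>"
      define m where "m = length (filter (\<lambda>x. \<not> h \<le> x) \<nu>)"
      have "filter (\<lambda>x. \<not> h \<le> x) \<nu> = replicate m (h - 2)"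
        unfolding m_def by (rule replicate_eqI[OF refl]) (use low in auto)
      then have \<nu>: "\<nu> = \<rho> @ replicate m (h - 2)" using split[OF P(1)] by (simp add: \<rho>_def)
      have "x0 \<in> set (filter (\<lambda>x. \<not> h \<le> x) \<nu>)" using x0 h3(2) by auto
      then have m0: "0 < m" unfolding m_def by (metis length_greater_0_conv length_pos_if_in_set)
      have \<rho>: "h \<le> x" "x \<in> set \<nu>" if "x \<in> set \<rho>" for x using that by (auto simp: \<rho>_def)
      have len: "length (\<rho> @ replicate m h) = k" using Suc.prems(2) \<nu> by simp
      have hr: "h \<le> r" "even (r + h)" "0 < h" using h3 by auto
      have K: "\<rho> @ replicate m h \<in> KR_shapes r k"
      proof (rule KR_shapesI)
        have "sorted_wrt (\<ge>) (replicate m h)" by (induction m) auto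
        moreover have "sorted_wrt (\<ge>) \<rho>" using P(1) by (simp add: \<rho>_def sorted_wrt_filter)
        ultimately show "sorted_wrt (\<ge>) (\<rho> @ replicate m h)" using \<rho>(1) by (auto simp: sorted_wrt_append)
        show "0 < x \<and> x \<le> r \<and> even (r + x)" if "x \<in> set (\<rho> @ replicate m h)" for x
          using that P(3)[OF \<rho>(2)] hr by auto
      qed (use len in auto)
      have "swaps (hw_tableau (\<rho> @ replicate m h)) (row (replicate l 1))"
        by (rule Suc.IH[OF K len]) (use \<rho>(1) h3 in fastforce)
      from link[OF K len h3(1) \<rho>(1) m0 this] show ?thesis unfolding \<nu> .
    qed
  qed
  from this[OF assms(2,3), of r] show ?thesis by simp
qed

end

section \<open>Highest weight elements in coordinates\<close>

context vec
begin

text \<open>No negative letter has an arrow downwards for the node n, so nothing in front of the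
  letters barred n and 0 shields them.\<close>

lemma weps_n_row:
  assumes "row_ok c"
  shows "c (- int n) \<le> weps n (rword c)" "c 0 \<le> weps n (rword c)"
proof -
  obtain P M Q where o: "ord = P @ [- int n] @ [0] @ [int n] @ Q"
    and P: "set P \<subseteq> {1 - int n..- 1}" and PM: "P = map (\<lambda>i. - int i) [1..<n]" and QM: "Q = rev (map int [1..<n])"
    by (rule ord_split_n) blast
  have lp0: "wphi i u = 0 \<and> weps i (u @ v) = weps i u + weps i v" if "\<forall>a\<in>set u. lp i a = 0" for i u v
  proof -
    have "wphi i u = 0" using that by (induction u) auto
    then show ?thesis by (simp add: weps_append)
  qed
  define u where "u = blk c P @ replicate (c (- int n)) (- int n)"
  define v where "v = blk c ([int n] @ Q)"
  have w: "rword c = u @ replicate (c 0) 0 @ v"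
    unfolding rword_def o u_def v_def by (simp add: blk_simps)
  have l: "lp n a = 0" if "a \<in> {- int n..- 1}" for a using that rank unfolding lp_def by (auto split: affine_type.split)
  have ln: "1 \<le> le n (- int n)" unfolding le_def by (auto split: affine_type.split)
  have "\<forall>a\<in>set (blk c P). lp n a = 0" using set_blk[of _ c P] P l by fastforce
  note 1 = lp0[OF this]
  have "\<forall>a\<in>set u. lp n a = 0" using set_blk[of _ c P] P l[of "- int n"] l rank unfolding u_def by fastforce
  note 2 = lp0[OF this]
  have "m \<le> weps n (replicate m (- int n))" for m
    using ln l[of "- int n"] rank by (induction m) auto
  then have "c (- int n) \<le> weps n u" using 1 unfolding u_def by (simp add: trans_le_add2)
  then show "c (- int n) \<le> weps n (rword c)" using 2 unfolding w by (simp add: trans_le_add1)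
  have "c 0 = 0 \<or> (c 0 = 1 \<and> t = B1)" using assms unfolding row_ok_def by auto
  then have "c 0 \<le> weps n (replicate (c 0) 0 @ v)"
  proof
    assume c1: "c 0 = 1 \<and> t = B1"
    then have "le n 0 = 1" using rank unfolding le_def by simp
    then show ?thesis using conjunct1[OF c1] by simp
  qed simp
  then show "c 0 \<le> weps n (rword c)" using 2 unfolding w by (simp add: trans_le_add2)
qed

text \<open>The multiplicity of height i in \<mu> vanishes unless i \<equiv> r. For the other i < n
  the bound on \<epsilon>_i splits into two conditions: there is no letter barred i, and the letters
  barred i + 1 suffice to shield all letters i + 1. For i \<equiv> r the letters barred i + 1 are
  then absent, and the bound becomes the linear inequality of \<open>dom\<close>.\<close>

lemma dom_highest:
  assumes \<mu>: "\<mu> \<in> KR_shapes r k" and r: "KR_type r" and c: "row_ok c" "\<And>a. int n < \<bar>a\<bar> \<Longrightarrow> c a = 0"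
    and hi: "\<And>i. i \<in> {1..n} \<Longrightarrow> weps i (rword c) \<le> wphi i (reading (hw_tableau \<mu>))"
  shows "dom r \<mu> c"
proof -
  have n: "3 \<le> n" "r \<le> n" using rank KR_typeD(1)[OF r] by auto
  note P = KR_shapes_props[OF \<mu>]
  have hn: "h \<le> n" if "h \<in> set \<mu>" for h using P(3)[OF that] n by simp
  have z: "count_list \<mu> i = 0" if "odd (r + i) \<or> r < i" for i
    using P(3)[of i] that by (intro count_notin) auto
  have wi: "c (- int i) + (c (int i + 1) - c (- int i - 1)) \<le> count_list \<mu> i" if "1 \<le> i" "i < n" for i
    using hi[of i] that raise_row(3)[of i c] wphi_hw(1)[OF _ hn, of i] by simp
  have wn: "weps n (rword c) \<le> count_list \<mu> n"
  proof -
    have "t = D1 \<longrightarrow> (\<forall>h\<in>set \<mu>. h + 2 \<le> n)" "t = B1 \<longrightarrow> (\<forall>h\<in>set \<mu>. h < n)"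
      using P(3) KR_typeD(2,3)[OF r] by fastforce+
    then show ?thesis using hi[of n] wphi_hw(2)[OF _ hn refl] n by simp
  qed
  note w0 = weps_n_row[OF c(1)]
  have cn: "c (- int n) \<le> count_list \<mu> n" using w0(1) wn by simp
  have c0: "c 0 = 0"
  proof (cases "t = B1")
    case True
    then have "count_list \<mu> n = 0" using KR_typeD(3)[OF r] z[of n] by simp
    then show ?thesis using w0(2) wn by simp
  qed (use c(1) in \<open>simp add: row_ok_def\<close>)
  have bar: "c (- int i) = 0" if i: "1 \<le> i" "odd (r + i)" for i
  proof -
    consider "i < n" | "i = n" | "n < i" by linarith
    then show ?thesis using wi[of i] z[of i] i cn c(2)[of "- int i"] by cases auto
  qed
  have ii: "c (int i) \<le> c (- int i)" if i: "2 \<le> i" "even (r + i)" for i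
  proof (cases "i \<le> n")
    case True
    obtain j where j: "i = Suc j" "1 \<le> j" using i by (cases i) auto
    have "c (int j + 1) - c (- int j - 1) = 0" using wi[of j] z[of j] j True i(2) by simp
    then show ?thesis unfolding j(1) int_Suc by simp
  next
    case False
    then show ?thesis using c(2)[of "int i"] by simp
  qed
  have sm: "c (- int i) + c (int i + 1) \<le> count_list \<mu> i" if i: "1 \<le> i" "even (r + i)" for i
  proof -
    consider "i < n" | "i = n" | "n < i" by linarith
    then show ?thesis
    proof cases
      case 1
      have "c (- int (Suc i)) = 0" by (rule bar) (use i in auto)
      moreover have "- int (Suc i) = - int i - 1" by simp
      ultimately have "c (- int i - 1) = 0" by metis
      then show ?thesis using wi[of i] i 1 by simp
    next
      case 2
      then show ?thesis using cn c(2)[of "int n + 1"] by simp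
    next
      case 3
      then show ?thesis using c(2)[of "int i + 1"] c(2)[of "- int i"] by simp
    qed
  qed
  show ?thesis unfolding dom_def using c0 c(2) bar ii sm by blast
qed

lemma wt_hw_1: "0 \<notin> set \<mu> \<Longrightarrow> wt (hw_tableau \<mu>) 1 = int (length \<mu>)"
proof (induction \<mu>)
  case Nil
  show ?case by (simp add: wt_def letter_count_def hw_tableau_def)
next
  case (Cons h \<mu>)
  have "1 \<le> h" using Cons.prems by (cases h) auto
  then have "[1..int h] = 1 # [2..int h]" using upto_rec1[of 1 "int h"] by simp
  then have "count_list [1..int h] 1 = 1" "count_list [1..int h] (- 1) = 0" by (auto intro: count_notin)
  then show ?case using Cons by (simp add: wt_def letter_count_def hw_tableau_def count_list_append)
qed

end

theorem theorem4p1: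
  fixes t :: affine_type and n r k l :: nat
    and \<sigma> \<sigma>' :: "tableau \<Rightarrow> tableau"
    and R :: "tableau \<times> tableau \<Rightarrow> tableau \<times> tableau"
    and H :: "tableau \<times> tableau \<Rightarrow> int"
    and b x :: tableau
  assumes "admissible t n r" and "1 \<le> k" and "1 \<le> l"
    and "KR_involution t n r k \<sigma>"
    and "KR_involution t n 1 l \<sigma>'"
    and "R_matrix n (KR_crystal t n r k \<sigma>) (KR_crystal t n 1 l \<sigma>') R"
    and "energy_function n (KR_crystal t n r k \<sigma>) (KR_crystal t n 1 l \<sigma>') R H"
    and "H (hw_tableau (replicate k r), hw_tableau (replicate l 1)) = 0"
    and "(b, x) \<in> elts (tensor (KR_crystal t n r k \<sigma>) (KR_crystal t n 1 l \<sigma>'))"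
    and "highest {1..n} (tensor (KR_crystal t n r k \<sigma>) (KR_crystal t n 1 l \<sigma>')) (b, x)"
  shows "\<exists>\<mu>\<in>KR_shapes r k. b = hw_tableau \<mu> \<and>
    (\<exists>P. KR_pm t n r k P \<and>
      R (b, x) = (hw_tableau (replicate l 1), Phi n P) \<and>
      (\<forall>i. i \<le> r \<and> i mod 2 = r mod 2 \<longrightarrow>
        p_none k P i =
          (if i = 0 then letter_count x (- 2) - letter_count x 2
                           - min (letter_count x 1 - fund_coeff k \<mu> 0) 0
           else if i = r then letter_count x (int r + 1)
           else letter_count x (- (int i + 2)) - letter_count x (int i + 2)) \<and>
        (1 \<le> i \<longrightarrow>
          p_plus P i =
            fund_coeff k \<mu> i - letter_count x (- int i) - letter_count x (int i + 1) \<and>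
          p_minus P i =
            (if i = 1 then letter_count x (- 1) else letter_count x (int i))) \<and>
        (2 \<le> i \<longrightarrow>
          p_both P i =
            (if i = 2 then min (fund_coeff k \<mu> 0) (letter_count x 1)
             else letter_count x (int i - 1)))) \<and>
      p_both P 1 = 0) \<and>
    H (b, x) =
      (if odd r then wt_tensor (b, x) 1 - int k - int l
       else max (wt_tensor (b, x) 1 - int k) 0 - int l)"
proof -
  have V: "vec t n" using assms(1) by (unfold_locales; cases t) auto
  interpret vec t n by (rule V)
  have rk: "KR_type r" "1 \<le> r" using assms(1) unfolding KR_type_def by (cases t; auto)+
  note \<sigma> = assms(4) and \<sigma>' = assms(5)
  define A where "A = KR_crystal t n r k \<sigma>"
  define B where "B = KR_crystal t n 1 l \<sigma>'"
  have rn: "r \<le> n" "1 \<le> n" using KR_typeD(1)[OF rk(1)] rank by auto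
  have NA: "normal_on {0..n} A" unfolding A_def by (rule normal_KR[OF rn(1) \<sigma>])
  have NB: "normal_on {0..n} B" unfolding B_def by (rule normal_KR[OF rn(2) \<sigma>'])
  have bx: "b \<in> elts A" "x \<in> elts B" using assms(9) by (simp_all add: A_def B_def)
  then have bK: "b \<in> elts (KR_classical t n r k)" and xK: "x \<in> elts (KR_classical t n 1 l)"
    by (simp_all add: A_def B_def)
  have hi: "teps i b = 0 \<and> teps i x \<le> tphi i b" if i: "i \<in> {1..n}" for i
  proof -
    have i0: "i \<in> {0..n}" using i by simp
    have "eop (tensor A B) i (b, x) = None" using assms(10) i unfolding highest_def A_def B_def by blast
    then have "veps (tensor A B) i (b, x) = 0"
      using seminormal_None(1)[OF normal_onD[OF normal_on_tensor[OF NA NB] i0], of "(b, x)"] bx by simp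
    then show ?thesis
      using veps_tensor(1)[OF NA NB i0 bx] veps_KR(1,2)[OF rn(1) \<sigma> bK] veps_KR(1)[OF rn(2) \<sigma>' xK] i
      unfolding A_def B_def by simp
  qed
  define \<mu> where "\<mu> = tshape b"
  have b: "b = hw_tableau \<mu>" unfolding \<mu>_def by (rule KR_highest[OF rn(1) bK]) (use hi in blast)
  have \<mu>: "\<mu> \<in> KR_shapes r k" using KR_elts[OF rn(1)] bK unfolding \<mu>_def by blast
  note P = KR_shapes_props[OF \<mu>]
  define c where "c = (\<lambda>a. count_list (reading x) a)"
  have x: "x = row (rword c)" "row_ok c" using KR_row[OF xK] unfolding c_def by auto
  have big: "c a = 0" if "int n < \<bar>a\<bar>" for a
  proof -
    have "set (reading x) \<subseteq> elts V" using KR_elts[OF rn(2)] xK unfolding KN_def tab_def by blast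
    then show ?thesis using that unfolding c_def elts_V[abs_def] by (intro count_notin) (auto simp: elts_V)
  qed
  have dom: "dom r \<mu> c"
  proof (rule dom_highest[OF \<mu> rk(1) x(2) big])
    fix i assume "i \<in> {1..n}"
    then show "weps i (rword c) \<le> wphi i (reading (hw_tableau \<mu>))"
      using hi unfolding b[symmetric] x(1) by simp
  qed
  have lc: "letter_count x a = int (c a)" for a
    using letter_count_row[of c a] big[of a] unfolding x(1)[symmetric] by auto
  interpret kr_pair t n r k l \<sigma> \<sigma>' R H
    using assms(6,7) \<sigma> \<sigma>' rk unfolding R_matrix_def by unfold_locales
  have H0: "H (hw_tableau (replicate k r), row (replicate l 1)) = 0" using assms(8) unfolding hw_row .
  note base = swaps_all[OF H0, unfolded swaps_def]
  have I: "R (b, x) = (row (replicate l 1), Ph r (image_data r k \<mu> c))"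
    "H (b, x) = (if odd r then int (c 1) - int (c (- 1)) - int l else int (c 1 - (k - length \<mu>)) - int l)"
    using image_thm[OF \<sigma> \<sigma>' \<mu> rk dom xK[unfolded x(1)] assms(6)[unfolded R_matrix_def] assms(7)] base
    unfolding b x(1) by blast+
  define D where "D = image_data r k \<mu> c"
  have pD: "pmd r k D" unfolding D_def by (rule image_outer(1)[OF \<mu> rk dom])
  have vD: "pm_valid r D" "length (pcols D r) = k" using pD unfolding pmd_def by auto
  note p = p_pcols[OF vD] and sel = image_data_sel[of r k \<mu> c, folded D_def]
  have f0: "fund_coeff k \<mu> 0 = int (k - length \<mu>)" using P(4) by (simp add: fund_coeff_def)
  have f: "fund_coeff k \<mu> i = int (count_list \<mu> i)" if "1 \<le> i" for i using that by (simp add: fund_coeff_def)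
  have counts: "p_none k (pm_of (pcols D r)) i =
          (if i = 0 then letter_count x (- 2) - letter_count x 2
                           - min (letter_count x 1 - fund_coeff k \<mu> 0) 0
           else if i = r then letter_count x (int r + 1)
           else letter_count x (- (int i + 2)) - letter_count x (int i + 2)) \<and>
        (1 \<le> i \<longrightarrow>
          p_plus (pm_of (pcols D r)) i =
            fund_coeff k \<mu> i - letter_count x (- int i) - letter_count x (int i + 1) \<and>
          p_minus (pm_of (pcols D r)) i =
            (if i = 1 then letter_count x (- 1) else letter_count x (int i))) \<and>
        (2 \<le> i \<longrightarrow>
          p_both (pm_of (pcols D r)) i =
            (if i = 2 then min (fund_coeff k \<mu> 0) (letter_count x 1)
             else letter_count x (int i - 1)))" if i: "i \<le> r \<and> i mod 2 = r mod 2" for i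
  proof -
    have ev: "even (r + i)" "i \<le> r" using i by presburger+
    have N0: "p_none k (pm_of (pcols D r)) 0 = letter_count x (- 2) - letter_count x 2
        - min (letter_count x 1 - fund_coeff k \<mu> 0) 0" if "i = 0"
    proof -
      have "c 2 \<le> c (- 2)" using domD(4)[OF dom, of 2] ev that by simp
      moreover have "p_none k (pm_of (pcols D r)) 0 = int (Nn D 0)" by (rule p(1))
      moreover have "Nn D 0 = (c (- 2) - c 2) + (k - length \<mu> - c 1)" using ev that by (simp add: sel)
      ultimately show ?thesis unfolding lc f0 by (auto simp: min_def)
    qed
    have Nr: "p_none k (pm_of (pcols D r)) r = letter_count x (int r + 1)"
      using rk(2) unfolding p(1) sel lc by simp
    have Ni: "p_none k (pm_of (pcols D r)) i = letter_count x (- (int i + 2)) - letter_count x (int i + 2)"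
      if "i \<noteq> 0" "i \<noteq> r"
    proof -
      have "c (int (i + 2)) \<le> c (- int (i + 2))" using domD(4)[OF dom, of "i + 2"] ev by simp
      moreover have "- int (i + 2) = - int i - 2" "int (i + 2) = int i + 2" "- (int i + 2) = - int i - 2" by simp_all
      ultimately have "c (int i + 2) \<le> c (- int i - 2)" "- (int i + 2) = - int i - 2" by metis+
      then show ?thesis using ev that unfolding p(1) sel lc by (simp add: of_nat_diff)
    qed
    have Pl: "p_plus (pm_of (pcols D r)) i = fund_coeff k \<mu> i - letter_count x (- int i) - letter_count x (int i + 1)"
      "p_minus (pm_of (pcols D r)) i = (if i = 1 then letter_count x (- 1) else letter_count x (int i))" if "1 \<le> i"
    proof -
      have i0: "0 < i" using that by simp
      have "c (- int i) + c (int i + 1) \<le> count_list \<mu> i" by (rule domD(5)[OF dom that ev(1)])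
      then show "p_plus (pm_of (pcols D r)) i = fund_coeff k \<mu> i - letter_count x (- int i) - letter_count x (int i + 1)"
        using ev that unfolding p(2)[OF i0] sel lc f[OF that] by simp
      show "p_minus (pm_of (pcols D r)) i = (if i = 1 then letter_count x (- 1) else letter_count x (int i))"
        using ev that unfolding p(3)[OF i0] sel lc by simp
    qed
    have Bo: "p_both (pm_of (pcols D r)) i = (if i = 2 then min (fund_coeff k \<mu> 0) (letter_count x 1)
        else letter_count x (int i - 1))" if "2 \<le> i"
    proof -
      have i0: "0 < i" using that by simp
      show ?thesis using ev that unfolding p(4)[OF i0] sel lc f0 by (simp add: min_def)
    qed
    show ?thesis using N0 Nr Ni Pl Bo by auto
  qed
  have b1: "p_both (pm_of (pcols D r)) 1 = 0" using p(4)[of 1] by (simp add: sel)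
  have wt: "wt_tensor (b, x) 1 = int (length \<mu>) + int (c 1) - int (c (- 1))"
    using wt_hw_1[OF P(2)] unfolding wt_tensor_def b by (simp add: wt_def lc)
  \<comment> \<open>For even r no barred 1 occurs, so \<lambda>_1 - k is x_1 - \<mu>_0 and the
    positive part is the truncated difference of \<open>I(2)\<close>. For odd r no column is missing
    and \<lambda>_1 - k is the difference of the two extreme coordinates.\<close>
  have cm: "c (- 1) = 0" if "even r" using domD(3)[OF dom, of 1] that by simp
  have Hb: "H (b, x) = (if odd r then wt_tensor (b, x) 1 - int k - int l
       else max (wt_tensor (b, x) 1 - int k) 0 - int l)"
    unfolding I(2) wt using P(4,5) cm by (cases "odd r") auto
  have Rb: "R (b, x) = (hw_tableau (replicate l 1), Phi n (pm_of (pcols D r)))"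
    unfolding I(1) hw_row D_def ..
  have KP: "KR_pm t n r k (pm_of (pcols D r))" by (rule KR_pm_pmd[OF pD rk(1)])
  show ?thesis
    using b Rb KP counts b1 Hb by (intro bexI[OF _ \<mu>] conjI exI[of _ "pm_of (pcols D r)"]) blast+
qed

end
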